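(* For a semantics $\sigma\in\{\mathtt{co},\mathtt{st},\mathtt{pr},\mathtt{sst}\}$, let $\mathsf{SF\text{-}VE}^{\sigma}$ be the following decision problem. Input: an argumentation framework $\Lambda=\langle A,R\rangle$, a goal argument $g\in A$, a $\sigma$-labelling $\mathcal{L}$ of $\Lambda$, and a labelling $\mathcal{L}'$. Question: does $\mathcal{L}'$ belong to the set $\mathcal{SF}^{\sigma}(g,\mathcal{L})$ of semifactuals of $\mathcal{L}$ w.r.t. $g$? Then $\mathsf{SF\text{-}VE}^{\sigma}$ is: (1) $coNP$-complete for $\sigma\in\{\mathtt{co},\mathtt{st}\}$; and (2) $\Pi_2^p$-complete for $\sigma\in\{\mathtt{pr},\mathtt{sst}\}$.
   Context: An argumentation framework (AF) is a pair $\Lambda=\langle A,R\rangle$ with $A$ a (finite) set of arguments and $R\subseteq A\times A$ a set of attacks. For $S\subseteq A$ let $\mathit{Def}(S)=\{a\in A\mid \exists b\in S,\ (b,a)\in R\}$ and $\mathit{Acc}(S)=\{a\in A\mid \forall (b,a)\in R,\ b\in \mathit{Def}(S)\}$. $S$ is conflict-free iff $S\cap \mathit{Def}(S)=\emptyset$, and admissible iff it is conflict-free and $S\subseteq \mathit{Acc}(S)$. A set $S\subseteq A$ is an extension called: complete ($\mathtt{co}$) iff it is admissible and $S=\mathit{Acc}(S)$; preferred ($\mathtt{pr}$) iff it is a $\subseteq$-maximal complete extension; stable ($\mathtt{st}$) iff it is a preferred extension with $S\cup \mathit{Def}(S)=A$; semi-stable ($\mathtt{sst}$) iff it is a preferred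 extension such that $S\cup \mathit{Def}(S)$ is $\subseteq$-maximal (among preferred extensions). A labelling is a total function $\mathcal{L}:A\to\{\mathbf{in},\mathbf{out},\mathbf{und}\}$. The labelling corresponding to an extension $E$ assigns $\mathbf{in}$ to the elements of $E$, $\mathbf{out}$ to the elements of $\mathit{Def}(E)$, and $\mathbf{und}$ to all other arguments. A $\sigma$-labelling of $\Lambda$ is the labelling corresponding to a $\sigma$-extension of $\Lambda$; $\sigma(\Lambda)$ denotes the set of $\sigma$-labellings of $\Lambda$. The distance between labellings is $\delta(\mathcal{L},\mathcal{L}')=|\{a\in A\mid \mathcal{L}(a)\neq\mathcal{L}'(a)\}|$. Semifactuals: for $g\in A$ and $\mathcal{L}\in\sigma(\Lambda)$, a labelling $\mathcal{L}'\in\sigma(\Lambda)$ is a semifactual of $\mathcal{L}$ w.r.t. $g$ if (i) $\mathcal{L}(g)=\mathcal{L}'(g)$, and (ii) there is no $\mathcal{L}''\in\sigma(\Lambda)$ with $\mathcal{L}(g)=\mathcal{L}''(g)$ and $\delta(\mathcal{L},\mathcal{L}'')>\delta(\mathcal{L},\mathcal{L}')$. $\mathcal{SF}^{\sigma}(g,\mathcal{L})$ denotes the set of all of them. Complexity: $\Sigma_2^p=NP^{NP}$ and $\Pi_2^p=co\Sigma_2^p$. *)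

theory Defs
  imports "HOL-Computational_Algebra.Polynomial"
begin

section \<open>Argumentation frameworks\<close>

text \<open>A framework is given by its finite set \<open>A\<close> of arguments and its attack relation \<open>R\<close>.\<close>

definition Def :: "'a set \<Rightarrow> ('a \<times> 'a) set \<Rightarrow> 'a set \<Rightarrow> 'a set" where
  "Def A R S = {a \<in> A. \<exists>b\<in>S. (b, a) \<in> R}"

definition Acc :: "'a set \<Rightarrow> ('a \<times> 'a) set \<Rightarrow> 'a set \<Rightarrow> 'a set" where
  "Acc A R S = {a \<in> A. \<forall>b. (b, a) \<in> R \<longrightarrow> b \<in> Def A R S}"

definition conflict_free :: "'a set \<Rightarrow> ('a \<times> 'a) set \<Rightarrow> 'a set \<Rightarrow> bool" where
  "conflict_free A R S \<longleftrightarrow> S \<inter> Def A R S = {}"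

definition admissible :: "'a set \<Rightarrow> ('a \<times> 'a) set \<Rightarrow> 'a set \<Rightarrow> bool" where
  "admissible A R S \<longleftrightarrow> S \<subseteq> A \<and> conflict_free A R S \<and> S \<subseteq> Acc A R S"

definition complete_ext :: "'a set \<Rightarrow> ('a \<times> 'a) set \<Rightarrow> 'a set \<Rightarrow> bool" where
  "complete_ext A R S \<longleftrightarrow> admissible A R S \<and> S = Acc A R S"

definition preferred_ext :: "'a set \<Rightarrow> ('a \<times> 'a) set \<Rightarrow> 'a set \<Rightarrow> bool" where
  "preferred_ext A R S \<longleftrightarrow> complete_ext A R S \<and> \<not> (\<exists>T. complete_ext A R T \<and> S \<subset> T)"

definition stable_ext :: "'a set \<Rightarrow> ('a \<times> 'a) set \<Rightarrow> 'a set \<Rightarrow> bool" where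
  "stable_ext A R S \<longleftrightarrow> preferred_ext A R S \<and> S \<union> Def A R S = A"

definition semistable_ext :: "'a set \<Rightarrow> ('a \<times> 'a) set \<Rightarrow> 'a set \<Rightarrow> bool" where
  "semistable_ext A R S \<longleftrightarrow> preferred_ext A R S \<and>
     \<not> (\<exists>T. preferred_ext A R T \<and> S \<union> Def A R S \<subset> T \<union> Def A R T)"

datatype semantics = Complete | Preferred | Stable | SemiStable

fun extension :: "semantics \<Rightarrow> 'a set \<Rightarrow> ('a \<times> 'a) set \<Rightarrow> 'a set \<Rightarrow> bool" where
  "extension Complete = complete_ext"
| "extension Preferred = preferred_ext"
| "extension Stable = stable_ext"
| "extension SemiStable = semistable_ext"

datatype label = In | Out | Und

text \<open>Labellings are total on \<open>A\<close>; as functions on the whole type they are normalised to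
  \<open>Und\<close> outside \<open>A\<close>, so that equality of functions is equality of labellings.\<close>

definition labelling :: "'a set \<Rightarrow> ('a \<Rightarrow> label) \<Rightarrow> bool" where
  "labelling A L \<longleftrightarrow> (\<forall>a. a \<notin> A \<longrightarrow> L a = Und)"

definition labelling_of :: "'a set \<Rightarrow> ('a \<times> 'a) set \<Rightarrow> 'a set \<Rightarrow> 'a \<Rightarrow> label" where
  "labelling_of A R E a = (if a \<in> E then In else if a \<in> Def A R E then Out else Und)"

definition labellings :: "semantics \<Rightarrow> 'a set \<Rightarrow> ('a \<times> 'a) set \<Rightarrow> ('a \<Rightarrow> label) set" where
  "labellings \<sigma> A R = labelling_of A R ` {E. extension \<sigma> A R E}"

definition distance :: "'a set \<Rightarrow> ('a \<Rightarrow> label) \<Rightarrow> ('a \<Rightarrow> label) \<Rightarrow> nat" where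
  "distance A L L' = card {a \<in> A. L a \<noteq> L' a}"

definition semifactuals ::
  "semantics \<Rightarrow> 'a set \<Rightarrow> ('a \<times> 'a) set \<Rightarrow> 'a \<Rightarrow> ('a \<Rightarrow> label) \<Rightarrow> ('a \<Rightarrow> label) set" where
  "semifactuals \<sigma> A R g L = {L' \<in> labellings \<sigma> A R. L g = L' g \<and>
     \<not> (\<exists>L''\<in>labellings \<sigma> A R. L g = L'' g \<and> distance A L L'' > distance A L L')}"


section \<open>Nondeterministic multi-tape oracle Turing machines\<close>

text \<open>A tape is two-way infinite and stored relative to its head: the scanned cell is cell 0,
  and moving the head shifts the contents. Symbol 0 is the blank, symbols 1 and 2 are the
  bits. States and symbols are natural numbers; finiteness of the transition relation makes
  the control and the alphabet finite.\<close>

type_synonym tape = "int \<Rightarrow> nat"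

datatype move = MoveLeft | Stay | MoveRight

text \<open>A transition \<open>(q, ss, q', as)\<close> applies in state \<open>q\<close> when the tapes scan the symbols
  \<open>ss\<close>; \<open>as\<close> lists, tape by tape, the symbol to write and the head movement.\<close>

type_synonym transition = "nat \<times> nat list \<times> nat \<times> (nat \<times> move) list"

text \<open>For oracle machines, \<open>tm_oracle\<close> holds the query state and the two states entered on a
  positive and on a negative answer.\<close>

record tm =
  tm_tapes :: nat
  tm_delta :: "transition set"
  tm_start :: nat
  tm_accept :: nat
  tm_oracle :: "(nat \<times> nat \<times> nat) option"

definition well_formed :: "tm \<Rightarrow> bool" where
  "well_formed M \<longleftrightarrow> tm_tapes M \<ge> 1 \<and> finite (tm_delta M) \<and>
     (\<forall>(q, ss, q', as) \<in> tm_delta M. length ss = tm_tapes M \<and> length as = tm_tapes M)"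

definition deterministic :: "tm \<Rightarrow> bool" where
  "deterministic M \<longleftrightarrow> (\<forall>q ss q1 as1 q2 as2.
     (q, ss, q1, as1) \<in> tm_delta M \<and> (q, ss, q2, as2) \<in> tm_delta M \<longrightarrow> q1 = q2 \<and> as1 = as2)"

definition oracle_free :: "tm \<Rightarrow> bool" where
  "oracle_free M \<longleftrightarrow> tm_oracle M = None"

fun bit_symbol :: "bool \<Rightarrow> nat" where
  "bit_symbol False = 1"
| "bit_symbol True = 2"

definition tape_of :: "bool list \<Rightarrow> tape" where
  "tape_of w i = (if 0 \<le> i \<and> i < int (length w) then bit_symbol (w ! nat i) else 0)"

text \<open>The word held by a tape runs from the scanned cell rightwards up to the first blank.\<close>

definition tape_holds :: "tape \<Rightarrow> bool list \<Rightarrow> bool" where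
  "tape_holds t w \<longleftrightarrow> (\<forall>i < length w. t (int i) = bit_symbol (w ! i)) \<and> t (int (length w)) = 0"

fun move_offset :: "move \<Rightarrow> int" where
  "move_offset MoveLeft = -1"
| "move_offset Stay = 0"
| "move_offset MoveRight = 1"

fun tape_act :: "nat \<times> move \<Rightarrow> tape \<Rightarrow> tape" where
  "tape_act (s, m) t = (\<lambda>i. (t(0 := s)) (i + move_offset m))"

type_synonym config = "nat \<times> tape list"

text \<open>The first tape carries the input (and the output of a computed function), the last tape
  carries the oracle queries. A query takes one step and leaves all tapes unchanged.\<close>

inductive tm_step :: "tm \<Rightarrow> bool list set \<Rightarrow> config \<Rightarrow> config \<Rightarrow> bool"
  for M :: tm and X :: "bool list set" where
  move: "(q, map (\<lambda>t. t 0) ts, q', as) \<in> tm_delta M \<Longrightarrow>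
    \<not> (\<exists>y n. tm_oracle M = Some (q, y, n)) \<Longrightarrow>
    tm_step M X (q, ts) (q', map2 tape_act as ts)"
| query_yes: "tm_oracle M = Some (q, y, n) \<Longrightarrow> \<exists>w\<in>X. tape_holds (last ts) w \<Longrightarrow>
    tm_step M X (q, ts) (y, ts)"
| query_no: "tm_oracle M = Some (q, y, n) \<Longrightarrow> \<not> (\<exists>w\<in>X. tape_holds (last ts) w) \<Longrightarrow>
    tm_step M X (q, ts) (n, ts)"

definition initial :: "tm \<Rightarrow> bool list \<Rightarrow> config" where
  "initial M w = (tm_start M, tape_of w # replicate (tm_tapes M - 1) (\<lambda>_. 0))"

definition halts_at :: "tm \<Rightarrow> bool list set \<Rightarrow> bool list \<Rightarrow> config \<Rightarrow> bool" where
  "halts_at M X w c \<longleftrightarrow> (tm_step M X)\<^sup>*\<^sup>* (initial M w) c \<and> \<not> (\<exists>c'. tm_step M X c c')"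

definition accepts :: "tm \<Rightarrow> bool list set \<Rightarrow> bool list \<Rightarrow> bool" where
  "accepts M X w \<longleftrightarrow> (\<exists>c. halts_at M X w c \<and> fst c = tm_accept M)"

text \<open>Every computation path, not only some accepting one, obeys the time bound.\<close>

definition poly_time :: "tm \<Rightarrow> bool list set \<Rightarrow> bool" where
  "poly_time M X \<longleftrightarrow> (\<exists>p :: nat poly. \<forall>w c n.
     (tm_step M X ^^ n) (initial M w) c \<longrightarrow> n \<le> poly p (length w))"


section \<open>Complexity classes\<close>

definition NP :: "bool list set set" where
  "NP = {{w. accepts M {} w} |M. well_formed M \<and> oracle_free M \<and> poly_time M {}}"

definition NP_oracle :: "bool list set \<Rightarrow> bool list set set" where
  "NP_oracle X = {{w. accepts M X w} |M. well_formed M \<and> poly_time M X}"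

definition co :: "bool list set set \<Rightarrow> bool list set set" where
  "co C = {Y. - Y \<in> C}"

definition coNP :: "bool list set set" where
  "coNP = co NP"

definition Sigma2p :: "bool list set set" where
  "Sigma2p = (\<Union>X\<in>NP. NP_oracle X)"

definition Pi2p :: "bool list set set" where
  "Pi2p = co Sigma2p"

definition poly_time_computable :: "(bool list \<Rightarrow> bool list) \<Rightarrow> bool" where
  "poly_time_computable f \<longleftrightarrow> (\<exists>M. well_formed M \<and> oracle_free M \<and> deterministic M \<and>
     poly_time M {} \<and> (\<forall>w. \<exists>c. halts_at M {} w c \<and> tape_holds (hd (snd c)) (f w)))"

text \<open>A decision problem consists of the set \<open>I\<close> of legal inputs and the set \<open>Y \<subseteq> I\<close> of
  yes-instances. Membership is required of the language \<open>Y\<close>, so illegal inputs have to be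
  rejected, while the reductions witnessing hardness must produce legal inputs only. This is
  the strongest reading; for \<open>I = UNIV\<close> it is ordinary completeness of a language.\<close>

definition poly_reducible :: "bool list set \<Rightarrow> bool list set \<Rightarrow> bool list set \<Rightarrow> bool" where
  "poly_reducible X I Y \<longleftrightarrow> (\<exists>f. poly_time_computable f \<and>
     (\<forall>w. f w \<in> I) \<and> (\<forall>w. w \<in> X \<longleftrightarrow> f w \<in> Y))"

definition complete_for :: "bool list set set \<Rightarrow> bool list set \<Rightarrow> bool list set \<Rightarrow> bool" where
  "complete_for C I Y \<longleftrightarrow> Y \<in> C \<and> (\<forall>X\<in>C. poly_reducible X I Y)"


section \<open>The semifactual verification problem\<close>

fun encode_label :: "label \<Rightarrow> bool list" where
  "encode_label In = [True, False]"
| "encode_label Out = [False, True]"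
| "encode_label Und = [False, False]"

text \<open>Concrete inputs have arguments \<open>{..<n}\<close>, with \<open>n\<close> in unary, the attack relation as its
  adjacency matrix (row by row), the goal as a 0-1 vector and two bits per label.\<close>

definition encode ::
  "nat \<Rightarrow> (nat \<times> nat) set \<Rightarrow> nat \<Rightarrow> (nat \<Rightarrow> label) \<Rightarrow> (nat \<Rightarrow> label) \<Rightarrow> bool list" where
  "encode n R g L L' = replicate n True @ [False] @
     concat (map (\<lambda>i. map (\<lambda>j. (i, j) \<in> R) [0..<n]) [0..<n]) @
     map (\<lambda>i. i = g) [0..<n] @
     concat (map (\<lambda>i. encode_label (L i)) [0..<n]) @
     concat (map (\<lambda>i. encode_label (L' i)) [0..<n])"

definition SF_VE_inputs :: "semantics \<Rightarrow> bool list set" where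
  "SF_VE_inputs \<sigma> = {encode n R g L L' |n R g L L'. R \<subseteq> {..<n} \<times> {..<n} \<and> g \<in> {..<n} \<and>
     L \<in> labellings \<sigma> {..<n} R \<and> labelling {..<n} L'}"

definition SF_VE :: "semantics \<Rightarrow> bool list set" where
  "SF_VE \<sigma> = {encode n R g L L' |n R g L L'. R \<subseteq> {..<n} \<times> {..<n} \<and> g \<in> {..<n} \<and>
     L \<in> labellings \<sigma> {..<n} R \<and> labelling {..<n} L' \<and>
     L' \<in> semifactuals \<sigma> {..<n} R g L}"

end

theory Submission
  imports Defs
begin

text \<open>That a labelling fails to be a semifactual is witnessed by a better labelling with the same goal
  label. Complete and stable labellings are recognised in polynomial time, and for preferred and
  semi-stable ones an NP oracle searches for a larger extension; this gives the upper bounds.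

  For hardness, a computation is a tableau, that is, an assignment of values from a fixed finite set
  to polynomially many variables subject to local constraints. A constraint system is turned into a
  framework with a labelling that is at distance 0 from itself, hence is a semifactual of itself iff
  it is the only labelling with its goal label; all others correspond to solutions of the system.
  For the second level, the framework contains a switch and self-attacking copies of the
  literals of some variables, so that a further preferred or semi-stable labelling
  corresponds to an assignment of these variables that extends to no solution. These variables
  describe a computation with an oracle, including certificates for the positive answers, and a
  solution exhibits a violated constraint or an accepting run that refutes a negative answer.\<close>

section \<open>Structured programs for Turing machines\<close>

text \<open>The machine model is concrete and bounds every computation path, so the upper bounds and
  the reductions both need actual machines. They come from functions with polynomially bounded
  values, computed in unary by head positions: closure under bounded sums yields bounded
  quantifiers, division and finite tables, and a predicate is polynomial-time as soon as it is
  written with these. The second level asks for outer variables that extend to no solution.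
  Preferred labellings supply precisely this, since a maximal labelling with an undecided blocker
  has no solution above it. The encoding of a computation is therefore inverted: a solution has to
  exist when the outer variables are wrong. Wrongness is a disjunction over polynomially many
  constraints, while one constraint sees only a fixed number of values; a chain of flags that rises
  at a violation makes the disjunction local. A negative oracle answer is a universal statement, so
  outer variables cannot certify it; it is the inner ones that may attack it.\<close>

inductive runs :: "('c \<Rightarrow> 'c \<Rightarrow> bool) \<Rightarrow> 'c \<Rightarrow> nat \<Rightarrow> 'c set \<Rightarrow> bool" for S where
  stop: "runs S c n {c}"
| step: "S c d \<Longrightarrow> (\<And>c'. S c c' \<Longrightarrow> runs S c' n (Q c')) \<Longrightarrow>
    runs S c (Suc n) (\<Union>c'\<in>{c'. S c c'}. Q c')"

lemma runs_mono: "runs S c n Q \<Longrightarrow> n \<le> m \<Longrightarrow> runs S c m Q"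
proof (induction arbitrary: m rule: runs.induct)
  case (stop c n)
  show ?case by (rule runs.stop)
next
  case (step c d n Q)
  then obtain m' where "m = Suc m'" "n \<le> m'" by (cases m) auto
  with step show ?case by (auto intro!: runs.step)
qed

lemma runs_trans:
  "runs S c n Q \<Longrightarrow> (\<And>c'. c' \<in> Q \<Longrightarrow> runs S c' m (Q' c')) \<Longrightarrow> runs S c (n + m) (\<Union>c'\<in>Q. Q' c')"
proof (induction rule: runs.induct)
  case (stop c n)
  then have "runs S c m (Q' c)" by simp
  then show ?case by (auto intro: runs_mono)
next
  case (step c d n Q)
  have "runs S c (Suc (n + m)) (\<Union>c'\<in>{c'. S c c'}. \<Union>x\<in>Q c'. Q' x)"
  proof (rule runs.step[where d = d])
    show "S c d" by fact
    show "runs S c' (n + m) (\<Union>x\<in>Q c'. Q' x)" if "S c c'" for c'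
      by (rule step.IH[OF that], rule step.prems) (use that in blast)
  qed
  then show ?case by simp
qed

lemma runs_det_step:
  assumes "S c d" "\<And>c'. S c c' \<Longrightarrow> c' = d" "runs S d n Q"
  shows "runs S c (Suc n) Q"
proof -
  have "{c'. S c c'} = {d}" using assms(1,2) by blast
  moreover have "runs S c (Suc n) (\<Union>c'\<in>{c'. S c c'}. Q)"
    by (rule runs.step[where d = d]) (use assms in blast)+
  ultimately show ?thesis by simp
qed

lemma runs_reach: "runs S c n Q \<Longrightarrow> c' \<in> Q \<Longrightarrow> S\<^sup>*\<^sup>* c c'"
  by (induction rule: runs.induct) (auto intro: converse_rtranclp_into_rtranclp)

text \<open>Every inner node of the tree has a successor and all its successors are expanded, so a
  halting configuration can only be met at a leaf. Together with \<open>runs_reach\<close> this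
  makes \<open>Q\<close> exact, which statements about non-acceptance require.\<close>

lemma runs_complete:
  "runs S c n Q \<Longrightarrow> S\<^sup>*\<^sup>* c c' \<Longrightarrow> \<not> (\<exists>d. S c' d) \<Longrightarrow>
    (\<And>q. q \<in> Q \<Longrightarrow> \<not> (\<exists>d. S q d)) \<Longrightarrow> c' \<in> Q"
proof (induction rule: runs.induct)
  case (stop c n)
  then show ?case by (metis converse_rtranclpE singletonD singletonI)
next
  case (step c d n Q)
  from step.prems(1) obtain e where e: "S c e" "S\<^sup>*\<^sup>* e c'"
    using step.hyps(1) step.prems(2) by (metis converse_rtranclpE)
  have "c' \<in> Q e" by (rule step.IH[OF e(1) e(2) step.prems(2)]) (use e(1) step.prems(3) in blast)
  with e(1) show ?case by blast
qed

lemma runs_bound: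
  "runs S c n Q \<Longrightarrow> (S ^^ k) c c' \<Longrightarrow> (\<And>q. q \<in> Q \<Longrightarrow> \<not> (\<exists>d. S q d)) \<Longrightarrow> k \<le> n"
proof (induction arbitrary: k rule: runs.induct)
  case (stop c n)
  then show ?case by (metis bot_nat_0.extremum not0_implies_Suc relpowp_Suc_E2 singletonI)
next
  case (step c d n Q)
  show ?case
  proof (cases k)
    case (Suc k')
    with step.prems obtain e where "S c e" "(S ^^ k') e c'" by (metis relpowp_Suc_E2)
    then have "k' \<le> n" using step.IH step.prems(2) by blast
    with Suc show ?thesis by simp
  qed simp
qed

section \<open>Structured programs and their transition tables\<close>

datatype prog =
    Do nat "nat \<Rightarrow> nat \<times> move"
  | Seq prog prog
  | If nat "nat \<Rightarrow> bool" prog prog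
  | While nat "nat \<Rightarrow> bool" prog
  | Choice prog prog

fun size_of :: "prog \<Rightarrow> nat" where
  "size_of (Do k F) = 1"
| "size_of (Seq c d) = size_of c + size_of d"
| "size_of (If k P c d) = size_of c + size_of d + 2"
| "size_of (While k P c) = size_of c + 2"
| "size_of (Choice c d) = size_of c + size_of d + 2"

text \<open>Programs write only the blank and the two bits; over this fixed alphabet the transitions
  of a test or an action can be listed outright.\<close>

definition scans :: "nat \<Rightarrow> nat list set" where
  "scans K = {ss. length ss = K \<and> set ss \<subseteq> {..<3}}"

definition keep :: "nat list \<Rightarrow> (nat \<times> move) list" where
  "keep ss = map (\<lambda>s. (s, Stay)) ss"

definition jump :: "nat \<Rightarrow> nat \<Rightarrow> (nat list \<Rightarrow> bool) \<Rightarrow> nat \<Rightarrow> transition set" where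
  "jump K a P b = (\<lambda>ss. (a, ss, b, keep ss)) ` {ss \<in> scans K. P ss}"

text \<open>Subprograms occupy disjoint intervals of states, so composition is a union of transition
  tables. A conditional and a choice spend one state on branching and one on jumping over the second
  branch, a loop one on the test and one on jumping back.\<close>

fun code :: "nat \<Rightarrow> nat \<Rightarrow> prog \<Rightarrow> transition set" where
  "code K a (Do k F) = (\<lambda>ss. (a, ss, Suc a, (keep ss)[k := F (ss ! k)])) ` scans K"
| "code K a (Seq c d) = code K a c \<union> code K (a + size_of c) d"
| "code K a (If k P c d) = jump K a (\<lambda>ss. P (ss ! k)) (Suc a) \<union>
     jump K a (\<lambda>ss. \<not> P (ss ! k)) (Suc (Suc (a + size_of c))) \<union>
     code K (Suc a) c \<union> jump K (Suc (a + size_of c)) (\<lambda>_. True) (a + size_of (If k P c d)) \<union>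
     code K (Suc (Suc (a + size_of c))) d"
| "code K a (While k P c) = jump K a (\<lambda>ss. P (ss ! k)) (Suc a) \<union>
     jump K a (\<lambda>ss. \<not> P (ss ! k)) (a + size_of (While k P c)) \<union>
     code K (Suc a) c \<union> jump K (Suc (a + size_of c)) (\<lambda>_. True) a"
| "code K a (Choice c d) = jump K a (\<lambda>_. True) (Suc a) \<union>
     jump K a (\<lambda>_. True) (Suc (Suc (a + size_of c))) \<union>
     code K (Suc a) c \<union> jump K (Suc (a + size_of c)) (\<lambda>_. True) (a + size_of (Choice c d)) \<union>
     code K (Suc (Suc (a + size_of c))) d"

lemma size_of_pos: "size_of c > 0"
  by (induction c) auto

lemma finite_scans: "finite (scans K)"
  unfolding scans_def using finite_lists_length_eq[of "{..<3::nat}" K] by (simp add: conj_commute)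

lemma finite_code: "finite (code K a c)"
  by (induction c arbitrary: a) (auto simp: jump_def finite_scans)

lemma code_source: "(q, ss, r, as) \<in> code K a c \<Longrightarrow> a \<le> q \<and> q < a + size_of c"
proof (induction c arbitrary: a)
  case (Seq c d)
  then show ?case using size_of_pos[of c] size_of_pos[of d] by fastforce
qed (fastforce simp: jump_def)+

fun choice_free :: "prog \<Rightarrow> bool" where
  "choice_free (Do k F) = True"
| "choice_free (Seq c d) = (choice_free c \<and> choice_free d)"
| "choice_free (If k P c d) = (choice_free c \<and> choice_free d)"
| "choice_free (While k P c) = choice_free c"
| "choice_free (Choice c d) = False"

lemma jump_iff: "(q, ss, r, as) \<in> jump K a P b \<longleftrightarrow> q = a \<and> ss \<in> scans K \<and> P ss \<and> r = b \<and> as = keep ss"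
  by (auto simp: jump_def)

lemma code_lengths: "(q, ss, r, as) \<in> code K a c \<Longrightarrow> length ss = K \<and> length as = K"
proof (induction c arbitrary: a)
  case (If k P c d)
  from If.prems show ?case by (auto simp: jump_iff keep_def scans_def dest!: If.IH)
next
  case (While k P c)
  from While.prems show ?case by (auto simp: jump_iff keep_def scans_def dest!: While.IH)
next
  case (Choice c d)
  from Choice.prems show ?case by (auto simp: jump_iff keep_def scans_def dest!: Choice.IH)
qed (auto simp: keep_def scans_def)

text \<open>By \<open>code_source\<close> the state of a transition determines the subprogram it
  belongs to, so two transitions for the same state come from the same place.\<close>

lemma code_det:
  "choice_free c \<Longrightarrow> (q, ss, r, as) \<in> code K a c \<Longrightarrow> (q, ss, r', as') \<in> code K a c \<Longrightarrow> r = r' \<and> as = as'"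
proof (induction c arbitrary: a)
  case (Do k F)
  then show ?case by auto
next
  case (Seq c d)
  have 1: "q < a + size_of c" if "(q, ss, r, as) \<in> code K a c" for r as
    using code_source[OF that] by simp
  have 2: "\<not> q < a + size_of c" if "(q, ss, r, as) \<in> code K (a + size_of c) d" for r as
    using code_source[OF that] by simp
  from Seq.prems(2,3) 1 2 consider "(q, ss, r, as) \<in> code K a c" "(q, ss, r', as') \<in> code K a c"
    | "(q, ss, r, as) \<in> code K (a + size_of c) d" "(q, ss, r', as') \<in> code K (a + size_of c) d"
    by (simp only: code.simps Un_iff) metis
  then show ?case
  proof cases
    case 1
    then show ?thesis using Seq.IH(1)[OF _ 1] Seq.prems(1) by simp
  next
    case 2
    then show ?thesis using Seq.IH(2)[OF _ 2] Seq.prems(1) by simp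
  qed
next
  case (If k P c d)
  have 1: "q < Suc (a + size_of c) \<and> q \<noteq> a" if "(q, ss, r, as) \<in> code K (Suc a) c" for r as
    using code_source[OF that] by simp
  have 2: "\<not> q \<le> Suc (a + size_of c)" if "(q, ss, r, as) \<in> code K (Suc (Suc (a + size_of c))) d" for r as
    using code_source[OF that] by simp
  show ?case
  proof (cases "q \<le> Suc (a + size_of c)")
    case False
    with If.prems(2,3) have "(q, ss, r, as) \<in> code K (Suc (Suc (a + size_of c))) d"
      "(q, ss, r', as') \<in> code K (Suc (Suc (a + size_of c))) d"
      using 1 by (auto simp: jump_iff)
    from If.IH(2)[OF _ this] If.prems(1) show ?thesis by simp
  next
    case le: True
    show ?thesis
    proof (cases "q = a \<or> q = Suc (a + size_of c)")
      case True
      with 1 2 have "(q, ss, r, as) \<notin> code K (Suc a) c" "(q, ss, r, as) \<notin> code K (Suc (Suc (a +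
          size_of c))) d" for r as
        by (metis less_irrefl, metis le)
      with True If.prems(2,3) show ?thesis by (auto simp: jump_iff)
    next
      case False
      with If.prems(2,3) le 2 have "(q, ss, r, as) \<in> code K (Suc a) c" "(q, ss, r', as') \<in> code K (Suc a) c"
        by (auto simp: jump_iff)
      from If.IH(1)[OF _ this] If.prems(1) show ?thesis by simp
    qed
  qed
next
  case (While k P c)
  have 1: "q < Suc (a + size_of c) \<and> q \<noteq> a" if "(q, ss, r, as) \<in> code K (Suc a) c" for r as
    using code_source[OF that] by simp
  show ?case
  proof (cases "q = a \<or> q = Suc (a + size_of c)")
    case True
    with 1 have "(q, ss, r, as) \<notin> code K (Suc a) c" for r as by (metis less_irrefl)
    with True While.prems(2,3) show ?thesis by (auto simp: jump_iff)
  next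
    case False
    with While.prems(2,3) have "(q, ss, r, as) \<in> code K (Suc a) c" "(q, ss, r', as') \<in> code K (Suc a) c"
      by (auto simp: jump_iff)
    from While.IH[OF _ this] While.prems(1) show ?thesis by simp
  qed
qed simp

text \<open>The program is left in state \<open>a + size_of c\<close>.\<close>

definition embeds :: "nat \<Rightarrow> nat \<Rightarrow> prog \<Rightarrow> tm \<Rightarrow> bool" where
  "embeds K a c M \<longleftrightarrow>
     (\<forall>q ss r as. a \<le> q \<and> q < a + size_of c \<longrightarrow> ((q, ss, r, as) \<in> tm_delta M \<longleftrightarrow> (q, ss, r, as) \<in> code K a c)) \<and>
     (\<forall>q y n. tm_oracle M = Some (q, y, n) \<longrightarrow> \<not> (a \<le> q \<and> q < a + size_of c))"

section \<open>Hoare triples with exact outcomes and time bounds\<close>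

abbreviation tapes :: "nat \<Rightarrow> (nat \<Rightarrow> tape) \<Rightarrow> tape list" where
  "tapes K \<tau> \<equiv> map \<tau> [0..<K]"

definition valid :: "(nat \<Rightarrow> tape) \<Rightarrow> bool" where
  "valid \<tau> \<longleftrightarrow> (\<forall>k i. \<tau> k i < 3)"

text \<open>A triple speaks about every machine, oracle and start state with the code embedded,
  which makes it compositional. \<open>Q\<close> is the exact set of outcomes. Tapes from
  \<open>K\<close> on do not exist in the machine; demanding that they stay fixed lets a
  configuration determine its tape assignment, see \<open>tapes_inj\<close>.\<close>

definition HT :: "nat \<Rightarrow> prog \<Rightarrow> (nat \<Rightarrow> tape) \<Rightarrow> nat \<Rightarrow> (nat \<Rightarrow> tape) set \<Rightarrow> bool" where
  "HT K c \<tau> n Q \<longleftrightarrow> (valid \<tau> \<longrightarrow> (\<forall>\<tau>'\<in>Q. valid \<tau>' \<and> (\<forall>k\<ge>K. \<tau>' k = \<tau> k)) \<and>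
     (\<forall>M X a. embeds K a c M \<longrightarrow>
        runs (tm_step M X) (a, tapes K \<tau>) n ((\<lambda>\<tau>'. (a + size_of c, tapes K \<tau>')) ` Q)))"

lemma HT_mono: "HT K c \<tau> n Q \<Longrightarrow> n \<le> m \<Longrightarrow> HT K c \<tau> m Q"
  unfolding HT_def by (meson runs_mono)

lemma scan_in_scans: "valid \<tau> \<Longrightarrow> map (\<lambda>k. \<tau> k 0) [0..<K] \<in> scans K"
  by (auto simp: valid_def scans_def)

lemma tape_act_stay [simp]: "tape_act (t 0, Stay) t = t"
  by (auto simp: fun_eq_iff)

lemma act_keep: "map2 tape_act (keep (map (\<lambda>k. \<tau> k 0) [0..<K])) (tapes K \<tau>) = tapes K \<tau>"
  by (rule nth_equalityI) (auto simp: keep_def simp del: tape_act.simps)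

lemma act_do:
  "map2 tape_act ((keep (map (\<lambda>k. \<tau> k 0) [0..<K]))[k := p]) (tapes K \<tau>) =
     tapes K (\<tau>(k := tape_act p (\<tau> k)))"
  by (rule nth_equalityI) (auto simp: keep_def nth_list_update simp del: tape_act.simps)

lemma tm_step_iff:
  assumes "\<not> (\<exists>y n. tm_oracle M = Some (q, y, n))"
  shows "tm_step M X (q, tapes K \<tau>) c' \<longleftrightarrow>
    (\<exists>r as. (q, map (\<lambda>k. \<tau> k 0) [0..<K], r, as) \<in> tm_delta M \<and> c' = (r, map2 tape_act as (tapes K \<tau>)))"
  using assms by (auto simp: tm_step.simps comp_def)

lemma runs_jump:
  assumes "\<not> (\<exists>y n. tm_oracle M = Some (q, y, n))"
    and "\<And>r as. (q, map (\<lambda>k. \<tau> k 0) [0..<K], r, as) \<in> tm_delta M \<longleftrightarrow>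
           r = b \<and> as = keep (map (\<lambda>k. \<tau> k 0) [0..<K])"
    and "runs (tm_step M X) (b, tapes K \<tau>) n Q"
  shows "runs (tm_step M X) (q, tapes K \<tau>) (Suc n) Q"
  by (rule runs_det_step[where d = "(b, tapes K \<tau>)"])
    (use assms in \<open>auto simp: tm_step_iff[OF assms(1)] act_keep\<close>)

lemma HT_Do:
  assumes "k < K" "fst (F (\<tau> k 0)) < 3"
  shows "HT K (Do k F) \<tau> 1 {\<tau>(k := tape_act (F (\<tau> k 0)) (\<tau> k))}"
  unfolding HT_def
proof (intro impI conjI allI)
  assume v: "valid \<tau>"
  show "\<forall>\<tau>'\<in>{\<tau>(k := tape_act (F (\<tau> k 0)) (\<tau> k))}. valid \<tau>' \<and> (\<forall>k\<ge>K. \<tau>' k = \<tau> k)"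
    using v assms by (cases "F (\<tau> k 0)") (auto simp: valid_def)
  fix M :: tm and X a assume e: "embeds K a (Do k F) M"
  have no: "\<not> (\<exists>y n. tm_oracle M = Some (a, y, n))" using e by (auto simp: embeds_def)
  have "(a, map (\<lambda>k. \<tau> k 0) [0..<K], r, as) \<in> tm_delta M \<longleftrightarrow>
     r = Suc a \<and> as = (keep (map (\<lambda>k. \<tau> k 0) [0..<K]))[k := F (\<tau> k 0)]" for r as
    using e scan_in_scans[OF v, of K] assms(1) by (auto simp: embeds_def image_iff)
  then have "tm_step M X (a, tapes K \<tau>) c' \<longleftrightarrow> c' = (Suc a, tapes K (\<tau>(k := tape_act (F (\<tau> k 0)) (\<tau>
      k))))" for c'
    by (simp add: tm_step_iff[OF no] act_do)
  then show "runs (tm_step M X) (a, tapes K \<tau>) 1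
      ((\<lambda>\<tau>'. (a + size_of (Do k F), tapes K \<tau>')) ` {\<tau>(k := tape_act (F (\<tau> k 0)) (\<tau> k))})"
    using runs_det_step[of "tm_step M X" "(a, tapes K \<tau>)" _ 0, OF _ _ runs.stop] by simp
qed

lemma tapes_inj:
  assumes "\<And>\<tau>'. \<tau>' \<in> Q \<Longrightarrow> \<forall>k\<ge>K. \<tau>' k = \<tau> k"
  shows "inj_on (\<lambda>\<tau>'. (b, tapes K \<tau>')) Q"
proof (rule inj_onI, rule ext)
  fix \<tau>1 \<tau>2 k assume a: "\<tau>1 \<in> Q" "\<tau>2 \<in> Q" "(b, tapes K \<tau>1) = (b, tapes K \<tau>2)"
  show "\<tau>1 k = \<tau>2 k"
    using a assms by (cases "k < K") auto
qed

text \<open>In \<open>runs_trans\<close> the continuation depends on a configuration, in the Hoare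
  rules on a tape assignment; injectivity converts one into the other.\<close>

lemma runs_trans_image:
  assumes "runs S c n (f ` Q)" "inj_on f Q" "\<And>t. t \<in> Q \<Longrightarrow> runs S (f t) m (Q' t)"
  shows "runs S c (n + m) (\<Union>t\<in>Q. Q' t)"
proof -
  have "runs S c (n + m) (\<Union>c'\<in>f ` Q. Q' (the_inv_into Q f c'))"
    by (rule runs_trans[OF assms(1)]) (use assms(2,3) in \<open>auto simp: the_inv_into_f_f\<close>)
  then show ?thesis using assms(2) by (simp add: the_inv_into_f_f)
qed

lemma embeds_transfer:
  assumes "embeds K a c M" "a \<le> b" "b + size_of d \<le> a + size_of c"
    and "\<And>q ss r as. b \<le> q \<Longrightarrow> q < b + size_of d \<Longrightarrow> (q, ss, r, as) \<in> code K a c \<longleftrightarrow> (q, ss, r, as) \<in> code K b d"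
  shows "embeds K b d M"
  using assms unfolding embeds_def by (meson le_trans less_le_trans)

lemma embeds_Seq:
  assumes "embeds K a (Seq c d) M"
  shows "embeds K a c M" "embeds K (a + size_of c) d M"
proof -
  have 1: "a \<le> q \<and> q < a + size_of c" if "(q, ss, r, as) \<in> code K a c" for q ss r as
    using code_source[OF that] by simp
  have 2: "a + size_of c \<le> q" if "(q, ss, r, as) \<in> code K (a + size_of c) d" for q ss r as
    using code_source[OF that] by simp
  show "embeds K a c M" "embeds K (a + size_of c) d M"
    by (rule embeds_transfer[OF assms]; auto dest: 1 2)+
qed

lemma embeds_If:
  assumes "embeds K a (If k P c d) M"
  shows "embeds K (Suc a) c M" "embeds K (Suc (Suc (a + size_of c))) d M"
    "q = a \<or> q = Suc (a + size_of c) \<Longrightarrow> \<not> (\<exists>y n. tm_oracle M = Some (q, y, n))"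
    "(Suc (a + size_of c), ss, r, as) \<in> tm_delta M \<longleftrightarrow> ss \<in> scans K \<and> r = a + size_of (If k P c d) \<and>
        as = keep ss"
    "(a, ss, r, as) \<in> tm_delta M \<longleftrightarrow>
       ss \<in> scans K \<and> r = (if P (ss ! k) then Suc a else Suc (Suc (a + size_of c))) \<and> as = keep ss"
proof -
  have 1: "Suc a \<le> q \<and> q < Suc (a + size_of c)" if "(q, ss, r, as) \<in> code K (Suc a) c" for q ss r as
    using code_source[OF that] by simp
  have 2: "Suc (Suc (a + size_of c)) \<le> q" if "(q, ss, r, as) \<in> code K (Suc (Suc (a + size_of c))) d"
      for q ss r as
    using code_source[OF that] by simp
  show "embeds K (Suc a) c M" "embeds K (Suc (Suc (a + size_of c))) d M"
    by (rule embeds_transfer[OF assms]; auto simp: jump_iff dest: 1 2)+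
  show "q = a \<or> q = Suc (a + size_of c) \<Longrightarrow> \<not> (\<exists>y n. tm_oracle M = Some (q, y, n))"
    using assms by (auto simp: embeds_def)
  have *: "(q, ss, r, as) \<in> tm_delta M \<longleftrightarrow> (q, ss, r, as) \<in> code K a (If k P c d)"
    if "a \<le> q" "q < a + size_of (If k P c d)" for q
    using assms that by (auto simp: embeds_def)
  have 3: "(a, ss, r, as) \<notin> code K (Suc a) c" "(a, ss, r, as) \<notin> code K (Suc (Suc (a + size_of c))) d"
    "(Suc (a + size_of c), ss, r, as) \<notin> code K (Suc a) c"
    "(Suc (a + size_of c), ss, r, as) \<notin> code K (Suc (Suc (a + size_of c))) d"
    by (auto dest: 1 2)
  show "(Suc (a + size_of c), ss, r, as) \<in> tm_delta M \<longleftrightarrow> ss \<in> scans K \<and> r = a + size_of (If k P c d)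
      \<and> as = keep ss"
    using *[of "Suc (a + size_of c)"] 3 by (auto simp: jump_iff)
  show "(a, ss, r, as) \<in> tm_delta M \<longleftrightarrow>
       ss \<in> scans K \<and> r = (if P (ss ! k) then Suc a else Suc (Suc (a + size_of c))) \<and> as = keep ss"
    using *[of a] 3 by (auto simp: jump_iff)
qed

lemma HT_Seq:
  assumes "HT K c \<tau> n Q" "\<And>\<tau>'. \<tau>' \<in> Q \<Longrightarrow> HT K d \<tau>' m (Q' \<tau>')"
  shows "HT K (Seq c d) \<tau> (n + m) (\<Union>\<tau>'\<in>Q. Q' \<tau>')"
  unfolding HT_def
proof (intro impI conjI allI)
  assume v: "valid \<tau>"
  show "\<forall>\<tau>'\<in>\<Union>\<tau>'\<in>Q. Q' \<tau>'. valid \<tau>' \<and> (\<forall>k\<ge>K. \<tau>' k = \<tau> k)"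
    using v assms by (simp add: HT_def)
  fix M :: tm and X a assume e: "embeds K a (Seq c d) M"
  have r: "runs (tm_step M X) (a, tapes K \<tau>) n ((\<lambda>\<tau>'. (a + size_of c, tapes K \<tau>')) ` Q)"
    using v assms(1) embeds_Seq(1)[OF e] by (auto simp: HT_def)
  have inj: "inj_on (\<lambda>\<tau>'. (a + size_of c, tapes K \<tau>')) Q"
    using v assms(1) by (intro tapes_inj[of _ K \<tau>]) (auto simp: HT_def)
  have r2: "runs (tm_step M X) (a + size_of c, tapes K \<tau>') m
      ((\<lambda>\<tau>'. (a + size_of (Seq c d), tapes K \<tau>')) ` Q' \<tau>')" if "\<tau>' \<in> Q" for \<tau>'
  proof -
    have "valid \<tau>'" using v assms(1) that by (auto simp: HT_def)
    then have "runs (tm_step M X) (a + size_of c, tapes K \<tau>') m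
      ((\<lambda>\<tau>'. (a + size_of c + size_of d, tapes K \<tau>')) ` Q' \<tau>')"
      using assms(2)[OF that] embeds_Seq(2)[OF e] unfolding HT_def by blast
    then show ?thesis by (simp only: size_of.simps add.assoc)
  qed
  show "runs (tm_step M X) (a, tapes K \<tau>) (n + m)
      ((\<lambda>\<tau>'. (a + size_of (Seq c d), tapes K \<tau>')) ` (\<Union>\<tau>'\<in>Q. Q' \<tau>'))"
    using runs_trans_image[OF r inj r2] by (simp add: image_UN)
qed

lemma HT_If_True:
  assumes "HT K c \<tau> n Q" "P (\<tau> k 0)" "k < K"
  shows "HT K (If k P c d) \<tau> (n + 2) Q"
  unfolding HT_def
proof (intro impI conjI allI)
  assume v: "valid \<tau>"
  show "\<forall>\<tau>'\<in>Q. valid \<tau>' \<and> (\<forall>k\<ge>K. \<tau>' k = \<tau> k)" using v assms by (simp add: HT_def)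
  fix M :: tm and X a assume e: "embeds K a (If k P c d) M"
  note e = embeds_If[OF e]
  have r: "runs (tm_step M X) (Suc a, tapes K \<tau>) n ((\<lambda>\<tau>'. (Suc a + size_of c, tapes K \<tau>')) ` Q)"
    using v assms(1) e(1) unfolding HT_def by blast
  have j: "runs (tm_step M X) (Suc a + size_of c, tapes K \<tau>') 1 {(a + size_of (If k P c d), tapes K
      \<tau>')}" if "\<tau>' \<in> Q" for \<tau>'
  proof -
    have "valid \<tau>'" using v assms(1) that by (auto simp: HT_def)
    from scan_in_scans[OF this] show ?thesis unfolding One_nat_def
      by (intro runs_jump[OF _ _ runs.stop]) (use e(3,4) in auto)
  qed
  have inj: "inj_on (\<lambda>\<tau>'. (Suc a + size_of c, tapes K \<tau>')) Q"
    using v assms(1) by (intro tapes_inj[of _ K \<tau>]) (auto simp: HT_def)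
  have "runs (tm_step M X) (a, tapes K \<tau>) (Suc (n + 1)) (\<Union>\<tau>'\<in>Q. {(a + size_of (If k P c d), tapes K \<tau>')})"
    by (intro runs_jump[OF _ _ runs_trans_image[OF r inj j]])
      (use e scan_in_scans[OF v] assms in auto)
  then show "runs (tm_step M X) (a, tapes K \<tau>) (n + 2) ((\<lambda>\<tau>'. (a + size_of (If k P c d), tapes K \<tau>')) ` Q)"
    by (simp add: UNION_singleton_eq_range)
qed


lemma HT_If_False:
  assumes "HT K d \<tau> n Q" "\<not> P (\<tau> k 0)" "k < K"
  shows "HT K (If k P c d) \<tau> (n + 1) Q"
  unfolding HT_def
proof (intro impI conjI allI)
  assume v: "valid \<tau>"
  show "\<forall>\<tau>'\<in>Q. valid \<tau>' \<and> (\<forall>k\<ge>K. \<tau>' k = \<tau> k)" using v assms by (simp add: HT_def)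
  fix M :: tm and X a assume e: "embeds K a (If k P c d) M"
  note e = embeds_If[OF e]
  have eq: "Suc (Suc (a + size_of c)) + size_of d = a + size_of (If k P c d)" by simp
  have "runs (tm_step M X) (Suc (Suc (a + size_of c)), tapes K \<tau>) n
      ((\<lambda>\<tau>'. (a + size_of (If k P c d), tapes K \<tau>')) ` Q)"
    using v assms(1) e(2) unfolding HT_def eq[symmetric] by blast
  then show "runs (tm_step M X) (a, tapes K \<tau>) (n + 1)
      ((\<lambda>\<tau>'. (a + size_of (If k P c d), tapes K \<tau>')) ` Q)"
    unfolding Suc_eq_plus1[symmetric]
    by (rule runs_jump[rotated 2]) (use e scan_in_scans[OF v] assms in auto)
qed

lemma embeds_While:
  assumes "embeds K a (While k P c) M"
  shows "embeds K (Suc a) c M"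
    "q = a \<or> q = Suc (a + size_of c) \<Longrightarrow> \<not> (\<exists>y n. tm_oracle M = Some (q, y, n))"
    "(Suc (a + size_of c), ss, r, as) \<in> tm_delta M \<longleftrightarrow> ss \<in> scans K \<and> r = a \<and> as = keep ss"
    "(a, ss, r, as) \<in> tm_delta M \<longleftrightarrow>
       ss \<in> scans K \<and> r = (if P (ss ! k) then Suc a else a + size_of (While k P c)) \<and> as = keep ss"
proof -
  have 1: "Suc a \<le> q \<and> q < Suc (a + size_of c)" if "(q, ss, r, as) \<in> code K (Suc a) c" for q ss r as
    using code_source[OF that] by simp
  show "embeds K (Suc a) c M"
    by (rule embeds_transfer[OF assms]; auto simp: jump_iff dest: 1)
  show "q = a \<or> q = Suc (a + size_of c) \<Longrightarrow> \<not> (\<exists>y n. tm_oracle M = Some (q, y, n))"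
    using assms by (auto simp: embeds_def)
  have *: "(q, ss, r, as) \<in> tm_delta M \<longleftrightarrow> (q, ss, r, as) \<in> code K a (While k P c)"
    if "a \<le> q" "q < a + size_of (While k P c)" for q
    using assms that by (auto simp: embeds_def)
  have 3: "(a, ss, r, as) \<notin> code K (Suc a) c" "(Suc (a + size_of c), ss, r, as) \<notin> code K (Suc a) c"
    by (auto dest: 1)
  show "(Suc (a + size_of c), ss, r, as) \<in> tm_delta M \<longleftrightarrow> ss \<in> scans K \<and> r = a \<and> as = keep ss"
    using *[of "Suc (a + size_of c)"] 3 by (auto simp: jump_iff)
  show "(a, ss, r, as) \<in> tm_delta M \<longleftrightarrow>
       ss \<in> scans K \<and> r = (if P (ss ! k) then Suc a else a + size_of (While k P c)) \<and> as = keep ss"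
    using *[of a] 3 by (auto simp: jump_iff)
qed

lemma HT_While_False:
  assumes "\<not> P (\<tau> k 0)" "k < K"
  shows "HT K (While k P c) \<tau> 1 {\<tau>}"
  unfolding HT_def
proof (intro impI conjI allI)
  assume v: "valid \<tau>"
  then show "\<forall>\<tau>'\<in>{\<tau>}. valid \<tau>' \<and> (\<forall>k\<ge>K. \<tau>' k = \<tau> k)" by simp
  fix M :: tm and X a assume e: "embeds K a (While k P c) M"
  note e = embeds_While[OF e]
  have "runs (tm_step M X) (a, tapes K \<tau>) (Suc 0) {(a + size_of (While k P c), tapes K \<tau>)}"
    by (rule runs_jump[OF _ _ runs.stop]) (use e scan_in_scans[OF v] assms in auto)
  then show "runs (tm_step M X) (a, tapes K \<tau>) 1
      ((\<lambda>\<tau>'. (a + size_of (While k P c), tapes K \<tau>')) ` {\<tau>})"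
    by simp
qed

lemma HT_While_True:
  assumes "P (\<tau> k 0)" "HT K c \<tau> n Q" "\<And>\<tau>'. \<tau>' \<in> Q \<Longrightarrow> HT K (While k P c) \<tau>' m (Q' \<tau>')" "k < K"
  shows "HT K (While k P c) \<tau> (n + m + 2) (\<Union>\<tau>'\<in>Q. Q' \<tau>')"
  unfolding HT_def
proof (intro impI conjI allI)
  assume v: "valid \<tau>"
  show "\<forall>\<tau>'\<in>\<Union>\<tau>'\<in>Q. Q' \<tau>'. valid \<tau>' \<and> (\<forall>k\<ge>K. \<tau>' k = \<tau> k)"
    using v assms(2,3) by (simp add: HT_def)
  fix M :: tm and X a assume em: "embeds K a (While k P c) M"
  note e = embeds_While[OF em]
  have r: "runs (tm_step M X) (Suc a, tapes K \<tau>) n ((\<lambda>\<tau>'. (Suc a + size_of c, tapes K \<tau>')) ` Q)"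
    using v assms(2) e(1) unfolding HT_def by blast
  have inj: "inj_on (\<lambda>\<tau>'. (Suc a + size_of c, tapes K \<tau>')) Q"
    using v assms(2) by (intro tapes_inj[of _ K \<tau>]) (auto simp: HT_def)
  have r2: "runs (tm_step M X) (Suc a + size_of c, tapes K \<tau>') (Suc m)
      ((\<lambda>\<tau>'. (a + size_of (While k P c), tapes K \<tau>')) ` Q' \<tau>')" if "\<tau>' \<in> Q" for \<tau>'
  proof -
    have v': "valid \<tau>'" using v assms(2) that by (auto simp: HT_def)
    then have "runs (tm_step M X) (a, tapes K \<tau>') m
      ((\<lambda>\<tau>'. (a + size_of (While k P c), tapes K \<tau>')) ` Q' \<tau>')"
      using assms(3)[OF that] em unfolding HT_def by blast
    then show ?thesis
      by (rule runs_jump[rotated 2]) (use e scan_in_scans[OF v'] in auto)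
  qed
  have "runs (tm_step M X) (a, tapes K \<tau>) (Suc (n + Suc m))
      (\<Union>\<tau>'\<in>Q. (\<lambda>\<tau>'. (a + size_of (While k P c), tapes K \<tau>')) ` Q' \<tau>')"
    by (intro runs_jump[OF _ _ runs_trans_image[OF r inj r2]])
      (use e scan_in_scans[OF v] assms in auto)
  then show "runs (tm_step M X) (a, tapes K \<tau>) (n + m + 2)
      ((\<lambda>\<tau>'. (a + size_of (While k P c), tapes K \<tau>')) ` (\<Union>\<tau>'\<in>Q. Q' \<tau>'))"
    by (simp add: image_UN)
qed

lemma embeds_Choice:
  assumes "embeds K a (Choice c d) M"
  shows "embeds K (Suc a) c M" "embeds K (Suc (Suc (a + size_of c))) d M"
    "q = a \<or> q = Suc (a + size_of c) \<Longrightarrow> \<not> (\<exists>y n. tm_oracle M = Some (q, y, n))"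
    "(Suc (a + size_of c), ss, r, as) \<in> tm_delta M \<longleftrightarrow> ss \<in> scans K \<and> r = a + size_of (Choice c d) \<and>
        as = keep ss"
    "(a, ss, r, as) \<in> tm_delta M \<longleftrightarrow>
       ss \<in> scans K \<and> (r = Suc a \<or> r = Suc (Suc (a + size_of c))) \<and> as = keep ss"
proof -
  have 1: "Suc a \<le> q \<and> q < Suc (a + size_of c)" if "(q, ss, r, as) \<in> code K (Suc a) c" for q ss r as
    using code_source[OF that] by simp
  have 2: "Suc (Suc (a + size_of c)) \<le> q" if "(q, ss, r, as) \<in> code K (Suc (Suc (a + size_of c))) d"
      for q ss r as
    using code_source[OF that] by simp
  show "embeds K (Suc a) c M" "embeds K (Suc (Suc (a + size_of c))) d M"
    by (rule embeds_transfer[OF assms]; auto simp: jump_iff dest: 1 2)+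
  show "q = a \<or> q = Suc (a + size_of c) \<Longrightarrow> \<not> (\<exists>y n. tm_oracle M = Some (q, y, n))"
    using assms by (auto simp: embeds_def)
  have *: "(q, ss, r, as) \<in> tm_delta M \<longleftrightarrow> (q, ss, r, as) \<in> code K a (Choice c d)"
    if "a \<le> q" "q < a + size_of (Choice c d)" for q
    using assms that by (auto simp: embeds_def)
  have 3: "(a, ss, r, as) \<notin> code K (Suc a) c" "(a, ss, r, as) \<notin> code K (Suc (Suc (a + size_of c))) d"
    "(Suc (a + size_of c), ss, r, as) \<notin> code K (Suc a) c"
    "(Suc (a + size_of c), ss, r, as) \<notin> code K (Suc (Suc (a + size_of c))) d"
    by (auto dest: 1 2)
  show "(Suc (a + size_of c), ss, r, as) \<in> tm_delta M \<longleftrightarrow> ss \<in> scans K \<and> r = a + size_of (Choice c d)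
      \<and> as = keep ss"
    using *[of "Suc (a + size_of c)"] 3 by (auto simp: jump_iff)
  show "(a, ss, r, as) \<in> tm_delta M \<longleftrightarrow>
       ss \<in> scans K \<and> (r = Suc a \<or> r = Suc (Suc (a + size_of c))) \<and> as = keep ss"
    using *[of a] 3 by (auto simp: jump_iff)
qed

lemma HT_Choice:
  assumes "HT K c \<tau> n Q1" "HT K d \<tau> n Q2"
  shows "HT K (Choice c d) \<tau> (n + 2) (Q1 \<union> Q2)"
  unfolding HT_def
proof (intro impI conjI allI)
  assume v: "valid \<tau>"
  show "\<forall>\<tau>'\<in>Q1 \<union> Q2. valid \<tau>' \<and> (\<forall>k\<ge>K. \<tau>' k = \<tau> k)" using v assms by (auto simp: HT_def)
  fix M :: tm and X a assume e: "embeds K a (Choice c d) M"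
  note e = embeds_Choice[OF e]
  let ?out = "\<lambda>\<tau>'. (a + size_of (Choice c d), tapes K \<tau>')"
  let ?l = "Suc a" and ?r = "Suc (Suc (a + size_of c))"
  have r: "runs (tm_step M X) (Suc a, tapes K \<tau>) n ((\<lambda>\<tau>'. (Suc a + size_of c, tapes K \<tau>')) ` Q1)"
    using v assms(1) e(1) unfolding HT_def by blast
  have j: "runs (tm_step M X) (Suc a + size_of c, tapes K \<tau>') 1 {?out \<tau>'}" if "\<tau>' \<in> Q1" for \<tau>'
  proof -
    have "valid \<tau>'" using v assms(1) that by (auto simp: HT_def)
    from scan_in_scans[OF this] show ?thesis unfolding One_nat_def
      by (intro runs_jump[OF _ _ runs.stop]) (use e(3,4) in auto)
  qed
  have inj: "inj_on (\<lambda>\<tau>'. (Suc a + size_of c, tapes K \<tau>')) Q1"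
    using v assms(1) by (intro tapes_inj[of _ K \<tau>]) (auto simp: HT_def)
  have 1: "runs (tm_step M X) (?l, tapes K \<tau>) (n + 1) (?out ` Q1)"
    using runs_trans_image[OF r inj j] by (simp add: UNION_singleton_eq_range)
  have eq: "?r + size_of d = a + size_of (Choice c d)" by simp
  have "runs (tm_step M X) (?r, tapes K \<tau>) n (?out ` Q2)"
    using v assms(2) e(2) unfolding HT_def eq[symmetric] by blast
  then have 2: "runs (tm_step M X) (?r, tapes K \<tau>) (n + 1) (?out ` Q2)"
    by (rule runs_mono) simp
  have s: "tm_step M X (a, tapes K \<tau>) c' \<longleftrightarrow> c' = (?l, tapes K \<tau>) \<or> c' = (?r, tapes K \<tau>)" for c'
    using e scan_in_scans[OF v] by (subst tm_step_iff) (auto simp: act_keep)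
  \<comment> \<open>\<open>runs.step\<close> wants the outcomes as a function of the successor; the
    two successors differ in their states, so the definition by cases is unambiguous.\<close>
  define Q where "Q c' = (if c' = (?l, tapes K \<tau>) then ?out ` Q1 else ?out ` Q2)" for c'
  have "runs (tm_step M X) (a, tapes K \<tau>) (Suc (n + 1)) (\<Union>c'\<in>{c'. tm_step M X (a, tapes K \<tau>) c'}. Q c')"
  proof (rule runs.step[where d = "(?l, tapes K \<tau>)"])
    show "tm_step M X (a, tapes K \<tau>) (?l, tapes K \<tau>)" by (simp add: s)
    show "runs (tm_step M X) c' (n + 1) (Q c')" if "tm_step M X (a, tapes K \<tau>) c'" for c'
    proof -
      from that consider "c' = (?l, tapes K \<tau>)" | "c' = (?r, tapes K \<tau>)" unfolding s by blast
      then show ?thesis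
      proof cases
        case 1
        then show ?thesis using \<open>runs _ (?l, tapes K \<tau>) (n + 1) _\<close> by (simp only: Q_def if_True refl)
      next
        case 2
        have "Q c' = ?out ` Q2" using 2 size_of_pos[of c] by (simp add: Q_def)
        with 2 show ?thesis using \<open>runs _ (?r, tapes K \<tau>) (n + 1) _\<close> by (simp only:)
      qed
    qed
  qed
  moreover have "(\<Union>c'\<in>{c'. tm_step M X (a, tapes K \<tau>) c'}. Q c') = ?out ` (Q1 \<union> Q2)"
  proof -
    have "{c'. tm_step M X (a, tapes K \<tau>) c'} = {(?l, tapes K \<tau>), (?r, tapes K \<tau>)}"
      unfolding s by blast
    moreover have "Q (?l, tapes K \<tau>) = ?out ` Q1" by (simp only: Q_def if_True refl)
    moreover have "Q (?r, tapes K \<tau>) = ?out ` Q2" using size_of_pos[of c] by (simp add: Q_def)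
    ultimately show ?thesis by (simp only: UN_insert UN_empty image_Un Un_empty_right)
  qed
  ultimately show "runs (tm_step M X) (a, tapes K \<tau>) (n + 2) (?out ` (Q1 \<union> Q2))"
    by simp
qed

section \<open>Machines built from programs\<close>

definition start :: "bool list \<Rightarrow> nat \<Rightarrow> tape" where
  "start w = (\<lambda>k. if k = 0 then tape_of w else (\<lambda>_. 0))"

lemma bit_symbol_bounds: "0 < bit_symbol b" "bit_symbol b < 3"
  by (cases b; simp)+

lemma valid_start: "valid (start w)"
  using bit_symbol_bounds by (auto simp: valid_def start_def tape_of_def)

lemma initial_eq:
  assumes "tm_start M = 0" "tm_tapes M = K" "K \<ge> 1"
  shows "initial M w = (0, tapes K (start w))"
proof -
  have "tape_of w # replicate (K - 1) (\<lambda>_. 0) = tapes K (start w)"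
    using assms(3) by (intro nth_equalityI) (auto simp: start_def nth_Cons')
  with assms show ?thesis by (simp add: initial_def)
qed

lemma HT_runs:
  assumes "embeds K 0 c M" "tm_start M = 0" "tm_tapes M = K" "K \<ge> 1" "HT K c (start w) n Q"
  shows "runs (tm_step M X) (initial M w) n ((\<lambda>\<tau>. (size_of c, tapes K \<tau>)) ` Q)"
proof -
  have "runs (tm_step M X) (0, tapes K (start w)) n ((\<lambda>\<tau>. (0 + size_of c, tapes K \<tau>)) ` Q)"
    using assms(1,5) valid_start[of w] unfolding HT_def by blast
  with assms show ?thesis by (simp add: initial_eq)
qed

lemma runs_halts:
  assumes "runs (tm_step M X) (initial M w) n Q" "\<And>q. q \<in> Q \<Longrightarrow> \<not> (\<exists>d. tm_step M X q d)"
  shows "halts_at M X w c \<longleftrightarrow> c \<in> Q"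
    and "accepts M X w \<longleftrightarrow> (\<exists>c\<in>Q. fst c = tm_accept M)"
proof -
  show *: "halts_at M X w c \<longleftrightarrow> c \<in> Q" for c
    unfolding halts_at_def using assms(2) runs_reach[OF assms(1)] runs_complete[OF assms(1) _ _
        assms(2)] by blast
  show "accepts M X w \<longleftrightarrow> (\<exists>c\<in>Q. fst c = tm_accept M)"
    unfolding accepts_def * by blast
qed

lemma poly_time_runs:
  assumes "\<And>w. \<exists>n Q. n \<le> poly p (length w) \<and> runs (tm_step M X) (initial M w) n Q \<and> (\<forall>q\<in>Q. \<not> (\<exists>d.
      tm_step M X q d))"
  shows "poly_time M X"
  unfolding poly_time_def
proof (intro exI allI impI)
  fix w c m assume a: "(tm_step M X ^^ m) (initial M w) c"
  obtain n Q where "n \<le> poly p (length w)" "runs (tm_step M X) (initial M w) n Q" "\<And>q. q \<in> Q \<Longrightarrow> \<not>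
      (\<exists>d. tm_step M X q d)"
    using assms by blast
  with runs_bound[OF this(2) a this(3)] show "m \<le> poly p (length w)" by simp
qed

text \<open>Acceptance is read off tape \<open>r\<close>: one extra transition leads from the exit
  state to the accepting one if a blank is scanned there. Otherwise the machine halts in the exit
  state, which does not accept.\<close>

lemma NP_program:
  assumes "r < K" "\<And>w. HT K c (start w) (poly p (length w)) (Q w)"
  shows "{w. \<exists>\<tau>\<in>Q w. \<tau> r 0 = 0} \<in> NP"
proof -
  define b where "b = size_of c"
  define M where "M = \<lparr>tm_tapes = K, tm_delta = code K 0 c \<union> jump K b (\<lambda>ss. ss ! r = 0) (Suc b),
    tm_start = 0, tm_accept = Suc b, tm_oracle = None\<rparr>"
  have wf: "well_formed M"
    using assms(1) code_lengths finite_scans[of K]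
    by (auto simp: well_formed_def M_def finite_code jump_def keep_def) (auto simp: scans_def)
  have em: "embeds K 0 c M" by (auto simp: embeds_def M_def jump_iff b_def)
  have no: "\<not> (\<exists>y n. tm_oracle M = Some (q, y, n))" for q by (simp add: M_def)
  have step: "tm_step M X (q, tapes K \<tau>) c' \<longleftrightarrow> q = b \<and> \<tau> r 0 = 0 \<and> c' = (Suc b, tapes K \<tau>)"
    if "q \<ge> b" "valid \<tau>" for q X \<tau> c'
    using that assms(1) code_source scan_in_scans[OF that(2), of K]
    by (subst tm_step_iff[OF no]) (fastforce simp: M_def jump_iff act_keep b_def)
  define Q' where "Q' w = (\<Union>\<tau>\<in>Q w. {(if \<tau> r 0 = 0 then Suc b else b, tapes K \<tau>)})" for w
  have val: "valid \<tau>" if "\<tau> \<in> Q w" for \<tau> w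
    using assms(2)[of w] valid_start[of w] that by (auto simp: HT_def)
  have run: "runs (tm_step M X) (initial M w) (poly p (length w) + 1) (Q' w)" for w X
    unfolding Q'_def
  proof (rule runs_trans_image[OF HT_runs[OF em _ _ _ assms(2)]])
    show "inj_on (\<lambda>\<tau>. (size_of c, tapes K \<tau>)) (Q w)"
      using assms(2)[of w] valid_start[of w] by (intro tapes_inj[of _ K "start w"]) (auto simp: HT_def)
    show "runs (tm_step M X) (size_of c, tapes K \<tau>) 1 {(if \<tau> r 0 = 0 then Suc b else b, tapes K \<tau>)}"
        if "\<tau> \<in> Q w" for \<tau>
    proof (cases "\<tau> r 0 = 0")
      case True
      then show ?thesis unfolding One_nat_def
        by (intro runs_det_step[where d = "(Suc b, tapes K \<tau>)"]) (use val[OF that] step runs.stop in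
            \<open>auto simp: b_def\<close>)
    qed (use runs.stop in \<open>simp add: b_def\<close>)
  qed (use assms(1) in \<open>auto simp: M_def\<close>)
  have fin: "\<not> (\<exists>d. tm_step M X q d)" if "q \<in> Q' w" for q w X
    using that val by (auto simp: Q'_def step split: if_splits)
  have "poly_time M {}"
    by (rule poly_time_runs[of "p + 1"]) (use run fin in \<open>metis poly_add poly_1 order_refl\<close>)
  moreover have "accepts M {} w \<longleftrightarrow> (\<exists>\<tau>\<in>Q w. \<tau> r 0 = 0)" for w
    by (subst runs_halts(2)[OF run fin]) (auto simp: Q'_def M_def)
  ultimately show ?thesis
    unfolding NP_def using wf by (auto intro!: exI[of _ M] simp: oracle_free_def M_def)
qed

text \<open>The exit state of the program is the query state, and the state for a negative answer
  accepts. The program only has to guess and to write the query, which is asked once at the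
  end.\<close>

lemma NP_oracle_program:
  assumes "K \<ge> 1" "\<And>w. HT K c (start w) (poly p (length w)) (Q w)"
  shows "{w. \<exists>\<tau>\<in>Q w. \<not> (\<exists>v\<in>X. tape_holds (\<tau> (K - 1)) v)} \<in> NP_oracle X"
proof -
  define b where "b = size_of c"
  define M where "M = \<lparr>tm_tapes = K, tm_delta = code K 0 c,
    tm_start = 0, tm_accept = Suc (Suc b), tm_oracle = Some (b, Suc b, Suc (Suc b))\<rparr>"
  have wf: "well_formed M"
    using assms(1) code_lengths by (auto simp: well_formed_def M_def finite_code)
  have em: "embeds K 0 c M" by (auto simp: embeds_def M_def b_def)
  have last: "last (tapes K \<tau>) = \<tau> (K - 1)" for \<tau> using assms(1) by (simp add: last_map)
  let ?ans = "\<lambda>\<tau>. if \<exists>v\<in>X. tape_holds (\<tau> (K - 1)) v then Suc b else Suc (Suc b)"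
  have step: "tm_step M X (b, tapes K \<tau>) c' \<longleftrightarrow> c' = (?ans \<tau>, tapes K \<tau>)" for \<tau> c'
    by (subst tm_step.simps) (auto simp: M_def last)
  have stuck: "\<not> tm_step M X (?ans \<tau>, tapes K \<tau>) c'" for \<tau> c'
    by (subst tm_step_iff) (auto simp: M_def b_def dest: code_source)
  define Q' where "Q' w = (\<Union>\<tau>\<in>Q w. {(?ans \<tau>, tapes K \<tau>)})" for w
  have run: "runs (tm_step M X) (initial M w) (poly p (length w) + 1) (Q' w)" for w
    unfolding Q'_def
  proof (rule runs_trans_image[OF HT_runs[OF em _ _ _ assms(2)]])
    show "inj_on (\<lambda>\<tau>. (size_of c, tapes K \<tau>)) (Q w)"
      using assms(2)[of w] valid_start[of w] by (intro tapes_inj[of _ K "start w"]) (auto simp: HT_def)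
    show "runs (tm_step M X) (size_of c, tapes K \<tau>) 1 {(?ans \<tau>, tapes K \<tau>)}" for \<tau>
      unfolding One_nat_def b_def[symmetric]
      by (rule runs_det_step[where d = "(?ans \<tau>, tapes K \<tau>)"]) (use step runs.stop in auto)
  qed (use assms(1) in \<open>auto simp: M_def\<close>)
  have fin: "\<not> (\<exists>d. tm_step M X q d)" if "q \<in> Q' w" for q w
    using that stuck unfolding Q'_def by blast
  have "poly_time M X"
    by (rule poly_time_runs[of "p + 1"]) (use run fin in \<open>metis poly_add poly_1 order_refl\<close>)
  moreover have "accepts M X w \<longleftrightarrow> (\<exists>\<tau>\<in>Q w. \<not> (\<exists>v\<in>X. tape_holds (\<tau> (K - 1)) v))" for w
    by (subst runs_halts(2)[OF run fin]) (auto simp: Q'_def M_def)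
  ultimately show ?thesis
    unfolding NP_oracle_def using wf by (auto intro!: exI[of _ M])
qed

lemma poly_time_computable_program:
  assumes "K \<ge> 1" "choice_free c" "\<And>w. HT K c (start w) (poly p (length w)) {\<tau> w}"
    "\<And>w. tape_holds (\<tau> w 0) (f w)"
  shows "poly_time_computable f"
proof -
  define M where "M = \<lparr>tm_tapes = K, tm_delta = code K 0 c,
    tm_start = 0, tm_accept = 0, tm_oracle = None\<rparr>"
  have wf: "well_formed M"
    using assms(1) code_lengths by (auto simp: well_formed_def M_def finite_code)
  have det: "deterministic M"
    using code_det[OF assms(2)] by (auto simp: deterministic_def M_def)
  have em: "embeds K 0 c M" by (auto simp: embeds_def M_def)
  have run: "runs (tm_step M X) (initial M w) (poly p (length w)) {(size_of c, tapes K (\<tau> w))}" for X w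
    using HT_runs[OF em _ _ _ assms(3)] assms(1) by (simp add: M_def)
  have fin: "\<not> (\<exists>d. tm_step M X q d)" if "q \<in> {(size_of c, tapes K (\<tau> w))}" for X q w
    using that by (auto simp: tm_step_iff M_def dest: code_source)
  have "poly_time M {}"
    by (rule poly_time_runs[of p]) (use run fin in blast)
  moreover have "halts_at M {} w (size_of c, tapes K (\<tau> w))" for w
    by (subst runs_halts(1)[OF run fin]) auto
  moreover have "hd (tapes K (\<tau> w)) = \<tau> w 0" for w using assms(1) by (simp add: hd_map)
  ultimately show ?thesis
    unfolding poly_time_computable_def using wf det assms(4)
    by (intro exI[of _ M]) (metis M_def oracle_free_def snd_conv tm.select_convs(5))
qed

section \<open>Polynomial-time counter functions\<close>

text \<open>A counter is a blank tape with a single mark; its value is the distance of the head from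
  the mark, so that it is changed by head movements only.\<close>

definition ctr :: "nat \<Rightarrow> tape" where
  "ctr x = (\<lambda>i. if i = - int x then 1 else 0)"

definition shift :: "tape \<Rightarrow> int \<Rightarrow> tape" where
  "shift t n = (\<lambda>i. t (i + n))"

lemma shift_simps [simp]: "shift t 0 = t" "shift (shift t m) n = shift t (m + n)"
  by (auto simp: shift_def algebra_simps)

lemma act_move: "tape_act (t 0, m) t = shift t (move_offset m)"
  by (auto simp: shift_def fun_eq_iff)

lemma ctr_shift [simp]: "shift (ctr x) 1 = ctr (Suc x)" "shift (ctr (Suc x)) (-1) = ctr x"
  by (auto simp: ctr_def shift_def fun_eq_iff)

lemma ctr_0 [simp]: "ctr x 0 = 1 \<longleftrightarrow> x = 0" "ctr x 0 = Suc 0 \<longleftrightarrow> x = 0"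
  by (auto simp: ctr_def)

lemma ctr_eq [simp]: "ctr x = ctr y \<longleftrightarrow> x = y"
proof
  assume "ctr x = ctr y"
  then have "ctr x (- int x) = ctr y (- int x)" by simp
  then show "x = y" by (simp add: ctr_def split: if_splits)
qed simp

section \<open>Deterministic triples and loops over counters\<close>

abbreviation DT :: "nat \<Rightarrow> prog \<Rightarrow> (nat \<Rightarrow> tape) \<Rightarrow> nat \<Rightarrow> (nat \<Rightarrow> tape) \<Rightarrow> bool" where
  "DT K c \<tau> n \<tau>' \<equiv> HT K c \<tau> n {\<tau>'}"

lemma DT_weaken: "DT K c \<tau> n \<tau>' \<Longrightarrow> n \<le> m \<Longrightarrow> \<tau>' = \<tau>'' \<Longrightarrow> DT K c \<tau> m \<tau>''"
  using HT_mono by blast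

lemma DT_Seq: "DT K c \<tau> n \<tau>1 \<Longrightarrow> DT K d \<tau>1 m \<tau>2 \<Longrightarrow> DT K (Seq c d) \<tau> (n + m) \<tau>2"
  using HT_Seq[of K c \<tau> n "{\<tau>1}" d m "\<lambda>_. {\<tau>2}"] by simp

definition mv :: "nat \<Rightarrow> move \<Rightarrow> prog" where
  "mv k m = Do k (\<lambda>s. (s, m))"

abbreviation inc :: "nat \<Rightarrow> prog" where "inc k \<equiv> mv k MoveRight"
abbreviation dec :: "nat \<Rightarrow> prog" where "dec k \<equiv> mv k MoveLeft"
abbreviation skip :: "nat \<Rightarrow> prog" where "skip k \<equiv> mv k Stay"

lemma HT_valid: "(valid \<tau> \<Longrightarrow> HT K c \<tau> n Q) \<Longrightarrow> HT K c \<tau> n Q"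
  by (auto simp: HT_def)

lemma DT_mv: "k < K \<Longrightarrow> DT K (mv k m) \<tau> 1 (\<tau>(k := shift (\<tau> k) (move_offset m)))"
proof (rule HT_valid)
  assume "k < K" "valid \<tau>"
  with HT_Do[of k K "\<lambda>s. (s, m)" \<tau>] show ?thesis
    by (simp add: mv_def act_move valid_def del: tape_act.simps)
qed

lemma DT_inc: "k < K \<Longrightarrow> \<tau> k = ctr x \<Longrightarrow> DT K (inc k) \<tau> 1 (\<tau>(k := ctr (Suc x)))"
  using DT_mv[of k K MoveRight \<tau>] by simp

lemma DT_dec: "k < K \<Longrightarrow> \<tau> k = ctr (Suc x) \<Longrightarrow> DT K (dec k) \<tau> 1 (\<tau>(k := ctr x))"
  using DT_mv[of k K MoveLeft \<tau>] by simp

lemma DT_skip: "k < K \<Longrightarrow> DT K (skip k) \<tau> 1 \<tau>"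
  using DT_mv[of k K Stay \<tau>] by simp

lemma choice_free_mv [simp]: "choice_free (mv k m)"
  by (simp add: mv_def)

lemma DT_While:
  assumes "k < K" "\<And>i. i < N \<Longrightarrow> P (S i k 0)" "\<not> P (S N k 0)"
    and "\<And>i. i < N \<Longrightarrow> DT K c (S i) n (S (Suc i))"
  shows "DT K (While k P c) (S 0) (N * (n + 2) + 1) (S N)"
proof -
  have "DT K (While k P c) (S i) ((N - i) * (n + 2) + 1) (S N)" if "i \<le> N" for i
    using that
  proof (induction "N - i" arbitrary: i)
    case 0
    then show ?case using HT_While_False[of P "S N" k K c] assms by simp
  next
    case (Suc m)
    then have i: "i < N" by simp
    have "DT K (While k P c) (S (Suc i)) (m * (n + 2) + 1) (S N)"
      using Suc.hyps(1)[of "Suc i"] Suc.hyps(2) i by (simp add: Suc_diff_Suc[symmetric])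
    then have "HT K (While k P c) (S i) (n + (m * (n + 2) + 1) + 2) (\<Union>\<tau>'\<in>{S (Suc i)}. {S N})"
      by (intro HT_While_True[where Q' = "\<lambda>_. {S N}"]) (use assms(1,2,4) i in auto)
    then have "DT K (While k P c) (S i) (n + (m * (n + 2) + 1) + 2) (S N)" by simp
    then show ?case using Suc.hyps(2)[symmetric] by (simp add: algebra_simps)
  qed
  from this[of 0] show ?thesis by simp
qed

definition For :: "nat \<Rightarrow> prog \<Rightarrow> prog" where
  "For k c = While k (\<lambda>s. s \<noteq> 1) (Seq (dec k) c)"

lemma choice_free_For [simp]: "choice_free (For k c) = choice_free c"
  by (simp add: For_def)

text \<open>The loop counts down, so the invariant \<open>S x\<close> is indexed by the number of
  rounds left. The body starts with the counter already lowered to \<open>x\<close> while all else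
  is still as in \<open>S (Suc x)\<close>.\<close>

lemma DT_For:
  assumes "k < K" "\<And>x. x \<le> N \<Longrightarrow> S x k = ctr x"
    and "\<And>x. x < N \<Longrightarrow> DT K c ((S (Suc x))(k := ctr x)) n (S x)"
    and "\<tau> = S N" "\<tau>' = S 0" "t \<ge> N * (n + 3) + 1"
  shows "DT K (For k c) \<tau> t \<tau>'"
proof -
  have "DT K (For k c) (S (N - 0)) (N * ((1 + n) + 2) + 1) (S (N - N))"
    unfolding For_def
  proof (rule DT_While[where S = "\<lambda>i. S (N - i)"])
    fix i assume i: "i < N"
    show "S (N - i) k 0 \<noteq> 1" using i assms(2) by simp
    obtain x where x: "N - i = Suc x" "N - Suc i = x" using i by (metis Suc_diff_Suc)
    show "DT K (Seq (dec k) c) (S (N - i)) (1 + n) (S (N - Suc i))"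
      unfolding x by (rule DT_Seq[OF DT_dec assms(3)]) (use assms(1,2) i x in auto)
  qed (use assms in auto)
  then have "DT K (For k c) \<tau> (N * ((1 + n) + 2) + 1) \<tau>'" using assms(4,5) by simp
  then show ?thesis by (rule DT_weaken) (use assms(6) in \<open>auto simp: algebra_simps\<close>)
qed

text \<open>Argument \<open>e i\<close> lives on counter \<open>\<rho> i\<close>, word \<open>k\<close> on tape \<open>\<omega> k\<close>; the program adds the
  value of the function to counter \<open>r\<close>, using the counters from \<open>s\<close> on as scratch space.\<close>

definition layout :: "nat \<Rightarrow> (nat \<Rightarrow> nat) \<Rightarrow> (nat \<Rightarrow> nat) \<Rightarrow> nat \<Rightarrow> nat \<Rightarrow> nat \<Rightarrow> bool" where
  "layout K \<omega> \<rho> r s d \<longleftrightarrow> s + d \<le> K \<and> r < s \<and> (\<forall>i. \<rho> i < s \<and> \<rho> i \<noteq> r) \<and>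
     (\<forall>k. \<omega> k < s \<and> \<omega> k \<noteq> r \<and> (\<forall>i. \<omega> k \<noteq> \<rho> i))"

definition state :: "(nat \<Rightarrow> nat) \<Rightarrow> (nat \<Rightarrow> nat) \<Rightarrow> nat \<Rightarrow> nat \<Rightarrow> (nat \<Rightarrow> bool list) \<Rightarrow> (nat \<Rightarrow> nat) \<Rightarrow>
    nat \<Rightarrow> (nat \<Rightarrow> tape) \<Rightarrow> bool" where
  "state \<omega> \<rho> s d ws e m \<tau> \<longleftrightarrow> (\<forall>i. \<tau> (\<rho> i) = ctr (e i)) \<and> (\<forall>k. \<tau> (\<omega> k) = tape_of (ws k)) \<and>
     (\<forall>j. s \<le> j \<and> j < s + d \<longrightarrow> \<tau> j = ctr 0) \<and> (\<forall>i. e i \<le> m) \<and> (\<forall>k. length (ws k) \<le> m)"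

lemma layoutD:
  assumes "layout K \<omega> \<rho> r s d"
  shows "s + d \<le> K" "r < s" "\<rho> i < s" "\<rho> i \<noteq> r" "\<rho> i \<noteq> s" "\<rho> i \<noteq> Suc s" "\<omega> k < s" "\<omega> k \<noteq> r" "\<omega> k \<noteq>
      s" "\<omega> k \<noteq> Suc s"
    "\<omega> k \<noteq> \<rho> i" "s \<noteq> \<rho> i" "Suc s \<noteq> \<rho> i" "s \<noteq> \<omega> k" "Suc s \<noteq> \<omega> k" "\<rho> i \<noteq> \<omega> k" "\<rho> i < Suc s" "\<omega> k < Suc s"
    "\<rho> i < Suc (Suc s)" "\<omega> k < Suc (Suc s)" "r < Suc s" "r \<noteq> s" "s \<noteq> r" "\<not> s \<le> r" "\<not> Suc s \<le> r"
  using assms by (auto simp: layout_def intro: less_trans) (metis less_irrefl less_SucI less_Suc_eq)+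

text \<open>The same polynomial bounds value and running time, in terms of a bound \<open>m\<close>
  on arguments and word lengths. The bound on the value is what keeps loops over computed values
  polynomial.\<close>

definition evaluates :: "((nat \<Rightarrow> bool list) \<Rightarrow> (nat \<Rightarrow> nat) \<Rightarrow> nat) \<Rightarrow> nat \<Rightarrow> nat poly \<Rightarrow>
    ((nat \<Rightarrow> nat) \<Rightarrow> (nat \<Rightarrow> nat) \<Rightarrow> nat \<Rightarrow> nat \<Rightarrow> prog) \<Rightarrow> bool" where
  "evaluates f d p cmp \<longleftrightarrow> (\<forall>\<omega> \<rho> r s. choice_free (cmp \<omega> \<rho> r s)) \<and>
     (\<forall>ws e m. (\<forall>i. e i \<le> m) \<and> (\<forall>k. length (ws k) \<le> m) \<longrightarrow> f ws e \<le> poly p m) \<and>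
     (\<forall>K \<omega> \<rho> r s \<tau> ws e m x. layout K \<omega> \<rho> r s d \<and> state \<omega> \<rho> s d ws e m \<tau> \<and> \<tau> r = ctr x \<longrightarrow>
        DT K (cmp \<omega> \<rho> r s) \<tau> (poly p m) (\<tau>(r := ctr (x + f ws e))))"

definition PF :: "((nat \<Rightarrow> bool list) \<Rightarrow> (nat \<Rightarrow> nat) \<Rightarrow> nat) \<Rightarrow> bool" where
  "PF f \<longleftrightarrow> (\<exists>d p cmp. evaluates f d p cmp)"

lemma PFI:
  assumes "\<And>\<omega> \<rho> r s. choice_free (cmp \<omega> \<rho> r s)"
    and "\<And>ws e m. \<forall>i. e i \<le> m \<Longrightarrow> \<forall>k. length (ws k) \<le> m \<Longrightarrow> f ws e \<le> poly p m"
    and "\<And>K \<omega> \<rho> r s \<tau> ws e m x. layout K \<omega> \<rho> r s d \<Longrightarrow> state \<omega> \<rho> s d ws e m \<tau> \<Longrightarrow> \<tau> r = ctr x \<Longrightarrow>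
        DT K (cmp \<omega> \<rho> r s) \<tau> (poly p m) (\<tau>(r := ctr (x + f ws e)))"
  shows "PF f"
  unfolding PF_def evaluates_def
  by (intro exI[of _ d] exI[of _ p] exI[of _ cmp] conjI allI impI; (elim conjE)?; rule assms; assumption)

text \<open>Scratch space may be larger than demanded, so that functions with different demands can
  share one layout.\<close>

lemma PFE:
  assumes "PF f"
  obtains d p cmp where "\<And>\<omega> \<rho> r s. choice_free (cmp \<omega> \<rho> r s)"
    "\<And>ws e m. \<forall>i. e i \<le> m \<Longrightarrow> \<forall>k. length (ws k) \<le> m \<Longrightarrow> f ws e \<le> poly p m"
    "\<And>K \<omega> \<rho> r s d' \<tau> ws e m x. layout K \<omega> \<rho> r s d' \<Longrightarrow> state \<omega> \<rho> s d' ws e m \<tau> \<Longrightarrow> \<tau> r = ctr x \<Longrightarrow> d \<le> d' \<Longrightarrow>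
        DT K (cmp \<omega> \<rho> r s) \<tau> (poly p m) (\<tau>(r := ctr (x + f ws e)))"
proof -
  from assms obtain d p cmp where *: "evaluates f d p cmp" unfolding PF_def by blast
  have mono: "layout K \<omega> \<rho> r s d" "state \<omega> \<rho> s d ws e m \<tau>"
    if "layout K \<omega> \<rho> r s d'" "state \<omega> \<rho> s d' ws e m \<tau>" "d \<le> d'" for K \<omega> \<rho> r s d' \<tau> ws e m
    using that by (auto simp: layout_def state_def)
  show thesis
  proof (rule that[of cmp p d])
    show "choice_free (cmp \<omega> \<rho> r s)" for \<omega> \<rho> r s using * by (simp add: evaluates_def)
    show "f ws e \<le> poly p m" if "\<forall>i. e i \<le> m" "\<forall>k. length (ws k) \<le> m" for ws e m
      using * that by (simp add: evaluates_def)
    show "DT K (cmp \<omega> \<rho> r s) \<tau> (poly p m) (\<tau>(r := ctr (x + f ws e)))"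
      if "layout K \<omega> \<rho> r s d'" "state \<omega> \<rho> s d' ws e m \<tau>" "\<tau> r = ctr x" "d \<le> d'" for K \<omega> \<rho> r s d' \<tau> ws e m x
      using * mono[OF that(1,2,4)] that(3) by (simp add: evaluates_def)
  qed
qed

section \<open>Basic functions and bounded sums\<close>

lemma PF_zero: "PF (\<lambda>ws e. 0)"
  by (rule PFI[where cmp = "\<lambda>\<omega> \<rho> r s. skip r" and p = 1 and d = 0])
    (auto simp: layout_def intro!: DT_weaken[OF DT_skip])

lemma PF_one: "PF (\<lambda>ws e. 1)"
  by (rule PFI[where cmp = "\<lambda>\<omega> \<rho> r s. inc r" and p = 1 and d = 0])
    (auto simp: layout_def intro!: DT_weaken[OF DT_inc])

lemma PF_add:
  assumes "PF f" "PF g"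
  shows "PF (\<lambda>ws e. f ws e + g ws e)"
proof -
  from assms(1) obtain d1 p1 c1 where f: "\<And>\<omega> \<rho> r s. choice_free (c1 \<omega> \<rho> r s)"
    "\<And>ws e m. \<forall>i. e i \<le> m \<Longrightarrow> \<forall>k. length (ws k) \<le> m \<Longrightarrow> f ws e \<le> poly p1 m"
    "\<And>K \<omega> \<rho> r s d' \<tau> ws e m x. layout K \<omega> \<rho> r s d' \<Longrightarrow> state \<omega> \<rho> s d' ws e m \<tau> \<Longrightarrow> \<tau> r = ctr x \<Longrightarrow> d1 \<le> d' \<Longrightarrow>
        DT K (c1 \<omega> \<rho> r s) \<tau> (poly p1 m) (\<tau>(r := ctr (x + f ws e)))" by (rule PFE) blast
  from assms(2) obtain d2 p2 c2 where g: "\<And>\<omega> \<rho> r s. choice_free (c2 \<omega> \<rho> r s)"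
    "\<And>ws e m. \<forall>i. e i \<le> m \<Longrightarrow> \<forall>k. length (ws k) \<le> m \<Longrightarrow> g ws e \<le> poly p2 m"
    "\<And>K \<omega> \<rho> r s d' \<tau> ws e m x. layout K \<omega> \<rho> r s d' \<Longrightarrow> state \<omega> \<rho> s d' ws e m \<tau> \<Longrightarrow> \<tau> r = ctr x \<Longrightarrow> d2 \<le> d' \<Longrightarrow>
        DT K (c2 \<omega> \<rho> r s) \<tau> (poly p2 m) (\<tau>(r := ctr (x + g ws e)))" by (rule PFE) blast
  show ?thesis
  proof (rule PFI[where cmp = "\<lambda>\<omega> \<rho> r s. Seq (c1 \<omega> \<rho> r s) (c2 \<omega> \<rho> r s)" and p = "p1 + p2" and d = "d1 + d2"])
    show "choice_free (Seq (c1 \<omega> \<rho> r s) (c2 \<omega> \<rho> r s))" for \<omega> \<rho> r s using f(1) g(1) by simp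
    show "f ws e + g ws e \<le> poly (p1 + p2) m" if "\<forall>i. e i \<le> m" "\<forall>k. length (ws k) \<le> m" for ws e m
      using f(2)[OF that] g(2)[OF that] by simp
    fix K \<omega> \<rho> r s \<tau> ws e m x
    assume a: "layout K \<omega> \<rho> r s (d1 + d2)" "state \<omega> \<rho> s (d1 + d2) ws e m \<tau>" "\<tau> r = ctr x"
    have "state \<omega> \<rho> s (d1 + d2) ws e m (\<tau>(r := ctr (x + f ws e)))"
      using a(1,2) by (auto simp: state_def layout_def)
    from DT_Seq[OF f(3)[OF a] g(3)[OF a(1) this]]
    show "DT K (Seq (c1 \<omega> \<rho> r s) (c2 \<omega> \<rho> r s)) \<tau> (poly (p1 + p2) m) (\<tau>(r := ctr (x + (f ws e + g ws e))))"
      by (simp add: add.assoc)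
  qed
qed

text \<open>\<open>layout\<close> does not ask the arguments to live on different counters, so a
  renaming, injective or not, only redirects the lookup \<open>\<rho>\<close>.\<close>

lemma PF_ren:
  assumes "PF f"
  shows "PF (\<lambda>ws e. f ws (\<lambda>i. e (\<pi> i)))"
proof -
  from assms(1) obtain d1 p1 c1 where f: "\<And>\<omega> \<rho> r s. choice_free (c1 \<omega> \<rho> r s)"
    "\<And>ws e m. \<forall>i. e i \<le> m \<Longrightarrow> \<forall>k. length (ws k) \<le> m \<Longrightarrow> f ws e \<le> poly p1 m"
    "\<And>K \<omega> \<rho> r s d' \<tau> ws e m x. layout K \<omega> \<rho> r s d' \<Longrightarrow> state \<omega> \<rho> s d' ws e m \<tau> \<Longrightarrow> \<tau> r = ctr x \<Longrightarrow> d1 \<le> d' \<Longrightarrow>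
        DT K (c1 \<omega> \<rho> r s) \<tau> (poly p1 m) (\<tau>(r := ctr (x + f ws e)))" by (rule PFE) blast
  show ?thesis
  proof (rule PFI[where cmp = "\<lambda>\<omega> \<rho> r s. c1 \<omega> (\<lambda>i. \<rho> (\<pi> i)) r s" and p = p1 and d = d1])
    fix K \<omega> \<rho> r s \<tau> ws e m x
    assume a: "layout K \<omega> \<rho> r s d1" "state \<omega> \<rho> s d1 ws e m \<tau>" "\<tau> r = ctr x"
    have "layout K \<omega> (\<lambda>i. \<rho> (\<pi> i)) r s d1" "state \<omega> (\<lambda>i. \<rho> (\<pi> i)) s d1 ws (\<lambda>i. e (\<pi> i)) m \<tau>"
      using a by (auto simp: layout_def state_def)
    from f(3)[OF this a(3)] show "DT K (c1 \<omega> (\<lambda>i. \<rho> (\<pi> i)) r s) \<tau> (poly p1 m) (\<tau>(r := ctr (x + f ws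
        (\<lambda>i. e (\<pi> i)))))"
      by simp
  qed (use f in auto)
qed

text \<open>Reading a counter destroys it. Its value \<open>v\<close> is moved to the scratch
  counter \<open>s\<close> and then back, the second loop also raising \<open>r\<close>; the loops
  cost \<open>4 v + 1\<close> and \<open>5 v + 1\<close> steps, which explains the
  constants.\<close>

lemma PF_arg: "PF (\<lambda>ws e. e i)"
proof (rule PFI[where cmp = "\<lambda>\<omega> \<rho> r s. Seq (For (\<rho> i) (inc s)) (For s (Seq (inc (\<rho> i)) (inc r)))"
    and d = 1 and p = "[:2, 9:]"])
  show "e i \<le> poly [:2, 9:] m" if "\<forall>i. e i \<le> m" for e :: "nat \<Rightarrow> nat" and m
    using that[rule_format, of i] by simp
  fix K \<omega> \<rho> r s \<tau> ws e m x
  assume a: "layout K \<omega> \<rho> r s 1" "state \<omega> \<rho> s 1 ws e m \<tau>" "\<tau> r = ctr x"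
  let ?k = "\<rho> i" and ?v = "e i"
  have b: "?k < s" "?k \<noteq> r" "r < s" "s < K" "\<tau> ?k = ctr ?v" "\<tau> s = ctr 0" "?v \<le> m"
    using a by (auto simp: layout_def state_def)
  have 1: "DT K (For ?k (inc s)) \<tau> (?v * 4 + 1) (\<tau>(?k := ctr 0, s := ctr ?v))"
  proof (rule DT_For[where S = "\<lambda>y. \<tau>(?k := ctr y, s := ctr (?v - y))" and N = ?v and n = 1])
    show "DT K (inc s) ((\<tau>(?k := ctr (Suc y), s := ctr (?v - Suc y)))(?k := ctr y)) 1 (\<tau>(?k := ctr
        y, s := ctr (?v - y)))"
      if "y < ?v" for y
      by (rule DT_weaken[OF DT_inc[where x = "?v - Suc y"]]) (use b that in \<open>auto simp: Suc_diff_Suc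
          fun_eq_iff\<close>)
  qed (use b in \<open>auto simp: fun_eq_iff\<close>)
  have 2: "DT K (For s (Seq (inc ?k) (inc r))) (\<tau>(?k := ctr 0, s := ctr ?v)) (?v * 5 + 1) (\<tau>(r :=
      ctr (x + ?v)))"
  proof (rule DT_For[where S = "\<lambda>y. \<tau>(s := ctr y, ?k := ctr (?v - y), r := ctr (x + (?v - y)))" and
      N = ?v and n = 2])
    show "DT K (Seq (inc ?k) (inc r)) ((\<tau>(s := ctr (Suc y), ?k := ctr (?v - Suc y), r := ctr (x +
        (?v - Suc y))))(s := ctr y)) 2
       (\<tau>(s := ctr y, ?k := ctr (?v - y), r := ctr (x + (?v - y))))"
      if "y < ?v" for y
      by (rule DT_weaken[OF DT_Seq[OF DT_inc[where x = "?v - Suc y"] DT_inc[where x = "x + (?v - Suc y)"]]])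
         (use b that in \<open>auto simp: Suc_diff_Suc fun_eq_iff\<close>)
  qed (use b a in \<open>auto simp: fun_eq_iff\<close>)
  show "DT K (Seq (For ?k (inc s)) (For s (Seq (inc ?k) (inc r)))) \<tau> (poly [:2, 9:] m) (\<tau>(r := ctr (x + ?v)))"
    by (rule DT_weaken[OF DT_Seq[OF 1 2]]) (use b in auto)
qed simp

lemma PF_minus:
  assumes "PF f" "PF g"
  shows "PF (\<lambda>ws e. f ws e - g ws e)"
proof -
  from assms(1) obtain d1 p1 c1 where f: "\<And>\<omega> \<rho> r s. choice_free (c1 \<omega> \<rho> r s)"
    "\<And>ws e m. \<forall>i. e i \<le> m \<Longrightarrow> \<forall>k. length (ws k) \<le> m \<Longrightarrow> f ws e \<le> poly p1 m"
    "\<And>K \<omega> \<rho> r s d' \<tau> ws e m x. layout K \<omega> \<rho> r s d' \<Longrightarrow> state \<omega> \<rho> s d' ws e m \<tau> \<Longrightarrow> \<tau> r = ctr x \<Longrightarrow> d1 \<le> d' \<Longrightarrow>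
        DT K (c1 \<omega> \<rho> r s) \<tau> (poly p1 m) (\<tau>(r := ctr (x + f ws e)))" by (rule PFE) blast
  from assms(2) obtain d2 p2 c2 where g: "\<And>\<omega> \<rho> r s. choice_free (c2 \<omega> \<rho> r s)"
    "\<And>ws e m. \<forall>i. e i \<le> m \<Longrightarrow> \<forall>k. length (ws k) \<le> m \<Longrightarrow> g ws e \<le> poly p2 m"
    "\<And>K \<omega> \<rho> r s d' \<tau> ws e m x. layout K \<omega> \<rho> r s d' \<Longrightarrow> state \<omega> \<rho> s d' ws e m \<tau> \<Longrightarrow> \<tau> r = ctr x \<Longrightarrow> d2 \<le> d' \<Longrightarrow>
        DT K (c2 \<omega> \<rho> r s) \<tau> (poly p2 m) (\<tau>(r := ctr (x + g ws e)))" by (rule PFE) blast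
  let ?sub = "\<lambda>s. For (Suc s) (If s (\<lambda>z. z \<noteq> 1) (dec s) (skip s))"
  show ?thesis
  \<comment> \<open>The first value \<open>u\<close> is lowered once per unit of the second value
    \<open>v\<close>, unless it is already zero, at a cost of \<open>6 v + 1\<close>; the transfer
    of the rest to \<open>r\<close> costs at most \<open>4 u + 1\<close>. With the two evaluations
    this gives the polynomial.\<close>
  proof (rule PFI[where cmp = "\<lambda>\<omega> \<rho> r s. Seq (Seq (c1 \<omega> \<rho> s (s + 2)) (c2 \<omega> \<rho> (Suc s) (s + 2))) (Seq
      (?sub s) (For s (inc r)))"
        and p = "5 * p1 + 7 * p2 + 2" and d = "2 + d1 + d2"])
    show "f ws e - g ws e \<le> poly (5 * p1 + 7 * p2 + 2) m" if "\<forall>i. e i \<le> m" "\<forall>k. length (ws k) \<le> m" for ws e m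
      using f(2)[OF that] by (auto simp flip: numeral_poly)
    fix K \<omega> \<rho> r s \<tau> ws e m x
    assume a: "layout K \<omega> \<rho> r s (2 + d1 + d2)" "state \<omega> \<rho> s (2 + d1 + d2) ws e m \<tau>" "\<tau> r = ctr x"
    let ?u = "f ws e" and ?v = "g ws e"
    have bd: "?u \<le> poly p1 m" "?v \<le> poly p2 m" using f(2)[of e m ws] g(2)[of e m ws] a by (auto
        simp: state_def)
    have b: "r < s" "Suc s < K" "\<tau> s = ctr 0" "\<tau> (Suc s) = ctr 0"
      using a by (auto simp: layout_def state_def)
    have 1: "DT K (c1 \<omega> \<rho> s (s + 2)) \<tau> (poly p1 m) (\<tau>(s := ctr (0 + ?u)))"
      by (rule f(3)[where d' = "d1 + d2"]) (use a b in \<open>auto simp: layout_def state_def layoutD[OF a(1)]\<close>)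
    have 2: "DT K (c2 \<omega> \<rho> (Suc s) (s + 2)) (\<tau>(s := ctr (0 + ?u))) (poly p2 m) (\<tau>(s := ctr (0 + ?u),
        Suc s := ctr (0 + ?v)))"
      by (rule g(3)[where d' = "d1 + d2"]) (use a b in \<open>auto simp: layout_def state_def layoutD[OF a(1)]\<close>)
    have 3: "DT K (?sub s) (\<tau>(s := ctr (0 + ?u), Suc s := ctr (0 + ?v))) (?v * 6 + 1) (\<tau>(s := ctr (?u - ?v)))"
    proof (rule DT_For[where S = "\<lambda>y. \<tau>(Suc s := ctr y, s := ctr (?u - (?v - y)))" and N = ?v and n = 3])
      fix y assume y: "y < ?v"
      let ?\<sigma> = "(\<tau>(Suc s := ctr (Suc y), s := ctr (?u - (?v - Suc y))))(Suc s := ctr y)"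
      show "DT K (If s (\<lambda>z. z \<noteq> 1) (dec s) (skip s)) ?\<sigma> 3 (\<tau>(Suc s := ctr y, s := ctr (?u - (?v - y))))"
      proof (cases "?u - (?v - Suc y)")
        case 0
        then have "?u - (?v - y) = 0" by simp
        with 0 show ?thesis
          by (intro DT_weaken[OF HT_If_False[OF DT_skip]]) (use b in \<open>auto simp: fun_eq_iff\<close>)
      next
        case (Suc n)
        with y have "?u - (?v - y) = n" by arith
        with Suc show ?thesis
          by (intro DT_weaken[OF HT_If_True[OF DT_dec]]) (use b in \<open>auto simp: fun_eq_iff\<close>)
      qed
    qed (use b in \<open>auto simp: fun_eq_iff\<close>)
    let ?w = "?u - ?v"
    have 4: "DT K (For s (inc r)) (\<tau>(s := ctr ?w)) (?w * 4 + 1) (\<tau>(r := ctr (x + ?w)))"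
    proof (rule DT_For[where S = "\<lambda>y. \<tau>(s := ctr y, r := ctr (x + (?w - y)))" and N = ?w and n = 1])
      show "DT K (inc r) ((\<tau>(s := ctr (Suc y), r := ctr (x + (?w - Suc y))))(s := ctr y)) 1 (\<tau>(s :=
          ctr y, r := ctr (x + (?w - y))))"
        if "y < ?w" for y
        by (rule DT_weaken[OF DT_inc[where x = "x + (?w - Suc y)"]]) (use b that in \<open>auto simp:
            Suc_diff_Suc fun_eq_iff\<close>)
    qed (use b a in \<open>auto simp: fun_eq_iff\<close>)
    show "DT K (Seq (Seq (c1 \<omega> \<rho> s (s + 2)) (c2 \<omega> \<rho> (Suc s) (s + 2))) (Seq (?sub s) (For s (inc r)))) \<tau>
        (poly (5 * p1 + 7 * p2 + 2) m) (\<tau>(r := ctr (x + ?w)))"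
      by (rule DT_weaken[OF DT_Seq[OF DT_Seq[OF 1 2] DT_Seq[OF 3 4]]]) (use bd in \<open>auto simp flip:
          numeral_poly\<close>)
  qed (use f(1) g(1) in auto)
qed

lemma poly_mono_nat: "x \<le> y \<Longrightarrow> poly p x \<le> poly p (y :: nat)"
  by (induction p) (auto intro: add_mono mult_mono)

text \<open>The loop counter is handed to the summand as argument 0 by \<open>case_nat\<close>, and
  the summands accumulate in \<open>r\<close> since programs add to their result. The loop variable
  may exceed \<open>m\<close>, but not the bound on the number of rounds, whence the argument
  \<open>m + poly p1 m\<close> of \<open>p2\<close>.\<close>

lemma PF_sum:
  assumes "PF f" "PF (\<lambda>ws e. g ws (e 0) (\<lambda>i. e (Suc i)))"
  shows "PF (\<lambda>ws e. \<Sum>x<f ws e. g ws x e)"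
proof -
  from assms(1) obtain d1 p1 c1 where f: "\<And>\<omega> \<rho> r s. choice_free (c1 \<omega> \<rho> r s)"
    "\<And>ws e m. \<forall>i. e i \<le> m \<Longrightarrow> \<forall>k. length (ws k) \<le> m \<Longrightarrow> f ws e \<le> poly p1 m"
    "\<And>K \<omega> \<rho> r s d' \<tau> ws e m x. layout K \<omega> \<rho> r s d' \<Longrightarrow> state \<omega> \<rho> s d' ws e m \<tau> \<Longrightarrow> \<tau> r = ctr x \<Longrightarrow> d1 \<le> d' \<Longrightarrow>
        DT K (c1 \<omega> \<rho> r s) \<tau> (poly p1 m) (\<tau>(r := ctr (x + f ws e)))" by (rule PFE) blast
  from assms(2) obtain d2 p2 c2 where g: "\<And>\<omega> \<rho> r s. choice_free (c2 \<omega> \<rho> r s)"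
    "\<And>ws e m. \<forall>i. e i \<le> m \<Longrightarrow> \<forall>k. length (ws k) \<le> m \<Longrightarrow> g ws (e 0) (\<lambda>i. e (Suc i)) \<le> poly p2 m"
    "\<And>K \<omega> \<rho> r s d' \<tau> ws e m x. layout K \<omega> \<rho> r s d' \<Longrightarrow> state \<omega> \<rho> s d' ws e m \<tau> \<Longrightarrow> \<tau> r = ctr x \<Longrightarrow> d2 \<le> d' \<Longrightarrow>
        DT K (c2 \<omega> \<rho> r s) \<tau> (poly p2 m) (\<tau>(r := ctr (x + g ws (e 0) (\<lambda>i. e (Suc i)))))" by (rule PFE) blast
  define q where "q = pcompose p2 ([:0, 1:] + p1)"
  have q: "poly q m = poly p2 (m + poly p1 m)" for m by (simp add: q_def poly_pcompose)
  have gq: "g ws y e \<le> poly q m" if "y < f ws e" "\<forall>i. e i \<le> m" "\<forall>k. length (ws k) \<le> m" for ws y e m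
  proof -
    have "g ws (case_nat y e 0) (\<lambda>i. case_nat y e (Suc i)) \<le> poly p2 (m + poly p1 m)"
      using that f(2)[OF that(2,3)] by (intro g(2)) (auto split: nat.splits intro: le_trans trans_le_add1)
    then show ?thesis by (simp add: q)
  qed
  show ?thesis
  proof (rule PFI[where cmp = "\<lambda>\<omega> \<rho> r s. Seq (c1 \<omega> \<rho> s (Suc s)) (For s (c2 \<omega> (case_nat s \<rho>) r (Suc s)))"
        and p = "p1 + (p1 * (q + 3) + 1)" and d = "1 + d1 + d2"])
    show "(\<Sum>x<f ws e. g ws x e) \<le> poly (p1 + (p1 * (q + 3) + 1)) m" if "\<forall>i. e i \<le> m" "\<forall>k. length (ws
        k) \<le> m" for ws e m
    proof -
      have "(\<Sum>x<f ws e. g ws x e) \<le> (\<Sum>x<f ws e. poly q m)" by (rule sum_mono) (use gq that in auto)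
      also have "\<dots> \<le> poly p1 m * poly q m" using f(2)[OF that] by simp
      finally show ?thesis by (simp add: algebra_simps)
    qed
    fix K \<omega> \<rho> r s \<tau> ws e m x
    assume a: "layout K \<omega> \<rho> r s (1 + d1 + d2)" "state \<omega> \<rho> s (1 + d1 + d2) ws e m \<tau>" "\<tau> r = ctr x"
    let ?u = "f ws e"
    have bd: "?u \<le> poly p1 m" using f(2)[of e m ws] a by (auto simp: state_def)
    have b: "r < s" "s < K" "\<tau> s = ctr 0" using a by (auto simp: layout_def state_def)
    have 1: "DT K (c1 \<omega> \<rho> s (Suc s)) \<tau> (poly p1 m) (\<tau>(s := ctr (0 + ?u)))"
      by (rule f(3)[where d' = "d1 + d2"]) (use a b in \<open>auto simp: layout_def state_def layoutD[OF a(1)]\<close>)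
    have 2: "DT K (For s (c2 \<omega> (case_nat s \<rho>) r (Suc s))) (\<tau>(s := ctr ?u)) (?u * (poly q m + 3) + 1)
        (\<tau>(r := ctr (x + (\<Sum>x<?u. g ws x e))))"
    proof (rule DT_For[where S = "\<lambda>y. \<tau>(s := ctr y, r := ctr (x + (\<Sum>x\<in>{y..<?u}. g ws x e)))" and N =
        ?u and n = "poly q m"])
      fix y assume y: "y < ?u"
      let ?\<tau> = "(\<tau>(s := ctr (Suc y), r := ctr (x + (\<Sum>x\<in>{Suc y..<?u}. g ws x e))))(s := ctr y)"
      have "DT K (c2 \<omega> (case_nat s \<rho>) r (Suc s)) ?\<tau> (poly p2 (m + poly p1 m))
         (?\<tau>(r := ctr (x + (\<Sum>x\<in>{Suc y..<?u}. g ws x e) + g ws (case_nat y e 0) (\<lambda>i. case_nat y e (Suc i)))))"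
        by (rule g(3)[where d' = "d1 + d2"])
          (use a b y bd in \<open>auto simp: layout_def state_def layoutD[OF a(1)] split: nat.splits
              intro: trans_le_add1\<close>)
      moreover have "(\<Sum>x\<in>{y..<?u}. g ws x e) = (\<Sum>x\<in>{Suc y..<?u}. g ws x e) + g ws y e"
        using y by (simp add: sum.atLeast_Suc_lessThan)
      ultimately show "DT K (c2 \<omega> (case_nat s \<rho>) r (Suc s)) ?\<tau> (poly q m)
         (\<tau>(s := ctr y, r := ctr (x + (\<Sum>x\<in>{y..<?u}. g ws x e))))"
        by (elim DT_weaken) (use b in \<open>auto simp: q fun_eq_iff add.assoc\<close>)
    qed (use b a in \<open>auto simp: fun_eq_iff atLeast0LessThan\<close>)
    have "?u * (poly q m + 3) \<le> poly p1 m * (poly q m + 3)" using bd by (rule mult_right_mono) simp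
    then show "DT K (Seq (c1 \<omega> \<rho> s (Suc s)) (For s (c2 \<omega> (case_nat s \<rho>) r (Suc s)))) \<tau>
        (poly (p1 + (p1 * (q + 3) + 1)) m) (\<tau>(r := ctr (x + (\<Sum>x<?u. g ws x e))))"
      by (intro DT_weaken[OF DT_Seq[OF 1[simplified] 2]]) (auto simp flip: numeral_poly)
  qed (use f(1) g(1) in auto)
qed


definition symb :: "bool list \<Rightarrow> nat \<Rightarrow> nat" where
  "symb w x = tape_of w (int x)"

lemma symb_eq: "symb w x = (if x < length w then if w ! x then 2 else 1 else 0)"
  by (cases "w ! x") (auto simp: symb_def tape_of_def)

text \<open>The head of the word tape must be at the first cell again afterwards, so its way to the
  right is recorded on a second counter and then undone.\<close>

lemma PF_symb:
  assumes "PF f"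
  shows "PF (\<lambda>ws e. symb (ws k) (f ws e))"
proof -
  from assms(1) obtain d1 p1 c1 where f: "\<And>\<omega> \<rho> r s. choice_free (c1 \<omega> \<rho> r s)"
    "\<And>ws e m. \<forall>i. e i \<le> m \<Longrightarrow> \<forall>k. length (ws k) \<le> m \<Longrightarrow> f ws e \<le> poly p1 m"
    "\<And>K \<omega> \<rho> r s d' \<tau> ws e m x. layout K \<omega> \<rho> r s d' \<Longrightarrow> state \<omega> \<rho> s d' ws e m \<tau> \<Longrightarrow> \<tau> r = ctr x \<Longrightarrow> d1 \<le> d' \<Longrightarrow>
        DT K (c1 \<omega> \<rho> r s) \<tau> (poly p1 m) (\<tau>(r := ctr (x + f ws e)))" by (rule PFE) blast
  let ?read = "\<lambda>k r. If k (\<lambda>z. z = 0) (skip r) (If k (\<lambda>z. z = 1) (inc r) (Seq (inc r) (inc r)))"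
  show ?thesis
  proof (rule PFI[where cmp = "\<lambda>\<omega> \<rho> r s. Seq (c1 \<omega> \<rho> s (s + 2)) (Seq (For s (Seq (mv (\<omega> k)
      MoveRight) (inc (Suc s))))
       (Seq (?read (\<omega> k) r) (For (Suc s) (mv (\<omega> k) MoveLeft))))" and p = "10 * p1 + 10" and d = "2 + d1"])
    show "symb (ws k) (f ws e) \<le> poly (10 * p1 + 10) m" for ws e m
      by (simp add: symb_eq flip: numeral_poly)
    fix K \<omega> \<rho> r s \<tau> ws e m x
    assume a: "layout K \<omega> \<rho> r s (2 + d1)" "state \<omega> \<rho> s (2 + d1) ws e m \<tau>" "\<tau> r = ctr x"
    let ?u = "f ws e" and ?k = "\<omega> k" and ?w = "tape_of (ws k)"
    have bd: "?u \<le> poly p1 m" using f(2)[of e m ws] a by (auto simp: state_def)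
    have b: "Suc s < K" "r < K" "?k < K" "\<tau> s = ctr 0" "\<tau> (Suc s) = ctr 0" "\<tau> ?k = ?w" "?k \<noteq> s" "?k
        \<noteq> Suc s" "?k \<noteq> r" "r < s"
      using a layoutD(7-10)[OF a(1), of k] layoutD(1,2)[OF a(1)] by (auto simp: state_def)
    have 1: "DT K (c1 \<omega> \<rho> s (s + 2)) \<tau> (poly p1 m) (\<tau>(s := ctr (0 + ?u)))"
      by (rule f(3)[where d' = d1]) (use a b in \<open>auto simp: layout_def state_def layoutD[OF a(1)]\<close>)
    let ?\<tau>2 = "\<tau>(Suc s := ctr ?u, ?k := shift ?w (int ?u))"
    have 2: "DT K (For s (Seq (mv ?k MoveRight) (inc (Suc s)))) (\<tau>(s := ctr ?u)) (?u * 5 + 1) ?\<tau>2"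
    proof (rule DT_For[where S = "\<lambda>y. \<tau>(s := ctr y, Suc s := ctr (?u - y), ?k := shift ?w (int (?u -
        y)))" and N = ?u and n = 2])
      show "DT K (Seq (mv ?k MoveRight) (inc (Suc s))) ((\<tau>(s := ctr (Suc y), Suc s := ctr (?u - Suc
          y), ?k := shift ?w (int (?u - Suc y))))(s := ctr y)) 2
        (\<tau>(s := ctr y, Suc s := ctr (?u - y), ?k := shift ?w (int (?u - y))))" if "y < ?u" for y
        by (rule DT_weaken[OF DT_Seq[OF DT_mv DT_inc[where x = "?u - Suc y"]]])
          (use that b in \<open>auto simp: fun_eq_iff Suc_diff_Suc of_nat_diff algebra_simps\<close>)
    qed (use b in \<open>auto simp: fun_eq_iff\<close>)
    let ?\<tau>3 = "?\<tau>2(r := ctr (x + symb (ws k) ?u))"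
    have sc: "?\<tau>2 ?k 0 = symb (ws k) ?u" by (simp add: shift_def symb_def)
    have 3: "DT K (?read ?k r) ?\<tau>2 5 ?\<tau>3"
    proof -
      have "symb (ws k) ?u = 0 \<or> symb (ws k) ?u = 1 \<or> symb (ws k) ?u = 2" by (simp add: symb_eq)
      then show ?thesis
      proof (elim disjE)
        assume 1: "symb (ws k) ?u = 0"
        show ?thesis
          by (rule DT_weaken[OF HT_If_True[OF DT_skip]]) (use a(3) 1 b sc in \<open>auto simp: fun_eq_iff\<close>)
      next
        assume 2: "symb (ws k) ?u = 1"
        show ?thesis
          by (rule DT_weaken[OF HT_If_False[OF HT_If_True[OF DT_inc[where x = x]]]]) (use a(3) 2 b
              sc in \<open>auto simp: fun_eq_iff\<close>)
      next
        assume 3: "symb (ws k) ?u = 2"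
        show ?thesis
          by (rule DT_weaken[OF HT_If_False[OF HT_If_False[OF DT_Seq[OF DT_inc[where x = x]
              DT_inc[where x = "Suc x"]]]]])
            (use a(3) 3 b sc in \<open>auto simp: fun_eq_iff\<close>)
      qed
    qed
    have 4: "DT K (For (Suc s) (mv ?k MoveLeft)) ?\<tau>3 (?u * 4 + 1) (\<tau>(r := ctr (x + symb (ws k) ?u)))"
    proof (rule DT_For[where S = "\<lambda>y. \<tau>(Suc s := ctr y, ?k := shift ?w (int y), r := ctr (x + symb
        (ws k) ?u))" and N = ?u and n = 1])
      show "DT K (mv ?k MoveLeft) ((\<tau>(Suc s := ctr (Suc y), ?k := shift ?w (int (Suc y)), r := ctr
          (x + symb (ws k) ?u)))(Suc s := ctr y)) 1
        (\<tau>(Suc s := ctr y, ?k := shift ?w (int y), r := ctr (x + symb (ws k) ?u)))" for y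
        by (rule DT_weaken[OF DT_mv]) (use b in \<open>auto simp: fun_eq_iff\<close>)
    qed (use b in \<open>auto simp: fun_eq_iff\<close>)
    show "DT K (Seq (c1 \<omega> \<rho> s (s + 2)) (Seq (For s (Seq (mv (\<omega> k) MoveRight) (inc (Suc s))))
       (Seq (?read (\<omega> k) r) (For (Suc s) (mv (\<omega> k) MoveLeft))))) \<tau> (poly (10 * p1 + 10) m)
       (\<tau>(r := ctr (x + symb (ws k) ?u)))"
      by (rule DT_weaken[OF DT_Seq[OF 1[unfolded add_0] DT_Seq[OF 2 DT_Seq[OF 3 4]]]]) (use bd in
          \<open>auto simp flip: numeral_poly\<close>)
  qed (use f in auto)
qed

lemma PF_length: "PF (\<lambda>ws e. length (ws k))"
proof (rule PFI[where cmp = "\<lambda>\<omega> \<rho> r s. Seq (While (\<omega> k) (\<lambda>z. z \<noteq> 0) (Seq (mv (\<omega> k) MoveRight) (Seq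
    (inc s) (inc r))))
       (For s (mv (\<omega> k) MoveLeft))" and p = "[:2, 9:]" and d = 1])
  show "length (ws k) \<le> poly [:2, 9:] m" if "\<forall>k. length (ws k) \<le> m" for ws :: "nat \<Rightarrow> bool list" and m
    using that[rule_format, of k] by simp
  fix K \<omega> \<rho> r s \<tau> ws e m x
  assume a: "layout K \<omega> \<rho> r s 1" "state \<omega> \<rho> s 1 ws e m \<tau>" "\<tau> r = ctr x"
  let ?k = "\<omega> k" and ?w = "tape_of (ws k)" and ?l = "length (ws k)"
  have b: "s < K" "r < K" "?k < K" "\<tau> s = ctr 0" "\<tau> ?k = ?w" "?k \<noteq> s" "?k \<noteq> r" "r < s" "?l \<le> m"
    using a layoutD(7-10)[OF a(1), of k] layoutD(1,2)[OF a(1)] by (auto simp: state_def)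
  define S where "S i = \<tau>(?k := shift ?w (int i), s := ctr i, r := ctr (x + i))" for i
  have "DT K (While ?k (\<lambda>z. z \<noteq> 0) (Seq (mv ?k MoveRight) (Seq (inc s) (inc r)))) (S 0) (?l * (3 +
      2) + 1) (S ?l)"
  proof (rule DT_While)
    show "S i ?k 0 \<noteq> 0" if "i < ?l" for i
      using that b bit_symbol_bounds by (auto simp: S_def shift_def tape_of_def)
    show "\<not> S ?l ?k 0 \<noteq> 0" using b by (auto simp: S_def shift_def tape_of_def)
    show "DT K (Seq (mv ?k MoveRight) (Seq (inc s) (inc r))) (S i) 3 (S (Suc i))" for i
      unfolding S_def by (rule DT_weaken[OF DT_Seq[OF DT_mv DT_Seq[OF DT_inc[where x = i]
          DT_inc[where x = "x + i"]]]])
        (use b in \<open>auto simp: fun_eq_iff algebra_simps\<close>)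
  qed (use b in auto)
  moreover have "S 0 = \<tau>" using a(3) b by (auto simp: S_def fun_eq_iff)
  ultimately have 1: "DT K (While ?k (\<lambda>z. z \<noteq> 0) (Seq (mv ?k MoveRight) (Seq (inc s) (inc r)))) \<tau>
      (?l * 5 + 1) (S ?l)"
    by simp
  have 2: "DT K (For s (mv ?k MoveLeft)) (S ?l) (?l * 4 + 1) (\<tau>(r := ctr (x + ?l)))"
  proof (rule DT_For[where S = "\<lambda>y. \<tau>(s := ctr y, ?k := shift ?w (int y), r := ctr (x + ?l))" and N
      = ?l and n = 1])
    show "DT K (mv ?k MoveLeft) ((\<tau>(s := ctr (Suc y), ?k := shift ?w (int (Suc y)), r := ctr (x +
        ?l)))(s := ctr y)) 1
      (\<tau>(s := ctr y, ?k := shift ?w (int y), r := ctr (x + ?l)))" for y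
      by (rule DT_weaken[OF DT_mv]) (use b in \<open>auto simp: fun_eq_iff\<close>)
  qed (use b in \<open>auto simp: S_def fun_eq_iff\<close>)
  show "DT K (Seq (While ?k (\<lambda>z. z \<noteq> 0) (Seq (mv ?k MoveRight) (Seq (inc s) (inc r)))) (For s (mv ?k
      MoveLeft))) \<tau>
     (poly [:2, 9:] m) (\<tau>(r := ctr (x + ?l)))"
    by (rule DT_weaken[OF DT_Seq[OF 1 2]]) (use b in auto)
qed simp

section \<open>Machines that guess, query and output words\<close>

fun init_ctrs :: "nat \<Rightarrow> nat \<Rightarrow> prog" where
  "init_ctrs a 0 = Do a (\<lambda>_. (1, Stay))"
| "init_ctrs a (Suc n) = Seq (init_ctrs a n) (Do (a + Suc n) (\<lambda>_. (1, Stay)))"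

lemma choice_free_init [simp]: "choice_free (init_ctrs a n)"
  by (induction n) auto

lemma DT_Do: "k < K \<Longrightarrow> s < 3 \<Longrightarrow> DT K (Do k (\<lambda>_. (s, m))) \<tau> 1 (\<tau>(k := tape_act (s, m) (\<tau> k)))"
  using HT_Do[of k K "\<lambda>_. (s, m)" \<tau>] by simp

lemma DT_init_ctrs:
  "a + n < K \<Longrightarrow> \<forall>j. a \<le> j \<and> j \<le> a + n \<longrightarrow> \<tau> j = (\<lambda>_. 0) \<Longrightarrow>
     DT K (init_ctrs a n) \<tau> (Suc n) (\<lambda>j. if a \<le> j \<and> j \<le> a + n then ctr 0 else \<tau> j)"
proof (induction n)
  case 0
  then show ?case
    by (auto intro!: DT_weaken[OF DT_Do] simp: fun_eq_iff ctr_def)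
next
  case (Suc n)
  let ?\<tau> = "\<lambda>j. if a \<le> j \<and> j \<le> a + n then ctr 0 else \<tau> j"
  have "DT K (Do (a + Suc n) (\<lambda>_. (1, Stay))) ?\<tau> 1 (\<lambda>j. if a \<le> j \<and> j \<le> a + Suc n then ctr 0 else \<tau> j)"
    using Suc.prems by (auto intro!: DT_weaken[OF DT_Do] simp: fun_eq_iff ctr_def)
  from DT_Seq[OF Suc.IH this] Suc.prems show ?case by simp
qed

text \<open>Words are written from right to left, each new symbol being put in front; in between,
  the head waits one cell to the left of the word.\<close>

definition left_of :: "bool list \<Rightarrow> tape" where
  "left_of v = shift (tape_of v) (-1)"

lemma left_of_Nil: "left_of [] = (\<lambda>_. 0)"
  by (auto simp: left_of_def shift_def tape_of_def)

lemma tape_of_Nil: "tape_of [] = (\<lambda>_. 0)"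
  by (auto simp: tape_of_def)

lemma left_of_Cons: "tape_act (bit_symbol b, MoveLeft) (left_of v) = left_of (b # v)"
proof
  fix i :: int
  have "nat (i - 1) = Suc (nat (i - 2))" if "i > 1" using that by simp
  then show "tape_act (bit_symbol b, MoveLeft) (left_of v) i = left_of (b # v) i"
    by (auto simp: left_of_def shift_def tape_of_def)
qed

lemma shift_left_of: "shift (left_of v) 1 = tape_of v"
  by (simp add: left_of_def)

lemma HT_For_0: "k < K \<Longrightarrow> \<tau> k = ctr 0 \<Longrightarrow> HT K (For k c) \<tau> 1 {\<tau>}"
  unfolding For_def by (rule HT_While_False) auto

lemma HT_For_Suc:
  assumes "k < K" "\<tau> k = ctr (Suc x)" "HT K c (\<tau>(k := ctr x)) n Q" "\<And>\<tau>'. \<tau>' \<in> Q \<Longrightarrow> HT K (For k c) \<tau>' m (Q' \<tau>')"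
  shows "HT K (For k c) \<tau> (n + m + 3) (\<Union>\<tau>'\<in>Q. Q' \<tau>')"
proof -
  have 1: "HT K (Seq (dec k) c) \<tau> (1 + n) Q"
    using HT_Seq[OF DT_dec[of k K \<tau> x], of c n "\<lambda>_. Q"] assms(1-3) by simp
  have "HT K (For k c) \<tau> (1 + n + m + 2) (\<Union>\<tau>'\<in>Q. Q' \<tau>')"
    unfolding For_def by (rule HT_While_True[OF _ 1]) (use assms in \<open>auto simp: For_def\<close>)
  then show ?thesis by (rule HT_mono) simp
qed

definition guess :: "nat \<Rightarrow> nat \<Rightarrow> prog" where
  "guess k c = Seq (For c (Choice (Do k (\<lambda>_. (1, MoveLeft))) (Do k (\<lambda>_. (2, MoveLeft))))) (mv k MoveRight)"

lemma HT_guess: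
  assumes "k < K" "c < K" "k \<noteq> c" "\<tau> c = ctr N" "\<tau> k = (\<lambda>_. 0)"
  shows "HT K (guess k c) \<tau> (N * 6 + 2) {\<tau>(c := ctr 0, k := tape_of u) |u. length u = N}"
proof -
  let ?b = "Choice (Do k (\<lambda>_. (1, MoveLeft))) (Do k (\<lambda>_. (2, MoveLeft)))"
  have body: "HT K ?b \<sigma> 3 {\<sigma>(k := left_of (b # v)) |b. True}" if "\<sigma> k = left_of v" for \<sigma> v
  proof -
    have 1: "DT K (Do k (\<lambda>_. (1, MoveLeft))) \<sigma> 1 (\<sigma>(k := left_of (False # v)))"
      using DT_Do[of k K 1 MoveLeft \<sigma>] assms(1) that left_of_Cons[of False v] by (simp del: tape_act.simps)
    have 2: "DT K (Do k (\<lambda>_. (2, MoveLeft))) \<sigma> 1 (\<sigma>(k := left_of (True # v)))"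
      using DT_Do[of k K 2 MoveLeft \<sigma>] assms(1) that left_of_Cons[of True v] by (simp del: tape_act.simps)
    have "{\<sigma>(k := left_of (b # v)) |b. True} = {\<sigma>(k := left_of (False # v))} \<union> {\<sigma>(k := left_of (True # v))}"
      by (auto simp: all_bool_eq) (metis (full_types))
    then show ?thesis using HT_Choice[OF 1 2] by (simp add: numeral_3_eq_3)
  qed
  have "HT K (For c ?b) \<sigma> (N * 6 + 1) {\<sigma>(c := ctr 0, k := left_of (u @ v)) |u. length u = N}"
    if "\<sigma> c = ctr N" "\<sigma> k = left_of v" for \<sigma> v
    using that
  proof (induction N arbitrary: \<sigma> v)
    case 0
    then have "\<sigma>(c := ctr 0, k := left_of ([] @ v)) = \<sigma>" by (auto simp: fun_eq_iff)
    then have eq: "{\<sigma>(c := ctr 0, k := left_of (u @ v)) |u. length u = 0} = {\<sigma>}" by auto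
    from HT_For_0[of c K \<sigma> ?b] 0 assms(2) show ?case by (subst eq) simp
  next
    case (Suc N)
    let ?\<sigma> = "\<lambda>b. \<sigma>(c := ctr N, k := left_of (b # v))"
    let ?Q = "{?\<sigma> b |b. True}"
    let ?R = "\<lambda>\<sigma>' v. {\<sigma>'(c := ctr 0, k := left_of (u @ v)) |u. length u = N}"
    have "HT K ?b (\<sigma>(c := ctr N)) 3 ?Q" using body[of "\<sigma>(c := ctr N)" v] Suc.prems assms(3) by simp
    \<comment> \<open>The outcomes have to be given as a function of the state after the first
      guess. The union over the bits that lead to this state has just one member, because the bit
      can be read off cell 1.\<close>
    moreover have "HT K (For c ?b) \<sigma>' (N * 6 + 1) (\<Union>b\<in>{b. \<sigma>' = ?\<sigma> b}. ?R \<sigma>' (b # v))" if "\<sigma>' \<in> ?Q" for \<sigma>'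
    proof -
      from that obtain b where b: "\<sigma>' = ?\<sigma> b" by blast
      have "left_of (False # v) 1 \<noteq> left_of (True # v) 1" by (simp add: left_of_def shift_def tape_of_def)
      then have "left_of (b # v) = left_of (b' # v) \<longleftrightarrow> b = b'" for b' by (metis (full_types))
      moreover have "?\<sigma> b = ?\<sigma> b' \<longleftrightarrow> left_of (b # v) = left_of (b' # v)" for b' by (metis fun_upd_same)
      ultimately have "{b. \<sigma>' = ?\<sigma> b} = {b}" unfolding b by simp
      moreover have "HT K (For c ?b) \<sigma>' (N * 6 + 1) (?R \<sigma>' (b # v))"
        by (rule Suc.IH) (use b assms(3) in auto)
      ultimately show ?thesis by (simp only: UN_insert UN_empty Un_empty_right)
    qed
    ultimately have "HT K (For c ?b) \<sigma> (3 + (N * 6 + 1) + 3)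
        (\<Union>\<sigma>'\<in>?Q. \<Union>b\<in>{b. \<sigma>' = ?\<sigma> b}. ?R \<sigma>' (b # v))"
      by (intro HT_For_Suc) (use Suc.prems assms in auto)
    moreover have "(\<Union>\<sigma>'\<in>?Q. \<Union>b\<in>{b. \<sigma>' = ?\<sigma> b}. ?R \<sigma>' (b # v)) = {\<sigma>(c := ctr 0, k := left_of (u @ v))
        |u. length u = Suc N}"
      (is "?A = ?B")
    proof (intro equalityI subsetI)
      fix x assume "x \<in> ?A"
      then obtain \<sigma>' b where "\<sigma>' = ?\<sigma> b" "x \<in> ?R \<sigma>' (b # v)" by (elim UN_E CollectE) blast
      then obtain u where "length u = N" "x = (?\<sigma> b)(c := ctr 0, k := left_of (u @ b # v))" by blast
      then show "x \<in> ?B" by (intro CollectI exI[of _ "u @ [b]"]) auto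
    next
      fix x assume "x \<in> ?B"
      then obtain u where u: "length u = Suc N" "x = \<sigma>(c := ctr 0, k := left_of (u @ v))" by blast
      then obtain u' b where "u = u' @ [b]" by (metis length_Suc_conv_rev)
      with u have "length u' = N" "x = (?\<sigma> b)(c := ctr 0, k := left_of (u' @ b # v))" by auto
      then have "x \<in> ?R (?\<sigma> b) (b # v)" by blast
      then show "x \<in> ?A" by (intro UN_I[of "?\<sigma> b"] UN_I[of b]) auto
    qed
    moreover have "3 + (N * 6 + 1) + 3 = Suc N * 6 + 1" by simp
    ultimately show ?case by (simp only:)
  qed
  from this[of \<tau> "[]"] have 1: "HT K (For c ?b) \<tau> (N * 6 + 1) {\<tau>(c := ctr 0, k := left_of u) |u.
      length u = N}"
    using assms by (simp add: left_of_Nil)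
  have "HT K (guess k c) \<tau> (N * 6 + 1 + 1)
    (\<Union>\<sigma>\<in>{\<tau>(c := ctr 0, k := left_of u) |u. length u = N}. {\<sigma>(k := shift (\<sigma> k) 1)})"
    unfolding guess_def by (rule HT_Seq[OF 1]) (use DT_mv[of k K MoveRight] assms in auto)
  moreover have "(\<Union>\<sigma>\<in>{\<tau>(c := ctr 0, k := left_of u) |u. length u = N}. {\<sigma>(k := shift (\<sigma> k) 1)})
     = {\<tau>(c := ctr 0, k := tape_of u) |u. length u = N}"
  proof -
    have "(\<Union>\<sigma>\<in>{F u |u. P u}. {G \<sigma>}) = {G (F u) |u. P u}" 
      for F :: "bool list \<Rightarrow> nat \<Rightarrow> tape" and G :: "(nat \<Rightarrow> tape) \<Rightarrow> nat \<Rightarrow> tape" and P by blast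
    then show ?thesis by (simp add: shift_left_of)
  qed
  ultimately show ?thesis by simp
qed

section \<open>Writing words given bit by bit\<close>

definition word_of :: "((nat \<Rightarrow> bool list) \<Rightarrow> (nat \<Rightarrow> nat) \<Rightarrow> nat) \<Rightarrow> ((nat \<Rightarrow> bool list) \<Rightarrow> (nat \<Rightarrow> nat) \<Rightarrow> nat) \<Rightarrow>
    (nat \<Rightarrow> bool list) \<Rightarrow> bool list" where
  "word_of l g ws = map (\<lambda>i. g ws (case_nat i (\<lambda>_. 0)) \<noteq> 0) [0..<l ws (\<lambda>_. 0)]"

text \<open>Bits come out from last to first as the loop counts down. Each value of \<open>g\<close>
  is collected on counter \<open>b\<close>, turned into a symbol by a test for zero, and cleared
  again for the next round. The many disequations keep the tapes involved apart.\<close>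

lemma output_program:
  assumes "PF l" "PF g"
  obtains cmp d p where "\<And>\<omega> \<rho> b s (c :: nat) (k :: nat). choice_free (cmp \<omega> \<rho> b s c k)"
    "\<And>K \<omega> \<rho> b s \<tau> ws m c k. layout K \<omega> \<rho> b s d \<Longrightarrow> state \<omega> \<rho> s d ws (\<lambda>_. 0) m \<tau> \<Longrightarrow> \<tau> b = ctr 0 \<Longrightarrow> \<tau> c = ctr 0 \<Longrightarrow>
      \<tau> k = (\<lambda>_. 0) \<Longrightarrow> k < K \<Longrightarrow> c < s \<Longrightarrow> b \<noteq> c \<Longrightarrow> k \<noteq> b \<Longrightarrow> k \<noteq> c \<Longrightarrow> k \<notin> {s..<s + d} \<Longrightarrow>
      k \<notin> range \<rho> \<Longrightarrow> k \<notin> range \<omega> \<Longrightarrow> c \<notin> range \<rho> \<Longrightarrow> c \<notin> range \<omega> \<Longrightarrow>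
      DT K (cmp \<omega> \<rho> b s c k) \<tau> (poly p m) (\<tau>(k := tape_of (word_of l g ws)))"
proof -
  from assms(1) obtain d1 p1 c1 where f: "\<And>\<omega> \<rho> r s. choice_free (c1 \<omega> \<rho> r s)"
    "\<And>ws e m. \<forall>i. e i \<le> m \<Longrightarrow> \<forall>k. length (ws k) \<le> m \<Longrightarrow> l ws e \<le> poly p1 m"
    "\<And>K \<omega> \<rho> r s d' \<tau> ws e m x. layout K \<omega> \<rho> r s d' \<Longrightarrow> state \<omega> \<rho> s d' ws e m \<tau> \<Longrightarrow> \<tau> r = ctr x \<Longrightarrow> d1 \<le> d' \<Longrightarrow>
        DT K (c1 \<omega> \<rho> r s) \<tau> (poly p1 m) (\<tau>(r := ctr (x + l ws e)))" by (rule PFE) blast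
  from assms(2) obtain d2 p2 c2 where g: "\<And>\<omega> \<rho> r s. choice_free (c2 \<omega> \<rho> r s)"
    "\<And>ws e m. \<forall>i. e i \<le> m \<Longrightarrow> \<forall>k. length (ws k) \<le> m \<Longrightarrow> g ws e \<le> poly p2 m"
    "\<And>K \<omega> \<rho> r s d' \<tau> ws e m x. layout K \<omega> \<rho> r s d' \<Longrightarrow> state \<omega> \<rho> s d' ws e m \<tau> \<Longrightarrow> \<tau> r = ctr x \<Longrightarrow> d2 \<le> d' \<Longrightarrow>
        DT K (c2 \<omega> \<rho> r s) \<tau> (poly p2 m) (\<tau>(r := ctr (x + g ws e)))" by (rule PFE) blast
  define q where "q = pcompose p2 ([:0, 1:] + p1)"
  have q: "poly q m = poly p2 (m + poly p1 m)" for m by (simp add: q_def poly_pcompose)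
  let ?wr = "\<lambda>b k. If b (\<lambda>z. z \<noteq> 1) (Seq (Do k (\<lambda>_. (2, MoveLeft))) (For b (skip b))) (Do k (\<lambda>_. (1,
      MoveLeft)))"
  let ?body = "\<lambda>\<omega> \<rho> b s c k. Seq (c2 \<omega> (case_nat c \<rho>) b s) (?wr b k)"
  let ?cmp = "\<lambda>\<omega> \<rho> b s c k. Seq (c1 \<omega> \<rho> c s) (Seq (For c (?body \<omega> \<rho> b s c k)) (mv k MoveRight))"
  show thesis
  \<comment> \<open>A round costs at most \<open>q\<close> for the value, \<open>4 q + 5\<close> for
    writing and clearing, and 3 for the loop; the final 2 pays for the exit of the loop and the last
    move.\<close>
  proof (rule that[of ?cmp "d1 + d2" "p1 + (p1 * ((q + (4 * q + 5)) + 3) + 2)"])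
    show "choice_free (?cmp \<omega> \<rho> b s c k)" for \<omega> \<rho> b s c k using f(1) g(1) by simp
    fix K \<omega> \<rho> b s \<tau> ws m c k
    assume a: "layout K \<omega> \<rho> b s (d1 + d2)" "state \<omega> \<rho> s (d1 + d2) ws (\<lambda>_. 0) m \<tau>" "\<tau> b = ctr 0" "\<tau> c = ctr 0"
      "\<tau> k = (\<lambda>_. 0)" "k < K" "c < s" "b \<noteq> c" "k \<noteq> b" "k \<noteq> c" "k \<notin> {s..<s + (d1 + d2)}" "k \<notin> range
          \<rho>" "k \<notin> range \<omega>"
      "c \<notin> range \<rho>" "c \<notin> range \<omega>"
    have ne: "\<rho> i \<noteq> k" "\<omega> j \<noteq> k" "\<rho> i \<noteq> c" "\<omega> j \<noteq> c" "k \<noteq> \<rho> i" "k \<noteq> \<omega> j" "c \<noteq> \<rho> i" "c \<noteq> \<omega> j" for i j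
        using a(12-15) by auto
    define N where "N = l ws (\<lambda>_. 0)"
    have N: "N \<le> poly p1 m" unfolding N_def using f(2)[of "\<lambda>_. 0" m ws] a(2) by (auto simp: state_def)
    have b: "b < s" "s \<le> K" using layoutD[OF a(1)] by auto
    have 1: "DT K (c1 \<omega> \<rho> c s) \<tau> (poly p1 m) (\<tau>(c := ctr (0 + N)))"
      unfolding N_def by (rule f(3)[where d' = "d1 + d2"]) (use a ne in \<open>auto simp: layout_def state_def\<close>)
    let ?bit = "\<lambda>i. g ws (case_nat i (\<lambda>_. 0)) \<noteq> 0"
    let ?S = "\<lambda>y. \<tau>(c := ctr y, k := left_of (map ?bit [y..<N]))"
    have 2: "DT K (For c (?body \<omega> \<rho> b s c k)) (\<tau>(c := ctr (0 + N))) (N * ((poly q m + (4 * poly q m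
        + 5)) + 3) + 1) (?S 0)"
    proof (rule DT_For[where S = ?S and N = N and n = "poly q m + (4 * poly q m + 5)"])
      fix y assume y: "y < N"
      let ?\<tau> = "(?S (Suc y))(c := ctr y)"
      let ?v = "g ws (case_nat y (\<lambda>_. 0))"
      let ?u = "map ?bit [Suc y..<N]"
      have v: "?v \<le> poly q m" unfolding q
        using y N a(2) by (intro g(2)) (auto simp: state_def split: nat.splits intro: trans_le_add1)
      have "DT K (c2 \<omega> (case_nat c \<rho>) b s) ?\<tau> (poly p2 (m + poly p1 m)) (?\<tau>(b := ctr (0 + ?v)))"
        by (rule g(3)[where d' = "d1 + d2"])
          (use a y N ne in \<open>auto simp: layout_def state_def split: nat.splits intro: trans_le_add1\<close>)
      then have 1: "DT K (c2 \<omega> (case_nat c \<rho>) b s) ?\<tau> (poly q m) (?\<tau>(b := ctr ?v))" by (simp add: q)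
      have u: "map ?bit [y..<N] = (?v \<noteq> 0) # ?u" using y by (subst upt_conv_Cons) auto
      have 2: "DT K (?wr b k) (?\<tau>(b := ctr ?v)) (4 * poly q m + 5) (?S y)"
      proof (cases "?v = 0")
        case True
        have "DT K (Do k (\<lambda>_. (1, MoveLeft))) (?\<tau>(b := ctr ?v)) 1 (?S y)"
          by (rule DT_weaken[OF DT_Do])
            (use a True u left_of_Cons[of False ?u] in \<open>auto simp: fun_eq_iff simp del:
                tape_act.simps upt_Suc\<close>)
        then show ?thesis
          by (intro DT_weaken[OF HT_If_False]) (use True b a in auto)
      next
        case False
        have w: "DT K (Do k (\<lambda>_. (2, MoveLeft))) (?\<tau>(b := ctr ?v)) 1 ((?S y)(b := ctr ?v))"
          by (rule DT_weaken[OF DT_Do])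
            (use a False u left_of_Cons[of True ?u] in \<open>auto simp: fun_eq_iff simp del:
                tape_act.simps upt_Suc\<close>)
        have z: "DT K (For b (skip b)) ((?S y)(b := ctr ?v)) (?v * 4 + 1) (?S y)"
          by (rule DT_For[where S = "\<lambda>z. (?S y)(b := ctr z)" and N = ?v and n = 1])
            (use b a in \<open>auto simp: fun_eq_iff intro!: DT_weaken[OF DT_skip]\<close>)
        show ?thesis
          by (rule DT_weaken[OF HT_If_True[OF DT_Seq[OF w z]]]) (use False b a v in auto)
      qed
      show "DT K (?body \<omega> \<rho> b s c k) ?\<tau> (poly q m + (4 * poly q m + 5)) (?S y)"
        by (rule DT_Seq[OF 1 2])
    qed (use a b in \<open>auto simp: fun_eq_iff left_of_Nil\<close>)
    have 3: "DT K (mv k MoveRight) (?S 0) 1 (\<tau>(k := tape_of (word_of l g ws)))"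
      by (rule DT_weaken[OF DT_mv]) (use a in \<open>auto simp: fun_eq_iff shift_left_of word_of_def N_def\<close>)
    have "N * ((poly q m + (4 * poly q m + 5)) + 3) \<le> poly p1 m * ((poly q m + (4 * poly q m + 5)) + 3)"
      using N by (rule mult_right_mono) simp
    then show "DT K (?cmp \<omega> \<rho> b s c k) \<tau> (poly (p1 + (p1 * ((q + (4 * q + 5)) + 3) + 2)) m)
        (\<tau>(k := tape_of (word_of l g ws)))"
      by (intro DT_weaken[OF DT_Seq[OF 1 DT_Seq[OF 2 3]]]) (auto simp flip: numeral_poly)
  qed
qed


section \<open>Machines that guess a certificate\<close>

definition pair :: "bool list \<Rightarrow> bool list \<Rightarrow> nat \<Rightarrow> bool list" where
  "pair w u = case_nat w (\<lambda>_. u)"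

lemma pair_simps [simp]: "pair w u 0 = w" "pair w u (Suc k) = u"
  by (auto simp: pair_def)

lemma tape_holds_tape_of: "tape_holds (tape_of v) u \<longleftrightarrow> u = v"
proof
  assume h: "tape_holds (tape_of v) u"
  have inj: "bit_symbol a = bit_symbol b \<Longrightarrow> a = b" for a b by (cases a; cases b) auto
  have pos: "bit_symbol a \<noteq> 0" for a by (cases a) auto
  have 1: "length u \<ge> length v"
    using h pos[of "v ! length u"] by (auto simp: tape_holds_def tape_of_def split: if_splits)
  have 2: "length u \<le> length v"
  proof (rule ccontr)
    assume "\<not> length u \<le> length v"
    then have "tape_of v (int (length v)) = bit_symbol (u ! length v)" using h by (simp add: tape_holds_def)
    then show False using pos[of "u ! length v"] by (simp add: tape_of_def del: neq0_conv)
  qed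
  from 1 2 have len: "length u = length v" by simp
  show "u = v"
  proof (rule nth_equalityI[OF len])
    fix i assume "i < length u"
    then show "u ! i = v ! i" using h len by (auto simp: tape_holds_def tape_of_def intro!: inj)
  qed
qed (auto simp: tape_holds_def tape_of_def)

lemma HT_Seq_DT: "DT K c \<tau> n \<tau>1 \<Longrightarrow> HT K d \<tau>1 m Q \<Longrightarrow> HT K (Seq c d) \<tau> (n + m) Q"
  using HT_Seq[of K c \<tau> n "{\<tau>1}" d m "\<lambda>_. Q"] by simp

text \<open>Tapes 0 and 1 hold input and guess, tapes 2 to \<open>K - 2\<close> are counters, and
  the last tape is left blank for an oracle query.\<close>

definition guessed :: "nat \<Rightarrow> bool list \<Rightarrow> bool list \<Rightarrow> nat \<Rightarrow> tape" where
  "guessed K w u j = (if j = 0 then tape_of w else if j = 1 then tape_of u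
     else if 2 \<le> j \<and> j < K - 1 then ctr 0 else (\<lambda>_. 0))"

definition two_words :: "nat \<Rightarrow> nat" where
  "two_words k = (if k = 0 then 0 else 1)"

text \<open>\<open>K\<close> is left open so that the program run after the guess can claim its own
  scratch counters. The functions concerned depend on words alone: all arguments are looked up on
  counter 2, which stays at 0.\<close>

lemma guess_program:
  assumes "PF l"
  obtains c p d where "\<And>K (w :: bool list). K \<ge> 5 + d \<Longrightarrow> HT K (c K) (start w) (K + poly p (length w))
      {guessed K w u |u :: bool list. length u = l (pair w []) (\<lambda>_. 0)}"
    and "\<And>w. l (pair w []) (\<lambda>_. 0) \<le> poly p (length w)"
proof -
  from assms(1) obtain d1 p1 c1 where l: "\<And>\<omega> \<rho> r s. choice_free (c1 \<omega> \<rho> r s)"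
    "\<And>ws e m. \<forall>i. e i \<le> m \<Longrightarrow> \<forall>k. length (ws k) \<le> m \<Longrightarrow> l ws e \<le> poly p1 m"
    "\<And>K \<omega> \<rho> r s d' \<tau> ws e m x. layout K \<omega> \<rho> r s d' \<Longrightarrow> state \<omega> \<rho> s d' ws e m \<tau> \<Longrightarrow> \<tau> r = ctr x \<Longrightarrow> d1 \<le> d' \<Longrightarrow>
        DT K (c1 \<omega> \<rho> r s) \<tau> (poly p1 m) (\<tau>(r := ctr (x + l ws e)))" by (rule PFE) blast
  let ?\<rho> = "\<lambda>_ :: nat. 2 :: nat"
  let ?c = "\<lambda>K. Seq (init_ctrs 2 (K - 4)) (Seq (c1 two_words ?\<rho> 3 4) (guess 1 3))"
  define N where "N w = l (pair w []) (\<lambda>_. 0)" for w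
  have N: "N w \<le> poly p1 (length w)" for w
    unfolding N_def by (rule l(2)) (auto simp: pair_def split: nat.splits)
  show thesis
  proof (rule that[of d1 ?c "7 * p1 + 2"])
    fix K and w :: "bool list" assume K: "5 + d1 \<le> K"
    let ?m = "length w"
    have lay: "layout K two_words ?\<rho> 3 4 d1" using K by (auto simp: layout_def two_words_def)
    have 1: "DT K (init_ctrs 2 (K - 4)) (start w) K (guessed K w [])"
      by (rule DT_weaken[OF DT_init_ctrs]) (use K in \<open>auto simp: start_def fun_eq_iff guessed_def
          tape_of_Nil\<close>)
    have 2: "DT K (c1 two_words ?\<rho> 3 4) (guessed K w []) (poly p1 ?m) ((guessed K w [])(3 := ctr (0 + N w)))"
      unfolding N_def by (rule l(3)[OF lay])
        (use K in \<open>auto simp: state_def guessed_def two_words_def pair_def split: nat.splits\<close>)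
    have "(guessed K w [])(3 := ctr (0 + N w), 3 := ctr 0, 1 := tape_of u) = guessed K w u" for u
      using K by (auto simp: guessed_def fun_eq_iff)
    then have 3: "HT K (guess 1 3) ((guessed K w [])(3 := ctr (0 + N w))) (N w * 6 + 2) {guessed K w
        u |u :: bool list. length u = N w}"
      using HT_guess[of 1 K 3 "(guessed K w [])(3 := ctr (0 + N w))" "N w"] K by (simp add:
          guessed_def tape_of_Nil)
    have "HT K (?c K) (start w) (K + (poly p1 ?m + (N w * 6 + 2))) {guessed K w u |u :: bool list.
        length u = N w}"
      by (rule HT_Seq_DT[OF 1 HT_Seq_DT[OF 2 3]])
    then show "HT K (?c K) (start w) (K + poly (7 * p1 + 2) ?m) {guessed K w u |u :: bool list.
        length u = l (pair w []) (\<lambda>_. 0)}"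
      unfolding N_def[symmetric] by (rule HT_mono) (use N[of w] in \<open>auto simp flip: numeral_poly\<close>)
  next
    show "l (pair w []) (\<lambda>_. 0) \<le> poly (7 * p1 + 2) (length w)" for w
      using N[of w] by (auto simp: N_def simp flip: numeral_poly)
  qed
qed

text \<open>Different guesses leave different tapes, so the outcomes of the second program may be
  indexed by the guess itself.\<close>

lemma HT_after_guess:
  fixes P :: "bool list \<Rightarrow> bool"
  assumes "HT K c (start w) n {guessed K w u |u. P u}" "\<And>u :: bool list. P u \<Longrightarrow> DT K d (guessed K w
      u) m (fin u)"
  shows "HT K (Seq c d) (start w) (n + m) {fin u |u. P u}"
proof -
  have inj: "guessed K w u = guessed K w u' \<longleftrightarrow> u = u'" for u u'
  proof
    assume "guessed K w u = guessed K w u'"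
    then have "guessed K w u 1 = guessed K w u' 1" by simp
    then have "tape_of u = tape_of u'" by (simp add: guessed_def)
    then show "u = u'" by (metis tape_holds_tape_of)
  qed simp
  have "HT K (Seq c d) (start w) (n + m)
      (\<Union>\<tau>\<in>{guessed K w u |u. P u}. {fin u |u. P u \<and> \<tau> = guessed K w u})"
  proof (rule HT_Seq[OF assms(1)])
    fix \<tau> assume "\<tau> \<in> {guessed K w u |u. P u}"
    then obtain u where u: "\<tau> = guessed K w u" "P u" by blast
    then have "{fin u |u. P u \<and> \<tau> = guessed K w u} = {fin u}" by (auto simp: inj)
    with assms(2)[OF u(2)] u(1) show "HT K d \<tau> m {fin u |u. P u \<and> \<tau> = guessed K w u}" by simp
  qed
  moreover have "(\<Union>\<tau>\<in>{guessed K w u |u. P u}. {fin u |u. P u \<and> \<tau> = guessed K w u}) = {fin u |u. P u}"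
    by blast
  ultimately show ?thesis by simp
qed

lemma bex_image_set: "(\<exists>x\<in>{F u |u. P u}. Q x) \<longleftrightarrow> (\<exists>u. P u \<and> Q (F u))"
  by blast

theorem NP_I:
  assumes "PF l" "PF f"
  shows "{w. \<exists>u. length u = l (pair w []) (\<lambda>_. 0) \<and> f (pair w u) (\<lambda>_. 0) \<noteq> 0} \<in> NP"
proof -
  from assms(2) obtain d2 p2 c2 where f: "\<And>\<omega> \<rho> r s. choice_free (c2 \<omega> \<rho> r s)"
    "\<And>ws e m. \<forall>i. e i \<le> m \<Longrightarrow> \<forall>k. length (ws k) \<le> m \<Longrightarrow> f ws e \<le> poly p2 m"
    "\<And>K \<omega> \<rho> r s d' \<tau> ws e m x. layout K \<omega> \<rho> r s d' \<Longrightarrow> state \<omega> \<rho> s d' ws e m \<tau> \<Longrightarrow> \<tau> r = ctr x \<Longrightarrow> d2 \<le> d' \<Longrightarrow>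
        DT K (c2 \<omega> \<rho> r s) \<tau> (poly p2 m) (\<tau>(r := ctr (x + f ws e)))" by (rule PFE) blast
  from assms(1) obtain c p d where g: "\<And>K (w :: bool list). K \<ge> 5 + d \<Longrightarrow> HT K (c K) (start w) (K +
      poly p (length w))
      {guessed K w u |u :: bool list. length u = l (pair w []) (\<lambda>_. 0)}" "\<And>w. l (pair w []) (\<lambda>_. 0)
          \<le> poly p (length w)"
    by (rule guess_program) blast
  define K where "K = 5 + (d + d2)"
  let ?\<rho> = "\<lambda>_ :: nat. 2 :: nat"
  let ?fin = "\<lambda>(w :: bool list) (u :: bool list). (guessed K w u)(3 := ctr (f (pair w u) (\<lambda>_. 0)))"
  let ?P = "[:K:] + p + pcompose p2 ([:0, 1:] + p)"
  have lay: "layout K two_words ?\<rho> 3 4 d2" by (auto simp: layout_def K_def two_words_def)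
  have "HT K (Seq (c K) (c2 two_words ?\<rho> 3 4)) (start w) (K + poly p (length w) + poly p2 (length w
      + poly p (length w)))
      {?fin w u |u. length u = l (pair w []) (\<lambda>_. 0)}" for w :: "bool list"
  proof (rule HT_after_guess[OF g(1)])
    fix u :: "bool list" assume u: "length u = l (pair w []) (\<lambda>_. 0)"
    have "DT K (c2 two_words ?\<rho> 3 4) (guessed K w u) (poly p2 (length w + poly p (length w)))
       ((guessed K w u)(3 := ctr (0 + f (pair w u) (\<lambda>_. 0))))"
      by (rule f(3)[OF lay])
        (use g(2)[of w] u in \<open>auto simp: state_def guessed_def two_words_def K_def pair_def split:
            nat.splits\<close>)
    then show "DT K (c2 two_words ?\<rho> 3 4) (guessed K w u) (poly p2 (length w + poly p (length w)))
        (?fin w u)" by simp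
  qed (simp add: K_def)
  then have "HT K (Seq (c K) (c2 two_words ?\<rho> 3 4)) (start w) (poly ?P (length w))
      {?fin w u |u. length u = l (pair w []) (\<lambda>_. 0)}" for w :: "bool list"
    by (simp add: poly_pcompose)
  from NP_program[OF _ this, of 3]
  have "{w. \<exists>\<tau>\<in>{?fin w u |u. length u = l (pair w []) (\<lambda>_. 0)}. \<tau> 3 0 = 0} \<in> NP" by (simp add: K_def)
  \<comment> \<open>The head of a counter scans the mark exactly at value 0 and a blank otherwise; a
    scanned blank means acceptance.\<close>
  moreover have "(ctr x 0 = 0) = (x \<noteq> 0)" for x by (simp add: ctr_def)
  then have "{w. \<exists>\<tau>\<in>{?fin w u |u. length u = l (pair w []) (\<lambda>_. 0)}. \<tau> 3 0 = 0} =
     {w. \<exists>u. length u = l (pair w []) (\<lambda>_. 0) \<and> f (pair w u) (\<lambda>_. 0) \<noteq> 0}"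
    by (subst bex_image_set) simp
  ultimately show ?thesis by simp
qed

text \<open>A guess is followed by one query that has to be answered negatively, so that an
  existential quantifier is followed by a universal one.\<close>

theorem Sigma2p_I:
  assumes "PF l" "PF n" "PF g" "X \<in> NP"
  shows "{w. \<exists>u. length u = l (pair w []) (\<lambda>_. 0) \<and> word_of n g (pair w u) \<notin> X} \<in> Sigma2p"
proof -
  obtain c2 d2 p2 where f: "\<And>K \<omega> \<rho> b s \<tau> ws m c k. layout K \<omega> \<rho> b s d2 \<Longrightarrow> state \<omega> \<rho> s d2 ws (\<lambda>_. 0) m
      \<tau> \<Longrightarrow> \<tau> b = ctr 0 \<Longrightarrow> \<tau> c = ctr 0 \<Longrightarrow>
      \<tau> k = (\<lambda>_. 0) \<Longrightarrow> k < K \<Longrightarrow> c < s \<Longrightarrow> b \<noteq> c \<Longrightarrow> k \<noteq> b \<Longrightarrow> k \<noteq> c \<Longrightarrow> k \<notin> {s..<s + d2} \<Longrightarrow>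
      k \<notin> range \<rho> \<Longrightarrow> k \<notin> range \<omega> \<Longrightarrow> c \<notin> range \<rho> \<Longrightarrow> c \<notin> range \<omega> \<Longrightarrow>
      DT K (c2 \<omega> \<rho> b s c k) \<tau> (poly p2 m) (\<tau>(k := tape_of (word_of n g ws)))"
    by (rule output_program[OF assms(2,3)]) blast
  from assms(1) obtain c p d where g: "\<And>K (w :: bool list). K \<ge> 5 + d \<Longrightarrow> HT K (c K) (start w) (K +
      poly p (length w))
      {guessed K w u |u :: bool list. length u = l (pair w []) (\<lambda>_. 0)}" "\<And>w. l (pair w []) (\<lambda>_. 0)
          \<le> poly p (length w)"
    by (rule guess_program) blast
  define K where "K = 6 + (d + d2)"
  let ?\<rho> = "\<lambda>_ :: nat. 2 :: nat"
  let ?fin = "\<lambda>(w :: bool list) (u :: bool list). (guessed K w u)(K - 1 := tape_of (word_of n g (pair w u)))"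
  let ?P = "[:K:] + p + pcompose p2 ([:0, 1:] + p)"
  have lay: "layout K two_words ?\<rho> 4 5 d2" by (auto simp: layout_def K_def two_words_def)
  have "HT K (Seq (c K) (c2 two_words ?\<rho> 4 5 3 (K - 1))) (start w) (K + poly p (length w) + poly p2
      (length w + poly p (length w)))
      {?fin w u |u. length u = l (pair w []) (\<lambda>_. 0)}" for w :: "bool list"
  proof (rule HT_after_guess[OF g(1)])
    fix u :: "bool list" assume u: "length u = l (pair w []) (\<lambda>_. 0)"
    show "DT K (c2 two_words ?\<rho> 4 5 3 (K - 1)) (guessed K w u) (poly p2 (length w + poly p (length
        w))) (?fin w u)"
      by (rule f[OF lay])
        (use g(2)[of w] u in \<open>auto simp: state_def guessed_def two_words_def K_def pair_def split:
            nat.splits\<close>)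
  qed (simp add: K_def)
  then have "HT K (Seq (c K) (c2 two_words ?\<rho> 4 5 3 (K - 1))) (start w) (poly ?P (length w))
      {?fin w u |u. length u = l (pair w []) (\<lambda>_. 0)}" for w :: "bool list"
    by (simp add: poly_pcompose)
  from NP_oracle_program[OF _ this]
  have "{w. \<exists>\<tau>\<in>{?fin w u |u. length u = l (pair w []) (\<lambda>_. 0)}. \<not> (\<exists>v\<in>X. tape_holds (\<tau> (K - 1)) v)}
      \<in> NP_oracle X"
    by (simp add: K_def)
  moreover have "(\<exists>v\<in>X. tape_holds (tape_of q) v) \<longleftrightarrow> q \<in> X" for q by (auto simp: tape_holds_tape_of)
  then have "{w. \<exists>\<tau>\<in>{?fin w u |u. length u = l (pair w []) (\<lambda>_. 0)}. \<not> (\<exists>v\<in>X. tape_holds (\<tau> (K - 1)) v)} =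
     {w. \<exists>u. length u = l (pair w []) (\<lambda>_. 0) \<and> word_of n g (pair w u) \<notin> X}"
    by (subst bex_image_set) simp
  ultimately show ?thesis using assms(4) by (auto simp: Sigma2p_def)
qed

lemma tape_of_erase:
  assumes "w \<noteq> []"
  shows "tape_act (0, MoveRight) (tape_of w) = tape_of (tl w)"
proof
  fix i :: int
  obtain b v where "w = b # v" using assms by (cases w) auto
  moreover have "nat (i + 1) = Suc (nat i)" if "i \<ge> 0" using that by simp
  ultimately show "tape_act (0, MoveRight) (tape_of w) i = tape_of (tl w) i"
    by (auto simp: tape_of_def)
qed

lemma tape_of_snoc:
  "tape_act (bit_symbol b, MoveRight) (shift (tape_of v) (int (length v))) =
     shift (tape_of (v @ [b])) (int (length v) + 1)"
  by (rule ext) (auto simp: shift_def tape_of_def nth_append nat_add_distrib algebra_simps)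

text \<open>Output is expected on tape 0, which holds the input. The input is therefore moved to
  tape 1, erasing tape 0 on the way, and read from there.\<close>

theorem poly_time_computable_I:
  assumes "PF l" "PF g"
  shows "poly_time_computable (\<lambda>w. word_of l g (\<lambda>_. w))"
proof -
  obtain c2 d2 p2 where f: "\<And>\<omega> \<rho> b s c k. choice_free (c2 \<omega> \<rho> b s c k)"
    "\<And>K \<omega> \<rho> b s \<tau> ws m c k. layout K \<omega> \<rho> b s d2 \<Longrightarrow> state \<omega> \<rho> s d2 ws (\<lambda>_. 0) m \<tau> \<Longrightarrow> \<tau> b = ctr 0 \<Longrightarrow> \<tau> c = ctr 0 \<Longrightarrow>
      \<tau> k = (\<lambda>_. 0) \<Longrightarrow> k < K \<Longrightarrow> c < s \<Longrightarrow> b \<noteq> c \<Longrightarrow> k \<noteq> b \<Longrightarrow> k \<noteq> c \<Longrightarrow> k \<notin> {s..<s + d2} \<Longrightarrow>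
      k \<notin> range \<rho> \<Longrightarrow> k \<notin> range \<omega> \<Longrightarrow> c \<notin> range \<rho> \<Longrightarrow> c \<notin> range \<omega> \<Longrightarrow>
      DT K (c2 \<omega> \<rho> b s c k) \<tau> (poly p2 m) (\<tau>(k := tape_of (word_of l g ws)))"
    by (rule output_program[OF assms(1,2)]) blast
  define K where "K = 5 + d2"
  let ?copy = "Seq (If 0 (\<lambda>z. z = 1) (Do 1 (\<lambda>_. (1, MoveRight))) (Do 1 (\<lambda>_. (2, MoveRight)))) (Do 0
      (\<lambda>_. (0, MoveRight)))"
  let ?rewind = "Seq (mv 1 MoveLeft) (Seq (While 1 (\<lambda>z. z \<noteq> 0) (mv 1 MoveLeft)) (mv 1 MoveRight))"
  let ?c = "Seq (init_ctrs 2 (K - 3)) (Seq (Seq (While 0 (\<lambda>z. z \<noteq> 0) ?copy) ?rewind) (c2 (\<lambda>_. 1)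
      (\<lambda>_. 2) 4 5 3 0))"
  define base where "base t0 t1 j = (if j = 0 then t0 else if j = 1 then t1 else if 2 \<le> j \<and> j < K
      then ctr 0 else (\<lambda>_. 0))"
    for t0 t1 j
  have upd: "(base t0 t1)(0 := t) = base t t1" "(base t0 t1)(1 := t) = base t0 t" "(base t0 t1)(Suc
      0 := t) = base t0 t" for t0 t1 t
    by (auto simp: base_def fun_eq_iff)
  have get: "base t0 t1 0 = t0" "base t0 t1 1 = t1" "base t0 t1 (Suc 0) = t1" for t0 t1 by (auto
      simp: base_def)
  let ?fin = "\<lambda>w. base (tape_of (word_of l g (\<lambda>_. w))) (tape_of w)"
  have run: "DT K ?c (start w) (K + ((length w * (5 + 2) + 1) + (1 + ((length w * (1 + 2) + 1) + 1))
      + poly p2 (length w))) (?fin w)" for w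
  proof -
    let ?n = "length w"
    have 1: "DT K (init_ctrs 2 (K - 3)) (start w) K (base (tape_of w) (tape_of []))"
      by (rule DT_weaken[OF DT_init_ctrs]) (auto simp: start_def fun_eq_iff base_def K_def tape_of_Nil)
    define S where "S i = base (tape_of (drop i w)) (shift (tape_of (take i w)) (int i))" for i
    have 2: "DT K (While 0 (\<lambda>z. z \<noteq> 0) ?copy) (S 0) (?n * (5 + 2) + 1) (S ?n)"
    proof (rule DT_While)
      fix i assume i: "i < ?n"
      then have d: "drop i w \<noteq> []" "tl (drop i w) = drop (Suc i) w" "take (Suc i) w = take i w @ [w
          ! i]" "length (take i w) = i"
        by (auto simp: drop_Suc take_Suc_conv_app_nth tl_drop)
      have sc: "S i 0 0 = bit_symbol (w ! i)" using i by (simp add: S_def get tape_of_def)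
      then show "S i 0 0 \<noteq> 0" using bit_symbol_bounds(1)[of "w ! i"] by simp
      let ?\<tau> = "base (tape_of (drop i w)) (shift (tape_of (take (Suc i) w)) (int (Suc i)))"
      have a: "tape_act (bit_symbol (w ! i), MoveRight) (shift (tape_of (take i w)) (int i)) = shift
          (tape_of (take (Suc i) w)) (int (Suc i))"
        using tape_of_snoc[of "w ! i" "take i w"] d(3,4) by (simp add: add.commute del: tape_act.simps)
      have c1: "DT K (If 0 (\<lambda>z. z = 1) (Do 1 (\<lambda>_. (1, MoveRight))) (Do 1 (\<lambda>_. (2, MoveRight)))) (S i) 3 ?\<tau>"
      proof (cases "w ! i")
        case True
        show ?thesis
          by (rule DT_weaken[OF HT_If_False[OF DT_Do]]) (use sc a True in \<open>auto simp: K_def S_def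
              get upd simp del: tape_act.simps\<close>)
      next
        case False
        show ?thesis
          by (rule DT_weaken[OF HT_If_True[OF DT_Do]]) (use sc a False in \<open>auto simp: K_def S_def
              get upd simp del: tape_act.simps\<close>)
      qed
      have c2: "DT K (Do 0 (\<lambda>_. (0, MoveRight))) ?\<tau> 1 (S (Suc i))"
        by (rule DT_weaken[OF DT_Do]) (use tape_of_erase[OF d(1)] d(2) in \<open>auto simp: K_def S_def
            get upd simp del: tape_act.simps\<close>)
      show "DT K ?copy (S i) 5 (S (Suc i))"
        by (rule DT_weaken[OF DT_Seq[OF c1 c2]]) auto
    qed (auto simp: K_def S_def get tape_of_def)
    define R where "R i = base (tape_of []) (shift (tape_of w) (int ?n - 1 - int i))" for i
    have 3: "DT K (mv 1 MoveLeft) (S ?n) 1 (R 0)"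
      by (rule DT_weaken[OF DT_mv]) (auto simp: K_def S_def R_def get upd)
    have 4: "DT K (While 1 (\<lambda>z. z \<noteq> 0) (mv 1 MoveLeft)) (R 0) (?n * (1 + 2) + 1) (R ?n)"
    proof (rule DT_While)
      show "R i 1 0 \<noteq> 0" if "i < ?n" for i
        using that bit_symbol_bounds(1) by (auto simp: R_def get shift_def tape_of_def simp del:
            neq0_conv intro!: gr_implies_not0)
      show "DT K (mv 1 MoveLeft) (R i) 1 (R (Suc i))" for i
        by (rule DT_weaken[OF DT_mv]) (auto simp: K_def R_def get upd algebra_simps)
    qed (auto simp: K_def R_def get shift_def tape_of_def)
    have 5: "DT K (mv 1 MoveRight) (R ?n) 1 (base (tape_of []) (tape_of w))"
      by (rule DT_weaken[OF DT_mv]) (auto simp: K_def R_def get upd)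
    have 6: "DT K (c2 (\<lambda>_. 1) (\<lambda>_. 2) 4 5 3 0) (base (tape_of []) (tape_of w)) (poly p2 ?n) (?fin w)"
    proof -
      have "DT K (c2 (\<lambda>_. 1) (\<lambda>_. 2) 4 5 3 0) (base (tape_of []) (tape_of w)) (poly p2 ?n)
          ((base (tape_of []) (tape_of w))(0 := tape_of (word_of l g (\<lambda>_. w))))"
        by (rule f(2)) (auto simp: layout_def state_def K_def base_def tape_of_Nil)
      then show ?thesis by (simp add: upd)
    qed
    have "S 0 = base (tape_of w) (tape_of [])" by (simp add: S_def)
    note S0 = this
    from DT_Seq[OF 1 DT_Seq[OF DT_Seq[OF 2[unfolded S0] DT_Seq[OF 3 DT_Seq[OF 4 5]]] 6]] show ?thesis by simp
  qed
  show ?thesis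
  proof (rule poly_time_computable_program[of K ?c "[:K + 4, 10:] + p2" ?fin])
    show "DT K ?c (start w) (poly ([:K + 4, 10:] + p2) (length w)) (?fin w)" for w
      by (rule HT_mono[OF run]) simp
    show "tape_holds (?fin w 0) (word_of l g (\<lambda>_. w))" for w by (simp add: get tape_holds_tape_of)
  qed (auto simp: K_def f(1))
qed

section \<open>Closure properties\<close>

definition PP :: "((nat \<Rightarrow> bool list) \<Rightarrow> (nat \<Rightarrow> nat) \<Rightarrow> bool) \<Rightarrow> bool" where
  "PP P \<longleftrightarrow> PF (\<lambda>ws e. of_bool (P ws e))"

lemma PF_cong: "PF f \<Longrightarrow> (\<And>ws e. f ws e = g ws e) \<Longrightarrow> PF g"
  by (metis ext)

lemma PP_cong: "PP P \<Longrightarrow> (\<And>ws e. P ws e = Q ws e) \<Longrightarrow> PP Q"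
  unfolding PP_def by (erule PF_cong) simp

lemma PF_const: "PF (\<lambda>ws e. c)"
proof (induction c)
  case (Suc c)
  from PF_add[OF this PF_one] show ?case by simp
qed (rule PF_zero)

lemma PF_Suc: "PF f \<Longrightarrow> PF (\<lambda>ws e. Suc (f ws e))"
  using PF_add[OF _ PF_one] by simp

lemma PF_mult: "PF f \<Longrightarrow> PF g \<Longrightarrow> PF (\<lambda>ws e. f ws e * g ws e)"
  by (rule PF_cong[OF PF_sum[where g = "\<lambda>ws x e. g ws e" and f = f]]) (auto intro: PF_ren)

lemma PF_of_bool: "PP P \<Longrightarrow> PF (\<lambda>ws e. of_bool (P ws e))"
  by (simp add: PP_def)

lemma PP_le: "PF f \<Longrightarrow> PF g \<Longrightarrow> PP (\<lambda>ws e. f ws e \<le> g ws e)"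
  unfolding PP_def by (rule PF_cong[OF PF_minus[OF PF_one PF_minus]]) (assumption | simp)+

lemma PP_not: "PP P \<Longrightarrow> PP (\<lambda>ws e. \<not> P ws e)"
  unfolding PP_def by (rule PF_cong[OF PF_minus[OF PF_one]]) (assumption | simp)+

lemma PP_conj: "PP P \<Longrightarrow> PP Q \<Longrightarrow> PP (\<lambda>ws e. P ws e \<and> Q ws e)"
  unfolding PP_def by (rule PF_cong[OF PF_mult]) (assumption | simp)+

lemma PP_disj: "PP P \<Longrightarrow> PP Q \<Longrightarrow> PP (\<lambda>ws e. P ws e \<or> Q ws e)"
  by (rule PP_cong[OF PP_not[OF PP_conj[OF PP_not PP_not]]]) (assumption | simp)+

lemma PP_imp: "PP P \<Longrightarrow> PP Q \<Longrightarrow> PP (\<lambda>ws e. P ws e \<longrightarrow> Q ws e)"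
  by (rule PP_cong[OF PP_disj[OF PP_not]]) (assumption | simp)+

lemma PP_iff: "PP P \<Longrightarrow> PP Q \<Longrightarrow> PP (\<lambda>ws e. P ws e \<longleftrightarrow> Q ws e)"
  by (rule PP_cong[OF PP_conj[OF PP_imp PP_imp]]) (assumption | blast)+

lemma PP_less: "PF f \<Longrightarrow> PF g \<Longrightarrow> PP (\<lambda>ws e. f ws e < g ws e)"
  by (rule PP_cong[OF PP_le[OF PF_Suc]]) (assumption | simp add: Suc_le_eq)+

lemma PP_eq: "PF f \<Longrightarrow> PF g \<Longrightarrow> PP (\<lambda>ws e. f ws e = g ws e)"
  by (rule PP_cong[OF PP_conj[OF PP_le PP_le]]) (assumption | auto)+

lemma PP_const: "PP (\<lambda>ws e. c)"
  unfolding PP_def by (rule PF_const)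

lemma PF_if: "PP P \<Longrightarrow> PF f \<Longrightarrow> PF g \<Longrightarrow> PF (\<lambda>ws e. if P ws e then f ws e else g ws e)"
  by (rule PF_cong[OF PF_add[OF PF_mult[OF PF_of_bool] PF_mult[OF PF_of_bool[OF PP_not]]]])
      (assumption | simp)+

lemma PP_if: "PP P \<Longrightarrow> PP Q \<Longrightarrow> PP R \<Longrightarrow> PP (\<lambda>ws e. if P ws e then Q ws e else R ws e)"
  by (rule PP_cong[OF PP_conj[OF PP_imp PP_imp[OF PP_not]]]) (assumption | simp)+

lemma PP_ex:
  assumes "PF f" "PP (\<lambda>ws e. P ws (e 0) (\<lambda>i. e (Suc i)))"
  shows "PP (\<lambda>ws e. \<exists>x<f ws e. P ws x e)"
proof -
  have "PP (\<lambda>ws e. (1 :: nat) \<le> (\<Sum>x<f ws e. of_bool (P ws x e)))"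
    by (intro PP_le PF_one PF_sum[where g = "\<lambda>ws x e. of_bool (P ws x e)"] assms(1) PF_of_bool assms(2))
  then show ?thesis by (rule PP_cong) (auto simp: Suc_le_eq card_gt_0_iff)
qed

lemma PP_all:
  assumes "PF f" "PP (\<lambda>ws e. P ws (e 0) (\<lambda>i. e (Suc i)))"
  shows "PP (\<lambda>ws e. \<forall>x<f ws e. P ws x e)"
  by (rule PP_cong[OF PP_not[OF PP_ex[OF assms(1) PP_not[OF assms(2)]]]]) auto

text \<open>Substitution is a sum with a single nonzero term, so composition needs no program of its
  own.\<close>

lemma PF_let:
  assumes "PF g" "PF (\<lambda>ws e. f ws (e 0) (\<lambda>i. e (Suc i)))"
  shows "PF (\<lambda>ws e. f ws (g ws e) e)"
proof -
  have "PF (\<lambda>ws e. \<Sum>x<Suc (g ws e). of_bool (x = g ws e) * f ws x e)"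
    by (intro PF_sum[where g = "\<lambda>ws x e. of_bool (x = g ws e) * f ws x e"] PF_Suc PF_mult PF_of_bool
        PP_eq PF_arg
        PF_ren[OF assms(1)] assms)
  then show ?thesis
    by (rule PF_cong) (simp add: lessThan_Suc)
qed

lemma PF_comp1:
  assumes "PF (\<lambda>ws e. h ws (e 0))" "PF f"
  shows "PF (\<lambda>ws e. h ws (f ws e))"
  using PF_let[OF assms(2), of "\<lambda>ws x e. h ws x"] assms(1) by simp

lemma PP_comp1: "PP (\<lambda>ws e. h ws (e 0)) \<Longrightarrow> PF f \<Longrightarrow> PP (\<lambda>ws e. h ws (f ws e))"
  unfolding PP_def by (rule PF_comp1)

lemma PF_min: "PF f \<Longrightarrow> PF g \<Longrightarrow> PF (\<lambda>ws e. min (f ws e) (g ws e))"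
  by (rule PF_cong[OF PF_if[OF PP_le]]) (assumption | simp add: min_def)+

text \<open>The quotient is the number of positive multiples of the divisor up to the
  dividend.\<close>

lemma PF_div:
  assumes "PF f" "PF g"
  shows "PF (\<lambda>ws e. f ws e div g ws e)"
proof -
  have eq: "(\<Sum>z<a. of_bool (Suc z * b \<le> a)) = a div b" if "b \<noteq> 0" for a b :: nat
  proof -
    have "(\<Sum>z<a. of_bool (Suc z * b \<le> a)) = card {z \<in> {..<a}. Suc z * b \<le> a}"
      by (simp add: Collect_conj_eq lessThan_def)
    also have "{z \<in> {..<a}. Suc z * b \<le> a} = {..<a div b}"
      using that by (auto simp: less_eq_div_iff_mult_less_eq[symmetric] simp del: mult_Suc intro:
          less_le_trans)
    finally show ?thesis by simp
  qed
  have "PF (\<lambda>ws e. if g ws e = 0 then 0 else \<Sum>z<f ws e. of_bool (Suc z * g ws e \<le> f ws e))"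
    by (intro PF_if PP_eq PF_const assms PF_of_bool PP_le PF_mult PF_Suc PF_arg
      PF_sum[where g = "\<lambda>ws x e. of_bool (Suc x * g ws e \<le> f ws e)"] PF_ren[OF assms(1)] PF_ren[OF assms(2)])
  then show ?thesis
  proof (rule PF_cong)
    fix ws e
    show "(if g ws e = 0 then 0 else \<Sum>z<f ws e. of_bool (Suc z * g ws e \<le> f ws e)) = f ws e div g ws e"
      using eq[of "g ws e" "f ws e"] by (cases "g ws e = 0") simp_all
  qed
qed

lemma PF_mod: "PF f \<Longrightarrow> PF g \<Longrightarrow> PF (\<lambda>ws e. f ws e mod g ws e)"
  by (rule PF_cong[OF PF_minus[OF _ PF_mult[OF _ PF_div]]]) (assumption | simp add: minus_mult_div_eq_mod)+

lemma PF_power: "PF f \<Longrightarrow> PF (\<lambda>ws e. f ws e ^ k)"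
  by (induction k) (simp_all add: PF_const PF_mult del: One_nat_def)

lemma PF_poly: "PF f \<Longrightarrow> PF (\<lambda>ws e. poly p (f ws e))"
  by (induction p) (simp_all add: PF_const PF_mult PF_add)

lemma PP_bit: "PF f \<Longrightarrow> PP (\<lambda>ws e. f ws e < length (ws k) \<and> ws k ! f ws e)"
  by (rule PP_cong[OF PP_eq[OF PF_symb[of _ k] PF_const[of 2]]]) (assumption | simp add: symb_eq)+

lemma PF_finite_sum: "(\<And>d. d < n \<Longrightarrow> PF (F d)) \<Longrightarrow> PF (\<lambda>ws e. \<Sum>d<n::nat. F d ws e)"
  by (induction n) (simp_all add: PF_const PF_add lessThan_Suc)

text \<open>An arbitrary function \<open>G\<close> of finitely many values below a constant is a
  finite case distinction. In this way the transition relations of arbitrary machines enter the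
  reductions, without \<open>G\<close> being given by a program.\<close>

lemma PF_table:
  "\<forall>f\<in>set fs. PF f \<Longrightarrow> PF (\<lambda>ws e. if \<forall>f\<in>set fs. f ws e < D then G (map (\<lambda>f. f ws e) fs) else 0)"
proof (induction fs arbitrary: G)
  case Nil
  then show ?case by (simp add: PF_const)
next
  case (Cons f fs)
  have "PF (\<lambda>ws e. \<Sum>d<D. of_bool (f ws e = d) * (if \<forall>f\<in>set fs. f ws e < D then G (d # map (\<lambda>f. f ws
      e) fs) else 0))"
    using Cons by (intro PF_finite_sum PF_mult PF_of_bool PP_eq PF_const Cons.IH) auto
  moreover have "(\<Sum>d<D. of_bool (x = d) * h d) = (if x < D then h x else 0)" for x and h :: "nat \<Rightarrow> nat"
    by (simp add: of_bool_def if_distrib[of "\<lambda>z. z * _"] sum.delta cong: if_cong)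
  ultimately show ?case by (auto intro: PF_cong)
qed

lemmas pf_intros = PF_arg PF_const PF_add PF_minus PF_mult PF_Suc PF_if PF_div PF_mod PF_power
    PF_poly PF_min PF_length PF_symb
  PF_of_bool PP_le PP_less PP_eq PP_not PP_conj PP_disj PP_imp PP_iff PP_const PP_if PP_ex PP_all PP_bit

section \<open>Complete labellings\<close>

text \<open>The conditions are local to an argument and its attackers, unlike the fixpoint of
  \<open>Acc\<close>; this suits both the polynomial-time check and the analysis of concrete
  frameworks. \<open>Und\<close> is what remains.\<close>

definition clab :: "'a set \<Rightarrow> ('a \<times> 'a) set \<Rightarrow> ('a \<Rightarrow> label) \<Rightarrow> bool" where
  "clab A R L \<longleftrightarrow> labelling A L \<and> (\<forall>a\<in>A. (L a = In \<longleftrightarrow> (\<forall>b\<in>A. (b, a) \<in> R \<longrightarrow> L b = Out)) \<and>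
     (L a = Out \<longleftrightarrow> (\<exists>b\<in>A. (b, a) \<in> R \<and> L b = In)))"

lemma clabD:
  assumes "clab A R L"
  shows "L a \<noteq> Und \<Longrightarrow> a \<in> A"
    and "a \<in> A \<Longrightarrow> L a = In \<longleftrightarrow> (\<forall>b\<in>A. (b, a) \<in> R \<longrightarrow> L b = Out)"
    and "a \<in> A \<Longrightarrow> L a = Out \<longleftrightarrow> (\<exists>b\<in>A. (b, a) \<in> R \<and> L b = In)"
  using assms unfolding clab_def labelling_def by blast+

definition ins :: "('a \<Rightarrow> label) \<Rightarrow> 'a set" where
  "ins L = {a. L a = In}"

definition decided :: "('a \<Rightarrow> label) \<Rightarrow> 'a set" where
  "decided L = {a. L a \<noteq> Und}"

lemma clab_of_complete:
  assumes "R \<subseteq> A \<times> A" "complete_ext A R E"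
  shows "clab A R (labelling_of A R E)" "ins (labelling_of A R E) = E"
    "decided (labelling_of A R E) = E \<union> Def A R E"
proof -
  have E: "E \<subseteq> A" "E \<inter> Def A R E = {}" "E = Acc A R E"
    using assms(2) by (auto simp: complete_ext_def admissible_def conflict_free_def)
  have i: "labelling_of A R E a = In \<longleftrightarrow> a \<in> E" for a by (simp add: labelling_of_def)
  have o: "labelling_of A R E a = Out \<longleftrightarrow> a \<in> Def A R E" for a using E(2) by (auto simp: labelling_of_def)
  show "ins (labelling_of A R E) = E" by (auto simp: ins_def i)
  show "decided (labelling_of A R E) = E \<union> Def A R E" by (auto simp: decided_def labelling_of_def)
  have "a \<in> E \<longleftrightarrow> (\<forall>b\<in>A. (b, a) \<in> R \<longrightarrow> b \<in> Def A R E)" if "a \<in> A" for a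
    using E(3) that assms(1) by (auto simp: Acc_def)
  moreover have "a \<in> Def A R E \<longleftrightarrow> (\<exists>b\<in>A. (b, a) \<in> R \<and> b \<in> E)" if "a \<in> A" for a
    using that E(1) by (auto simp: Def_def)
  moreover have "labelling A (labelling_of A R E)"
    using E(1) by (auto simp: labelling_def labelling_of_def Def_def)
  ultimately show "clab A R (labelling_of A R E)" unfolding clab_def i o by blast
qed

lemma complete_of_clab:
  assumes "R \<subseteq> A \<times> A" "clab A R L"
  shows "complete_ext A R (ins L)" "labelling_of A R (ins L) = L"
proof -
  have out: "Def A R (ins L) = {a. L a = Out}"
  proof (intro set_eqI iffI)
    fix a assume "a \<in> Def A R (ins L)"
    then have "a \<in> A" "\<exists>b\<in>A. (b, a) \<in> R \<and> L b = In" using assms(1) by (auto simp: Def_def ins_def)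
    then show "a \<in> {a. L a = Out}" using clabD(3)[OF assms(2)] by blast
  next
    fix a assume a: "a \<in> {a. L a = Out}"
    then have "a \<in> A" using clabD(1)[OF assms(2), of a] by simp
    with a show "a \<in> Def A R (ins L)" using clabD(3)[OF assms(2), of a] by (auto simp: Def_def ins_def)
  qed
  have sub: "ins L \<subseteq> A" using clabD(1)[OF assms(2)] by (auto simp: ins_def)
  have "a \<in> Acc A R (ins L) \<longleftrightarrow> L a = In" for a
  proof (cases "a \<in> A")
    case True
    then have "a \<in> Acc A R (ins L) \<longleftrightarrow> (\<forall>b\<in>A. (b, a) \<in> R \<longrightarrow> L b = Out)"
      using assms(1) unfolding Acc_def out by blast
    with clabD(2)[OF assms(2) True] show ?thesis by blast
  next
    case False
    with clabD(1)[OF assms(2), of a] show ?thesis by (auto simp: Acc_def)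
  qed
  then have "Acc A R (ins L) = ins L" by (auto simp: ins_def)
  moreover have "ins L \<inter> Def A R (ins L) = {}" unfolding out by (auto simp: ins_def)
  ultimately show "complete_ext A R (ins L)"
    using sub by (auto simp: complete_ext_def admissible_def conflict_free_def)
  show "labelling_of A R (ins L) = L"
  proof
    fix a show "labelling_of A R (ins L) a = L a"
      unfolding labelling_of_def out by (cases "L a") (auto simp: ins_def)
  qed
qed

lemma complete_iff_clab:
  assumes "R \<subseteq> A \<times> A"
  shows "complete_ext A R E \<longleftrightarrow> (\<exists>L. clab A R L \<and> ins L = E)"
  using clab_of_complete[OF assms] complete_of_clab[OF assms] by metis

lemma clab_inj: "R \<subseteq> A \<times> A \<Longrightarrow> clab A R L \<Longrightarrow> clab A R L' \<Longrightarrow> ins L = ins L' \<Longrightarrow> L = L'"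
  by (metis complete_of_clab(2))

text \<open>An \<open>Out\<close> label is witnessed by an attacker labelled \<open>In\<close>, and
  the witness survives when the \<open>In\<close>-part grows.\<close>

lemma clab_mono:
  assumes "R \<subseteq> A \<times> A" "clab A R L" "clab A R L'" "ins L \<subseteq> ins L'"
  shows "decided L \<subseteq> decided L'"
proof
  fix a assume "a \<in> decided L"
  then have a: "L a = In \<or> L a = Out" "a \<in> A"
    using clabD(1)[OF assms(2), of a] by (cases "L a"; auto simp: decided_def)+
  then show "a \<in> decided L'"
  proof (elim disjE conjE)
    assume "L a = In"
    then have "L' a = In" using assms(4) by (auto simp: ins_def)
    then show ?thesis by (simp add: decided_def)
  next
    assume "L a = Out"
    then obtain b where "b \<in> A" "(b, a) \<in> R" "L b = In" using clabD(3)[OF assms(2) a(2)] by blast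
    moreover have "L' b = In" using \<open>L b = In\<close> assms(4) by (auto simp: ins_def)
    ultimately have "L' a = Out" using clabD(3)[OF assms(3) a(2)] by blast
    then show ?thesis by (simp add: decided_def)
  qed
qed

lemma labellings_Complete:
  assumes "R \<subseteq> A \<times> A"
  shows "L \<in> labellings Complete A R \<longleftrightarrow> clab A R L"
  using clab_of_complete[OF assms] complete_of_clab[OF assms] unfolding labellings_def
  by (simp add: image_iff) metis

lemma preferred_clab:
  assumes "R \<subseteq> A \<times> A" "clab A R L"
  shows "preferred_ext A R (ins L) \<longleftrightarrow> \<not> (\<exists>T. clab A R T \<and> ins L \<subset> ins T)"
  unfolding preferred_ext_def complete_iff_clab[OF assms(1)] using assms(2) by blast

lemma extension_complete: "extension \<sigma> A R E \<Longrightarrow> complete_ext A R E"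
  by (cases \<sigma>) (auto simp: stable_ext_def semistable_ext_def preferred_ext_def)

lemma labellings_via:
  assumes "R \<subseteq> A \<times> A"
  shows "L \<in> labellings \<sigma> A R \<longleftrightarrow> clab A R L \<and> extension \<sigma> A R (ins L)"
proof
  assume "L \<in> labellings \<sigma> A R"
  then obtain E where "L = labelling_of A R E" "extension \<sigma> A R E" by (auto simp: labellings_def)
  with extension_complete[of \<sigma> A R E] clab_of_complete[OF assms(1), of E] show "clab A R L \<and>
      extension \<sigma> A R (ins L)" by simp
next
  assume a: "clab A R L \<and> extension \<sigma> A R (ins L)"
  with complete_of_clab(2)[OF assms(1), of L] show "L \<in> labellings \<sigma> A R"
    unfolding labellings_def by (metis (mono_tags) imageI mem_Collect_eq)
qed

lemma labellings_Preferred: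
  assumes "R \<subseteq> A \<times> A"
  shows "L \<in> labellings Preferred A R \<longleftrightarrow> clab A R L \<and> \<not> (\<exists>T. clab A R T \<and> ins L \<subset> ins T)"
  using labellings_via[OF assms, where \<sigma> = Preferred] preferred_clab[OF assms]
  by (simp only: extension.simps) blast

lemma decided_clab:
  assumes "R \<subseteq> A \<times> A" "clab A R L"
  shows "ins L \<union> Def A R (ins L) = decided L"
  using clab_of_complete(3)[OF assms(1) complete_of_clab(1)[OF assms]] complete_of_clab(2)[OF assms] by simp

text \<open>Without undecided arguments maximality comes for free: an argument that is newly
  \<open>In\<close> was \<open>Out\<close> before, so one of its attackers was \<open>In\<close>,
  stays \<open>In\<close>, and forces it to be \<open>Out\<close>.\<close>

lemma labellings_Stable:
  assumes "R \<subseteq> A \<times> A"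
  shows "L \<in> labellings Stable A R \<longleftrightarrow> clab A R L \<and> (\<forall>a\<in>A. L a \<noteq> Und)"
proof -
  have "stable_ext A R (ins L) \<longleftrightarrow> (\<forall>a\<in>A. L a \<noteq> Und)" if L: "clab A R L"
  proof
    assume "stable_ext A R (ins L)"
    then show "\<forall>a\<in>A. L a \<noteq> Und" using decided_clab[OF assms L] by (auto simp: stable_ext_def decided_def)
  next
    assume d: "\<forall>a\<in>A. L a \<noteq> Und"
    have "\<not> ins L \<subset> ins T" if T: "clab A R T" for T
    proof
      assume s: "ins L \<subset> ins T"
      then obtain a where a: "T a = In" "L a \<noteq> In" by (auto simp: ins_def)
      then have "a \<in> A" using clabD(1)[OF T, of a] by simp
      with a d have "L a = Out" by (metis label.exhaust)
      then obtain b where "b \<in> A" "(b, a) \<in> R" "L b = In" using clabD(3)[OF L \<open>a \<in> A\<close>] by blast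
      moreover from this s have "T b = In" by (auto simp: ins_def)
      ultimately have "T a = Out" using clabD(3)[OF T \<open>a \<in> A\<close>] by blast
      with a show False by simp
    qed
    moreover have "decided L = A" using d clabD(1)[OF L] by (auto simp: decided_def)
    ultimately show "stable_ext A R (ins L)"
      using preferred_clab[OF assms L] decided_clab[OF assms L] by (auto simp: stable_ext_def)
  qed
  then show ?thesis using labellings_via[OF assms, where \<sigma> = Stable]
    by (simp only: extension.simps) blast
qed

lemma clab_finite: "finite A \<Longrightarrow> clab A R L \<Longrightarrow> finite (ins L) \<and> ins L \<subseteq> A"
  using clabD(1)[of A R L] by (metis (mono_tags, lifting) finite_subset ins_def label.distinct(3)
      mem_Collect_eq subsetI)

lemma preferred_above:
  assumes "finite A" "clab A R L"
  obtains T where "clab A R T" "ins L \<subseteq> ins T" "\<not> (\<exists>T'. clab A R T' \<and> ins T \<subset> ins T')"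
proof -
  have "finite {E \<in> Pow A. \<exists>T. clab A R T \<and> ins T = E}" using assms(1) by simp
  moreover have "ins L \<in> {E \<in> Pow A. \<exists>T. clab A R T \<and> ins T = E}" using assms clab_finite by blast
  ultimately obtain E where E: "E \<in> {E \<in> Pow A. \<exists>T. clab A R T \<and> ins T = E}" "ins L \<subseteq> E"
    "\<forall>E'\<in>{E \<in> Pow A. \<exists>T. clab A R T \<and> ins T = E}. E \<subseteq> E' \<longrightarrow> E' = E"
    using finite_has_maximal2 by (metis (no_types, lifting))
  then obtain T where T: "clab A R T" "ins T = E" by blast
  have "\<not> ins T \<subset> ins T'" if "clab A R T'" for T'
    using E(3) T clab_finite[OF assms(1) that] that by blast
  with T E(2) that show thesis by blast
qed

text \<open>Range maximality among preferred extensions can be tested against all complete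
  labellings: each of them lies below a preferred one, and passing to it only enlarges the decided
  part (\<open>clab_mono\<close>). Thus a single complete labelling is a certificate against
  semi-stability.\<close>

lemma labellings_SemiStable:
  assumes "R \<subseteq> A \<times> A" "finite A"
  shows "L \<in> labellings SemiStable A R \<longleftrightarrow>
    clab A R L \<and> \<not> (\<exists>T. clab A R T \<and> (ins L \<subset> ins T \<or> decided L \<subset> decided T))"
proof -
  have "semistable_ext A R (ins L) \<longleftrightarrow> \<not> (\<exists>T. clab A R T \<and> (ins L \<subset> ins T \<or> decided L \<subset> decided T))"
      if L: "clab A R L"
  proof
    assume s: "semistable_ext A R (ins L)"
    then have p: "\<not> (\<exists>T. clab A R T \<and> ins L \<subset> ins T)"
      using preferred_clab[OF assms(1) L] by (simp add: semistable_ext_def)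
    have "\<not> decided L \<subset> decided T" if T: "clab A R T" for T
    proof
      assume d: "decided L \<subset> decided T"
      obtain T' where T': "clab A R T'" "ins T \<subseteq> ins T'" "\<not> (\<exists>T''. clab A R T'' \<and> ins T' \<subset> ins T'')"
        by (rule preferred_above[OF assms(2) T])
      then have "preferred_ext A R (ins T')" using preferred_clab[OF assms(1)] by blast
      moreover have "decided L \<subset> decided T'" using clab_mono[OF assms(1) T T'(1,2)] d by blast
      ultimately show False
        using s decided_clab[OF assms(1) L] decided_clab[OF assms(1) T'(1)] unfolding
            semistable_ext_def by metis
    qed
    with p show "\<not> (\<exists>T. clab A R T \<and> (ins L \<subset> ins T \<or> decided L \<subset> decided T))" by blast
  next
    assume n: "\<not> (\<exists>T. clab A R T \<and> (ins L \<subset> ins T \<or> decided L \<subset> decided T))"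
    have False if E: "preferred_ext A R E" "ins L \<union> Def A R (ins L) \<subset> E \<union> Def A R E" for E
    proof -
      have c: "complete_ext A R E" using E(1) by (simp add: preferred_ext_def)
      from n clab_of_complete[OF assms(1) c] E(2) decided_clab[OF assms(1) L] show False by metis
    qed
    then show "semistable_ext A R (ins L)"
      unfolding semistable_ext_def using n preferred_clab[OF assms(1) L] by blast
  qed
  then show ?thesis using labellings_via[OF assms(1), where \<sigma> = SemiStable]
    by (simp only: extension.simps) blast
qed

lemma labellings_clab: 
  assumes "R \<subseteq> A \<times> A" "L \<in> labellings \<sigma> A R"
  shows "clab A R L"
  using labellings_via[OF assms(1)] assms(2) by simp

lemma semifactual_self:
  assumes "R \<subseteq> A \<times> A" "finite A" "L \<in> labellings \<sigma> A R"
  shows "L \<in> semifactuals \<sigma> A R g L \<longleftrightarrow> \<not> (\<exists>L'\<in>labellings \<sigma> A R. L' g = L g \<and> L' \<noteq> L)"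
proof -
  have "distance A L L' > distance A L L \<longleftrightarrow> L' \<noteq> L" if "L' \<in> labellings \<sigma> A R" for L'
  proof -
    have "L a = L' a" if "a \<notin> A" for a
      using clabD(1)[OF labellings_clab[OF assms(1,3)], of a]
        clabD(1)[OF labellings_clab[OF assms(1) \<open>L' \<in> _\<close>], of a] that by metis
    then have "{a \<in> A. L a \<noteq> L' a} = {} \<longleftrightarrow> L' = L" by (simp add: fun_eq_iff) metis
    with assms(2) show ?thesis by (auto simp: distance_def card_gt_0_iff)
  qed
  with assms(3) show ?thesis unfolding semifactuals_def mem_Collect_eq by metis
qed

section \<open>The framework of a constraint system\<close>

text \<open>Argument \<open>9 x + k\<close> is the \<open>x\<close>-th argument of kind \<open>k\<close>: literals (0), where number
  \<open>x\<close> says that variable \<open>x div D\<close> has value \<open>x mod D\<close>, clauses (1), the formula (2), the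
  blocker (3), a switch and its opposite (4, 5) and self-attacking copies of literals and
  switches (6, 7, 8), by which the range of a labelling determines its \<open>In\<close>-part. The arguments of
  each of the kinds 2 to 5 are attacked by the same arguments and hence labelled alike.\<close>

definition att :: "nat \<Rightarrow> (nat \<Rightarrow> bool) \<Rightarrow> (nat \<Rightarrow> nat \<Rightarrow> bool) \<Rightarrow> (nat \<Rightarrow> bool) \<Rightarrow> bool \<Rightarrow> bool \<Rightarrow>
    nat \<Rightarrow> nat \<Rightarrow> nat \<Rightarrow> nat \<Rightarrow> bool" where
  "att D isY opp bad sw self k x l y \<longleftrightarrow>
     k = 0 \<and> l = 0 \<and> x div D = y div D \<and> x \<noteq> y \<or> k = 0 \<and> l = 1 \<and> opp y x \<or>
     k = 1 \<and> l = 1 \<and> x = y \<or> k = 1 \<and> l = 2 \<and> bad x \<or> k = 2 \<and> l = 1 \<and> \<not> bad y \<or>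
     k = 2 \<and> l = 3 \<or> k = 3 \<and> l = 3 \<and> self \<or> k = 3 \<and> (l = 1 \<or> l = 2 \<or> l = 0 \<and> \<not> isY (y div D)) \<or>
     sw \<and> (k = 4 \<and> (l = 0 \<or> l = 2 \<or> l = 5 \<or> l = 7) \<or> k = 5 \<and> (l = 4 \<or> l = 8) \<or>
       k = 0 \<and> l = 6 \<and> x = y \<or> k = l \<and> l \<ge> 6 \<and> x = y)"

definition gadget_rel :: "nat \<Rightarrow> nat \<Rightarrow> (nat \<Rightarrow> bool) \<Rightarrow> (nat \<Rightarrow> nat \<Rightarrow> bool) \<Rightarrow> (nat \<Rightarrow> bool) \<Rightarrow> bool \<Rightarrow> bool \<Rightarrow>
    (nat \<times> nat) set" where
  "gadget_rel Q D isY opp bad sw self = {(a, b). a < 9 * Q \<and> b < 9 * Q \<and>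
     att D isY opp bad sw self (a mod 9) (a div 9) (b mod 9) (b div 9)}"

definition lab_of :: "nat \<Rightarrow> (nat \<Rightarrow> nat \<Rightarrow> label) \<Rightarrow> nat \<Rightarrow> label" where
  "lab_of Q l a = (if a < 9 * Q then l (a mod 9) (a div 9) else Und)"

lemma all9: "(\<forall>k<9::nat. P k) \<longleftrightarrow> P 0 \<and> P 1 \<and> P 2 \<and> P 3 \<and> P 4 \<and> P 5 \<and> P 6 \<and> P 7 \<and> P 8"
  by (simp add: numeral_eq_Suc All_less_Suc) blast

lemma ex9: "(\<exists>k<9::nat. P k) \<longleftrightarrow> P 0 \<or> P 1 \<or> P 2 \<or> P 3 \<or> P 4 \<or> P 5 \<or> P 6 \<or> P 7 \<or> P 8"
  using all9[of "\<lambda>k. \<not> P k"] by blast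

lemma ball_args: "(\<forall>a\<in>{..<9 * Q}. P (a mod 9) (a div 9)) \<longleftrightarrow> (\<forall>x<Q. \<forall>k<9::nat. P k x)"
proof (intro iffI allI impI ballI)
  fix x k :: nat assume a: "\<forall>a\<in>{..<9 * Q}. P (a mod 9) (a div 9)" "x < Q" "k < 9"
  then have "9 * x + k < 9 * Q" by linarith
  with a(1) have "P ((9 * x + k) mod 9) ((9 * x + k) div 9)" by blast
  with a(3) show "P k x" by simp
qed (auto simp: less_mult_imp_div_less mult.commute)

lemma bex_args: "(\<exists>a\<in>{..<9 * Q}. P (a mod 9) (a div 9)) \<longleftrightarrow> (\<exists>x<Q. \<exists>k<9::nat. P k x)"
  using ball_args[of Q "\<lambda>k x. \<not> P k x"] by blast

section \<open>Labellings of the framework and solutions\<close>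

locale gadget =
  fixes Q D :: nat and isY :: "nat \<Rightarrow> bool" and opp :: "nat \<Rightarrow> nat \<Rightarrow> bool" and bad :: "nat \<Rightarrow> bool"
    and sw self :: bool
  assumes D: "D dvd Q" and Q: "0 < Q"
begin

abbreviation "A \<equiv> {..<9 * Q}"
abbreviation "R \<equiv> gadget_rel Q D isY opp bad sw self"

lemma R_sub: "R \<subseteq> A \<times> A"
  by (auto simp: gadget_rel_def)

text \<open>Attackers are grouped by kind, so that later arguments become first-order reasoning
  about nine label functions.\<close>

definition klab :: "(nat \<Rightarrow> nat \<Rightarrow> label) \<Rightarrow> bool" where
  "klab l \<longleftrightarrow> (\<forall>x<Q.
    (l 0 x = In \<longleftrightarrow> (\<forall>y<Q. y div D = x div D \<and> y \<noteq> x \<longrightarrow> l 0 y = Out) \<and>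
      (\<not> isY (x div D) \<longrightarrow> (\<forall>y<Q. l 3 y = Out)) \<and> (sw \<longrightarrow> (\<forall>y<Q. l 4 y = Out))) \<and>
    (l 0 x = Out \<longleftrightarrow> (\<exists>y<Q. y div D = x div D \<and> y \<noteq> x \<and> l 0 y = In) \<or>
      \<not> isY (x div D) \<and> (\<exists>y<Q. l 3 y = In) \<or> sw \<and> (\<exists>y<Q. l 4 y = In)) \<and>
    (l 1 x = In \<longleftrightarrow> (\<forall>y<Q. opp x y \<longrightarrow> l 0 y = Out) \<and> l 1 x = Out \<and> (\<not> bad x \<longrightarrow> (\<forall>y<Q. l 2 y = Out)) \<and>
      (\<forall>y<Q. l 3 y = Out)) \<and>
    (l 1 x = Out \<longleftrightarrow> (\<exists>y<Q. opp x y \<and> l 0 y = In) \<or> l 1 x = In \<or> \<not> bad x \<and> (\<exists>y<Q. l 2 y = In) \<or>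
      (\<exists>y<Q. l 3 y = In)) \<and>
    (l 2 x = In \<longleftrightarrow> (\<forall>y<Q. bad y \<longrightarrow> l 1 y = Out) \<and> (\<forall>y<Q. l 3 y = Out) \<and> (sw \<longrightarrow> (\<forall>y<Q. l 4 y = Out))) \<and>
    (l 2 x = Out \<longleftrightarrow> (\<exists>y<Q. bad y \<and> l 1 y = In) \<or> (\<exists>y<Q. l 3 y = In) \<or> sw \<and> (\<exists>y<Q. l 4 y = In)) \<and>
    (l 3 x = In \<longleftrightarrow> (\<forall>y<Q. l 2 y = Out) \<and> (self \<longrightarrow> (\<forall>y<Q. l 3 y = Out))) \<and>
    (l 3 x = Out \<longleftrightarrow> (\<exists>y<Q. l 2 y = In) \<or> self \<and> (\<exists>y<Q. l 3 y = In)) \<and>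
    (l 4 x = In \<longleftrightarrow> (sw \<longrightarrow> (\<forall>y<Q. l 5 y = Out))) \<and> (l 4 x = Out \<longleftrightarrow> sw \<and> (\<exists>y<Q. l 5 y = In)) \<and>
    (l 5 x = In \<longleftrightarrow> (sw \<longrightarrow> (\<forall>y<Q. l 4 y = Out))) \<and> (l 5 x = Out \<longleftrightarrow> sw \<and> (\<exists>y<Q. l 4 y = In)) \<and>
    (l 6 x = In \<longleftrightarrow> (sw \<longrightarrow> l 0 x = Out \<and> l 6 x = Out)) \<and> (l 6 x = Out \<longleftrightarrow> sw \<and> (l 0 x = In \<or> l 6 x = In)) \<and>
    (l 7 x = In \<longleftrightarrow> (sw \<longrightarrow> (\<forall>y<Q. l 4 y = Out) \<and> l 7 x = Out)) \<and>
    (l 7 x = Out \<longleftrightarrow> sw \<and> ((\<exists>y<Q. l 4 y = In) \<or> l 7 x = In)) \<and>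
    (l 8 x = In \<longleftrightarrow> (sw \<longrightarrow> (\<forall>y<Q. l 5 y = Out) \<and> l 8 x = Out)) \<and>
    (l 8 x = Out \<longleftrightarrow> sw \<and> ((\<exists>y<Q. l 5 y = In) \<or> l 8 x = In)))"

lemma clab_klab: "clab A R (lab_of Q l) \<longleftrightarrow> klab l"
proof -
  let ?att = "att D isY opp bad sw self"
  have 1: "(\<forall>b\<in>A. (b, a) \<in> R \<longrightarrow> lab_of Q l b = Out) \<longleftrightarrow>
      (\<forall>x<Q. \<forall>k<9. ?att k x (a mod 9) (a div 9) \<longrightarrow> l k x = Out)" if "a \<in> A" for a
    unfolding ball_args[symmetric] using that by (auto simp: gadget_rel_def lab_of_def)
  have 2: "(\<exists>b\<in>A. (b, a) \<in> R \<and> lab_of Q l b = In) \<longleftrightarrow>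
      (\<exists>x<Q. \<exists>k<9. ?att k x (a mod 9) (a div 9) \<and> l k x = In)" if "a \<in> A" for a
    unfolding bex_args[symmetric] using that by (auto simp: gadget_rel_def lab_of_def)
  have 3: "lab_of Q l a = l (a mod 9) (a div 9)" if "a \<in> A" for a
    using that by (simp add: lab_of_def)
  have "clab A R (lab_of Q l) \<longleftrightarrow> (\<forall>a\<in>A.
     (l (a mod 9) (a div 9) = In \<longleftrightarrow> (\<forall>x<Q. \<forall>k<9. ?att k x (a mod 9) (a div 9) \<longrightarrow> l k x = Out)) \<and>
     (l (a mod 9) (a div 9) = Out \<longleftrightarrow> (\<exists>x<Q. \<exists>k<9. ?att k x (a mod 9) (a div 9) \<and> l k x = In)))"
  proof -
    have "labelling A (lab_of Q l)" by (auto simp: labelling_def lab_of_def)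
    then show ?thesis unfolding clab_def
      by (simp only: simp_thms) (rule ball_cong[OF refl], simp only: 1 2, simp only: 3)
  qed
  also have "\<dots> \<longleftrightarrow> (\<forall>x<Q. \<forall>k<9.
     (l k x = In \<longleftrightarrow> (\<forall>y<Q. \<forall>m<9. ?att m y k x \<longrightarrow> l m y = Out)) \<and>
     (l k x = Out \<longleftrightarrow> (\<exists>y<Q. \<exists>m<9. ?att m y k x \<and> l m y = In)))"
    by (rule ball_args)
  also have "\<dots> \<longleftrightarrow> (\<forall>x<Q. \<forall>k<9.
     (l k x = In \<longleftrightarrow> (\<forall>m<9. \<forall>y<Q. ?att m y k x \<longrightarrow> l m y = Out)) \<and>
     (l k x = Out \<longleftrightarrow> (\<exists>m<9. \<exists>y<Q. ?att m y k x \<and> l m y = In)))"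
    by (intro all_cong arg_cong2[of _ _ _ _ "(\<and>)"] arg_cong2[of _ _ _ _ "(\<longleftrightarrow>)"] refl) blast+
  also have "\<dots> \<longleftrightarrow> klab l"
    unfolding klab_def all9 ex9
  proof (intro all_cong, goal_cases)
    case (1 x)
    then have x: "x < Q" .
    have r: "(\<forall>y<Q. x = y \<longrightarrow> P y) \<longleftrightarrow> P x" "(\<forall>y<Q. y = x \<longrightarrow> P y) \<longleftrightarrow> P x"
      "(\<exists>y<Q. x = y \<and> P y) \<longleftrightarrow> P x" "(\<exists>y<Q. y = x \<and> P y) \<longleftrightarrow> P x" for P using x by auto
    have u: "(\<forall>y<Q. p \<longrightarrow> P y) \<longleftrightarrow> (p \<longrightarrow> (\<forall>y<Q. P y))" "(\<exists>y<Q. p \<and> P y) \<longleftrightarrow> p \<and> (\<exists>y<Q. P y)"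
      "(\<forall>y<Q. p \<and> y = x \<longrightarrow> P y) \<longleftrightarrow> (p \<longrightarrow> P x)" "(\<exists>y<Q. (p \<and> y = x) \<and> P y) \<longleftrightarrow> p \<and> P x"
      for p P using x by auto
    show ?case
      unfolding conj_assoc
      by (intro arg_cong2[of _ _ _ _ "(\<and>)"]; rule arg_cong2[of _ _ _ _ "(\<longleftrightarrow>)"], rule refl;
          (auto simp: att_def r u; fail)?; simp add: att_def r u; blast)
  qed
  finally show ?thesis .
qed

lemma klabD:
  assumes "klab l" "x < Q"
  shows
    "l 0 x = In \<longleftrightarrow> (\<forall>y<Q. y div D = x div D \<and> y \<noteq> x \<longrightarrow> l 0 y = Out) \<and>
      (\<not> isY (x div D) \<longrightarrow> (\<forall>y<Q. l 3 y = Out)) \<and> (sw \<longrightarrow> (\<forall>y<Q. l 4 y = Out))"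
    "l 0 x = Out \<longleftrightarrow> (\<exists>y<Q. y div D = x div D \<and> y \<noteq> x \<and> l 0 y = In) \<or>
      \<not> isY (x div D) \<and> (\<exists>y<Q. l 3 y = In) \<or> sw \<and> (\<exists>y<Q. l 4 y = In)"
    "l 1 x = In \<longleftrightarrow> (\<forall>y<Q. opp x y \<longrightarrow> l 0 y = Out) \<and> l 1 x = Out \<and> (\<not> bad x \<longrightarrow> (\<forall>y<Q. l 2 y = Out)) \<and>
      (\<forall>y<Q. l 3 y = Out)"
    "l 1 x = Out \<longleftrightarrow> (\<exists>y<Q. opp x y \<and> l 0 y = In) \<or> l 1 x = In \<or> \<not> bad x \<and> (\<exists>y<Q. l 2 y = In) \<or>
      (\<exists>y<Q. l 3 y = In)"
    "l 2 x = In \<longleftrightarrow> (\<forall>y<Q. bad y \<longrightarrow> l 1 y = Out) \<and> (\<forall>y<Q. l 3 y = Out) \<and> (sw \<longrightarrow> (\<forall>y<Q. l 4 y = Out))"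
    "l 2 x = Out \<longleftrightarrow> (\<exists>y<Q. bad y \<and> l 1 y = In) \<or> (\<exists>y<Q. l 3 y = In) \<or> sw \<and> (\<exists>y<Q. l 4 y = In)"
    "l 3 x = In \<longleftrightarrow> (\<forall>y<Q. l 2 y = Out) \<and> (self \<longrightarrow> (\<forall>y<Q. l 3 y = Out))"
    "l 3 x = Out \<longleftrightarrow> (\<exists>y<Q. l 2 y = In) \<or> self \<and> (\<exists>y<Q. l 3 y = In)"
    "l 4 x = In \<longleftrightarrow> (sw \<longrightarrow> (\<forall>y<Q. l 5 y = Out))" "l 4 x = Out \<longleftrightarrow> sw \<and> (\<exists>y<Q. l 5 y = In)"
    "l 5 x = In \<longleftrightarrow> (sw \<longrightarrow> (\<forall>y<Q. l 4 y = Out))" "l 5 x = Out \<longleftrightarrow> sw \<and> (\<exists>y<Q. l 4 y = In)"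
    "l 6 x = In \<longleftrightarrow> (sw \<longrightarrow> l 0 x = Out \<and> l 6 x = Out)" "l 6 x = Out \<longleftrightarrow> sw \<and> (l 0 x = In \<or> l 6 x = In)"
    "l 7 x = In \<longleftrightarrow> (sw \<longrightarrow> (\<forall>y<Q. l 4 y = Out) \<and> l 7 x = Out)"
    "l 7 x = Out \<longleftrightarrow> sw \<and> ((\<exists>y<Q. l 4 y = In) \<or> l 7 x = In)"
    "l 8 x = In \<longleftrightarrow> (sw \<longrightarrow> (\<forall>y<Q. l 5 y = Out) \<and> l 8 x = Out)"
    "l 8 x = Out \<longleftrightarrow> sw \<and> ((\<exists>y<Q. l 5 y = In) \<or> l 8 x = In)"
  by (insert assms(1)[unfolded klab_def, THEN spec, THEN mp, OF assms(2)]) (elim conjE, assumption)+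

definition SAT :: "(nat \<Rightarrow> nat) \<Rightarrow> bool" where
  "SAT u \<longleftrightarrow> (\<forall>j<Q. bad j \<longrightarrow> (\<exists>x<Q. x mod D = u (x div D) \<and> opp j x))"

lemma lab_eq: "klab l \<Longrightarrow> lab_of Q l = lab_of Q l' \<longleftrightarrow> (\<forall>x<Q. \<forall>k<9. l k x = l' k x)"
  unfolding ball_args[symmetric] by (auto simp: lab_of_def fun_eq_iff)

lemma clab_obtain:
  assumes "clab A R L"
  obtains l where "L = lab_of Q l" "klab l"
proof -
  define l where "l k x = L (9 * x + k)" for k x
  have "L = lab_of Q l"
    using clabD(1)[OF assms] by (fastforce simp: lab_of_def l_def fun_eq_iff mult.commute)
  with that clab_klab assms show thesis by blast
qed

lemma true_lit:
  assumes "x < Q" "u (x div D) < D"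
  shows "\<exists>y<Q. y div D = x div D \<and> y mod D = u (x div D)"
proof -
  obtain q where q: "Q = D * q" using D by blast
  let ?y = "D * (x div D) + u (x div D)"
  have "x div D < q" using assms(1) q by (simp add: less_mult_imp_div_less mult.commute)
  then have "D * (x div D) + D \<le> D * q" using mult_le_mono2[of "Suc (x div D)" q D] by simp
  then have "?y < Q" using assms(2) q by simp
  with assms(2) show ?thesis by (intro exI[of _ ?y]) simp
qed

text \<open>Literals of the same variable attack each other, so at most one of them is
  \<open>In\<close>; \<open>u\<close> is the default for variables without such a literal. The
  default matters in \<open>switch_gadget\<close>, where it is the given assignment.\<close>

lemma assignment_of:
  assumes "klab l" "\<And>v. u v < D"
  obtains u' where "\<And>v. u' v < D" "\<And>x. x < Q \<Longrightarrow> l 0 x = In \<Longrightarrow> u' (x div D) = x mod D"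
    "\<And>v. (\<forall>x<Q. x div D = v \<longrightarrow> l 0 x \<noteq> In) \<Longrightarrow> u' v = u v"
proof -
  have D0: "0 < D" using assms(2)[of 0] by simp
  have uniq: "x = y" if "x < Q" "y < Q" "x div D = y div D" "l 0 x = In" "l 0 y = In" for x y
  proof (rule ccontr)
    assume "x \<noteq> y"
    then have "l 0 y = Out" using klabD(1)[OF assms(1) that(1)] that by metis
    with that show False by simp
  qed
  define u' where "u' v = (if \<exists>x<Q. x div D = v \<and> l 0 x = In then (SOME x. x < Q \<and> x div D = v \<and> l 0
      x = In) mod D else u v)" for v
  show thesis
  proof (rule that[of u'])
    show "u' v < D" for v using assms(2) D0 by (simp add: u'_def)
    show "u' (x div D) = x mod D" if x: "x < Q" "l 0 x = In" for x
    proof -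
      let ?P = "\<lambda>y. y < Q \<and> y div D = x div D \<and> l 0 y = In"
      have "?P (SOME y. ?P y)" by (rule someI[of ?P x]) (use x in simp)
      then have "(SOME y. ?P y) = x" using uniq x by blast
      moreover have "\<exists>y<Q. y div D = x div D \<and> l 0 y = In" using x by blast
      ultimately show ?thesis unfolding u'_def by simp
    qed
    show "u' v = u v" if "\<forall>x<Q. x div D = v \<longrightarrow> l 0 x \<noteq> In" for v using that unfolding u'_def by auto
  qed
qed

text \<open>If the formula is \<open>In\<close>, the clauses attacking it are \<open>Out\<close> and
  need an attacker labelled \<open>In\<close>: not themselves, not the blocker, which is
  \<open>Out\<close>, and not the formula, which attacks only clauses that forbid nothing. What
  remains is a true literal.\<close>

lemma SAT_of_labelling:
  assumes "klab l" "x < Q" "l 2 x = In" "\<And>y. y < Q \<Longrightarrow> l 0 y = In \<Longrightarrow> u (y div D) = y mod D"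
  shows "SAT u"
  unfolding SAT_def
proof (intro allI impI)
  fix j assume j: "j < Q" "bad j"
  from klabD(5)[OF assms(1,2)] assms(3) j have "l 1 j = Out" and b: "\<forall>y<Q. l 3 y = Out" by blast+
  then have "\<exists>y<Q. opp j y \<and> l 0 y = In"
    using klabD(4)[OF assms(1) j(1)] j(2) by (metis label.distinct(1))
  with assms(4) show "\<exists>x<Q. x mod D = u (x div D) \<and> opp j x" by metis
qed

text \<open>Without a switch a solution decides every argument, as stable semantics demands. With a
  switch, the self-attacking copies that lack an attacker labelled \<open>In\<close> stay
  undecided.\<close>

definition sat_lab :: "(nat \<Rightarrow> nat) \<Rightarrow> nat \<Rightarrow> nat \<Rightarrow> label" where
  "sat_lab u k x = (if k = 0 then if x mod D = u (x div D) then In else Out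
     else if k = 1 \<or> k = 3 then Out else if k = 2 \<or> k = 5 \<or> \<not> sw then In
     else if k = 4 \<or> k = 8 \<or> k = 6 \<and> x mod D = u (x div D) then Out else Und)"

lemma klab_sat:
  assumes "SAT u" "\<And>v. u v < D"
  shows "klab (sat_lab u)"
proof -
  have inj: "y = x" if "y div D = x div D" "y mod D = x mod D" for x y by (metis div_mult_mod_eq that)
  show ?thesis
    unfolding klab_def
  proof (intro allI impI, goal_cases)
    case (1 x)
    then have x: "x < Q" .
    have 1: "(\<exists>y<Q. y div D = x div D \<and> y \<noteq> x \<and> y mod D = u (y div D)) \<longleftrightarrow> x mod D \<noteq> u (x div D)"
      using true_lit[OF x, of u] assms(2) inj by metis
    have 2: "(\<forall>y<Q. y div D = x div D \<and> y \<noteq> x \<longrightarrow> y mod D \<noteq> u (y div D)) \<longleftrightarrow> x mod D = u (x div D)"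
      using 1 by blast
    have 3: "\<exists>y<Q. opp x y \<and> y mod D = u (y div D)" if "bad x" using assms(1) that x by (auto simp: SAT_def)
    have 4: "\<not> bad x \<longrightarrow> (\<exists>y. y < Q)" using Q by blast
    have 5: "(\<forall>y<Q. p) \<longleftrightarrow> p" "(\<exists>y<Q. p) \<longleftrightarrow> p" for p using Q by auto
    have sl: "sat_lab u 0 z = In \<longleftrightarrow> z mod D = u (z div D)" "sat_lab u 0 z = Out \<longleftrightarrow> z mod D \<noteq> u (z div D)"
      "sat_lab u 1 z = Out" "sat_lab u 2 z = In" "sat_lab u 3 z = Out" "sat_lab u 5 z = In"
      "sat_lab u 4 z = In \<longleftrightarrow> \<not> sw" "sat_lab u 4 z = Out \<longleftrightarrow> sw" "sat_lab u 8 z = In \<longleftrightarrow> \<not> sw" "sat_lab u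
          8 z = Out \<longleftrightarrow> sw"
      "sat_lab u 7 z = In \<longleftrightarrow> \<not> sw" "sat_lab u 7 z \<noteq> Out" "sat_lab u 6 z = In \<longleftrightarrow> \<not> sw"
      "sat_lab u 6 z = Out \<longleftrightarrow> sw \<and> z mod D = u (z div D)" for z
      by (auto simp: sat_lab_def)
    show ?case
      by (intro conjI; (simp only: sl simp_thms 1 2 5 label.distinct)?; (simp add: 1 2 5)?; (use 3 x
          in blast)?)
  qed
qed

text \<open>The labelling that encodes no assignment. With a switch, kind 4 defeats all literals and
  the formula; without one, the blocker does so if it may be \<open>In\<close>, and a self-attacking
  blocker leaves literals, clauses and the formula undecided.\<close>

definition base_lab :: "nat \<Rightarrow> nat \<Rightarrow> label" where
  "base_lab k x = (if sw then if k = 4 then In else if k = 0 \<or> k = 2 \<or> k = 5 \<or> k = 7 then Out else Und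
     else if k \<ge> 4 then In else if self then Und else if k = 3 then In else Out)"

lemma klab_base:
  assumes "sw \<Longrightarrow> self" "\<And>v. \<not> sw \<Longrightarrow> \<not> isY v"
  shows "klab base_lab"
proof -
  have 5: "(\<forall>y<Q. p) \<longleftrightarrow> p" "(\<exists>y<Q. p) \<longleftrightarrow> p" for p using Q by auto
  have 6: "\<exists>y. y < Q" using Q by blast
  show ?thesis
  proof (cases sw)
    case True
    have "base_lab 0 z = Out" "base_lab 1 z = Und" "base_lab 2 z = Out" "base_lab 3 z = Und"
        "base_lab 4 z = In"
      "base_lab 5 z = Out" "base_lab 6 z = Und" "base_lab 7 z = Out" "base_lab 8 z = Und" for z
      unfolding base_lab_def using True by simp_all
    with True assms(1) show ?thesis unfolding klab_def
      by (intro allI impI conjI; simp add: 5 6)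
  next
    case False
    show ?thesis
    proof (cases self)
      case True
      have "base_lab 0 z = Und" "base_lab 1 z = Und" "base_lab 2 z = Und" "base_lab 3 z = Und"
          "base_lab 4 z = In"
        "base_lab 5 z = In" "base_lab 6 z = In" "base_lab 7 z = In" "base_lab 8 z = In" for z
        unfolding base_lab_def using True False by simp_all
      with True False assms(2) show ?thesis unfolding klab_def
        by (intro allI impI conjI; simp add: 5 6)
    next
      case s: False
      have "base_lab 0 z = Out" "base_lab 1 z = Out" "base_lab 2 z = Out" "base_lab 3 z = In"
          "base_lab 4 z = In"
        "base_lab 5 z = In" "base_lab 6 z = In" "base_lab 7 z = In" "base_lab 8 z = In" for z
        unfolding base_lab_def using s False by simp_all
      with s False assms(2) show ?thesis unfolding klab_def
        by (intro allI impI conjI; simp add: 5 6)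
    qed
  qed
qed

lemma D_pos: "0 < D"
  using D Q by (metis dvd_0_left_iff neq0_conv)

text \<open>As long as no formula argument is \<open>In\<close>, the blocker has only one possible
  label: \<open>Und\<close> if it attacks itself, \<open>In\<close> if all arguments must be
  decided. As it attacks all arguments of kinds 0 to 2, their labels follow.\<close>

lemma klab_outside_base:
  assumes "klab l" "\<not> sw" "\<And>v. \<not> isY v" "\<And>x. x < Q \<Longrightarrow> l 2 x \<noteq> In"
    and "self \<or> (\<forall>x<Q. \<forall>k<9. l k x \<noteq> Und)"
  shows "\<forall>x<Q. \<forall>k<9. l k x = base_lab k x"
proof (intro allI impI)
  have lab: "t = In \<or> t = Out \<or> t = Und" for t by (cases t) auto
  note D = klabD[OF assms(1)]
  fix x k :: nat assume x: "x < Q" and k: "k < 9"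
  have "\<forall>x<Q. l 4 x = In \<and> l 5 x = In \<and> l 6 x = In \<and> l 7 x = In \<and> l 8 x = In"
    using D(9,11,13,15,17) assms(2) by blast
  moreover have "\<forall>x<Q. l 0 x = base_lab 0 x \<and> l 1 x = base_lab 1 x \<and> l 2 x = base_lab 2 x \<and> l 3 x =
      base_lab 3 x"
  proof (cases self)
    case True
    have 3: "l 3 y = Und" if y: "y < Q" for y
      using D(7,8)[OF y] D(7) assms(4) True y lab[of "l 3 y"] by (metis label.distinct(1))
    have n: "l 0 y \<noteq> In" "l 1 y \<noteq> In" "l 2 y \<noteq> In" if y: "y < Q" for y
      using D(1,3,5)[OF y] 3[OF y] y assms(3) by (metis label.distinct(5))+
    have o: "l 0 y \<noteq> Out" "l 1 y \<noteq> Out" "l 2 y \<noteq> Out" if y: "y < Q" for y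
      using D(2,4,6)[OF y] 3 n assms(2) y by (metis label.distinct(3))+
    have "base_lab 0 z = Und" "base_lab 1 z = Und" "base_lab 2 z = Und" "base_lab 3 z = Und" for z
      unfolding base_lab_def using True assms(2) by simp_all
    with 3 n o lab show ?thesis by metis
  next
    case False
    with assms(5) k have u: "l k x \<noteq> Und" if "x < Q" "k < 9" for x k using that by blast
    have 3: "l 3 y = In" if y: "y < Q" for y
      using D(8)[OF y] False assms(4) u[OF y, of 3] lab[of "l 3 y"] by auto
    have "l 0 y = Out" "l 1 y = Out" "l 2 y = Out" if y: "y < Q" for y
      using D(2,4,6)[OF y] 3[OF y] y assms(3) by blast+
    moreover have "base_lab 0 z = Out" "base_lab 1 z = Out" "base_lab 2 z = Out" "base_lab 3 z = In" for z
      unfolding base_lab_def using False assms(2) by simp_all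
    ultimately show ?thesis using 3 by metis
  qed
  moreover have "k = 0 \<or> k = 1 \<or> k = 2 \<or> k = 3 \<or> k = 4 \<or> k = 5 \<or> k = 6 \<or> k = 7 \<or> k = 8" using k by linarith
  moreover have "base_lab k z = In" if "k \<ge> 4" for z
    unfolding base_lab_def using assms(2) that by simp
  ultimately show "l k x = base_lab k x" using x by auto
qed

text \<open>The goal 4 is an argument of kind 4, unattacked without a switch and hence
  \<open>In\<close> throughout, so that the condition on its label excludes no labelling.\<close>

lemma simple_gadget:
  assumes "\<not> sw" "\<And>v. \<not> isY v" "\<sigma> = (if self then Complete else Stable)"
  shows "lab_of Q base_lab \<in> labellings \<sigma> A R"
    and "lab_of Q base_lab \<in> semifactuals \<sigma> A R 4 (lab_of Q base_lab) \<longleftrightarrow> \<not> (\<exists>u. (\<forall>v. u v < D) \<and> SAT u)"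
proof -
  let ?L = "lab_of Q base_lab"
  have lab: "L \<in> labellings \<sigma> A R \<longleftrightarrow> clab A R L \<and> (self \<or> (\<forall>a\<in>A. L a \<noteq> Und))" for L
    using labellings_Complete[OF R_sub] labellings_Stable[OF R_sub] unfolding assms(3)
    by (cases self) (simp_all only: if_True if_False simp_thms)
  have lab': "lab_of Q l \<in> labellings \<sigma> A R \<longleftrightarrow> klab l \<and> (self \<or> (\<forall>x<Q. \<forall>k<9. l k x \<noteq> Und))" for l
    unfolding lab clab_klab ball_args[symmetric] by (simp add: lab_of_def)
  have kb: "klab base_lab" using klab_base assms by blast
  show L: "?L \<in> labellings \<sigma> A R"
    unfolding lab' using kb assms(1) unfolding base_lab_def by auto
  have "(\<exists>L'\<in>labellings \<sigma> A R. L' 4 = ?L 4 \<and> L' \<noteq> ?L) \<longleftrightarrow> (\<exists>u. (\<forall>v. u v < D) \<and> SAT u)"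
  proof
    assume "\<exists>L'\<in>labellings \<sigma> A R. L' 4 = ?L 4 \<and> L' \<noteq> ?L"
    then obtain L' where L': "L' \<in> labellings \<sigma> A R" "L' \<noteq> ?L" by blast
    then obtain l where l: "L' = lab_of Q l" "klab l" using lab clab_obtain by blast
    with L' lab_eq kb have ne: "\<not> (\<forall>x<Q. \<forall>k<9. l k x = base_lab k x)" by blast
    have "self \<or> (\<forall>x<Q. \<forall>k<9. l k x \<noteq> Und)" using L'(1) l lab' by blast
    with klab_outside_base[OF l(2) assms(1,2)] ne obtain x where x: "x < Q" "l 2 x = In" by blast
    obtain u where u: "\<And>v. u v < D" "\<And>x. x < Q \<Longrightarrow> l 0 x = In \<Longrightarrow> u (x div D) = x mod D"
      using assignment_of[OF l(2), of "\<lambda>_. 0"] D_pos by metis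
    with SAT_of_labelling[OF l(2) x] show "\<exists>u. (\<forall>v. u v < D) \<and> SAT u" by blast
  next
    assume "\<exists>u. (\<forall>v. u v < D) \<and> SAT u"
    then obtain u where u: "\<And>v. u v < D" "SAT u" by blast
    have "lab_of Q (sat_lab u) \<in> labellings \<sigma> A R"
      unfolding lab' using klab_sat[OF u(2,1)] assms(1) unfolding sat_lab_def by auto
    moreover have "lab_of Q (sat_lab u) 4 = ?L 4" unfolding lab_of_def sat_lab_def base_lab_def
        using assms(1) by simp
    moreover have "sat_lab u 3 0 \<noteq> base_lab 3 0" unfolding sat_lab_def base_lab_def using assms(1) by simp
    then have "lab_of Q (sat_lab u) \<noteq> ?L" using lab_eq[OF klab_sat[OF u(2,1)], of base_lab] Q by auto
    ultimately show "\<exists>L'\<in>labellings \<sigma> A R. L' 4 = ?L 4 \<and> L' \<noteq> ?L" by blast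
  qed
  then show "?L \<in> semifactuals \<sigma> A R 4 ?L \<longleftrightarrow> \<not> (\<exists>u. (\<forall>v. u v < D) \<and> SAT u)"
    by (simp only: semifactual_self[OF R_sub finite_lessThan L])
qed

section \<open>The framework with a switch\<close>

lemma ins_lab_sub:
  "ins (lab_of Q l) \<subseteq> ins (lab_of Q l') \<longleftrightarrow> (\<forall>x<Q. \<forall>k<9. l k x = In \<longrightarrow> l' k x = In)"
proof -
  have "ins (lab_of Q l) \<subseteq> ins (lab_of Q l') \<longleftrightarrow> (\<forall>a\<in>A. l (a mod 9) (a div 9) = In \<longrightarrow> l' (a mod 9) (a
      div 9) = In)"
    by (auto simp: ins_def lab_of_def)
  then show ?thesis using ball_args[of Q "\<lambda>k x. l k x = In \<longrightarrow> l' k x = In"] by simp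
qed

lemma decided_lab_sub:
  "decided (lab_of Q l) \<subseteq> decided (lab_of Q l') \<longleftrightarrow> (\<forall>x<Q. \<forall>k<9. l k x \<noteq> Und \<longrightarrow> l' k x \<noteq> Und)"
proof -
  have "decided (lab_of Q l) \<subseteq> decided (lab_of Q l') \<longleftrightarrow> (\<forall>a\<in>A. l (a mod 9) (a div 9) \<noteq> Und \<longrightarrow> l' (a
      mod 9) (a div 9) \<noteq> Und)"
    by (auto simp: decided_def lab_of_def)
  then show ?thesis using ball_args[of Q "\<lambda>k x. l k x \<noteq> Und \<longrightarrow> l' k x \<noteq> Und"] by simp
qed

lemma lt9: "k < 9 \<longleftrightarrow> k = 0 \<or> k = 1 \<or> k = 2 \<or> k = 3 \<or> k = 4 \<or> k = 5 \<or> k = 6 \<or> k = 7 \<or> k = (8 :: nat)"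
  by auto

lemma ins_klab_sub:
  assumes "klab l" "sw" "self"
  shows "x < Q \<Longrightarrow> l 1 x \<noteq> In" "x < Q \<Longrightarrow> l 3 x \<noteq> In" "x < Q \<Longrightarrow> l 6 x \<noteq> In" "x < Q \<Longrightarrow> l 7 x \<noteq> In" "x < Q \<Longrightarrow>
      l 8 x \<noteq> In"
  using klabD(3,7,13,15,17)[OF assms(1)] assms(2,3) by (metis label.distinct(1))+

text \<open>Each argument that can be \<open>In\<close> attacks a self-attacking one, which is
  decided only if it has an attacker labelled \<open>In\<close>: a literal its copy of kind 6, the
  formula the blocker, kinds 4 and 5 the kinds 7 and 8. Comparing ranges thus amounts to comparing
  \<open>In\<close>-parts, and one proof serves preferred and semi-stable semantics.\<close>

lemma decided_ins:
  assumes "klab l" "klab l'" "sw" "self" "decided (lab_of Q l) \<subseteq> decided (lab_of Q l')"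
  shows "ins (lab_of Q l) \<subseteq> ins (lab_of Q l')"
  unfolding ins_lab_sub
proof (intro allI impI)
  have d: "l' k x = In \<or> l' k x = Out" if "l k x = In \<or> l k x = Out" "x < Q" "k < 9" for k x
    using assms(5) that unfolding decided_lab_sub by (metis label.distinct(3,5) label.exhaust)
  note n = ins_klab_sub[OF assms(1,3,4)] and n' = ins_klab_sub[OF assms(2,3,4)]
  note D = klabD[OF assms(1)] and D' = klabD[OF assms(2)]
  fix x k assume x: "x < Q" and k: "k < (9 :: nat)" and "l k x = In"
  then consider "k = 0" | "k = 2" | "k = 4" | "k = 5" using n[OF x] unfolding lt9 by metis
  then show "l' k x = In"
  proof cases
    case 1
    then have "l 6 x = Out" using \<open>l k x = In\<close> D(14)[OF x] assms(3) by blast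
    then have "l' 6 x = Out" using d[of 6 x] x n'(3) by auto
    then show ?thesis using D'(14)[OF x] n'(3)[OF x] 1 by blast
  next
    case 2
    then have "l 3 x = Out" using \<open>l k x = In\<close> D(8)[OF x] x by blast
    then have "l' 3 x = Out" using d[of 3 x] x n'(2) by auto
    then obtain y where "y < Q" "l' 2 y = In" using D'(8)[OF x] n'(2) by blast
    then show ?thesis using D'(5)[OF x] D'(5)[of y] 2 by blast
  next
    case 3
    then have "l 7 x = Out" using \<open>l k x = In\<close> D(16)[OF x] assms(3) x by blast
    then have "l' 7 x = Out" using d[of 7 x] x n'(4) by auto
    then obtain y where "y < Q" "l' 4 y = In" using D'(16)[OF x] n'(4)[OF x] by blast
    then show ?thesis using D'(9)[OF x] D'(9)[of y] 3 by blast
  next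
    case 4
    then have "l 8 x = Out" using \<open>l k x = In\<close> D(18)[OF x] assms(3) x by blast
    then have "l' 8 x = Out" using d[of 8 x] x n'(5) by auto
    then obtain y where "y < Q" "l' 5 y = In" using D'(18)[OF x] n'(5)[OF x] by blast
    then show ?thesis using D'(11)[OF x] D'(11)[of y] 4 by blast
  qed
qed

lemma switch_labellings:
  assumes "sw" "self" "\<sigma> \<in> {Preferred, SemiStable}"
  shows "lab_of Q l \<in> labellings \<sigma> A R \<longleftrightarrow> klab l \<and> \<not> (\<exists>t. klab t \<and> ins (lab_of Q l) \<subset> ins (lab_of Q t))"
proof -
  let ?imp = "\<lambda>l t. ins (lab_of Q l) \<subset> ins (lab_of Q t)"
  have ex: "(\<exists>T. clab A R T \<and> P T) \<longleftrightarrow> (\<exists>t. klab t \<and> P (lab_of Q t))" for P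
    using clab_obtain clab_klab by metis
  have "?imp l t" if "klab l" "klab t" "decided (lab_of Q l) \<subset> decided (lab_of Q t)" for t
    using decided_ins[OF that(1,2) assms(1,2)] that(3) clab_inj[OF R_sub] that(1,2) clab_klab by
        (metis psubset_imp_subset psubset_eq)
  then have "klab l \<and> \<not> (\<exists>t. klab t \<and> (?imp l t \<or> decided (lab_of Q l) \<subset> decided (lab_of Q t))) \<longleftrightarrow>
      klab l \<and> \<not> (\<exists>t. klab t \<and> ?imp l t)" by metis
  with assms(3) labellings_Preferred[OF R_sub, of "lab_of Q l"] labellings_SemiStable[OF R_sub, of
      "lab_of Q l"]
  show ?thesis by (elim insertE emptyE) (simp_all only: ex clab_klab finite_lessThan simp_thms)
qed

text \<open>Kind 4 labelled \<open>In\<close> defeats kinds 0, 2, 5 and 7. The other kinds attack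
  themselves and have lost all attackers that could be \<open>In\<close>, so they are
  undecided.\<close>

lemma switch_on:
  assumes "sw" "self" "klab l" "x < Q" "l 4 x = In"
  shows "\<forall>x<Q. \<forall>k<9. l k x = base_lab k x"
proof (intro allI impI)
  note D = klabD[OF assms(3)] and n = ins_klab_sub[OF assms(3,1,2)]
  have lab: "t = In \<or> t = Out \<or> t = Und" for t by (cases t) auto
  have 4: "l 4 y = In" if "y < Q" for y using D(9)[OF assms(4)] D(9)[OF that] assms(5) by blast
  have o: "l 0 y = Out" "l 2 y = Out" "l 5 y = Out" "l 7 y = Out" if "y < Q" for y
    using D(2,6,12,16)[OF that] 4 assms(1,4) by blast+
  have u: "l 1 y = Und" "l 3 y = Und" "l 6 y = Und" "l 8 y = Und" if y: "y < Q" for y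
  proof -
    have "l 1 y \<noteq> Out" using D(4)[OF y] n(1)[OF y] n(2) o(1,2) by (metis label.distinct(1))
    moreover have "l 3 y \<noteq> Out" using D(8)[OF y] n(2) o(2) by (metis label.distinct(1))
    moreover have "l 6 y \<noteq> Out" using D(14)[OF y] n(3)[OF y] o(1)[OF y] by simp
    moreover have "l 8 y \<noteq> Out" using D(18)[OF y] n(5)[OF y] o(3) by (metis label.distinct(1))
    ultimately show "l 1 y = Und" "l 3 y = Und" "l 6 y = Und" "l 8 y = Und"
      using n(1,2,3,5)[OF y] lab by metis+
  qed
  fix y k assume "y < Q" "k < (9 :: nat)"
  then show "l k y = base_lab k y"
    unfolding base_lab_def lt9 using assms(1) 4 o u by auto
qed

text \<open>Records \<open>u\<close> on the outer variables only. The other literals stay undecided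
  because the blocker does, and only a formula labelled \<open>In\<close> can release them.\<close>

definition half_lab :: "(nat \<Rightarrow> nat) \<Rightarrow> nat \<Rightarrow> nat \<Rightarrow> label" where
  "half_lab u k x = (if k = 0 then if isY (x div D) then if x mod D = u (x div D) then In else Out else Und
     else if k = 1 then if \<exists>y<Q. opp x y \<and> isY (y div D) \<and> y mod D = u (y div D) then Out else Und
     else if k = 5 then In else if k = 4 \<or> k = 8 then Out
     else if k = 6 \<and> isY (x div D) \<and> x mod D = u (x div D) then Out else Und)"

lemma klab_half:
  assumes "\<And>v. u v < D" "sw" "self"
  shows "klab (half_lab u)"
proof -
  have inj: "y = x" if "y div D = x div D" "y mod D = x mod D" for x y by (metis div_mult_mod_eq that)
  show ?thesis
    unfolding klab_def
  proof (intro allI impI, goal_cases)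
    case (1 x)
    then have x: "x < Q" .
    have 1: "(\<exists>y<Q. y div D = x div D \<and> y \<noteq> x \<and> isY (y div D) \<and> y mod D = u (y div D)) \<longleftrightarrow>
        isY (x div D) \<and> x mod D \<noteq> u (x div D)"
      using true_lit[OF x, of u] assms(1) inj by metis
    have 6: "\<exists>y. y < Q" using Q by blast
    have 5: "(\<forall>y<Q. p) \<longleftrightarrow> p" "(\<exists>y<Q. p) \<longleftrightarrow> p" for p using Q by auto
    have hl: "half_lab u 0 z = In \<longleftrightarrow> isY (z div D) \<and> z mod D = u (z div D)"
      "half_lab u 0 z = Out \<longleftrightarrow> isY (z div D) \<and> z mod D \<noteq> u (z div D)"
      "half_lab u 1 z \<noteq> In" "half_lab u 1 z = Out \<longleftrightarrow> (\<exists>y<Q. opp z y \<and> isY (y div D) \<and> y mod D = u (y div D))"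
      "half_lab u 2 z = Und" "half_lab u 3 z = Und" "half_lab u 4 z = Out" "half_lab u 5 z = In"
          "half_lab u 8 z = Out"
      "half_lab u 7 z = Und" "half_lab u 6 z \<noteq> In"
      "half_lab u 6 z = Out \<longleftrightarrow> isY (z div D) \<and> z mod D = u (z div D)" for z
      by (auto simp: half_lab_def)
    have 7: "isY (x div D) \<and> x mod D = u (x div D) \<longleftrightarrow>
      (\<forall>y<Q. y div D = x div D \<and> y \<noteq> x \<longrightarrow> isY (x div D) \<and> y mod D \<noteq> u (x div D)) \<and> isY (x div D)"
      using 1 by metis
    show ?case
      by (intro conjI; (simp only: hl simp_thms 5 label.distinct assms(2,3))?; (simp add: 1 5 6)?)
          (use 7 x in blast)
  qed
qed

text \<open>The goal is a blocker argument, undecided in the base labelling; keeping it so forbids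
  the formula to be \<open>In\<close>. A maximal labelling other than the base one then has kind 5
  \<open>In\<close> and an outer assignment without a solution, as a solution would give a larger
  labelling.\<close>

lemma switch_gadget:
  assumes "sw" "self" "\<sigma> \<in> {Preferred, SemiStable}"
  shows "lab_of Q base_lab \<in> labellings \<sigma> A R"
    and "lab_of Q base_lab \<in> semifactuals \<sigma> A R 3 (lab_of Q base_lab) \<longleftrightarrow>
      \<not> (\<exists>u. (\<forall>v. u v < D) \<and> \<not> (\<exists>u'. (\<forall>v. u' v < D) \<and> (\<forall>v. isY v \<longrightarrow> u' v = u v) \<and> SAT u'))"
proof -
  let ?L = "lab_of Q base_lab"
  note lab = switch_labellings[OF assms]
  have kb: "klab base_lab" using klab_base assms by blast
  have b: "base_lab 4 z = In" "base_lab 3 z = Und" "base_lab k z = In \<longleftrightarrow> k = 4" for k z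
    unfolding base_lab_def using assms(1) by auto
  have "\<not> ins ?L \<subset> ins (lab_of Q t)" if t: "klab t" for t
  proof
    assume s: "ins ?L \<subset> ins (lab_of Q t)"
    then have "t 4 0 = In" using ins_lab_sub[of base_lab t] b(1)[of 0] Q by auto
    from switch_on[OF assms(1,2) t Q this] have "lab_of Q t = ?L" using lab_eq[OF t] by blast
    with s show False by simp
  qed
  then show L: "?L \<in> labellings \<sigma> A R" unfolding lab using kb by blast
  have L3: "lab_of Q l 3 = l 3 0" for l using Q by (simp add: lab_of_def)
  have "(\<exists>L'\<in>labellings \<sigma> A R. L' 3 = ?L 3 \<and> L' \<noteq> ?L) \<longleftrightarrow>
     (\<exists>u. (\<forall>v. u v < D) \<and> \<not> (\<exists>u'. (\<forall>v. u' v < D) \<and> (\<forall>v. isY v \<longrightarrow> u' v = u v) \<and> SAT u'))"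
  proof
    assume "\<exists>L'\<in>labellings \<sigma> A R. L' 3 = ?L 3 \<and> L' \<noteq> ?L"
    then obtain L' where L': "L' \<in> labellings \<sigma> A R" "L' 3 = ?L 3" "L' \<noteq> ?L" by blast
    obtain l where l: "L' = lab_of Q l" "klab l" using clab_obtain[OF labellings_clab[OF R_sub
        L'(1)]] by blast
    note D = klabD[OF l(2)] and n = ins_klab_sub[OF l(2) assms(1,2)]
    have mx: "\<not> ins (lab_of Q l) \<subset> ins (lab_of Q t)" if "klab t" for t using L'(1) l that lab by blast
    have l3: "l 3 0 = Und" using L'(2) L3 l(1) b(2) by simp
    have n4: "l 4 x \<noteq> In" if "x < Q" for x
      using switch_on[OF assms(1,2) l(2) that] lab_eq[OF l(2), of base_lab] L'(3) l(1) by blast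
    have n2: "l 2 x \<noteq> In" if "x < Q" for x
      using D(8)[OF Q] l3 that by auto
    have n3: "l 3 x \<noteq> Out" if "x < Q" for x using D(8)[OF that] n2 n(2) by blast
    have n0: "l 0 x \<noteq> In" if "x < Q" "\<not> isY (x div D)" for x using D(1)[OF that(1)] that n3 by blast
    \<comment> \<open>A literal needs kind 4 to be \<open>Out\<close>, hence kind 5 to be
      \<open>In\<close>; otherwise nothing is \<open>In\<close> at all and the base labelling lies
      above.\<close>
    have ex5: "\<exists>x<Q. l 5 x = In"
    proof (rule ccontr)
      assume n5: "\<not> (\<exists>x<Q. l 5 x = In)"
      have "l 0 x \<noteq> In" if "x < Q" for x using D(1)[OF that] D(10) n5 assms(1) that by blast
      then have "l k x \<noteq> In" if "x < Q" "k < 9" for k x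
        using that n[OF that(1)] n2[OF that(1)] n4[OF that(1)] n5 unfolding lt9 by blast
      then have "ins (lab_of Q l) \<subseteq> ins ?L" "\<not> ins ?L \<subseteq> ins (lab_of Q l)"
        unfolding ins_lab_sub using b(1) Q by (blast, metis b(3) lt9)
      with mx[OF kb] show False by blast
    qed
    obtain u where u: "\<And>v. u v < D" "\<And>x. x < Q \<Longrightarrow> l 0 x = In \<Longrightarrow> u (x div D) = x mod D"
      using assignment_of[OF l(2), of "\<lambda>_. 0"] D_pos by metis
    have "\<not> (\<exists>u'. (\<forall>v. u' v < D) \<and> (\<forall>v. isY v \<longrightarrow> u' v = u v) \<and> SAT u')"
    proof
      assume "\<exists>u'. (\<forall>v. u' v < D) \<and> (\<forall>v. isY v \<longrightarrow> u' v = u v) \<and> SAT u'"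
      then obtain u' where u': "\<And>v. u' v < D" "\<And>v. isY v \<Longrightarrow> u' v = u v" "SAT u'" by blast
      have s: "sat_lab u' 0 x = (if x mod D = u' (x div D) then In else Out)" "sat_lab u' 5 x = In"
          "sat_lab u' 2 x = In" for x
        by (simp_all add: sat_lab_def)
      have "sat_lab u' 0 x = In" if "x < Q" "l 0 x = In" for x
        using n0[OF that(1)] that u(2)[OF that] u'(2) s(1) by metis
      then have "ins (lab_of Q l) \<subseteq> ins (lab_of Q (sat_lab u'))"
        unfolding ins_lab_sub lt9 using n n2 n4 s(2) by metis
      moreover have "\<not> ins (lab_of Q (sat_lab u')) \<subseteq> ins (lab_of Q l)"
        unfolding ins_lab_sub using n2[OF Q] s(3) Q by (metis lt9)
      ultimately show False using mx[OF klab_sat[OF u'(3,1)]] by blast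
    qed
    with u(1) show "\<exists>u. (\<forall>v. u v < D) \<and> \<not> (\<exists>u'. (\<forall>v. u' v < D) \<and> (\<forall>v. isY v \<longrightarrow> u' v = u v) \<and> SAT u')" by blast
  next
    assume "\<exists>u. (\<forall>v. u v < D) \<and> \<not> (\<exists>u'. (\<forall>v. u' v < D) \<and> (\<forall>v. isY v \<longrightarrow> u' v = u v) \<and> SAT u')"
    then obtain u where u: "\<And>v. u v < D" "\<not> (\<exists>u'. (\<forall>v. u' v < D) \<and> (\<forall>v. isY v \<longrightarrow> u' v = u v) \<and> SAT
        u')" by blast
    have kh: "klab (half_lab u)" using klab_half u(1) assms by blast
    then obtain T where T: "clab A R T" "ins (lab_of Q (half_lab u)) \<subseteq> ins T" "\<not> (\<exists>T'. clab A R T' \<and>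
        ins T \<subset> ins T')"
      using preferred_above[of A R "lab_of Q (half_lab u)"] clab_klab by blast
    obtain l where l: "T = lab_of Q l" "klab l" using clab_obtain[OF T(1)] by blast
    note D = klabD[OF l(2)] and n = ins_klab_sub[OF l(2) assms(1,2)]
    have "T \<in> labellings \<sigma> A R" unfolding l(1) lab using T(3) l clab_klab by blast
    moreover have sub: "l k x = In" if "half_lab u k x = In" "x < Q" "k < 9" for k x
      using T(2) that unfolding l(1) ins_lab_sub by blast
    then have l5: "l 5 0 = In" using Q by (simp add: half_lab_def)
    have "T \<noteq> ?L"
    proof
      assume "T = ?L"
      then have "l 5 0 = base_lab 5 0" using lab_eq[OF l(2), of base_lab] l(1) Q by simp
      with l5 b(3)[of 5 0] show False by simp
    qed
    moreover have "l 3 0 = Und"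
    proof (rule ccontr)
      assume "l 3 0 \<noteq> Und"
      then have "l 3 0 = Out" using n(2)[OF Q] by (cases "l 3 0") auto
      then obtain x where x: "x < Q" "l 2 x = In" using D(8)[OF Q] n(2) by blast
      obtain u' where u': "\<And>v. u' v < D" "\<And>x. x < Q \<Longrightarrow> l 0 x = In \<Longrightarrow> u' (x div D) = x mod D"
        "\<And>v. (\<forall>x<Q. x div D = v \<longrightarrow> l 0 x \<noteq> In) \<Longrightarrow> u' v = u v"
        using assignment_of[OF l(2), of u] u(1) by blast
      \<comment> \<open>A variable of the framework has its literal fixed by
        \<open>half_lab\<close>; for one without literals the default of
        \<open>assignment_of\<close> applies.\<close>
      have "u' v = u v" if "isY v" for v
      proof (cases "\<exists>x<Q. x div D = v")
        case True
        then obtain x where "x < Q" "x div D = v" by blast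
        with true_lit[of x u] u(1) obtain y where y: "y < Q" "y div D = v" "y mod D = u v" by metis
        then have "l 0 y = In" using sub[of 0 y] that by (simp add: half_lab_def)
        with u'(2)[OF y(1)] y show ?thesis by simp
      next
        case False
        then show ?thesis using u'(3) by blast
      qed
      with u'(1) SAT_of_labelling[OF l(2) x u'(2)] u(2) show False by blast
    qed
    ultimately show "\<exists>L'\<in>labellings \<sigma> A R. L' 3 = ?L 3 \<and> L' \<noteq> ?L"
      using L3 l(1) b(2) by metis
  qed
  then show "?L \<in> semifactuals \<sigma> A R 3 ?L \<longleftrightarrow>
      \<not> (\<exists>u. (\<forall>v. u v < D) \<and> \<not> (\<exists>u'. (\<forall>v. u' v < D) \<and> (\<forall>v. isY v \<longrightarrow> u' v = u v) \<and> SAT u'))"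
    by (simp only: semifactual_self[OF R_sub finite_lessThan L])
qed

end

section \<open>Membership\<close>

lemma map_append_upt:
  "map f [0..<a] @ map g [0..<b] = map (\<lambda>p. if p < a then f p else g (p - a)) [0..<a + b]"
  by (rule nth_equalityI) (auto simp: nth_append)

lemma concat_map_upt:
  "concat (map (\<lambda>i. map (f i) [0..<b]) [0..<a]) = map (\<lambda>p. f (p div b) (p mod b)) [0..<a * b]"
proof (induction a)
  case (Suc a)
  have "concat (map (\<lambda>i. map (f i) [0..<b]) [0..<Suc a]) = map (\<lambda>p. f (p div b) (p mod b)) [0..<a *
      b] @ map (f a) [0..<b]"
    by (simp add: Suc)
  also have "\<dots> = map (\<lambda>p. f (p div b) (p mod b)) [0..<Suc a * b]"
  proof (rule nth_equalityI, goal_cases)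
    case (2 i)
    show ?case
    proof (cases "i < a * b")
      case False
      with 2 have "i div b = a" by (intro div_nat_eqI) (auto simp: mult.commute)
      with False 2 show ?thesis by (simp add: nth_append modulo_nat_def mult.commute del: upt_Suc)
    qed (simp add: nth_append del: upt_Suc)
  qed simp
  finally show ?case .
qed simp

section \<open>Codes of inputs, bit by bit\<close>

definition lbit :: "(nat \<Rightarrow> label) \<Rightarrow> nat \<Rightarrow> bool" where
  "lbit L q \<longleftrightarrow> (if q mod 2 = 0 then L (q div 2) = In else L (q div 2) = Out)"

text \<open>A closed form for single bits serves the decoding, and it is the form in which
  \<open>word_of\<close> produces a code.\<close>

definition encode_bit :: "nat \<Rightarrow> (nat \<times> nat) set \<Rightarrow> nat \<Rightarrow> (nat \<Rightarrow> label) \<Rightarrow> (nat \<Rightarrow> label) \<Rightarrow> nat \<Rightarrow> bool" where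
  "encode_bit n R g L L' p \<longleftrightarrow>
     (if p < n then True else if p < n + 1 then False
      else if p < n + 1 + n * n then ((p - (n + 1)) div n, (p - (n + 1)) mod n) \<in> R
      else if p < n + 1 + n * n + n then p - (n + 1 + n * n) = g
      else if p < n + 1 + n * n + n + n * 2 then lbit L (p - (n + 1 + n * n + n))
      else lbit L' (p - (n + 1 + n * n + n + n * 2)))"

lemma encode_eq: "encode n R g L L' = map (encode_bit n R g L L') [0..<n * n + 6 * n + 1]"
proof -
  have lab: "concat (map (\<lambda>i. encode_label (L i)) [0..<n]) = map (lbit L) [0..<n * 2]" for L
  proof -
    have "encode_label (L i) = map (\<lambda>j. if j = 0 then L i = In else L i = Out) [0..<2]" for i
      by (cases "L i") (auto simp: upt_rec)
    then have "concat (map (\<lambda>i. encode_label (L i)) [0..<n]) =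
        concat (map (\<lambda>i. map (\<lambda>j. if j = 0 then L i = In else L i = Out) [0..<2]) [0..<n])" by simp
    then show ?thesis unfolding concat_map_upt by (simp add: lbit_def fun_eq_iff)
  qed
  have 1: "replicate n True = map (\<lambda>p. True) [0..<n]" "[False] = map (\<lambda>p. False) [0..<1]"
    by (auto simp: map_replicate_const)
  have e: "n + (1 + (n * n + (n + (n * 2 + n * 2)))) = n * n + 6 * n + 1" by simp
  show ?thesis
    unfolding encode_def lab concat_map_upt 1 map_append_upt e
    by (rule map_cong[OF refl]) (auto simp: encode_bit_def)
qed

definition lab_bits :: "nat \<Rightarrow> (nat \<Rightarrow> bool) \<Rightarrow> nat \<Rightarrow> label" where
  "lab_bits n c i = (if i < n then if c (2 * i) then In else if c (2 * i + 1) then Out else Und else Und)"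

text \<open>The number of arguments is the length of the unary prefix. It is written as a bounded
  sum so that the closure properties apply to it.\<close>

definition leading :: "(nat \<Rightarrow> bool) \<Rightarrow> nat \<Rightarrow> nat" where
  "leading b m = (\<Sum>x<m. of_bool (\<forall>y<Suc x. b y))"

lemma leading_eq:
  assumes "n < m" "\<And>x. x < n \<Longrightarrow> b x" "\<not> b n"
  shows "leading b m = n"
proof -
  have "{x. x < m \<and> (\<forall>y<Suc x. b y)} = {..<n}"
    using assms by (auto simp: less_Suc_eq_le) (metis linorder_not_less)
  then show ?thesis by (simp add: leading_def Collect_conj_eq lessThan_def)
qed

lemma leading_prefix: "x < leading b m \<Longrightarrow> b x"
proof (rule ccontr)
  assume a: "x < leading b m" "\<not> b x"
  have "leading b m = card ({..<m} \<inter> {z. \<forall>y<Suc z. b y})" by (simp add: leading_def)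
  also have "\<dots> \<le> card {..<x}"
    by (rule card_mono) (use a(2) in \<open>auto simp: less_Suc_eq_le, metis linorder_not_less\<close>)
  finally show False using a(1) by simp
qed

definition rel_bits :: "nat \<Rightarrow> (nat \<Rightarrow> bool) \<Rightarrow> nat \<Rightarrow> nat \<Rightarrow> bool" where
  "rel_bits n b i j = b (n + 1 + i * n + j)"

text \<open>The two labellings follow each other in the word, so a range of \<open>2 * n\<close>
  pairs of bits covers both; a pair of two ones is no label. The goal is a parameter because the
  code gives it only as a unit vector.\<close>

definition legal :: "nat \<Rightarrow> nat \<Rightarrow> (nat \<Rightarrow> bool) \<Rightarrow> nat \<Rightarrow> bool" where
  "legal m n b g \<longleftrightarrow> m = n * n + 6 * n + 1 \<and> \<not> b n \<and> (\<forall>i<n. b (n + 1 + n * n + i) \<longleftrightarrow> i = g) \<and>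
     (\<forall>i<2 * n. \<not> (b (n * n + 2 * n + 1 + 2 * i) \<and> b (n * n + 2 * n + 1 + (2 * i + 1))))"

definition acc :: "bool list \<Rightarrow> nat \<Rightarrow> bool" where
  "acc w x \<longleftrightarrow> x < length w \<and> w ! x"

lemma acc_encode: "x < n * n + 6 * n + 1 \<Longrightarrow> acc (encode n R g L L') x = encode_bit n R g L L' x"
  by (simp add: acc_def encode_eq del: upt_Suc)

abbreviation labL :: "nat \<Rightarrow> (nat \<Rightarrow> bool) \<Rightarrow> nat \<Rightarrow> bool" where
  "labL n b \<equiv> \<lambda>x. b (n * n + 2 * n + 1 + x)"

abbreviation labL' :: "nat \<Rightarrow> (nat \<Rightarrow> bool) \<Rightarrow> nat \<Rightarrow> bool" where
  "labL' n b \<equiv> \<lambda>x. b (n * n + 4 * n + 1 + x)"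

lemma decode_encode:
  assumes "w = encode n R g L L'" "R \<subseteq> {..<n} \<times> {..<n}" "g < n" "labelling {..<n} L" "labelling {..<n} L'"
  shows "leading (acc w) (length w) = n" "legal (length w) n (acc w) g"
    "\<And>i j. i < n \<Longrightarrow> j < n \<Longrightarrow> rel_bits n (acc w) i j \<longleftrightarrow> (i, j) \<in> R"
    "lab_bits n (labL n (acc w)) = L" "lab_bits n (labL' n (acc w)) = L'"
proof -
  have len: "length w = n * n + 6 * n + 1" by (simp add: assms(1) encode_eq)
  have a: "acc w x = encode_bit n R g L L' x" if "x < n * n + 6 * n + 1" for x
    unfolding assms(1) by (rule acc_encode[OF that])
  show "leading (acc w) (length w) = n"
    by (rule leading_eq) (auto simp: len a encode_bit_def)
  have l: "acc w (n * n + 2 * n + 1 + x) = lbit L x" if "x < 2 * n" for x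
    using that by (subst a) (auto simp: encode_bit_def)
  have l': "acc w (n * n + 4 * n + 1 + x) = lbit L' x" if "x < 2 * n" for x
    using that by (subst a) (auto simp: encode_bit_def)
  have s: "i * n + j < n * n" if "i < n" "j < n" for i j
  proof -
    have "i * n + j < Suc i * n" using that by simp
    also have "\<dots> \<le> n * n" using that by (intro mult_le_mono1) simp
    finally show ?thesis .
  qed
  show "rel_bits n (acc w) i j \<longleftrightarrow> (i, j) \<in> R" if "i < n" "j < n" for i j
  proof -
    have "n + 1 + i * n + j < n * n + 6 * n + 1" using s[OF that] by simp
    from a[OF this] show ?thesis using s[OF that] that by (simp add: rel_bits_def encode_bit_def)
  qed
  have o: "\<not> L i = In" "\<not> L i = Out" "\<not> L' i = In" "\<not> L' i = Out" if "\<not> i < n" for i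
    using assms(4,5) that by (auto simp: labelling_def)
  show "lab_bits n (labL n (acc w)) = L"
  proof
    fix i show "lab_bits n (labL n (acc w)) i = L i"
      using o[of i] l[of "2 * i"] l[of "2 * i + 1"] unfolding lab_bits_def lbit_def by (cases "L i") auto
  qed
  show "lab_bits n (labL' n (acc w)) = L'"
  proof
    fix i show "lab_bits n (labL' n (acc w)) i = L' i"
      using o[of i] l'[of "2 * i"] l'[of "2 * i + 1"] unfolding lab_bits_def lbit_def by (cases "L' i") auto
  qed
  show "legal (length w) n (acc w) g"
    unfolding legal_def
  proof (intro conjI allI impI)
    show "\<not> acc w n" by (simp add: a encode_bit_def)
    show "acc w (n + 1 + n * n + i) \<longleftrightarrow> i = g" if "i < n" for i
      using that by (subst a) (auto simp: encode_bit_def)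
    show "\<not> (acc w (n * n + 2 * n + 1 + 2 * i) \<and> acc w (n * n + 2 * n + 1 + (2 * i + 1)))" if "i < 2
        * n" for i
    proof (cases "i < n")
      case True
      then show ?thesis using l[of "2 * i"] l[of "2 * i + 1"] by (simp add: lbit_def)
    next
      case False
      then obtain j where j: "i = n + j" "j < n" using \<open>i < 2 * n\<close> by (metis add_diff_inverse_nat
          add_less_cancel_left mult_2)
      have "lbit L' (2 * j) \<longleftrightarrow> L' j = In" "lbit L' (2 * j + 1) \<longleftrightarrow> L' j = Out" by (simp_all add: lbit_def)
      with j show ?thesis using l'[of "2 * j"] l'[of "2 * j + 1"] by (simp add: algebra_simps)
    qed
  qed (simp add: len)
qed

lemma encode_decode:
  assumes "n = leading (acc w) (length w)" "legal (length w) n (acc w) g" "g < n"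
  shows "w = encode n {(i, j). i < n \<and> j < n \<and> rel_bits n (acc w) i j} g (lab_bits n (labL n (acc
      w))) (lab_bits n (labL' n (acc w)))"
    (is "w = encode n ?R g ?L ?L'")
proof -
  have len: "length w = n * n + 6 * n + 1" using assms(2) by (simp add: legal_def)
  have lb: "lbit (lab_bits n c) q \<longleftrightarrow> c q"
    if "q < 2 * n" "\<And>i. i < n \<Longrightarrow> \<not> (c (2 * i) \<and> c (2 * i + 1))" for c q
  proof -
    have "q div 2 < n" using that(1) by linarith
    moreover have "q = (if q mod 2 = 0 then 2 * (q div 2) else 2 * (q div 2) + 1)" by presburger
    ultimately show ?thesis using that(2)[of "q div 2"] unfolding lbit_def lab_bits_def by (auto
        split: if_splits)
  qed
  have ex: "\<not> (acc w (n * n + 2 * n + 1 + 2 * i) \<and> acc w (n * n + 2 * n + 1 + (2 * i + 1)))" if "i <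
      2 * n" for i
    using assms(2) that unfolding legal_def by blast
  have "acc w p = encode_bit n ?R g ?L ?L' p" if p: "p < n * n + 6 * n + 1" for p
  proof -
    consider "p < n" | "p = n" | "n + 1 \<le> p" "p < n + 1 + n * n" | "n + 1 + n * n \<le> p" "p < n + 1 + n * n + n"
      | "n + 1 + n * n + n \<le> p" "p < n + 1 + n * n + n + n * 2" | "n + 1 + n * n + n + n * 2 \<le> p" by linarith
    then show ?thesis
    proof cases
      case 1
      then show ?thesis using leading_prefix[of p "acc w" "length w"] assms(1) by (simp add: encode_bit_def)
    next
      case 2
      then show ?thesis using assms(2) by (simp add: encode_bit_def legal_def)
    next
      case 3
      let ?q = "p - (n + 1)"
      have q: "?q < n * n" using 3 by linarith
      then have "?q div n < n" "?q mod n < n" using assms(3) by (auto simp: less_mult_imp_div_less)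
      moreover have "n + 1 + ?q div n * n + ?q mod n = p" using 3 by (simp add: add.assoc)
      ultimately show ?thesis using 3 by (simp add: encode_bit_def rel_bits_def)
    next
      case 4
      then obtain i where i: "p = n + 1 + n * n + i" "i < n" by (metis add_less_cancel_left le_Suc_ex)
      then show ?thesis using assms(2) by (simp add: encode_bit_def legal_def)
    next
      case 5
      then obtain i where i: "p = n + 1 + n * n + n + i" "i < 2 * n" by (metis add_less_cancel_left
          le_Suc_ex mult.commute)
      have "lbit ?L i \<longleftrightarrow> labL n (acc w) i" by (rule lb[OF i(2)]) (use ex in auto)
      moreover have "encode_bit n ?R g ?L ?L' p = lbit ?L i" unfolding encode_bit_def using i by auto
      moreover have "p = n * n + 2 * n + 1 + i" using i by simp
      ultimately show ?thesis by (simp only:)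
    next
      case 6
      then obtain i where i: "p = n + 1 + n * n + n + n * 2 + i" by (metis le_Suc_ex)
      then have i2: "i < 2 * n" using p by simp
      have "lbit ?L' i \<longleftrightarrow> labL' n (acc w) i"
      proof (rule lb[OF i2])
        fix j assume "j < n"
        then show "\<not> (labL' n (acc w) (2 * j) \<and> labL' n (acc w) (2 * j + 1))"
          using ex[of "n + j"] by (simp add: algebra_simps)
      qed
      moreover have "encode_bit n ?R g ?L ?L' p = lbit ?L' i" unfolding encode_bit_def using i by auto
      moreover have "p = n * n + 4 * n + 1 + i" using i by simp
      ultimately show ?thesis by (simp only:)
    qed
  qed
  then show ?thesis unfolding encode_eq
    by (intro nth_equalityI) (auto simp: len acc_def simp del: upt_Suc)
qed


section \<open>Semifactuals by two nested certificates\<close>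

definition base_ext :: "semantics \<Rightarrow> nat \<Rightarrow> (nat \<Rightarrow> nat \<Rightarrow> bool) \<Rightarrow> (nat \<Rightarrow> label) \<Rightarrow> bool" where
  "base_ext \<sigma> n r L \<longleftrightarrow> (\<forall>a<n. (L a = In \<longleftrightarrow> (\<forall>x<n. r x a \<longrightarrow> L x = Out)) \<and> (L a = Out \<longleftrightarrow> (\<exists>x<n. r x a \<and> L
      x = In))) \<and>
     (\<sigma> = Stable \<longrightarrow> (\<forall>a<n. L a \<noteq> Und))"

text \<open>\<open>T\<close> certifies that \<open>L\<close> is not a labelling of the semantics.
  For complete and stable semantics no such certificate exists, membership being settled by
  \<open>base_ext\<close> alone.\<close>

definition better :: "semantics \<Rightarrow> nat \<Rightarrow> (nat \<Rightarrow> label) \<Rightarrow> (nat \<Rightarrow> label) \<Rightarrow> bool" where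
  "better \<sigma> n L T \<longleftrightarrow>
     (\<sigma> = Preferred \<or> \<sigma> = SemiStable) \<and> (\<forall>a<n. L a = In \<longrightarrow> T a = In) \<and> (\<exists>a<n. T a = In \<and> L a \<noteq> In) \<or>
     \<sigma> = SemiStable \<and> (\<forall>a<n. L a \<noteq> Und \<longrightarrow> T a \<noteq> Und) \<and> (\<exists>a<n. T a \<noteq> Und \<and> L a = Und)"

lemma labellings_iff:
  assumes "R \<subseteq> {..<n} \<times> {..<n}"
  shows "L \<in> labellings \<sigma> {..<n} R \<longleftrightarrow> labelling {..<n} L \<and> base_ext \<sigma> n (\<lambda>i j. (i, j) \<in> R) L \<and>
     \<not> (\<exists>T. labelling {..<n} T \<and> base_ext \<sigma> n (\<lambda>i j. (i, j) \<in> R) T \<and> better \<sigma> n L T)"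
proof -
  let ?r = "\<lambda>i j. (i, j) \<in> R"
  have c: "clab {..<n} R L \<longleftrightarrow> labelling {..<n} L \<and> base_ext Complete n ?r L" for L
    by (simp add: clab_def base_ext_def Ball_def Bex_def)
  have i: "ins L \<subset> ins T \<longleftrightarrow> (\<forall>a<n. L a = In \<longrightarrow> T a = In) \<and> (\<exists>a<n. T a = In \<and> L a \<noteq> In)"
    if "labelling {..<n} L" "labelling {..<n} T" for L T
    using that unfolding labelling_def ins_def psubset_eq by (auto simp: set_eq_iff; metis label.distinct(3))
  have d: "decided L \<subset> decided T \<longleftrightarrow> (\<forall>a<n. L a \<noteq> Und \<longrightarrow> T a \<noteq> Und) \<and> (\<exists>a<n. T a \<noteq> Und \<and> L a = Und)"
    if "labelling {..<n} L" "labelling {..<n} T" for L T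
    using that unfolding labelling_def decided_def psubset_eq by (auto simp: set_eq_iff; metis)
  show ?thesis
  proof (cases \<sigma>)
    case Complete
    then show ?thesis using labellings_Complete[OF assms] c by (simp add: better_def)
  next
    case Stable
    then show ?thesis using labellings_Stable[OF assms] c by (auto simp: better_def base_ext_def)
  next
    case Preferred
    then have "base_ext \<sigma> n ?r L \<longleftrightarrow> base_ext Complete n ?r L" for L by (simp add: base_ext_def)
    moreover have "better \<sigma> n L T \<longleftrightarrow> ins L \<subset> ins T" if "labelling {..<n} L" "labelling {..<n} T" for L T
      unfolding i[OF that] better_def using Preferred by auto
    ultimately show ?thesis using labellings_Preferred[OF assms] c Preferred by metis
  next
    case SemiStable
    then have "base_ext \<sigma> n ?r L \<longleftrightarrow> base_ext Complete n ?r L" for L by (simp add: base_ext_def)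
    moreover have "better \<sigma> n L T \<longleftrightarrow> ins L \<subset> ins T \<or> decided L \<subset> decided T" if "labelling {..<n} L"
        "labelling {..<n} T" for L T
      unfolding i[OF that] d[OF that] better_def using SemiStable by auto
    ultimately show ?thesis using labellings_SemiStable[OF assms finite_lessThan] c SemiStable by metis
  qed
qed

text \<open>The universal \<open>U\<close> has three roles: against the maximality of
  \<open>L\<close>, against that of \<open>L'\<close>, and as a more distant competitor with the
  same goal label. Only the last one calls for an answer: \<open>V\<close> shows that
  \<open>U\<close> is itself not maximal.\<close>

definition verify :: "semantics \<Rightarrow> nat \<Rightarrow> nat \<Rightarrow> (nat \<Rightarrow> bool) \<Rightarrow> (nat \<Rightarrow> label) \<Rightarrow> (nat \<Rightarrow> label) \<Rightarrow> bool" where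
  "verify \<sigma> m n b U V \<longleftrightarrow> (\<exists>g<n. legal m n b g \<and>
     (let r = rel_bits n b; L = lab_bits n (labL n b); L' = lab_bits n (labL' n b) in
      base_ext \<sigma> n r L \<and> base_ext \<sigma> n r L' \<and> L g = L' g \<and>
      (base_ext \<sigma> n r U \<longrightarrow> \<not> better \<sigma> n L U \<and> \<not> better \<sigma> n L' U \<and>
        (U g = L g \<and> (\<Sum>a<n. of_bool (L a \<noteq> L' a)) < (\<Sum>a<n. (of_bool (L a \<noteq> U a) :: nat)) \<longrightarrow>
          base_ext \<sigma> n r V \<and> better \<sigma> n U V))))"

lemma distance_sum: "distance {..<n :: nat} L L' = (\<Sum>a<n. of_bool (L a \<noteq> L' a))"
  by (subst sum_of_bool_eq) (auto simp: distance_def intro!: arg_cong[of _ _ card])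

lemma SF_VE_iff:
  "w \<in> SF_VE \<sigma> \<longleftrightarrow> (let n = leading (acc w) (length w) in
     \<forall>U. labelling {..<n} U \<longrightarrow> (\<exists>V. labelling {..<n} V \<and> verify \<sigma> (length w) n (acc w) U V))"
proof -
  define n where "n = leading (acc w) (length w)"
  define R where "R = {(i, j). i < n \<and> j < n \<and> rel_bits n (acc w) i j}"
  define L where "L = lab_bits n (labL n (acc w))"
  define L' where "L' = lab_bits n (labL' n (acc w))"
  have R: "R \<subseteq> {..<n} \<times> {..<n}" by (auto simp: R_def)
  have lab: "labelling {..<n} L" "labelling {..<n} L'" by (auto simp: labelling_def L_def L'_def lab_bits_def)
  have br: "base_ext \<sigma> n (rel_bits n (acc w)) T \<longleftrightarrow> base_ext \<sigma> n (\<lambda>i j. (i, j) \<in> R) T" for T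
    unfolding base_ext_def R_def by auto
  have 1: "w \<in> SF_VE \<sigma> \<longleftrightarrow> (\<exists>g<n. legal (length w) n (acc w) g \<and> L \<in> labellings \<sigma> {..<n} R \<and> L' \<in>
      semifactuals \<sigma> {..<n} R g L)"
  proof
    assume "w \<in> SF_VE \<sigma>"
    then obtain n' R' g M M' where w: "w = encode n' R' g M M'" "R' \<subseteq> {..<n'} \<times> {..<n'}" "g < n'"
        "M \<in> labellings \<sigma> {..<n'} R'" "labelling {..<n'} M'" "M' \<in> semifactuals \<sigma> {..<n'} R' g M"
      by (auto simp: SF_VE_def)
    have "labelling {..<n'} M" using labellings_clab[OF w(2,4)] by (simp add: clab_def)
    note dec = decode_encode[OF w(1-3) this w(5)]
    have "n' = n" using dec(1) by (simp add: n_def)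
    moreover have "R = R'" unfolding R_def \<open>n' = n\<close>[symmetric] using dec(3) w(2) by auto
    ultimately show "\<exists>g<n. legal (length w) n (acc w) g \<and> L \<in> labellings \<sigma> {..<n} R \<and> L' \<in>
        semifactuals \<sigma> {..<n} R g L"
      using dec w unfolding L_def L'_def by metis
  next
    assume "\<exists>g<n. legal (length w) n (acc w) g \<and> L \<in> labellings \<sigma> {..<n} R \<and> L' \<in> semifactuals \<sigma> {..<n} R g L"
    then obtain g where g: "g < n" "legal (length w) n (acc w) g" "L \<in> labellings \<sigma> {..<n} R" "L' \<in>
        semifactuals \<sigma> {..<n} R g L" by blast
    from encode_decode[OF n_def g(2,1)] have "w = encode n R g L L'" by (simp add: R_def L_def L'_def)
    with g lab(2) R show "w \<in> SF_VE \<sigma>" unfolding SF_VE_def by blast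
  qed
  \<comment> \<open>\<open>verify\<close> chooses the goal anew for every \<open>U\<close> and
    \<open>V\<close>; as the code determines it, the choices agree.\<close>
  have uniq: "g = g'" if "legal (length w) n (acc w) g" "legal (length w) n (acc w) g'" "g < n" "g'
      < n" for g g'
    using that unfolding legal_def by blast
  define C where "C T \<longleftrightarrow> base_ext \<sigma> n (\<lambda>i j. (i, j) \<in> R) T" for T
  have v: "verify \<sigma> (length w) n (acc w) U V \<longleftrightarrow> (\<exists>g<n. legal (length w) n (acc w) g \<and> C L \<and> C L' \<and> L g = L' g \<and>
      (C U \<longrightarrow> \<not> better \<sigma> n L U \<and> \<not> better \<sigma> n L' U \<and>
        (U g = L g \<and> distance {..<n} L L' < distance {..<n} L U \<longrightarrow> C V \<and> better \<sigma> n U V)))" for U V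
    unfolding verify_def Let_def br distance_sum C_def[symmetric] L_def[symmetric] L'_def[symmetric] ..
  have lb: "T \<in> labellings \<sigma> {..<n} R \<longleftrightarrow> labelling {..<n} T \<and> C T \<and> \<not> (\<exists>V. labelling {..<n} V \<and> C V \<and>
      better \<sigma> n T V)" for T
    unfolding labellings_iff[OF R] C_def ..
  have "w \<in> SF_VE \<sigma> \<longleftrightarrow> (\<forall>U. labelling {..<n} U \<longrightarrow> (\<exists>V. labelling {..<n} V \<and> verify \<sigma> (length w) n (acc w) U V))"
  proof
    assume "w \<in> SF_VE \<sigma>"
    with 1 obtain g where g: "g < n" "legal (length w) n (acc w) g" "L \<in> labellings \<sigma> {..<n} R" "L'
        \<in> semifactuals \<sigma> {..<n} R g L" by blast
    then have L': "L' \<in> labellings \<sigma> {..<n} R" "L g = L' g"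
      "\<And>U. U \<in> labellings \<sigma> {..<n} R \<Longrightarrow> L g = U g \<Longrightarrow> \<not> distance {..<n} L L' < distance {..<n} L U"
      by (auto simp: semifactuals_def)
    have l: "C L" "C L'" "\<And>V. labelling {..<n} V \<Longrightarrow> C V \<Longrightarrow> \<not> better \<sigma> n L V \<and> \<not> better \<sigma> n L' V"
      using g(3) L'(1) unfolding lb by blast+
    show "\<forall>U. labelling {..<n} U \<longrightarrow> (\<exists>V. labelling {..<n} V \<and> verify \<sigma> (length w) n (acc w) U V)"
    proof (intro allI impI)
      fix U assume U: "labelling {..<n} U"
      show "\<exists>V. labelling {..<n} V \<and> verify \<sigma> (length w) n (acc w) U V"
      proof (cases "C U \<and> U g = L g \<and> distance {..<n} L L' < distance {..<n} L U")
        case True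
        then have "U \<notin> labellings \<sigma> {..<n} R" using L'(3)[of U] by auto
        then obtain V where "labelling {..<n} V" "C V" "better \<sigma> n U V" using lb U True by blast
        then show ?thesis unfolding v using g(1,2) l L'(2) U by metis
      next
        case False
        then show ?thesis unfolding v using g(1,2) l L'(2) U by metis
      qed
    qed
  next
    assume a: "\<forall>U. labelling {..<n} U \<longrightarrow> (\<exists>V. labelling {..<n} V \<and> verify \<sigma> (length w) n (acc w) U V)"
    then obtain g where g: "g < n" "legal (length w) n (acc w) g" "C L" "C L'" "L g = L' g"
      unfolding v using lab(1) by blast
    have *: "C U \<longrightarrow> \<not> better \<sigma> n L U \<and> \<not> better \<sigma> n L' U \<and>
        (U g = L g \<and> distance {..<n} L L' < distance {..<n} L U \<longrightarrow> (\<exists>V. labelling {..<n} V \<and> C V \<and>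
            better \<sigma> n U V))"
      if "labelling {..<n} U" for U
      using a[rule_format, OF that] uniq[OF g(2) _ g(1)] unfolding v by metis
    have "L \<in> labellings \<sigma> {..<n} R" "L' \<in> labellings \<sigma> {..<n} R" unfolding lb using * g lab by blast+
    moreover have "\<not> distance {..<n} L L' < distance {..<n} L U" if "U \<in> labellings \<sigma> {..<n} R" "L g
        = U g" for U
      using that(1) *[of U] that(2) unfolding lb by auto
    ultimately have "L' \<in> semifactuals \<sigma> {..<n} R g L" unfolding semifactuals_def using g(5) by blast
    with g \<open>L \<in> _\<close> show "w \<in> SF_VE \<sigma>" unfolding 1 by blast
  qed
  then show ?thesis by (simp add: n_def Let_def)
qed

section \<open>Polynomial-time check of the certificates\<close>

definition BF :: "((nat \<Rightarrow> bool list) \<Rightarrow> nat \<Rightarrow> bool) \<Rightarrow> bool" where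
  "BF b \<longleftrightarrow> (\<forall>f. PF f \<longrightarrow> PP (\<lambda>ws e. b ws (f ws e)))"

definition PL :: "((nat \<Rightarrow> bool list) \<Rightarrow> nat \<Rightarrow> label) \<Rightarrow> bool" where
  "PL l \<longleftrightarrow> BF (\<lambda>ws x. l ws x = In) \<and> BF (\<lambda>ws x. l ws x = Out)"

definition RF :: "((nat \<Rightarrow> bool list) \<Rightarrow> nat \<Rightarrow> nat \<Rightarrow> bool) \<Rightarrow> bool" where
  "RF r \<longleftrightarrow> (\<forall>f g. PF f \<longrightarrow> PF g \<longrightarrow> PP (\<lambda>ws e. r ws (f ws e) (g ws e)))"

lemma BF_D: "BF b \<Longrightarrow> PF f \<Longrightarrow> PP (\<lambda>ws e. b ws (f ws e))"
  by (auto simp: BF_def)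

lemma RF_D: "RF r \<Longrightarrow> PF f \<Longrightarrow> PF g \<Longrightarrow> PP (\<lambda>ws e. r ws (f ws e) (g ws e))"
  by (auto simp: RF_def)

lemma PL_In: "PL l \<Longrightarrow> PF f \<Longrightarrow> PP (\<lambda>ws e. l ws (f ws e) = In)"
  using BF_D[of "\<lambda>ws x. l ws x = In"] by (simp add: PL_def)

lemma PL_Out: "PL l \<Longrightarrow> PF f \<Longrightarrow> PP (\<lambda>ws e. l ws (f ws e) = Out)"
  using BF_D[of "\<lambda>ws x. l ws x = Out"] by (simp add: PL_def)

lemma PL_Und: "PL l \<Longrightarrow> PF f \<Longrightarrow> PP (\<lambda>ws e. l ws (f ws e) = Und)"
  by (rule PP_cong[OF PP_conj[OF PP_not[OF PL_In] PP_not[OF PL_Out]]]) (assumption | metis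
      label.exhaust label.distinct)+

lemma PL_eq:
  assumes "PL l" "PL l'" "PF f" "PF f'"
  shows "PP (\<lambda>ws e. l ws (f ws e) = l' ws (f' ws e))"
  by (rule PP_cong[OF PP_conj[OF PP_iff[OF PL_In PL_In] PP_iff[OF PL_Out PL_Out]],
        OF assms(1,3) assms(2,4) assms(1,3) assms(2,4)]) (metis label.exhaust label.distinct)

lemma BF_acc: "BF (\<lambda>ws. acc (ws k))"
  unfolding BF_def acc_def by (intro allI impI PP_bit)

lemma BF_shift: "BF b \<Longrightarrow> PF (\<lambda>ws e. c ws) \<Longrightarrow> BF (\<lambda>ws x. b ws (c ws + x))"
  unfolding BF_def by (blast intro: PF_add)

lemma PF_leading:
  assumes "BF b" "PF (\<lambda>ws e. m ws)"
  shows "PF (\<lambda>ws e. leading (b ws) (m ws))"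
  unfolding leading_def
  by (intro PF_sum[where g = "\<lambda>ws x e. of_bool (\<forall>y<Suc x. b ws y)"] assms(2) PF_of_bool PP_all
      PF_Suc PF_arg BF_D[OF assms(1)])

lemma PL_lab_bits:
  assumes "BF c" "PF (\<lambda>ws e. n ws)"
  shows "PL (\<lambda>ws. lab_bits (n ws) (c ws))"
  unfolding PL_def BF_def
proof (intro conjI allI impI)
  fix f assume f: "PF f"
  have "PP (\<lambda>ws e. f ws e < n ws \<and> c ws (2 * f ws e))"
    by (intro pf_intros f assms(2) BF_D[OF assms(1)])
  then show "PP (\<lambda>ws e. lab_bits (n ws) (c ws) (f ws e) = In)" by (rule PP_cong) (simp add: lab_bits_def)
  have "PP (\<lambda>ws e. f ws e < n ws \<and> \<not> c ws (2 * f ws e) \<and> c ws (2 * f ws e + 1))"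
    by (intro pf_intros f assms(2) BF_D[OF assms(1)])
  then show "PP (\<lambda>ws e. lab_bits (n ws) (c ws) (f ws e) = Out)" by (rule PP_cong) (simp add: lab_bits_def)
qed

lemma PP_base_ext:
  assumes "PF (\<lambda>ws e. n ws)" "RF r" "PL l"
  shows "PP (\<lambda>ws e. base_ext \<sigma> (n ws) (r ws) (l ws))"
  unfolding base_ext_def
  by (intro PP_all PP_ex PP_conj PP_iff PP_imp PP_not PP_const PF_arg PL_In[OF assms(3)] PL_Out[OF
      assms(3)] PL_Und[OF assms(3)]
      RF_D[OF assms(2)] assms(1))

lemma PP_better:
  assumes "PF (\<lambda>ws e. n ws)" "PL l" "PL l'"
  shows "PP (\<lambda>ws e. better \<sigma> (n ws) (l ws) (l' ws))"
  unfolding better_def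
  by (intro PP_all PP_ex PP_conj PP_disj PP_imp PP_not PP_const PF_arg PL_In[OF assms(2)] PL_Und[OF assms(2)]
      PL_In[OF assms(3)] PL_Und[OF assms(3)] assms(1))

lemma PP_verify:
  assumes "PF (\<lambda>ws e. m ws)" "PF (\<lambda>ws e. n ws)" "BF b" "PL U" "PL V"
  shows "PP (\<lambda>ws e. verify \<sigma> (m ws) (n ws) (b ws) (U ws) (V ws))"
proof -
  have r: "RF (\<lambda>ws. rel_bits (n ws) (b ws))"
    unfolding RF_def rel_bits_def by (intro allI impI BF_D[OF assms(3)] pf_intros assms(2))
  have L: "PL (\<lambda>ws. lab_bits (n ws) (labL (n ws) (b ws)))" "PL (\<lambda>ws. lab_bits (n ws) (labL' (n ws) (b ws)))"
    by (intro PL_lab_bits BF_shift assms(3) pf_intros assms(2))+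
  have leg: "PP (\<lambda>ws e. legal (m ws) (n ws) (b ws) (f ws e))" if f: "PF f" for f
    unfolding legal_def
    by (intro PP_all PP_conj PP_iff PP_not PP_eq BF_D[OF assms(3)] PF_arg PF_add PF_mult PF_const
        assms(1,2) PF_ren[OF f, of Suc])
  have S: "PF (\<lambda>ws e. \<Sum>a<n ws. (of_bool (l ws a \<noteq> l' ws a) :: nat))" if "PL l" "PL l'" for l l'
    by (intro PF_sum[where g = "\<lambda>ws a e. of_bool (l ws a \<noteq> l' ws a)"] assms(2) PF_of_bool PP_not
        PL_eq that PF_arg)
  show ?thesis
    unfolding verify_def Let_def
    by (intro PP_ex PP_conj PP_imp PP_not PP_less S leg PF_arg assms PP_base_ext PP_better PL_eq L r)
qed

lemma lab_bits_labelling: "labelling {..<n} (lab_bits n c)"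
  by (simp add: labelling_def lab_bits_def)

lemma lab_bits_surj:
  assumes "labelling {..<n} U" "2 * n \<le> k"
  shows "\<exists>u. length u = k \<and> lab_bits n (acc u) = U"
proof (intro exI conjI)
  show "lab_bits n (acc (map (lbit U) [0..<k])) = U"
  proof
    fix i
    have "\<not> i < n \<Longrightarrow> U i = Und" using assms(1) by (simp add: labelling_def)
    then show "lab_bits n (acc (map (lbit U) [0..<k])) i = U i"
      using assms(2) by (cases "U i") (auto simp: lab_bits_def acc_def lbit_def)
  qed
qed simp

lemma verify_short: "verify \<sigma> m n b U V \<Longrightarrow> 2 * n \<le> m"
  by (auto simp: verify_def legal_def)

text \<open>Every word denotes a labelling via \<open>lab_bits\<close>, and by
  \<open>verify_short\<close> an input that passes is long enough for each labelling to be denoted.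
  \<open>v\<close> has twice the length of \<open>w\<close> because it will be guessed by a machine
  whose input is \<open>w\<close> followed by \<open>u\<close>.\<close>

lemma SF_VE_words:
  "w \<in> SF_VE \<sigma> \<longleftrightarrow> (\<forall>u. length u = length w \<longrightarrow> (\<exists>v. length v = 2 * length w \<and>
     (let n = leading (acc w) (length w) in verify \<sigma> (length w) n (acc w) (lab_bits n (acc u))
         (lab_bits n (acc v)))))"
proof -
  define n where "n = leading (acc w) (length w)"
  let ?v = "verify \<sigma> (length w) n (acc w)"
  have "w \<in> SF_VE \<sigma> \<longleftrightarrow> (\<forall>U. labelling {..<n} U \<longrightarrow> (\<exists>V. labelling {..<n} V \<and> ?v U V))"
    by (simp add: SF_VE_iff n_def Let_def)
  also have "\<dots> \<longleftrightarrow> (\<forall>u. length u = length w \<longrightarrow> (\<exists>v. length v = 2 * length w \<and> ?v (lab_bits n (acc u))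
      (lab_bits n (acc v))))"
  proof (intro iffI allI impI)
    fix u :: "bool list"
    assume "\<forall>U. labelling {..<n} U \<longrightarrow> (\<exists>V. labelling {..<n} V \<and> ?v U V)"
    then obtain V where V: "labelling {..<n} V" "?v (lab_bits n (acc u)) V" using lab_bits_labelling by blast
    with verify_short[OF V(2)] lab_bits_surj[OF V(1), of "2 * length w"]
    show "\<exists>v. length v = 2 * length w \<and> ?v (lab_bits n (acc u)) (lab_bits n (acc v))" by auto
  next
    fix U assume a: "\<forall>u. length u = length w \<longrightarrow> (\<exists>v. length v = 2 * length w \<and> ?v (lab_bits n (acc
        u)) (lab_bits n (acc v)))"
      and U: "labelling {..<n} U"
    \<comment> \<open>The word \<open>w\<close> itself serves as a trial certificate, merely to
      learn that the input is long enough.\<close>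
    from a[rule_format, of w] verify_short have "2 * n \<le> length w" by blast
    from lab_bits_surj[OF U this] a lab_bits_labelling
    show "\<exists>V. labelling {..<n} V \<and> ?v U V" by metis
  qed
  finally show ?thesis by (simp add: n_def Let_def)
qed

lemma pair_1 [simp]: "pair w u 1 = u"
  using pair_simps(2)[of w u 0] by (simp del: pair_simps)

lemma word_of_append:
  "word_of (\<lambda>ws e. length (ws 0) + length (ws 1)) (\<lambda>ws e. of_bool (if e 0 < length (ws 0) then acc
      (ws 0) (e 0)
     else acc (ws 1) (e 0 - length (ws 0)))) (pair w u) = w @ u"
  unfolding word_of_def by (rule nth_equalityI) (auto simp: nth_append acc_def simp del: One_nat_def)

text \<open>As \<open>better\<close> never holds here, the inner quantifier collapses
  (\<open>V\<close> may be taken to be \<open>U\<close>), and a single guess refutes a wrong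
  input.\<close>

lemma SF_VE_coNP:
  assumes "\<sigma> \<in> {Complete, Stable}"
  shows "SF_VE \<sigma> \<in> coNP"
proof -
  define v where "v ws = (let n = leading (acc (ws 0)) (length (ws 0)); U = lab_bits n (acc (ws 1)) in
    verify \<sigma> (length (ws 0)) n (acc (ws 0)) U U)" for ws :: "nat \<Rightarrow> bool list"
  have "PF (\<lambda>ws e. of_bool (\<not> v ws))"
    unfolding v_def Let_def
    by (intro PF_of_bool PP_not PP_verify PL_lab_bits BF_acc PF_length PF_leading[OF BF_acc PF_length])
  from NP_I[OF PF_length[of 0] this]
  have "{w. \<exists>u. length u = length w \<and> \<not> v (pair w u)} \<in> NP" by simp
  moreover have "\<not> better \<sigma> n L T" for n L T
    using assms by (auto simp: better_def)
  then have nb: "verify \<sigma> m n b U V \<longleftrightarrow> verify \<sigma> m n b U U" for m n b U V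
    unfolding verify_def Let_def by simp
  have "- SF_VE \<sigma> = {w. \<exists>u. length u = length w \<and> \<not> v (pair w u)}"
  proof -
    have "w \<in> SF_VE \<sigma> \<longleftrightarrow> (\<forall>u. length u = length w \<longrightarrow> v (pair w u))" for w
    proof -
      have "\<exists>z :: bool list. length z = 2 * length w" by (rule Ex_list_of_length)
      then show ?thesis
        unfolding SF_VE_words v_def Let_def using nb One_nat_def by (metis pair_simps)
    qed
    then show ?thesis by auto
  qed
  ultimately show ?thesis by (simp add: coNP_def co_def)
qed

lemma SF_VE_Pi2p:
  shows "SF_VE \<sigma> \<in> Pi2p"
proof -
  \<comment> \<open>A query is an input followed by a certificate of equal length and is taken apart
    at its middle.\<close>
  let ?m = "\<lambda>ws :: nat \<Rightarrow> bool list. length (ws 0) div 2"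
  let ?b = "\<lambda>(ws :: nat \<Rightarrow> bool list) x. x < ?m ws \<and> acc (ws 0) x"
  define v where "v ws = (let n = leading (?b ws) (?m ws) in
    verify \<sigma> (?m ws) n (?b ws) (lab_bits n (\<lambda>x. acc (ws 0) (?m ws + x))) (lab_bits n (acc (ws 1))))" for ws
  have m: "PF (\<lambda>ws e. ?m ws)" by (intro pf_intros)
  have b: "BF ?b" unfolding BF_def by (intro allI impI PP_conj PP_less m BF_D[OF BF_acc])
  have "PF (\<lambda>ws e. of_bool (v ws))"
    unfolding v_def Let_def
    by (intro PF_of_bool PP_verify PL_lab_bits BF_acc BF_shift b m PF_leading[OF b m])
  from NP_I[OF PF_length[of 0] this]
  have O: "{q. \<exists>u. length u = length q \<and> v (pair q u)} \<in> NP" (is "?O \<in> NP") by simp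
  have l: "PF (\<lambda>ws e. length (ws 0) + length (ws 1))" by (intro pf_intros)
  have g: "PF (\<lambda>ws e. of_bool (if e 0 < length (ws 0) then acc (ws 0) (e 0) else acc (ws 1) (e 0 -
      length (ws 0))))"
    by (intro PF_of_bool PP_if PP_less PF_arg PF_length BF_D[OF BF_acc] PF_minus)
  have "{w. \<exists>u. length u = length w \<and> w @ u \<notin> ?O} \<in> Sigma2p"
    using Sigma2p_I[OF PF_length[of 0] l g O] unfolding word_of_append by simp
  moreover have "- SF_VE \<sigma> = {w. \<exists>u. length u = length w \<and> w @ u \<notin> ?O}"
  proof -
    have "w @ u \<in> ?O \<longleftrightarrow> (\<exists>v. length v = 2 * length w \<and>
        (let n = leading (acc w) (length w) in verify \<sigma> (length w) n (acc w) (lab_bits n (acc u))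
            (lab_bits n (acc v))))"
      if "length u = length w" for w u
    proof -
      have "(\<lambda>x. x < length w \<and> acc (w @ u) x) = acc w" "(\<lambda>x. acc (w @ u) (length w + x)) = acc u"
        using that by (auto simp: acc_def nth_append fun_eq_iff)
      moreover have "?m (pair (w @ u) z) = length w" for z using that by simp
      ultimately show ?thesis using that by (simp add: v_def Let_def mult_2)
    qed
    then show ?thesis unfolding SF_VE_words set_eq_iff Compl_iff mem_Collect_eq not_all not_imp by metis
  qed
  ultimately show ?thesis by (simp add: Pi2p_def co_def)
qed

section \<open>Computations as locally checkable tableaux\<close>

text \<open>Steps are recorded by codes: the number of a transition, then idling in a halting
  configuration, a positive and a negative oracle answer (not checked for truth here).\<close>

definition halted :: "tm \<Rightarrow> nat \<Rightarrow> nat list \<Rightarrow> bool" where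
  "halted M q ss \<longleftrightarrow> \<not> (\<exists>y n. tm_oracle M = Some (q, y, n)) \<and> \<not> (\<exists>q' as. (q, ss, q', as) \<in> tm_delta M)"

definition scan :: "tape list \<Rightarrow> nat list" where
  "scan ts = map (\<lambda>t. t 0) ts"

definition gstep :: "tm \<Rightarrow> transition list \<Rightarrow> nat \<Rightarrow> config \<Rightarrow> config \<Rightarrow> bool" where
  "gstep M dl d c c' \<longleftrightarrow>
     d < length dl \<and> \<not> (\<exists>y n. tm_oracle M = Some (fst c, y, n)) \<and>
       (\<exists>as. dl ! d = (fst c, scan (snd c), fst c', as) \<and> snd c' = map2 tape_act as (snd c)) \<or>
     d = length dl \<and> halted M (fst c) (scan (snd c)) \<and> c' = c \<or>
     d = length dl + 1 \<and> (\<exists>y n. tm_oracle M = Some (fst c, y, n) \<and> c' = (y, snd c)) \<or>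
     d = length dl + 2 \<and> (\<exists>y n. tm_oracle M = Some (fst c, y, n) \<and> c' = (n, snd c))"

text \<open>Tapes move under a fixed head, at cell \<open>T\<close> of the table. A cell is copied
  from the old cell that moves onto it, except where the freshly written symbol arrives;
  \<open>place\<close> tells which of the three cells around the head, if any, is concerned.\<close>

fun cell_value :: "nat \<times> move \<Rightarrow> nat \<Rightarrow> nat \<Rightarrow> nat \<Rightarrow> nat \<Rightarrow> nat" where
  "cell_value (s, MoveLeft) p cm c0 cp = (if p = 2 then s else cm)"
| "cell_value (s, Stay) p cm c0 cp = (if p = 1 then s else c0)"
| "cell_value (s, MoveRight) p cm c0 cp = (if p = 0 then s else cp)"

definition place :: "nat \<Rightarrow> nat \<Rightarrow> nat" where
  "place T x = (if x + 1 = T then 0 else if x = T then 1 else if x = T + 1 then 2 else 3)"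

lemma cell_value_act:
  "tape_act a t (int x - int T) = cell_value a (place T x) (t (int x - 1 - int T)) (t (int x - int
      T)) (t (int x + 1 - int T))"
proof (cases a)
  case (Pair s m)
  then show ?thesis by (cases m) (auto simp: place_def algebra_simps)
qed

definition local_step :: "tm \<Rightarrow> transition list \<Rightarrow> nat \<Rightarrow> nat \<Rightarrow> nat \<Rightarrow> nat \<Rightarrow> nat \<Rightarrow> nat \<Rightarrow> nat \<Rightarrow> nat \<Rightarrow> nat
    \<Rightarrow> nat list \<Rightarrow> bool" where
  "local_step M dl k p q q' d cm c0 cp new ss \<longleftrightarrow>
     d < length dl \<and> \<not> (\<exists>y n. tm_oracle M = Some (q, y, n)) \<and>
       (\<exists>as. dl ! d = (q, ss, q', as) \<and> new = cell_value (as ! k) p cm c0 cp) \<or>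
     d = length dl \<and> halted M q ss \<and> q' = q \<and> new = c0 \<or>
     d = length dl + 1 \<and> (\<exists>y n. tm_oracle M = Some (q, y, n) \<and> q' = y) \<and> new = c0 \<or>
     d = length dl + 2 \<and> (\<exists>y n. tm_oracle M = Some (q, y, n) \<and> q' = n) \<and> new = c0"

text \<open>Constraining only a window that shrinks by one cell per step on either side keeps all
  neighbours available, so the border of the table needs no rule of its own.\<close>

definition tableau :: "tm \<Rightarrow> transition list \<Rightarrow> nat \<Rightarrow> (nat \<Rightarrow> nat) \<Rightarrow> (nat \<Rightarrow> nat) \<Rightarrow> (nat \<Rightarrow> nat \<Rightarrow> nat \<Rightarrow>
    nat) \<Rightarrow> bool" where
  "tableau M dl T st tr cl \<longleftrightarrow> (\<forall>t<T. \<forall>k<tm_tapes M. \<forall>x. t + 1 \<le> x \<and> x + t + 1 \<le> 2 * T \<longrightarrow>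
     local_step M dl k (place T x) (st t) (st (Suc t)) (tr t) (cl t k (x - 1)) (cl t k x) (cl t k (x + 1))
       (cl (Suc t) k x) (map (\<lambda>j. cl t j T) [0..<tm_tapes M]))"

text \<open>Cell \<open>x\<close> of the tableau is tape cell \<open>x - T\<close>; at time \<open>t\<close> it is correct for
  \<open>\<bar>x - T\<bar> \<le> T - t\<close>.\<close>

definition depicts :: "tm \<Rightarrow> nat \<Rightarrow> (nat \<Rightarrow> nat) \<Rightarrow> (nat \<Rightarrow> nat \<Rightarrow> nat \<Rightarrow> nat) \<Rightarrow> nat \<Rightarrow> config \<Rightarrow> bool" where
  "depicts M T st cl t c \<longleftrightarrow> st t = fst c \<and> length (snd c) = tm_tapes M \<and>
     (\<forall>k<tm_tapes M. \<forall>x. t \<le> x \<and> x + t \<le> 2 * T \<longrightarrow> cl t k x = (snd c ! k) (int x - int T))"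

lemma step_sound:
  assumes wf: "well_formed M" "set dl = tm_delta M" and tab: "tableau M dl T st tr cl"
    and dep: "depicts M T st cl t c" and t: "t < T"
  shows "\<exists>c'. gstep M dl (tr t) c c' \<and> depicts M T st cl (Suc t) c'"
proof -
  let ?K = "tm_tapes M"
  have K: "0 < ?K" using wf(1) by (simp add: well_formed_def)
  obtain q ts where c: "c = (q, ts)" by force
  have len: "length ts = ?K" and q: "st t = q" using dep c by (auto simp: depicts_def)
  have cl: "cl t k x = (ts ! k) (int x - int T)" if "k < ?K" "t \<le> x" "x + t \<le> 2 * T" for k x
    using dep c that by (simp add: depicts_def)
  have ss: "map (\<lambda>j. cl t j T) [0..<?K] = scan ts"
    by (rule nth_equalityI) (use len cl t in \<open>auto simp: scan_def\<close>)
  have ls: "local_step M dl k (place T x) q (st (Suc t)) (tr t) (cl t k (x - 1)) (cl t k x) (cl t k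
      (x + 1)) (cl (Suc t) k x) (scan ts)"
    if "k < ?K" "t + 1 \<le> x" "x + t + 1 \<le> 2 * T" for k x
    using tab t that q unfolding tableau_def ss[symmetric] by blast
  \<comment> \<open>Cell \<open>T\<close> lies in the window at every time before \<open>T\<close>;
    the next state and the step code are read off there.\<close>
  have l0: "local_step M dl 0 (place T T) q (st (Suc t)) (tr t) (cl t 0 (T - 1)) (cl t 0 T) (cl t 0
      (T + 1)) (cl (Suc t) 0 T) (scan ts)"
    by (rule ls) (use K t in auto)
  have stay: "depicts M T st cl (Suc t) (st (Suc t), ts)"
    if "\<And>k x. k < ?K \<Longrightarrow> t + 1 \<le> x \<Longrightarrow> x + t + 1 \<le> 2 * T \<Longrightarrow> cl (Suc t) k x = cl t k x"
    using that cl len by (auto simp: depicts_def)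
  consider "tr t < length dl" | "tr t = length dl" | "tr t = length dl + 1" | "tr t = length dl + 2"
    using l0 by (auto simp: local_step_def)
  then show ?thesis
  proof cases
    case 1
    then obtain as where as: "dl ! tr t = (q, scan ts, st (Suc t), as)" "\<not> (\<exists>y n. tm_oracle M = Some
        (q, y, n))"
      using l0 by (auto simp: local_step_def)
    then have "(q, scan ts, st (Suc t), as) \<in> tm_delta M" using 1 wf(2) by (metis nth_mem)
    then have la: "length as = ?K" using wf(1) by (auto simp: well_formed_def)
    have "cl (Suc t) k x = (map2 tape_act as ts ! k) (int x - int T)" if "k < ?K" "t + 1 \<le> x" "x + t
        + 1 \<le> 2 * T" for k x
    proof -
      have "cl (Suc t) k x = cell_value (as ! k) (place T x) (cl t k (x - 1)) (cl t k x) (cl t k (x + 1))"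
        using ls[OF that] 1 as by (auto simp: local_step_def)
      also have "\<dots> = tape_act (as ! k) (ts ! k) (int x - int T)"
        unfolding cell_value_act using that cl[of k "x - 1"] cl[of k x] cl[of k "x + 1"] by (simp
            add: of_nat_diff algebra_simps)
      finally show ?thesis using that len la by simp
    qed
    then have "depicts M T st cl (Suc t) (st (Suc t), map2 tape_act as ts)"
      using len la by (auto simp: depicts_def)
    moreover have "gstep M dl (tr t) c (st (Suc t), map2 tape_act as ts)"
      using 1 as c by (auto simp: gstep_def)
    ultimately show ?thesis by blast
  next
    case 2
    have "cl (Suc t) k x = cl t k x" if "k < ?K" "t + 1 \<le> x" "x + t + 1 \<le> 2 * T" for k x
      using ls[OF that] 2 by (simp add: local_step_def)
    from stay[OF this] show ?thesis using 2 l0 c by (auto simp: local_step_def gstep_def)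
  next
    case 3
    have "cl (Suc t) k x = cl t k x" if "k < ?K" "t + 1 \<le> x" "x + t + 1 \<le> 2 * T" for k x
      using ls[OF that] 3 by (simp add: local_step_def)
    from stay[OF this] show ?thesis using 3 l0 c by (auto simp: local_step_def gstep_def)
  next
    case 4
    have "cl (Suc t) k x = cl t k x" if "k < ?K" "t + 1 \<le> x" "x + t + 1 \<le> 2 * T" for k x
      using ls[OF that] 4 by (simp add: local_step_def)
    from stay[OF this] show ?thesis using 4 l0 c by (auto simp: local_step_def gstep_def)
  qed
qed

lemma tableau_sound:
  assumes "well_formed M" "set dl = tm_delta M" "tableau M dl T st tr cl" "depicts M T st cl 0 c"
  shows "\<exists>cs. cs 0 = c \<and> (\<forall>t\<le>T. depicts M T st cl t (cs t)) \<and> (\<forall>t<T. gstep M dl (tr t) (cs t) (cs (Suc t)))"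
proof -
  define nxt where "nxt t c = (SOME c'. gstep M dl (tr t) c c' \<and> depicts M T st cl (Suc t) c')" for t c
  define cs where "cs = rec_nat c nxt"
  have n: "gstep M dl (tr t) (cs t) (cs (Suc t)) \<and> depicts M T st cl (Suc t) (cs (Suc t))"
    if "t < T" "depicts M T st cl t (cs t)" for t
    using someI_ex[OF step_sound[OF assms(1-3) that(2,1)]] by (simp add: cs_def nxt_def)
  have d: "depicts M T st cl t (cs t)" if "t \<le> T" for t
    using that
  proof (induction t)
    case 0
    then show ?case using assms(4) by (simp add: cs_def)
  next
    case (Suc t)
    then show ?case using n[of t] by simp
  qed
  with n show ?thesis by (intro exI[of _ cs]) (auto simp: cs_def)
qed

lemma gstep_length:
  assumes "well_formed M" "set dl = tm_delta M" "gstep M dl d c c'" "length (snd c) = tm_tapes M"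
  shows "length (snd c') = tm_tapes M"
proof (cases "d < length dl")
  case True
  then obtain as where as: "dl ! d = (fst c, scan (snd c), fst c', as)" "snd c' = map2 tape_act as (snd c)"
    using assms(3) by (auto simp: gstep_def)
  then have "(fst c, scan (snd c), fst c', as) \<in> tm_delta M" using assms(2) True by (metis nth_mem)
  then have "length as = tm_tapes M" using assms(1) by (auto simp: well_formed_def)
  with as assms(4) show ?thesis by simp
qed (use assms(3,4) in \<open>auto simp: gstep_def\<close>)

lemma step_complete:
  assumes wf: "well_formed M" "set dl = tm_delta M" and g: "gstep M dl d c c'" and len: "length (snd
      c) = tm_tapes M" and k: "k < tm_tapes M"
  shows "local_step M dl k (place T x) (fst c) (fst c') d ((snd c ! k) (int x - 1 - int T)) ((snd c
      ! k) (int x - int T))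
     ((snd c ! k) (int x + 1 - int T)) ((snd c' ! k) (int x - int T)) (scan (snd c))"
proof -
  obtain q ts q' ts' where c: "c = (q, ts)" "c' = (q', ts')" by force
  consider (tr) as where "d < length dl" "\<not> (\<exists>y n. tm_oracle M = Some (q, y, n))" "dl ! d = (q, scan
      ts, q', as)" "ts' = map2 tape_act as ts"
    | "d = length dl" "halted M q (scan ts)" "q' = q" "ts' = ts"
    | y n where "d = length dl + 1" "tm_oracle M = Some (q, y, n)" "q' = y" "ts' = ts"
    | y n where "d = length dl + 2" "tm_oracle M = Some (q, y, n)" "q' = n" "ts' = ts"
    using g unfolding gstep_def c by auto
  then show ?thesis
  proof cases
    case tr
    then have "(q, scan ts, q', as) \<in> tm_delta M" using wf(2) by (metis nth_mem)
    then have "length as = tm_tapes M" using wf(1) by (auto simp: well_formed_def)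
    then have "(ts' ! k) (int x - int T) = tape_act (as ! k) (ts ! k) (int x - int T)" using tr len
        k c by simp
    then show ?thesis using tr unfolding cell_value_act by (auto simp: local_step_def c)
  qed (auto simp: local_step_def c)
qed

lemma tableau_complete:
  assumes wf: "well_formed M" "set dl = tm_delta M" and g: "\<And>t. t < T \<Longrightarrow> gstep M dl (ds t) (cs t) (cs (Suc t))"
    and len: "length (snd (cs 0)) = tm_tapes M"
  shows "tableau M dl T (\<lambda>t. fst (cs t)) ds (\<lambda>t k x. (snd (cs t) ! k) (int x - int T))"
  unfolding tableau_def
proof (intro allI impI)
  have l: "length (snd (cs t)) = tm_tapes M" if "t \<le> T" for t
    using that by (induction t) (use len gstep_length[OF wf g] in auto)
  fix t k x assume t: "t < T" and k: "k < tm_tapes M" and x: "t + 1 \<le> x \<and> x + t + 1 \<le> 2 * T"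
  have "map (\<lambda>j. (snd (cs t) ! j) (int T - int T)) [0..<tm_tapes M] = scan (snd (cs t))"
    by (rule nth_equalityI) (use l[of t] t in \<open>auto simp: scan_def\<close>)
  then show "local_step M dl k (place T x) (fst (cs t)) (fst (cs (Suc t))) (ds t) ((snd (cs t) ! k)
      (int (x - 1) - int T))
     ((snd (cs t) ! k) (int x - int T)) ((snd (cs t) ! k) (int (x + 1) - int T)) ((snd (cs (Suc t))
         ! k) (int x - int T))
     (map (\<lambda>j. (snd (cs t) ! j) (int T - int T)) [0..<tm_tapes M])"
    using step_complete[OF wf g[OF t] _ k, where x = x and T = T] l[of t] t x by (simp add:
        of_nat_diff algebra_simps)
qed

section \<open>Truthful oracle answers and acceptance\<close>

definition truthful :: "tm \<Rightarrow> transition list \<Rightarrow> bool list set \<Rightarrow> nat \<Rightarrow> config \<Rightarrow> bool" where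
  "truthful M dl X d c \<longleftrightarrow> (d = length dl + 1 \<longrightarrow> (\<exists>v\<in>X. tape_holds (last (snd c)) v)) \<and>
     (d = length dl + 2 \<longrightarrow> \<not> (\<exists>v\<in>X. tape_holds (last (snd c)) v))"

lemma gstep_tm_step:
  assumes "set dl = tm_delta M" "gstep M dl d c c'" "truthful M dl X d c" "d \<noteq> length dl"
  shows "tm_step M X c c'"
proof -
  obtain q ts where c: "c = (q, ts)" by force
  from assms(2,4) consider (tr) as where "d < length dl" "\<not> (\<exists>y n. tm_oracle M = Some (q, y, n))"
      "dl ! d = (q, scan ts, fst c', as)" "snd c' = map2 tape_act as ts"
    | (yes) y n where "d = length dl + 1" "tm_oracle M = Some (q, y, n)" "c' = (y, ts)"
    | (no) y n where "d = length dl + 2" "tm_oracle M = Some (q, y, n)" "c' = (n, ts)"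
    unfolding gstep_def c by auto
  then show ?thesis
  proof cases
    case tr
    then have "(q, map (\<lambda>t. t 0) ts, fst c', as) \<in> tm_delta M" using assms(1) by (metis nth_mem scan_def)
    from tm_step.move[OF this tr(2)] tr(4) show ?thesis by (metis c prod.collapse)
  next
    case yes
    then show ?thesis using assms(3) tm_step.query_yes[of M q y n X ts] c by (simp add: truthful_def)
  next
    case no
    then show ?thesis using assms(3) tm_step.query_no[of M q y n X ts] c by (simp add: truthful_def)
  qed
qed

lemma tm_step_gstep:
  assumes "set dl = tm_delta M" "tm_step M X c c'"
  shows "\<exists>d. gstep M dl d c c' \<and> truthful M dl X d c \<and> d \<noteq> length dl \<and> d < length dl + 3"
  using assms(2)
proof cases
  case (move q ts q' as)
  then obtain d where "d < length dl" "dl ! d = (q, map (\<lambda>t. t 0) ts, q', as)" using assms(1) by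
      (metis in_set_conv_nth)
  with move show ?thesis by (intro exI[of _ d]) (auto simp: gstep_def truthful_def scan_def)
next
  case (query_yes q y n ts)
  then show ?thesis by (intro exI[of _ "length dl + 1"]) (auto simp: gstep_def truthful_def)
next
  case (query_no q y n ts)
  then show ?thesis by (intro exI[of _ "length dl + 2"]) (auto simp: gstep_def truthful_def)
qed

lemma halted_iff: "halted M (fst c) (scan (snd c)) \<longleftrightarrow> \<not> (\<exists>c'. tm_step M X c c')"
proof
  assume h: "halted M (fst c) (scan (snd c))"
  show "\<not> (\<exists>c'. tm_step M X c c')"
    using h by (auto simp: halted_def scan_def elim!: tm_step.cases)
next
  assume n: "\<not> (\<exists>c'. tm_step M X c c')"
  obtain q ts where c: "c = (q, ts)" by force
  have 1: "\<not> (\<exists>y n. tm_oracle M = Some (q, y, n))"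
  proof
    assume "\<exists>y n. tm_oracle M = Some (q, y, n)"
    then obtain y m where "tm_oracle M = Some (q, y, m)" by blast
    then show False using n c tm_step.query_yes[of M q y m X ts] tm_step.query_no[of M q y m X ts] by blast
  qed
  then have "\<not> (\<exists>q' as. (q, scan ts, q', as) \<in> tm_delta M)"
    using n c tm_step.move[of q ts _ _ M X] by (auto simp: scan_def)
  with 1 c show "halted M (fst c) (scan (snd c))" by (simp add: halted_def)
qed

text \<open>Idling demands a halting configuration and leaves it unchanged, and in such a
  configuration no other step applies.\<close>

lemma idle_forever:
  assumes "\<And>t. t < T \<Longrightarrow> gstep M dl (ds t) (cs t) (cs (Suc t))" "set dl = tm_delta M" "s < T" "ds s = length dl"
  shows "s \<le> t \<Longrightarrow> t \<le> T \<Longrightarrow> cs t = cs s \<and> (t < T \<longrightarrow> ds t = length dl)"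
proof (induction t rule: nat_induct_at_least)
  case base
  then show ?case using assms(4) by simp
next
  case (Suc t)
  then have t: "cs t = cs s" "ds t = length dl" by auto
  have e: "cs (Suc t) = cs s" using assms(1)[of t] t Suc by (auto simp: gstep_def)
  have "halted M (fst (cs s)) (scan (snd (cs s)))" using assms(1)[OF assms(3)] assms(4) by (auto
      simp: gstep_def)
  then have "ds (Suc t) = length dl" if "Suc t < T"
    using assms(1)[OF that] e assms(2) unfolding gstep_def halted_def by (metis nth_mem)
  with e show ?case by simp
qed

text \<open>Computations of different lengths are padded by idling to the common length
  \<open>T\<close>. Conversely \<open>T\<close> real steps would exceed the time bound, so some step
  idles, and the first such step marks a halting configuration.\<close>

lemma accepts_iff_gsteps:
  assumes "well_formed M" "set dl = tm_delta M" "\<And>n c. (tm_step M X ^^ n) (initial M w) c \<Longrightarrow> n < T"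
  shows "accepts M X w \<longleftrightarrow> (\<exists>cs ds. cs 0 = initial M w \<and> (\<forall>t<T. gstep M dl (ds t) (cs t) (cs (Suc t))
      \<and> ds t < length dl + 3 \<and>
     truthful M dl X (ds t) (cs t)) \<and> fst (cs T) = tm_accept M)"
proof
  assume "accepts M X w"
  then obtain c where c: "(tm_step M X)\<^sup>*\<^sup>* (initial M w) c" "\<not> (\<exists>c'. tm_step M X c c')" "fst c = tm_accept M"
    by (auto simp: accepts_def halts_at_def)
  then obtain n f where f: "f 0 = initial M w" "f n = c" "\<forall>i<n. tm_step M X (f i) (f (Suc i))" "n < T"
    using assms(3) unfolding rtranclp_power by (metis relpowp_fun_conv)
  then obtain g where g: "\<And>i. i < n \<Longrightarrow> gstep M dl (g i) (f i) (f (Suc i)) \<and> truthful M dl X (g i) (f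
      i) \<and> g i < length dl + 3"
  proof -
    have "\<forall>i. \<exists>d. i < n \<longrightarrow> gstep M dl d (f i) (f (Suc i)) \<and> truthful M dl X d (f i) \<and> d < length dl + 3"
      using f(3) tm_step_gstep[OF assms(2)] by meson
    then show thesis using that by metis
  qed
  let ?cs = "\<lambda>t. f (min t n)" and ?ds = "\<lambda>t. if t < n then g t else length dl"
  have "gstep M dl (?ds t) (?cs t) (?cs (Suc t)) \<and> ?ds t < length dl + 3 \<and> truthful M dl X (?ds t)
      (?cs t)" for t
  proof (cases "t < n")
    case True
    then show ?thesis using g[OF True] by simp
  next
    case False
    then show ?thesis using f(2) c(2) halted_iff[of M c X] by (auto simp: gstep_def truthful_def)
  qed
  then show "\<exists>cs ds. cs 0 = initial M w \<and> (\<forall>t<T. gstep M dl (ds t) (cs t) (cs (Suc t)) \<and> ds t <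
      length dl + 3 \<and>
     truthful M dl X (ds t) (cs t)) \<and> fst (cs T) = tm_accept M"
    using f c(3) by (intro exI[of _ ?cs] exI[of _ ?ds]) auto
next
  assume "\<exists>cs ds. cs 0 = initial M w \<and> (\<forall>t<T. gstep M dl (ds t) (cs t) (cs (Suc t)) \<and> ds t < length dl + 3 \<and>
     truthful M dl X (ds t) (cs t)) \<and> fst (cs T) = tm_accept M"
  then obtain cs ds where cs: "cs 0 = initial M w" "\<And>t. t < T \<Longrightarrow> gstep M dl (ds t) (cs t) (cs (Suc t))"
    "\<And>t. t < T \<Longrightarrow> truthful M dl X (ds t) (cs t)" "fst (cs T) = tm_accept M" by blast
  have path: "(tm_step M X ^^ s) (initial M w) (cs s)" if "s \<le> T" "\<forall>t<s. ds t \<noteq> length dl" for s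
  proof -
    have "tm_step M X (cs i) (cs (Suc i))" if "i < s" for i
      using gstep_tm_step[OF assms(2) cs(2) cs(3)] that \<open>s \<le> T\<close> \<open>\<forall>t<s. _ t\<close> by simp
    then show ?thesis unfolding relpowp_fun_conv using cs(1) by blast
  qed
  have "\<exists>s<T. ds s = length dl"
    using path[of T] assms(3)[of T "cs T"] by blast
  then obtain s where s: "s < T" "ds s = length dl" "\<forall>t<s. ds t \<noteq> length dl"
  proof -
    let ?P = "\<lambda>s. s < T \<and> ds s = length dl"
    have "?P (LEAST s. ?P s)" using \<open>\<exists>s<T. ds s = length dl\<close> by (rule LeastI_ex)
    moreover have "\<forall>t<(LEAST s. ?P s). ds t \<noteq> length dl"
      using not_less_Least[of _ ?P] calculation by (meson dual_order.strict_trans)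
    ultimately show thesis using that by blast
  qed
  have "(tm_step M X)\<^sup>*\<^sup>* (initial M w) (cs s)" using path[of s] s unfolding rtranclp_power by auto
  moreover have "cs T = cs s" using idle_forever[OF cs(2) assms(2) s(1,2), of T] s(1) by simp
  moreover have "\<not> (\<exists>c'. tm_step M X (cs s) c')" using cs(2)[OF s(1)] s(2) halted_iff[of M "cs s" X]
      by (auto simp: gstep_def)
  ultimately show "accepts M X w" unfolding accepts_def halts_at_def using cs(4) by metis
qed

section \<open>Reductions from local constraint systems\<close>

lemma PP_table:
  assumes "\<forall>f\<in>set fs. PF f \<and> (\<forall>ws e. f ws e < D)"
  shows "PP (\<lambda>ws e. G (map (\<lambda>f. f ws e) fs))"
  unfolding PP_def
  by (rule PF_cong[OF PF_table[where fs = fs and D = D and G = "\<lambda>xs. of_bool (G xs)"]]) (use assms in auto)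

fun num :: "nat \<Rightarrow> (nat \<Rightarrow> nat) \<Rightarrow> nat \<Rightarrow> nat" where
  "num D f 0 = 0"
| "num D f (Suc k) = f 0 + D * num D (\<lambda>i. f (Suc i)) k"

definition digit :: "nat \<Rightarrow> nat \<Rightarrow> nat \<Rightarrow> nat" where
  "digit D b i = b div D ^ i mod D"

lemma num_less: "(\<And>i. i < k \<Longrightarrow> f i < D) \<Longrightarrow> num D f k < D ^ k"
proof (induction k arbitrary: f)
  case (Suc k)
  have "num D (\<lambda>i. f (Suc i)) k < D ^ k" by (rule Suc.IH) (use Suc.prems in auto)
  then have "D * (num D (\<lambda>i. f (Suc i)) k + 1) \<le> D * D ^ k" by (intro mult_le_mono2) simp
  with Suc.prems[of 0] show ?case by simp
qed simp

lemma digit_num: "(\<And>i. i < k \<Longrightarrow> f i < D) \<Longrightarrow> i < k \<Longrightarrow> digit D (num D f k) i = f i"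
proof (induction k arbitrary: f i)
  case (Suc k)
  show ?case
  proof (cases i)
    case 0
    then show ?thesis using Suc.prems(1)[of 0] by (simp add: digit_def)
  next
    case (Suc j)
    have "(f 0 + D * num D (\<lambda>i. f (Suc i)) k) div D = num D (\<lambda>i. f (Suc i)) k"
      using Suc.prems(1)[of 0] by simp
    then have "digit D (num D f (Suc k)) i = digit D (num D (\<lambda>i. f (Suc i)) k) j"
      by (simp add: digit_def Suc div_mult2_eq)
    also have "\<dots> = f (Suc j)" by (rule Suc.IH) (use Suc.prems Suc in auto)
    finally show ?thesis by (simp add: Suc)
  qed
qed simp

lemma digit_less: "0 < D \<Longrightarrow> digit D b i < D"
  by (simp add: digit_def)

lemma PF_digit: "PF f \<Longrightarrow> PF (\<lambda>ws e. digit D (f ws e) i)"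
  unfolding digit_def by (intro pf_intros)

lemma PP_finite_ex: "(\<And>i. i < n \<Longrightarrow> PP (P i)) \<Longrightarrow> PP (\<lambda>ws e. \<exists>i<n::nat. P i ws e)"
proof (induction n)
  case (Suc n)
  have "PP (\<lambda>ws e. P n ws e \<or> (\<exists>i<n. P i ws e))" by (intro PP_disj Suc) auto
  then show ?case by (rule PP_cong) (auto simp: less_Suc_eq)
qed (simp add: PP_const)

text \<open>\<open>SF_VE\<close> is a set of words, so a word might belong to it on behalf of
  another instance; unique decodability excludes this.\<close>

lemma encode_SF_VE:
  assumes "R \<subseteq> {..<n} \<times> {..<n}" "g < n" "L \<in> labellings \<sigma> {..<n} R" "labelling {..<n} L'"
  shows "encode n R g L L' \<in> SF_VE \<sigma> \<longleftrightarrow> L' \<in> semifactuals \<sigma> {..<n} R g L"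
proof
  assume "encode n R g L L' \<in> SF_VE \<sigma>"
  then obtain n' R' g' M M' where w: "encode n R g L L' = encode n' R' g' M M'" "R' \<subseteq> {..<n'} \<times>
      {..<n'}" "g' < n'"
      "M \<in> labellings \<sigma> {..<n'} R'" "labelling {..<n'} M'" "M' \<in> semifactuals \<sigma> {..<n'} R' g' M"
    by (auto simp: SF_VE_def)
  have l: "labelling {..<n} L" "labelling {..<n'} M"
    using labellings_clab[OF assms(1,3)] labellings_clab[OF w(2,4)] by (auto simp: clab_def)
  note d = decode_encode[OF refl assms(1,2) l(1) assms(4)] and d' = decode_encode[OF w(1) w(2,3) l(2) w(5)]
  have n: "n' = n" using d(1) d'(1) by simp
  have "R' = R" using d(3) d'(3) w(2) assms(1) unfolding n by auto
  moreover have "g' = g" using d(2) d'(2) assms(2) w(3) unfolding n legal_def by blast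
  moreover have "M = L" "M' = L'" using d(4,5) d'(4,5) unfolding n by auto
  ultimately show "L' \<in> semifactuals \<sigma> {..<n} R g L" using w(6) n by simp
next
  assume "L' \<in> semifactuals \<sigma> {..<n} R g L"
  with assms show "encode n R g L L' \<in> SF_VE \<sigma>" unfolding SF_VE_def by blast
qed

type_synonym wfun = "bool list \<Rightarrow> nat \<Rightarrow> nat"

text \<open>Constraint \<open>c < N w\<close> depends on finitely many features of \<open>c\<close> and on the values at
  finitely many addresses; clause \<open>c D\<^sup>k + b\<close> of the framework forbids the pattern \<open>b\<close> of values.\<close>

locale system =
  fixes D :: nat and feats adrs :: "wfun list" and G :: "nat list \<Rightarrow> nat list \<Rightarrow> bool" and N B ::
      "bool list \<Rightarrow> nat"
    and isY :: "nat \<Rightarrow> bool"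
  assumes D: "0 < D"
    and feats: "\<And>\<phi>. \<phi> \<in> set feats \<Longrightarrow> PF (\<lambda>ws e. \<phi> (ws 0) (e 0))" "\<And>\<phi> w c. \<phi> \<in> set feats \<Longrightarrow> \<phi> w c < D"
    and adrs: "\<And>a. a \<in> set adrs \<Longrightarrow> PF (\<lambda>ws e. a (ws 0) (e 0))" "\<And>a w c. a \<in> set adrs \<Longrightarrow> c < N w \<Longrightarrow> a w c < B w"
    and NB: "PF (\<lambda>ws e. N (ws 0))" "PF (\<lambda>ws e. B (ws 0))"
    and isY: "PP (\<lambda>ws e. isY (e 0))"
begin

abbreviation "kk \<equiv> length adrs"

definition holds :: "bool list \<Rightarrow> (nat \<Rightarrow> nat) \<Rightarrow> bool" where
  "holds w u \<longleftrightarrow> (\<forall>c<N w. G (map (\<lambda>\<phi>. \<phi> w c) feats) (map (\<lambda>a. u (a w c)) adrs))"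

definition bad :: "bool list \<Rightarrow> nat \<Rightarrow> bool" where
  "bad w j \<longleftrightarrow> j div D ^ kk < N w \<and>
     \<not> G (map (\<lambda>\<phi>. \<phi> w (j div D ^ kk)) feats) (map (\<lambda>i. digit D (j mod D ^ kk) i) [0..<kk])"

text \<open>The literals of a clause are the values that deviate from the forbidden pattern at one
  of its addresses.\<close>

definition opp :: "bool list \<Rightarrow> nat \<Rightarrow> nat \<Rightarrow> bool" where
  "opp w j x \<longleftrightarrow> (\<exists>i<kk. (adrs ! i) w (j div D ^ kk) = x div D \<and> digit D (j mod D ^ kk) i \<noteq> x mod D)"

text \<open>One number serves for all kinds of arguments: it exceeds the number
  \<open>N w * D ^ kk\<close> of clauses and the number \<open>B w * D\<close> of literals, and
  \<open>D\<close> divides it as the locale demands.\<close>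

definition Q :: "bool list \<Rightarrow> nat" where
  "Q w = D ^ Suc kk * (N w + B w + 1)"

lemma gadget: "gadget (Q w) D"
  using D by (auto simp: gadget_def Q_def)

lemma SAT_holds:
  assumes "\<And>v. u v < D"
  shows "gadget.SAT (Q w) D (opp w) (bad w) u \<longleftrightarrow> holds w u"
  unfolding gadget.SAT_def[OF gadget]
proof
  assume s: "\<forall>j<Q w. bad w j \<longrightarrow> (\<exists>x<Q w. x mod D = u (x div D) \<and> opp w j x)"
  show "holds w u"
    unfolding holds_def
  proof (intro allI impI, rule ccontr)
    fix c assume c: "c < N w" and n: "\<not> G (map (\<lambda>\<phi>. \<phi> w c) feats) (map (\<lambda>a. u (a w c)) adrs)"
    \<comment> \<open>The pattern taken by \<open>u\<close> at the violated constraint; the clause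
      that forbids it contains no true literal.\<close>
    define b where "b = num D (\<lambda>i. u ((adrs ! i) w c)) kk"
    have b: "b < D ^ kk" "\<And>i. i < kk \<Longrightarrow> digit D b i = u ((adrs ! i) w c)"
      unfolding b_def using num_less digit_num assms by auto
    define j where "j = c * D ^ kk + b"
    have j: "j div D ^ kk = c" using b(1) by (intro div_nat_eqI) (auto simp: j_def mult.commute)
    then have j2: "j mod D ^ kk = b" by (simp add: modulo_nat_def j_def)
    note j = j j2
    have "map (\<lambda>i. digit D b i) [0..<kk] = map (\<lambda>a. u (a w c)) adrs"
      by (rule nth_equalityI) (auto simp: b(2))
    then have bd: "bad w j" unfolding bad_def j using c n by simp
    have "j < (c + 1) * D ^ kk" using b(1) by (simp add: j_def)
    also have "\<dots> \<le> (N w + B w + 1) * D ^ kk" using c by (intro mult_le_mono1) simp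
    also have "\<dots> \<le> (N w + B w + 1) * D ^ Suc kk" using D by (intro mult_le_mono2) simp
    also have "\<dots> = Q w" by (simp only: Q_def mult.commute)
    finally obtain x where "x < Q w" "x mod D = u (x div D)" "opp w j x" using s bd by blast
    then show False unfolding opp_def j using b(2) by auto
  qed
next
  assume h: "holds w u"
  show "\<forall>j<Q w. bad w j \<longrightarrow> (\<exists>x<Q w. x mod D = u (x div D) \<and> opp w j x)"
  proof (intro allI impI)
    fix j assume "bad w j"
    define c where "c = j div D ^ kk"
    have c: "c < N w" "\<not> G (map (\<lambda>\<phi>. \<phi> w c) feats) (map (\<lambda>i. digit D (j mod D ^ kk) i) [0..<kk])"
      using \<open>bad w j\<close> by (auto simp: bad_def c_def)
    have "map (\<lambda>i. digit D (j mod D ^ kk) i) [0..<kk] \<noteq> map (\<lambda>a. u (a w c)) adrs"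
      using h c unfolding holds_def by metis
    moreover have "map (\<lambda>i. digit D (j mod D ^ kk) i) [0..<kk] = map (\<lambda>a. u (a w c)) adrs"
      if "\<forall>i<kk. digit D (j mod D ^ kk) i = u ((adrs ! i) w c)"
      by (rule nth_equalityI) (use that in auto)
    ultimately obtain i where i: "i < kk" "digit D (j mod D ^ kk) i \<noteq> u ((adrs ! i) w c)" by blast
    let ?a = "(adrs ! i) w c"
    have "?a * D + u ?a < (?a + 1) * D" using assms by simp
    also have "\<dots> \<le> B w * D" using adrs(2)[of "adrs ! i" c w] i(1) c(1) by (intro mult_le_mono1)
        (simp add: Suc_le_eq)
    also have "\<dots> \<le> (N w + B w + 1) * (D ^ Suc kk)" using D by (intro mult_le_mono) auto
    finally have "?a * D + u ?a < Q w" by (simp add: Q_def mult.commute)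
    moreover have "(?a * D + u ?a) mod D = u ?a" using assms by simp
    moreover have "(?a * D + u ?a) div D = ?a" using assms by (intro div_nat_eqI) (auto simp: mult.commute)
    ultimately show "\<exists>x<Q w. x mod D = u (x div D) \<and> opp w j x"
      unfolding opp_def c_def[symmetric] using i by (intro exI[of _ "?a * D + u ?a"]) auto
  qed
qed

lemma PF_feat: "\<phi> \<in> set feats \<Longrightarrow> PF f \<Longrightarrow> PF (\<lambda>ws e. \<phi> (ws 0) (f ws e))"
  using PF_comp1[of "\<lambda>ws. \<phi> (ws 0)"] feats(1) by simp

lemma PF_adr: "a \<in> set adrs \<Longrightarrow> PF f \<Longrightarrow> PF (\<lambda>ws e. a (ws 0) (f ws e))"
  using PF_comp1[of "\<lambda>ws. a (ws 0)"] adrs(1) by simp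

text \<open>Features and digits lie below \<open>D\<close>, so \<open>G\<close> is a finite table
  and may be any predicate.\<close>

lemma PP_bad:
  assumes "PF f"
  shows "PP (\<lambda>ws e. bad (ws 0) (f ws e))"
proof -
  let ?fs = "map (\<lambda>\<phi> ws e. \<phi> (ws 0) (f ws e div D ^ kk)) feats @ map (\<lambda>i ws e. digit D (f ws e mod D
      ^ kk) i) [0..<kk]"
  let ?G = "\<lambda>xs. \<not> G (take (length feats) xs) (drop (length feats) xs)"
  have ft: "PF (\<lambda>ws e. \<phi> (ws 0) (f ws e div D ^ kk))" if "\<phi> \<in> set feats" for \<phi>
    using PF_feat[OF that, of "\<lambda>ws e. f ws e div D ^ kk"] PF_div[OF assms PF_const] by simp
  have dg: "PF (\<lambda>ws e. digit D (f ws e mod D ^ kk) i)" for i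
    by (rule PF_digit[OF PF_mod[OF assms PF_const]])
  have fs: "(\<exists>\<phi>\<in>set feats. h = (\<lambda>ws e. \<phi> (ws 0) (f ws e div D ^ kk))) \<or> (\<exists>i. h = (\<lambda>ws e. digit D (f
      ws e mod D ^ kk) i))"
    if "h \<in> set ?fs" for h using that by auto
  have "\<forall>h\<in>set ?fs. PF h \<and> (\<forall>ws e. h ws e < D)"
  proof
    fix h assume "h \<in> set ?fs"
    from fs[OF this] show "PF h \<and> (\<forall>ws e. h ws e < D)"
    proof (elim disjE bexE exE)
      fix \<phi> assume p: "\<phi> \<in> set feats" and h: "h = (\<lambda>ws e. \<phi> (ws 0) (f ws e div D ^ kk))"
      show ?thesis unfolding h using ft[OF p] feats(2)[OF p] by blast
    next
      fix i assume h: "h = (\<lambda>ws e. digit D (f ws e mod D ^ kk) i)"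
      show ?thesis unfolding h using dg digit_less[OF D] by blast
    qed
  qed
  then have "PP (\<lambda>ws e. ?G (map (\<lambda>h. h ws e) ?fs))" by (rule PP_table)
  then have "PP (\<lambda>ws e. f ws e div D ^ kk < N (ws 0) \<and> ?G (map (\<lambda>h. h ws e) ?fs))"
    by (rule PP_conj[OF PP_less[OF PF_div[OF assms PF_const] NB(1)]])
  then show ?thesis by (rule PP_cong) (simp add: bad_def comp_def)
qed

lemma PP_opp:
  assumes "PF f" "PF g"
  shows "PP (\<lambda>ws e. opp (ws 0) (f ws e) (g ws e))"
  unfolding opp_def
proof (rule PP_finite_ex)
  fix i assume "i < kk"
  then have "PF (\<lambda>ws e. (adrs ! i) (ws 0) (f ws e div D ^ kk))"
    by (intro PF_adr[OF nth_mem] PF_div assms PF_const)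
  then show "PP (\<lambda>ws e. (adrs ! i) (ws 0) (f ws e div D ^ kk) = g ws e div D \<and> digit D (f ws e mod D
      ^ kk) i \<noteq> g ws e mod D)"
    by (intro PP_conj PP_eq PP_not PF_digit PF_div PF_mod PF_const assms)
qed

lemma PP_isY: "PF f \<Longrightarrow> PP (\<lambda>ws e. isY (f ws e))"
  using PP_comp1[of "\<lambda>ws. isY"] isY by simp

lemma PP_att:
  assumes "PF k" "PF x" "PF l" "PF y"
  shows "PP (\<lambda>ws e. att D isY (opp (ws 0)) (bad (ws 0)) sw self (k ws e) (x ws e) (l ws e) (y ws e))"
  unfolding att_def
  by (intro PP_disj PP_conj PP_not PP_eq PP_le PP_const PF_const PF_div PP_isY PP_opp PP_bad assms)

lemma base_lab_In: "gadget.base_lab sw self k x = In \<longleftrightarrow> (if sw then k = 4 else if self then 4 \<le> k else 3 \<le> k)"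
  unfolding gadget.base_lab_def[OF gadget] by auto

lemma base_lab_Out:
  "gadget.base_lab sw self k x = Out \<longleftrightarrow> (if sw then k = 0 \<or> k = 2 \<or> k = 5 \<or> k = 7 else \<not> self \<and> k < 3)"
  unfolding gadget.base_lab_def[OF gadget] by auto

lemma PF_Q: "PF (\<lambda>ws e. Q (ws 0))"
  unfolding Q_def by (intro pf_intros NB)

lemma PP_lbit:
  assumes "PF f"
  shows "PP (\<lambda>ws e. lbit (lab_of (Q (ws 0)) (gadget.base_lab sw self)) (f ws e))"
proof -
  have "PP (\<lambda>ws e. f ws e div 2 < 9 * Q (ws 0) \<and> (if f ws e mod 2 = 0
      then (if sw then f ws e div 2 mod 9 = 4 else if self then 4 \<le> f ws e div 2 mod 9 else 3 \<le> f ws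
          e div 2 mod 9)
      else (if sw then f ws e div 2 mod 9 = 0 \<or> f ws e div 2 mod 9 = 2 \<or> f ws e div 2 mod 9 = 5 \<or> f
          ws e div 2 mod 9 = 7
        else \<not> self \<and> f ws e div 2 mod 9 < 3)))"
    by (intro PP_conj PP_disj PP_if PP_not PP_const PP_le PP_less PP_eq pf_intros PF_Q assms)
  then show ?thesis
    by (rule PP_cong) (simp add: lbit_def lab_of_def base_lab_In base_lab_Out)
qed

text \<open>The base labelling fills both places of the instance. Its label at an argument depends
  on the kind alone, so it is computed without solving the system.\<close>

lemma reduction:
  assumes "\<not> sw \<and> (\<forall>v. \<not> isY v) \<and> \<sigma> = (if self then Complete else Stable) \<or> sw \<and> self \<and> \<sigma> \<in>
      {Preferred, SemiStable}"
  shows "\<exists>f. poly_time_computable f \<and> (\<forall>w. f w \<in> SF_VE_inputs \<sigma>) \<and> (\<forall>w. f w \<in> SF_VE \<sigma> \<longleftrightarrow>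
    \<not> (if sw then \<exists>u. (\<forall>v. u v < D) \<and> \<not> (\<exists>u'. (\<forall>v. u' v < D) \<and> (\<forall>v. isY v \<longrightarrow> u' v = u v) \<and> holds w u')
       else \<exists>u. (\<forall>v. u v < D) \<and> holds w u))"
proof -
  define R where "R w = gadget_rel (Q w) D isY (opp w) (bad w) sw self" for w
  define L where "L w = lab_of (Q w) (gadget.base_lab sw self)" for w
  define g where "g = (if sw then 3 else 4 :: nat)"
  let ?n = "\<lambda>ws :: nat \<Rightarrow> bool list. 9 * Q (ws 0)"
  let ?l = "\<lambda>(ws :: nat \<Rightarrow> bool list) (e :: nat \<Rightarrow> nat). ?n ws * ?n ws + 6 * ?n ws + 1"
  let ?g = "\<lambda>(ws :: nat \<Rightarrow> bool list) (e :: nat \<Rightarrow> nat). of_bool (encode_bit (?n ws) (R (ws 0)) g (L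
      (ws 0)) (L (ws 0)) (e 0)) :: nat"
  have l: "PF ?l" by (intro pf_intros PF_Q)
  have R: "PP (\<lambda>ws e. (f ws e, h ws e) \<in> R (ws 0))" if "PF f" "PF h" for f h
    unfolding R_def gadget_rel_def mem_Collect_eq prod.case by (intro PP_conj PP_less PP_att
        pf_intros PF_Q that)
  have lb: "PP (\<lambda>ws e. lbit (L (ws 0)) (f ws e))" if "PF f" for f unfolding L_def by (rule PP_lbit[OF that])
  have "PF ?g"
    unfolding encode_bit_def by (intro PF_of_bool PP_if PP_less PP_const PP_eq R lb pf_intros PF_Q)
  from poly_time_computable_I[OF l this]
  have "poly_time_computable (\<lambda>w. word_of ?l ?g (\<lambda>_. w))" .
  moreover have "word_of ?l ?g (\<lambda>_. w) = encode (9 * Q w) (R w) g (L w) (L w)" for w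
    by (simp add: word_of_def encode_eq del: upt_Suc)
  ultimately have pt: "poly_time_computable (\<lambda>w. encode (9 * Q w) (R w) g (L w) (L w))" by simp
  have Rs: "R w \<subseteq> {..<9 * Q w} \<times> {..<9 * Q w}" for w unfolding R_def by (rule gadget.R_sub[OF gadget])
  have gl: "g < 9 * Q w" for w using gadget[of w] by (auto simp: g_def gadget_def)
  have key: "L w \<in> labellings \<sigma> {..<9 * Q w} (R w) \<and> (L w \<in> semifactuals \<sigma> {..<9 * Q w} (R w) g (L w) \<longleftrightarrow>
     \<not> (if sw then \<exists>u. (\<forall>v. u v < D) \<and> \<not> (\<exists>u'. (\<forall>v. u' v < D) \<and> (\<forall>v. isY v \<longrightarrow> u' v = u v) \<and> holds w u')
       else \<exists>u. (\<forall>v. u v < D) \<and> holds w u))" for w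
  proof (cases sw)
    case True
    then have a: "sw" self "\<sigma> \<in> {Preferred, SemiStable}" using assms by auto
    have "(\<exists>u. (\<forall>v. u v < D) \<and> \<not> (\<exists>u'. (\<forall>v. u' v < D) \<and> (\<forall>v. isY v \<longrightarrow> u' v = u v) \<and> gadget.SAT (Q w)
        D (opp w) (bad w) u')) \<longleftrightarrow>
      (\<exists>u. (\<forall>v. u v < D) \<and> \<not> (\<exists>u'. (\<forall>v. u' v < D) \<and> (\<forall>v. isY v \<longrightarrow> u' v = u v) \<and> holds w u'))"
    proof -
      have "(\<forall>v. u' v < D) \<and> (\<forall>v. isY v \<longrightarrow> u' v = u v) \<and> gadget.SAT (Q w) D (opp w) (bad w) u' \<longleftrightarrow>
        (\<forall>v. u' v < D) \<and> (\<forall>v. isY v \<longrightarrow> u' v = u v) \<and> holds w u'" for u u'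
        using SAT_holds[of u' w] by blast
      then show ?thesis by (simp only:)
    qed
    then show ?thesis
      using gadget.switch_gadget[OF gadget[of w] a, where isY = isY and opp = "opp w" and bad = "bad w"] True
      unfolding R_def L_def g_def by (simp only: if_True simp_thms)
  next
    case False
    then have a: "\<not> sw" "\<And>v. \<not> isY v" "\<sigma> = (if self then Complete else Stable)" using assms by auto
    have "(\<exists>u. (\<forall>v. u v < D) \<and> gadget.SAT (Q w) D (opp w) (bad w) u) \<longleftrightarrow> (\<exists>u. (\<forall>v. u v < D) \<and> holds w u)"
    proof -
      have "(\<forall>v. u v < D) \<and> gadget.SAT (Q w) D (opp w) (bad w) u \<longleftrightarrow> (\<forall>v. u v < D) \<and> holds w u" for u
        using SAT_holds[of u w] by blast
      then show ?thesis by (simp only:)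
    qed
    then show ?thesis
      using gadget.simple_gadget[OF gadget[of w] a, where opp = "opp w" and bad = "bad w"] False
      unfolding R_def L_def g_def by (simp only: if_False simp_thms)
  qed
  have "labelling {..<9 * Q w} (L w)" for w by (auto simp: labelling_def L_def lab_of_def)
  then have "encode (9 * Q w) (R w) g (L w) (L w) \<in> SF_VE_inputs \<sigma>" for w
    unfolding SF_VE_inputs_def using Rs gl key by blast
  moreover have "encode (9 * Q w) (R w) g (L w) (L w) \<in> SF_VE \<sigma> \<longleftrightarrow> L w \<in> semifactuals \<sigma> {..<9 * Q w}
      (R w) g (L w)" for w
    by (rule encode_SF_VE[OF Rs gl]) (use key \<open>labelling _ (L w)\<close> in auto)
  ultimately show ?thesis using pt key by blast
qed

end

section \<open>Accepting runs as tables with bounded entries\<close>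

lemma initial_tapes:
  assumes "well_formed M"
  shows "initial M w = (tm_start M, tapes (tm_tapes M) (start w))"
proof -
  have "tape_of w # replicate (tm_tapes M - 1) (\<lambda>_. 0) = tapes (tm_tapes M) (start w)"
    using assms by (intro nth_equalityI) (auto simp: start_def nth_Cons' well_formed_def)
  then show ?thesis by (simp add: initial_def)
qed

text \<open>States and symbols that can occur have to be values of variables. All large
  \<open>D\<close> qualify, so two machines can share one range.\<close>

definition bounds :: "tm \<Rightarrow> nat \<Rightarrow> bool" where
  "bounds M D \<longleftrightarrow> 3 \<le> D \<and> tm_start M < D \<and> (\<forall>(q, ss, q', as)\<in>tm_delta M. q' < D \<and> (\<forall>(s, m)\<in>set as. s < D)) \<and>
     (\<forall>q y n. tm_oracle M = Some (q, y, n) \<longrightarrow> y < D \<and> n < D)"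

lemma ex_bounds:
  assumes "finite (tm_delta M)"
  shows "\<exists>D0. \<forall>D\<ge>D0. bounds M D"
proof -
  let ?S = "{tm_start M} \<union> (\<Union>(q, ss, q', as)\<in>tm_delta M. insert q' (fst ` set as)) \<union>
     (case tm_oracle M of None \<Rightarrow> {} | Some (q, y, n) \<Rightarrow> {y, n})"
  have "finite ?S" using assms by (auto split: option.splits)
  then obtain b where b: "\<forall>x\<in>?S. x < b" using finite_nat_set_iff_bounded by blast
  have "bounds M D" if D: "D \<ge> max b 3" for D
    unfolding bounds_def
  proof (intro conjI)
    show "3 \<le> D" using D by simp
    have lt: "x < D" if "x \<in> ?S" for x using b that D by (meson less_le_trans max.boundedE)
    show "tm_start M < D" by (rule lt) simp
    show "\<forall>(q, ss, q', as)\<in>tm_delta M. q' < D \<and> (\<forall>(s, m)\<in>set as. s < D)"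
    proof (clarify, intro conjI ballI, goal_cases)
      case (1 q ss q' as)
      then show ?case by (intro lt) force
    next
      case (2 q ss q' as p)
      obtain s m where p: "p = (s, m)" by force
      have "s < D" by (rule lt) (use 2 p in \<open>force intro: rev_image_eqI\<close>)
      then show ?case by (simp add: p)
    qed
    show "\<forall>q y n. tm_oracle M = Some (q, y, n) \<longrightarrow> y < D \<and> n < D"
      by (auto intro!: lt)
  qed
  then show ?thesis by blast
qed

definition small :: "nat \<Rightarrow> config \<Rightarrow> bool" where
  "small D c \<longleftrightarrow> fst c < D \<and> (\<forall>t\<in>set (snd c). \<forall>i. t i < D)"

lemma small_initial: "well_formed M \<Longrightarrow> bounds M D \<Longrightarrow> small D (initial M w)"
  unfolding small_def initial_tapes using valid_start[of w]
  by (auto simp: initial_tapes bounds_def valid_def intro: less_le_trans)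

lemma gstep_delta:
  assumes "set dl = tm_delta M" "gstep M dl d c c'" "d < length dl"
  obtains as where "(fst c, scan (snd c), fst c', as) \<in> tm_delta M" "snd c' = map2 tape_act as (snd c)"
  using assms unfolding gstep_def by (metis add_lessD1 less_irrefl nth_mem)

lemma small_step:
  assumes "set dl = tm_delta M" "bounds M D" "gstep M dl d c c'" "small D c"
  shows "small D c'"
proof (cases "d < length dl")
  case True
  then obtain as where as: "(fst c, scan (snd c), fst c', as) \<in> tm_delta M" "snd c' = map2 tape_act
      as (snd c)"
    using gstep_delta assms by blast
  then have b: "fst c' < D" "\<And>s m. (s, m) \<in> set as \<Longrightarrow> s < D" using assms(2) by (auto simp: bounds_def)
  have "t i < D" if t: "t \<in> set (snd c')" for t i
  proof -
    from t as(2) obtain s m t0 where a: "t = tape_act (s, m) t0" "((s, m), t0) \<in> set (zip as (snd c))" by auto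
    then have "(s, m) \<in> set as" "t0 \<in> set (snd c)" by (blast dest: set_zip_leftD set_zip_rightD)+
    then have "s < D" "\<forall>i. t0 i < D" using b(2) assms(4) by (auto simp: small_def)
    then show ?thesis by (simp add: a(1))
  qed
  with b show ?thesis by (auto simp: small_def)
next
  case False
  then show ?thesis using assms(2-4) by (auto simp: gstep_def small_def bounds_def)
qed

text \<open>Heads move at most one cell per step, so the nonblank part of a tape stays near its
  head; this bounds the length of oracle queries.\<close>

definition blank_beyond :: "int \<Rightarrow> config \<Rightarrow> bool" where
  "blank_beyond b c \<longleftrightarrow> (\<forall>t\<in>set (snd c). \<forall>i. \<bar>i\<bar> > b \<longrightarrow> t i = 0)"

lemma blank_beyond_step:
  assumes "set dl = tm_delta M" "gstep M dl d c c'" "blank_beyond b c" "0 \<le> b"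
  shows "blank_beyond (b + 1) c'"
proof (cases "d < length dl")
  case True
  then obtain as where as: "snd c' = map2 tape_act as (snd c)"
    using gstep_delta assms by blast
  show ?thesis
    unfolding blank_beyond_def
  proof (intro ballI allI impI)
    fix t i assume t: "t \<in> set (snd c')" and i: "b + 1 < \<bar>i\<bar>"
    from t as obtain s m t0 where a: "t = tape_act (s, m) t0" "t0 \<in> set (snd c)" by (auto dest:
        set_zip_rightD)
    have "b < \<bar>i + move_offset m\<bar>" "i + move_offset m \<noteq> 0" using i assms(4) by (cases m; simp)+
    then show "t i = 0" using a assms(3) by (simp add: blank_beyond_def)
  qed
next
  case False
  then show ?thesis using assms(2,3) by (auto simp: gstep_def blank_beyond_def)
qed

lemma blank_beyond_initial: "well_formed M \<Longrightarrow> blank_beyond (int (length w)) (initial M w)"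
  by (auto simp: blank_beyond_def initial_tapes start_def tape_of_def)

definition input_at :: "tm \<Rightarrow> nat \<Rightarrow> (nat \<Rightarrow> nat \<Rightarrow> nat) \<Rightarrow> bool list \<Rightarrow> bool" where
  "input_at M T c0 w \<longleftrightarrow> (\<forall>k<tm_tapes M. \<forall>x\<le>2 * T. c0 k x = start w k (int x - int T))"

definition run_on :: "tm \<Rightarrow> transition list \<Rightarrow> nat \<Rightarrow> (nat \<Rightarrow> nat) \<Rightarrow> (nat \<Rightarrow> nat) \<Rightarrow> (nat \<Rightarrow> nat \<Rightarrow> nat \<Rightarrow>
    nat) \<Rightarrow> bool" where
  "run_on M dl T st tr cl \<longleftrightarrow> tableau M dl T st tr cl \<and> st 0 = tm_start M \<and> st T = tm_accept M"

lemma run_sound: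
  assumes "well_formed M" "set dl = tm_delta M" "run_on M dl T st tr cl" "input_at M T (cl 0) w"
  shows "\<exists>cs. cs 0 = initial M w \<and> (\<forall>t\<le>T. depicts M T st cl t (cs t)) \<and>
    (\<forall>t<T. gstep M dl (tr t) (cs t) (cs (Suc t))) \<and> fst (cs T) = tm_accept M"
proof -
  have "depicts M T st cl 0 (initial M w)"
    using assms by (auto simp: depicts_def initial_tapes run_on_def input_at_def)
  from tableau_sound[OF assms(1,2) _ this] assms(3) show ?thesis
    unfolding run_on_def by (metis depicts_def order_refl)
qed

lemma gsteps_length:
  assumes "well_formed M" "set dl = tm_delta M" "cs 0 = initial M w" "\<And>t. t < T \<Longrightarrow> gstep M dl (ds t)
      (cs t) (cs (Suc t))" "t \<le> T"
  shows "length (snd (cs t)) = tm_tapes M"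
  using assms(5)
proof (induction t)
  case 0
  then show ?case using assms(3) initial_tapes[OF assms(1)] by simp
next
  case (Suc t)
  then show ?case using gstep_length[OF assms(1,2,4), of t] by simp
qed

lemma gsteps_small:
  assumes "well_formed M" "set dl = tm_delta M" "bounds M D" "cs 0 = initial M w"
    "\<And>t. t < T \<Longrightarrow> gstep M dl (ds t) (cs t) (cs (Suc t))" "t \<le> T"
  shows "small D (cs t)"
  using assms(6)
proof (induction t)
  case 0
  then show ?case using assms(4) small_initial[OF assms(1,3)] by simp
next
  case (Suc t)
  then show ?case using small_step[OF assms(2,3,5), of t] by simp
qed

lemma gsteps_blank:
  assumes "well_formed M" "set dl = tm_delta M" "cs 0 = initial M w"
    "\<And>t. t < T \<Longrightarrow> gstep M dl (ds t) (cs t) (cs (Suc t))" "t \<le> T"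
  shows "blank_beyond (int (length w + t)) (cs t)"
  using assms(5)
proof (induction t)
  case 0
  then show ?case using blank_beyond_initial[OF assms(1)] assms(3) by simp
next
  case (Suc t)
  then show ?case using blank_beyond_step[OF assms(2,4), of t "int (length w + t)"] by (simp add: add.commute)
qed

lemma run_complete:
  assumes "well_formed M" "set dl = tm_delta M" "bounds M D" "cs 0 = initial M w"
    "\<And>t. t < T \<Longrightarrow> gstep M dl (ds t) (cs t) (cs (Suc t))" "fst (cs T) = tm_accept M"
  obtains st cl where "run_on M dl T st ds cl" "input_at M T (cl 0) w" "\<And>t. t \<le> T \<Longrightarrow> st t < D"
    "\<And>t k x. t \<le> T \<Longrightarrow> k < tm_tapes M \<Longrightarrow> cl t k x < D" "\<And>t. t \<le> T \<Longrightarrow> depicts M T st cl t (cs t)"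
proof
  let ?st = "\<lambda>t. fst (cs t)" and ?cl = "\<lambda>t k x. (snd (cs t) ! k) (int x - int T)"
  have l: "length (snd (cs t)) = tm_tapes M" if "t \<le> T" for t using gsteps_length[OF assms(1,2,4,5)
      that] by blast
  have s: "small D (cs t)" if "t \<le> T" for t using gsteps_small[OF assms(1-4,5) that] by blast
  show "run_on M dl T ?st ds ?cl"
    using tableau_complete[OF assms(1,2,5) l[of 0]] assms(4,6) initial_tapes[OF assms(1), of w] by
        (simp add: run_on_def)
  show "input_at M T (?cl 0) w" using assms(4) initial_tapes[OF assms(1), of w] by (simp add: input_at_def)
  show "?st t < D" if "t \<le> T" for t using s[OF that] by (simp add: small_def)
  show "?cl t k x < D" if "t \<le> T" "k < tm_tapes M" for t k x using s[OF that(1)] l[OF that(1)]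
      that(2) by (auto simp: small_def)
  show "depicts M T ?st ?cl t (cs t)" if "t \<le> T" for t using l[OF that] by (auto simp: depicts_def)
qed

text \<open>The first form derives acceptance from any table; the second supplies a table with
  entries below \<open>D\<close>, that is, one that an assignment can store.\<close>

lemma accepts_iff_run:
  assumes "well_formed M" "set dl = tm_delta M" "oracle_free M" "bounds M D" "length dl < D"
    "\<And>n c. (tm_step M {} ^^ n) (initial M w) c \<Longrightarrow> n < T"
  shows "accepts M {} w \<longleftrightarrow> (\<exists>st tr cl. run_on M dl T st tr cl \<and> input_at M T (cl 0) w)"
    and "accepts M {} w \<longleftrightarrow> (\<exists>st tr cl. run_on M dl T st tr cl \<and> input_at M T (cl 0) w \<and> (\<forall>t\<le>T. st t < D) \<and>
      (\<forall>t<T. tr t < D) \<and> (\<forall>t\<le>T. \<forall>k<tm_tapes M. \<forall>x. cl t k x < D))" (is "_ \<longleftrightarrow> ?R")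
proof -
  have tf: "truthful M dl {} d c \<and> d \<le> length dl" if "gstep M dl d c c'" for d c c'
    using that assms(3) by (auto simp: truthful_def gstep_def oracle_free_def)
  have acc: "accepts M {} w \<longleftrightarrow> (\<exists>cs ds. cs 0 = initial M w \<and> (\<forall>t<T. gstep M dl (ds t) (cs t) (cs (Suc t)) \<and>
      ds t < length dl + 3 \<and> truthful M dl {} (ds t) (cs t)) \<and> fst (cs T) = tm_accept M)"
    by (rule accepts_iff_gsteps[OF assms(1,2)]) (rule assms(6))
  have 1: "accepts M {} w" if r: "run_on M dl T st tr cl" "input_at M T (cl 0) w" for st tr cl
  proof -
    from run_sound[OF assms(1,2) r] obtain cs where cs: "cs 0 = initial M w"
      "\<forall>t<T. gstep M dl (tr t) (cs t) (cs (Suc t))" "fst (cs T) = tm_accept M" by blast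
    have "gstep M dl (tr t) (cs t) (cs (Suc t)) \<and> tr t < length dl + 3 \<and> truthful M dl {} (tr t) (cs
        t)" if "t < T" for t
      using tf[of "tr t" "cs t" "cs (Suc t)"] cs(2) that by simp
    with cs(1,3) show ?thesis unfolding acc by (intro exI[of _ cs] exI[of _ tr]) simp
  qed
  have 2: ?R if "accepts M {} w"
  proof -
    from that[unfolded acc] obtain cs ds where cs: "cs 0 = initial M w"
      "\<And>t. t < T \<Longrightarrow> gstep M dl (ds t) (cs t) (cs (Suc t))" "fst (cs T) = tm_accept M" by blast
    from run_complete[OF assms(1,2,4) cs] obtain st cl where "run_on M dl T st ds cl" "input_at M T
        (cl 0) w" "\<And>t. t \<le> T \<Longrightarrow> st t < D"
      "\<And>t k x. t \<le> T \<Longrightarrow> k < tm_tapes M \<Longrightarrow> cl t k x < D" by metis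
    moreover have "ds t < D" if "t < T" for t using tf[OF cs(2)[OF that]] assms(5) by simp
    ultimately show ?R by (intro exI[of _ st] exI[of _ ds] exI[of _ cl]) simp
  qed
  show "accepts M {} w \<longleftrightarrow> ?R"
    by (rule iffI, erule 2) (elim exE conjE, erule (1) 1)
  show "accepts M {} w \<longleftrightarrow> (\<exists>st tr cl. run_on M dl T st tr cl \<and> input_at M T (cl 0) w)"
  proof
    assume "accepts M {} w"
    from 2[OF this] show "\<exists>st tr cl. run_on M dl T st tr cl \<and> input_at M T (cl 0) w" by (elim exE
        conjE) (intro exI conjI)
  qed (elim exE conjE, erule (1) 1)
qed

text \<open>Local form of the condition that a machine is started on the word held by a tape \<open>f\<close>: a cell
  is blank as soon as its left neighbour or the corresponding cell of \<open>f\<close> is.\<close>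

definition copy_cell :: "nat \<Rightarrow> nat \<Rightarrow> nat \<Rightarrow> bool \<Rightarrow> bool" where
  "copy_cell new left f first \<longleftrightarrow> new = (if \<not> first \<and> left = 0 \<or> f = 0 then 0 else f) \<and> new < 3"

text \<open>The word ends at the first blank of \<open>f\<close>, which \<open>E\<close> guarantees
  to exist. From there on blanks propagate along the new tape, and before it the condition
  \<open>new < 3\<close> makes each symbol a bit.\<close>

lemma copy_cells:
  assumes "f E = 0" "E \<le> m"
  shows "(\<forall>i\<le>m. copy_cell (c i) (c (i - 1)) (f i) (i = 0)) \<longleftrightarrow>
    (\<exists>v. length v \<le> E \<and> (\<forall>i<length v. f i = bit_symbol (v ! i)) \<and> f (length v) = 0 \<and> (\<forall>i\<le>m. c i =
        tape_of v (int i)))"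
proof
  assume h: "\<forall>i\<le>m. copy_cell (c i) (c (i - 1)) (f i) (i = 0)"
  define l where "l = (LEAST i. f i = 0)"
  have l: "f l = 0" "\<And>i. i < l \<Longrightarrow> f i \<noteq> 0" "l \<le> E"
    unfolding l_def using assms(1) by (auto intro: LeastI Least_le dest: not_less_Least)
  have lo: "c i = f i \<and> f i < 3" if "i < l" for i
    using that
  proof (induction i)
    case 0
    then show ?case using h[rule_format, of 0] l(2)[of 0] by (simp add: copy_cell_def)
  next
    case (Suc i)
    then show ?case using h[rule_format, of "Suc i"] l(2)[of "Suc i"] l(2)[of i] l(3) assms(2) by
        (simp add: copy_cell_def)
  qed
  have hi: "c i = 0" if "l \<le> i" "i \<le> m" for i
    using that
  proof (induction i rule: nat_induct_at_least)
    case base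
    then show ?case using h[rule_format, of l] l(1) by (simp add: copy_cell_def)
  next
    case (Suc i)
    then show ?case using h[rule_format, of "Suc i"] by (simp add: copy_cell_def)
  qed
  define v where "v = map (\<lambda>i. f i = 2) [0..<l]"
  then have lv: "length v = l" by simp
  have b: "f i = bit_symbol (v ! i)" if "i < l" for i
  proof -
    have "f i = 1 \<or> f i = 2" using l(2)[OF that] lo[OF that] by linarith
    then show ?thesis using that by (auto simp: v_def)
  qed
  have "c i = tape_of v (int i)" if "i \<le> m" for i
  proof (cases "i < l")
    case True
    then show ?thesis using lo[OF True] b[OF True] lv by (simp add: tape_of_def)
  next
    case False
    then show ?thesis using hi[of i] that lv by (simp add: tape_of_def)
  qed
  then show "\<exists>v. length v \<le> E \<and> (\<forall>i<length v. f i = bit_symbol (v ! i)) \<and> f (length v) = 0 \<and> (\<forall>i\<le>m.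
      c i = tape_of v (int i))"
    using b l(1,3) by (intro exI[of _ v]) (simp add: lv)
next
  assume "\<exists>v. length v \<le> E \<and> (\<forall>i<length v. f i = bit_symbol (v ! i)) \<and> f (length v) = 0 \<and> (\<forall>i\<le>m. c i
      = tape_of v (int i))"
  then obtain v where v: "\<And>i. i < length v \<Longrightarrow> f i = bit_symbol (v ! i)" "f (length v) = 0" "\<And>i. i \<le> m
      \<Longrightarrow> c i = tape_of v (int i)" by blast
  show "\<forall>i\<le>m. copy_cell (c i) (c (i - 1)) (f i) (i = 0)"
  proof (intro allI impI)
    fix i assume i: "i \<le> m"
    have p: "0 < bit_symbol x" "bit_symbol x < 3" for x by (rule bit_symbol_bounds)+
    consider "i < length v" | "i = length v" | "i > length v" by linarith
    then show "copy_cell (c i) (c (i - 1)) (f i) (i = 0)"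
    proof cases
      case 1
      then have "c i = f i" "0 < f i" "f i < 3" using v(1,3)[of i] i p by (auto simp: tape_of_def)
      moreover have "c (i - 1) \<noteq> 0" using v(3)[of "i - 1"] 1 i p by (simp add: tape_of_def)
      ultimately show ?thesis by (simp add: copy_cell_def)
    next
      case 2
      then show ?thesis using v(2) v(3)[of i] i by (simp add: copy_cell_def tape_of_def)
    next
      case 3
      then have "c (i - 1) = 0" "c i = 0" using v(3)[of "i - 1"] v(3)[of i] i by (auto simp: tape_of_def)
      then show ?thesis using 3 by (simp add: copy_cell_def)
    qed
  qed
qed

section \<open>Hardness\<close>

text \<open>Variables are addressed by a tag, a run, a time, a tape and a cell. The tags 0, 1, 2 stand for the
  states, steps and cells of the computation, 3, 4, 5 for those of the runs certifying positive oracle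
  answers (run \<open>r\<close> belongs to a query at time \<open>r\<close>), 6, 7, 8 for those of a run refuting a negative
  answer, 9 marks the refuted answer, and the values with tag 10 link all constraints.\<close>

definition ad :: "nat \<Rightarrow> nat \<Rightarrow> nat \<Rightarrow> nat \<Rightarrow> nat \<Rightarrow> nat \<Rightarrow> nat" where
  "ad S tag r t k x = 11 * (r + S * (t + S * (k + S * x))) + tag"

definition st_of :: "nat \<Rightarrow> (nat \<Rightarrow> nat) \<Rightarrow> nat \<Rightarrow> nat \<Rightarrow> nat \<Rightarrow> nat" where
  "st_of S u tag r t = u (ad S tag r t 0 0)"

definition tr_of :: "nat \<Rightarrow> (nat \<Rightarrow> nat) \<Rightarrow> nat \<Rightarrow> nat \<Rightarrow> nat \<Rightarrow> nat" where
  "tr_of S u tag r t = u (ad S (tag + 1) r t 0 0)"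

definition cl_of :: "nat \<Rightarrow> (nat \<Rightarrow> nat) \<Rightarrow> nat \<Rightarrow> nat \<Rightarrow> nat \<Rightarrow> nat \<Rightarrow> nat \<Rightarrow> nat" where
  "cl_of S u tag r t k x = u (ad S (tag + 2) r t k x)"

definition block_vals :: "nat \<Rightarrow> nat \<Rightarrow> nat \<Rightarrow> nat \<Rightarrow> nat \<Rightarrow> (nat \<Rightarrow> nat) \<Rightarrow> (nat \<Rightarrow> nat) \<Rightarrow> (nat \<Rightarrow> nat \<Rightarrow> nat
    \<Rightarrow> nat) \<Rightarrow> nat list" where
  "block_vals K T t k x st tr cl = [st t, st (Suc t), tr t, cl t k (x - 1), cl t k x, cl t k (x +
      1), cl (Suc t) k x, st 0, st T] @
     map (\<lambda>j. cl t j T) [0..<K]"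

text \<open>Start and accepting state are tested in every constraint, not only at the ends of the
  run; this keeps the constraints uniform. The values from index 9 on are the symbols scanned by the
  heads.\<close>

definition block_ok :: "tm \<Rightarrow> transition list \<Rightarrow> nat \<Rightarrow> nat \<Rightarrow> nat \<Rightarrow> nat list \<Rightarrow> bool" where
  "block_ok M dl b p k v \<longleftrightarrow>
     (b = 1 \<longrightarrow> local_step M dl k p (v ! 0) (v ! 1) (v ! 2) (v ! 3) (v ! 4) (v ! 5) (v ! 6) (drop 9 v)) \<and>
     v ! 7 = tm_start M \<and> v ! 8 = tm_accept M"

definition flag :: "nat \<Rightarrow> nat \<Rightarrow> nat \<Rightarrow> nat \<Rightarrow> nat \<Rightarrow> nat" where
  "flag K T t k x = of_bool (t < T \<and> k < K \<and> t + 1 \<le> x \<and> x + t + 1 \<le> 2 * T)"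

lemma length_block_vals [simp]: "length (block_vals K T t k x st tr cl) = 9 + K"
  by (simp add: block_vals_def)

lemma block_ok_vals:
  "block_ok M dl (flag K T t k x) p j (block_vals K T t k x st tr cl) \<longleftrightarrow>
     (t < T \<and> k < K \<and> t + 1 \<le> x \<and> x + t + 1 \<le> 2 * T \<longrightarrow>
       local_step M dl j p (st t) (st (Suc t)) (tr t) (cl t k (x - 1)) (cl t k x) (cl t k (x + 1))
           (cl (Suc t) k x)
         (map (\<lambda>j. cl t j T) [0..<K])) \<and> st 0 = tm_start M \<and> st T = tm_accept M"
proof (cases "t < T \<and> k < K \<and> t + 1 \<le> x \<and> x + t + 1 \<le> 2 * T")
  case True
  then have "flag K T t k x = 1" unfolding flag_def by simp
  then show ?thesis using True unfolding block_ok_def by (simp add: block_vals_def)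
next
  case False
  then have "flag K T t k x = 0" unfolding flag_def by simp
  moreover have "block_ok M dl 0 p j (block_vals K T t k x st tr cl) \<longleftrightarrow> st 0 = tm_start M \<and> st T = tm_accept M"
    unfolding block_ok_def by (simp add: block_vals_def)
  ultimately show ?thesis using False by (simp only: simp_thms)
qed

text \<open>The tape number is a feature and must stay below \<open>D\<close>, hence the
  \<open>min\<close>; the tapes of the machine are not affected since
  \<open>tm_tapes M < D\<close>.\<close>

lemma blocks_run:
  assumes "2 * T < S" "tm_tapes M \<le> S" "tm_tapes M < D"
  shows "(\<forall>t<S. \<forall>k<S. \<forall>x<S. block_ok M dl (flag (tm_tapes M) T t k x) (place T x) (min k (D - 1))
      (block_vals (tm_tapes M) T t k x st tr cl)) \<longleftrightarrow> run_on M dl T st tr cl" (is "?L = ?R")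
proof
  assume l: ?L
  have "0 < S" using assms(1) by simp
  then have "st 0 = tm_start M \<and> st T = tm_accept M" using l unfolding block_ok_vals by blast
  moreover have "tableau M dl T st tr cl"
    unfolding tableau_def
  proof (intro allI impI)
    fix t k x assume a: "t < T" "k < tm_tapes M" "t + 1 \<le> x \<and> x + t + 1 \<le> 2 * T"
    then have "t < S" "k < S" "x < S" "min k (D - 1) = k" using assms by linarith+
    with l a show "local_step M dl k (place T x) (st t) (st (Suc t)) (tr t) (cl t k (x - 1)) (cl t k
        x) (cl t k (x + 1))
       (cl (Suc t) k x) (map (\<lambda>j. cl t j T) [0..<tm_tapes M])" unfolding block_ok_vals by metis
  qed
  ultimately show ?R by (simp add: run_on_def)
next
  assume r: ?R
  show ?L
    unfolding block_ok_vals
  proof (intro allI impI conjI)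
    fix t k x assume a: "t < T \<and> k < tm_tapes M \<and> t + 1 \<le> x \<and> x + t + 1 \<le> 2 * T"
    then have m: "min k (D - 1) = k" using assms(3) by linarith
    show "local_step M dl (min k (D - 1)) (place T x) (st t) (st (Suc t)) (tr t) (cl t k (x - 1))
        (cl t k x) (cl t k (x + 1))
       (cl (Suc t) k x) (map (\<lambda>j. cl t j T) [0..<tm_tapes M])"
      unfolding m using r a unfolding run_on_def tableau_def by blast
  qed (use r in \<open>auto simp: run_on_def\<close>)
qed

lemma run_on_cong:
  assumes "\<And>t. t \<le> T \<Longrightarrow> st t = st' t" "\<And>t. t < T \<Longrightarrow> tr t = tr' t"
    "\<And>t k x. t \<le> T \<Longrightarrow> k < tm_tapes M \<Longrightarrow> cl t k x = cl' t k x"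
  shows "run_on M dl T st tr cl \<longleftrightarrow> run_on M dl T st' tr' cl'"
proof -
  have "run_on M dl T st' tr' cl'" if r: "run_on M dl T st tr cl" and e: "\<forall>t\<le>T. st t = st' t" "\<forall>t<T.
      tr t = tr' t"
    "\<forall>t\<le>T. \<forall>k<tm_tapes M. \<forall>x. cl t k x = cl' t k x" for st tr cl st' tr' cl'
    unfolding run_on_def tableau_def
  proof (intro conjI allI impI)
    fix t k x assume a: "t < T" "k < tm_tapes M" "t + 1 \<le> x \<and> x + t + 1 \<le> 2 * T"
    have "map (\<lambda>j. cl t j T) [0..<tm_tapes M] = map (\<lambda>j. cl' t j T) [0..<tm_tapes M]" using a e(3) by simp
    moreover have "st t = st' t" "st (Suc t) = st' (Suc t)" "tr t = tr' t" "cl t k y = cl' t k y"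
      "cl (Suc t) k y = cl' (Suc t) k y" for y using a e by simp_all
    moreover have "local_step M dl k (place T x) (st t) (st (Suc t)) (tr t) (cl t k (x - 1)) (cl t k
        x) (cl t k (x + 1))
       (cl (Suc t) k x) (map (\<lambda>j. cl t j T) [0..<tm_tapes M])" using r a unfolding run_on_def
           tableau_def by blast
    ultimately show "local_step M dl k (place T x) (st' t) (st' (Suc t)) (tr' t) (cl' t k (x - 1))
        (cl' t k x) (cl' t k (x + 1))
       (cl' (Suc t) k x) (map (\<lambda>j. cl' t j T) [0..<tm_tapes M])" by (simp only:)
  qed (use r e in \<open>auto simp: run_on_def\<close>)
  from this[of st tr cl st' tr' cl'] this[of st' tr' cl' st tr cl] show ?thesis using assms by auto
qed

text \<open>Run, time, tape and cell of constraint \<open>c\<close> are the digits of \<open>c\<close> in base \<open>S w\<close>.\<close>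

abbreviation cr :: "(bool list \<Rightarrow> nat) \<Rightarrow> wfun" where "cr S w c \<equiv> c mod S w"
abbreviation ct :: "(bool list \<Rightarrow> nat) \<Rightarrow> wfun" where "ct S w c \<equiv> c div S w mod S w"
abbreviation ck :: "(bool list \<Rightarrow> nat) \<Rightarrow> wfun" where "ck S w c \<equiv> c div S w ^ 2 mod S w"
abbreviation cx :: "(bool list \<Rightarrow> nat) \<Rightarrow> wfun" where "cx S w c \<equiv> c div S w ^ 3"

section \<open>Numbering of constraints and addresses\<close>

lemma components:
  fixes S :: nat
  assumes "r < S" "t < S" "k < S"
  shows "(r + S * (t + S * (k + S * x))) mod S = r" "(r + S * (t + S * (k + S * x))) div S mod S = t"
    "(r + S * (t + S * (k + S * x))) div S ^ 2 mod S = k" "(r + S * (t + S * (k + S * x))) div S ^ 3 = x"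
  using assms by (simp_all add: power2_eq_square power3_eq_cube div_mult2_eq)

lemma component_bounds:
  fixes S :: nat
  assumes "c < S ^ 4"
  shows "c mod S < S" "c div S mod S < S" "c div S ^ 2 mod S < S" "c div S ^ 3 < S"
proof -
  have "0 < S" using assms by (cases S) auto
  then show "c mod S < S" "c div S mod S < S" "c div S ^ 2 mod S < S" by auto
  have "c < S * S ^ 3" using assms by (simp add: numeral_eq_Suc)
  then show "c div S ^ 3 < S" by (simp add: less_mult_imp_div_less)
qed

lemma compose:
  fixes S :: nat
  shows "c mod S + S * (c div S mod S + S * (c div S ^ 2 mod S + S * (c div S ^ 3))) = c"
proof -
  have "c div S ^ 3 = c div S ^ 2 div S" "c div S ^ 2 = c div S div S"
    by (simp_all add: power2_eq_square power3_eq_cube div_mult2_eq mult.assoc)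
  then show ?thesis by (metis mod_mult_div_eq)
qed

lemma all_components:
  fixes S :: nat
  shows "(\<forall>c<S ^ 4. P (c mod S) (c div S mod S) (c div S ^ 2 mod S) (c div S ^ 3)) \<longleftrightarrow>
     (\<forall>r<S. \<forall>t<S. \<forall>k<S. \<forall>x<S. P r t k x)"
proof
  assume a: "\<forall>c<S ^ 4. P (c mod S) (c div S mod S) (c div S ^ 2 mod S) (c div S ^ 3)"
  show "\<forall>r<S. \<forall>t<S. \<forall>k<S. \<forall>x<S. P r t k x"
  proof (intro allI impI)
    fix r t k x assume b: "r < S" "t < S" "k < S" "x < S"
    have l: "i + S * j < S * n" if "i < S" "j < n" for i j n :: nat
    proof -
      have "i + S * j < S * Suc j" using that(1) by simp
      also have "\<dots> \<le> S * n" using that(2) by (intro mult_le_mono2) simp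
      finally show ?thesis .
    qed
    have "r + S * (t + S * (k + S * x)) < S * (S * (S * S))" by (intro l b)
    then have "r + S * (t + S * (k + S * x)) < S ^ 4" by (simp add: numeral_eq_Suc)
    from a[rule_format, OF this] show "P r t k x" unfolding components[OF b(1-3)] .
  qed
next
  assume a: "\<forall>r<S. \<forall>t<S. \<forall>k<S. \<forall>x<S. P r t k x"
  show "\<forall>c<S ^ 4. P (c mod S) (c div S mod S) (c div S ^ 2 mod S) (c div S ^ 3)"
    using a component_bounds by simp
qed

definition block_adrs :: "(bool list \<Rightarrow> nat) \<Rightarrow> (bool list \<Rightarrow> nat) \<Rightarrow> nat \<Rightarrow> nat \<Rightarrow> wfun \<Rightarrow> wfun list" where
  "block_adrs S T K tag \<rho> =
     [\<lambda>w c. ad (S w) tag (\<rho> w c) (ct S w c) 0 0, \<lambda>w c. ad (S w) tag (\<rho> w c) (Suc (ct S w c)) 0 0,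
      \<lambda>w c. ad (S w) (tag + 1) (\<rho> w c) (ct S w c) 0 0,
      \<lambda>w c. ad (S w) (tag + 2) (\<rho> w c) (ct S w c) (ck S w c) (cx S w c - 1),
      \<lambda>w c. ad (S w) (tag + 2) (\<rho> w c) (ct S w c) (ck S w c) (cx S w c),
      \<lambda>w c. ad (S w) (tag + 2) (\<rho> w c) (ct S w c) (ck S w c) (cx S w c + 1),
      \<lambda>w c. ad (S w) (tag + 2) (\<rho> w c) (Suc (ct S w c)) (ck S w c) (cx S w c),
      \<lambda>w c. ad (S w) tag (\<rho> w c) 0 0 0, \<lambda>w c. ad (S w) tag (\<rho> w c) (T w) 0 0] @
     map (\<lambda>j w c. ad (S w) (tag + 2) (\<rho> w c) (ct S w c) j (T w)) [0..<K]"

lemma map_block_adrs: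
  "map (\<lambda>a. u (a w c)) (block_adrs S T K tag \<rho>) =
     block_vals K (T w) (ct S w c) (ck S w c) (cx S w c) (st_of (S w) u tag (\<rho> w c)) (tr_of (S w) u
         tag (\<rho> w c)) (cl_of (S w) u tag (\<rho> w c))"
  by (simp add: block_adrs_def block_vals_def st_of_def tr_of_def cl_of_def)

definition wPF :: "wfun \<Rightarrow> bool" where
  "wPF a \<longleftrightarrow> PF (\<lambda>ws e. a (ws 0) (e 0))"

lemma wPF_intros:
  "PF (\<lambda>ws e. S (ws 0)) \<Longrightarrow> wPF (\<lambda>w c. S w)"
  "wPF (\<lambda>w c. c)"
  "wPF (\<lambda>w c. n)"
  "wPF f \<Longrightarrow> wPF g \<Longrightarrow> wPF (\<lambda>w c. f w c + g w c)"
  "wPF f \<Longrightarrow> wPF g \<Longrightarrow> wPF (\<lambda>w c. f w c - g w c)"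
  "wPF f \<Longrightarrow> wPF g \<Longrightarrow> wPF (\<lambda>w c. f w c * g w c)"
  "wPF f \<Longrightarrow> wPF (\<lambda>w c. Suc (f w c))"
  "wPF f \<Longrightarrow> wPF g \<Longrightarrow> wPF (\<lambda>w c. f w c div g w c)"
  "wPF f \<Longrightarrow> wPF g \<Longrightarrow> wPF (\<lambda>w c. f w c mod g w c)"
  "wPF f \<Longrightarrow> wPF (\<lambda>w c. f w c ^ n)"
  "wPF f \<Longrightarrow> wPF g \<Longrightarrow> wPF (\<lambda>w c. min (f w c) (g w c))"
  "wPF f \<Longrightarrow> wPF (\<lambda>w c. symb w (f w c))"
  unfolding wPF_def
  by (intro pf_intros | assumption | rule PF_symb[where k = 0])+

lemma wPF_ad:
  assumes "PF (\<lambda>ws e. S (ws 0))" "wPF r" "wPF t" "wPF k" "wPF x"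
  shows "wPF (\<lambda>w c. ad (S w) tag (r w c) (t w c) (k w c) (x w c))"
  unfolding ad_def by (intro wPF_intros assms)

lemma wPF_block:
  assumes "PF (\<lambda>ws e. S (ws 0))" "PF (\<lambda>ws e. T (ws 0))" "wPF \<rho>" "a \<in> set (block_adrs S T K tag \<rho>)"
  shows "wPF a"
proof -
  have c: "wPF (\<lambda>w c. ct S w c)" "wPF (\<lambda>w c. ck S w c)" "wPF (\<lambda>w c. cx S w c)"
    by (intro wPF_intros assms)+
  have "\<forall>a\<in>set (block_adrs S T K tag \<rho>). wPF a"
    unfolding block_adrs_def set_append set_map ball_Un list.set ball_simps
    by (intro conjI ballI TrueI wPF_ad wPF_intros(1,3-5,7) assms c)
  with assms(4) show ?thesis by blast
qed

text \<open>Times and cells are also addressed at their successors and so may reach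
  \<open>S\<close>; the factor 2 leaves room for this.\<close>

definition ad_bound :: "nat \<Rightarrow> nat" where
  "ad_bound S = 11 * (2 * S + S * (2 * S + S * (2 * S + S * (2 * S)))) + 11"

lemma ad_less: "tag < 11 \<Longrightarrow> r \<le> 2 * S \<Longrightarrow> t \<le> 2 * S \<Longrightarrow> k \<le> 2 * S \<Longrightarrow> x \<le> 2 * S \<Longrightarrow> ad S tag r t k x < ad_bound S"
  unfolding ad_def ad_bound_def by (intro add_le_less_mono mult_le_mono add_mono order_refl)

lemma block_adrs_less:
  assumes "a \<in> set (block_adrs S T K tag \<rho>)" "c < S w ^ 4" "T w \<le> S w" "K \<le> S w" "\<rho> w c \<le> S w" "tag + 2 < 11"
  shows "a w c < ad_bound (S w)"
proof -
  note b = component_bounds[OF assms(2)]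
  have c: "ct S w c \<le> 2 * S w" "Suc (ct S w c) \<le> 2 * S w" "ck S w c \<le> 2 * S w" "cx S w c \<le> 2 * S w"
      "cx S w c - 1 \<le> 2 * S w"
    "cx S w c + 1 \<le> 2 * S w" "T w \<le> 2 * S w" "\<rho> w c \<le> 2 * S w"
    using b assms(3-5) by linarith+
  have "\<forall>a\<in>set (block_adrs S T K tag \<rho>). a w c < ad_bound (S w)"
    unfolding block_adrs_def set_append set_map ball_Un list.set ball_simps
    using assms(4,6) by (intro conjI ballI TrueI ad_less c) auto
  with assms(1) show ?thesis by blast
qed

lemma wPF_of_bool: "PP (\<lambda>ws e. P (ws 0) (e 0)) \<Longrightarrow> wPF (\<lambda>w c. of_bool (P w c))"
  unfolding wPF_def by (rule PF_of_bool)

lemma PP_wPF: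
  assumes "wPF f" "wPF g"
  shows "PP (\<lambda>ws e. f (ws 0) (e 0) < g (ws 0) (e 0))" "PP (\<lambda>ws e. f (ws 0) (e 0) \<le> g (ws 0) (e 0))"
    "PP (\<lambda>ws e. f (ws 0) (e 0) = g (ws 0) (e 0))"
  using assms unfolding wPF_def by (rule PP_less PP_le PP_eq; assumption)+

lemma wPF_if: "PP (\<lambda>ws e. P (ws 0) (e 0)) \<Longrightarrow> wPF f \<Longrightarrow> wPF g \<Longrightarrow> wPF (\<lambda>w c. if P w c then f w c else g w c)"
  unfolding wPF_def by (rule PF_if)

lemma wPF_flag:
  assumes "PF (\<lambda>ws e. T (ws 0))" "wPF t" "wPF k" "wPF x"
  shows "wPF (\<lambda>w c. flag K (T w) (t w c) (k w c) (x w c))"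
  unfolding flag_def by (intro wPF_of_bool PP_conj PP_wPF wPF_intros(1,3,4,6) assms)

lemma wPF_place:
  assumes "PF (\<lambda>ws e. T (ws 0))" "wPF x"
  shows "wPF (\<lambda>w c. place (T w) (x w c))"
  unfolding place_def by (intro wPF_if PP_wPF wPF_intros(1,3,4) assms)

definition input_flag :: "nat \<Rightarrow> nat \<Rightarrow> nat \<Rightarrow> nat \<Rightarrow> nat" where
  "input_flag K T k x = of_bool (k < K \<and> x \<le> 2 * T)"

definition input_symb :: "nat \<Rightarrow> bool list \<Rightarrow> nat \<Rightarrow> nat \<Rightarrow> nat" where
  "input_symb T w k x = (if k = 0 \<and> T \<le> x then symb w (x - T) else 0)"

lemma symb_less: "symb w x < 3"
  by (simp add: symb_eq)

lemma input_symb_start: "input_symb T w k x = start w k (int x - int T)"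
  by (auto simp: input_symb_def start_def symb_def of_nat_diff tape_of_def)

lemma inputs_at:
  assumes "2 * T < S" "tm_tapes M \<le> S"
  shows "(\<forall>k<S. \<forall>x<S. input_flag (tm_tapes M) T k x = 1 \<longrightarrow> c0 k x = input_symb T w k x) \<longleftrightarrow> input_at M T c0 w"
  unfolding input_at_def input_symb_start input_flag_def using assms by (auto simp: less_le_trans)

lemma wPF_input:
  assumes "PF (\<lambda>ws e. T (ws 0))" "wPF k" "wPF x"
  shows "wPF (\<lambda>w c. input_flag K (T w) (k w c) (x w c))" "wPF (\<lambda>w c. input_symb (T w) w (k w c) (x w c))"
  unfolding input_flag_def input_symb_def
  by (intro wPF_of_bool wPF_if PP_conj PP_wPF wPF_intros(1,3,5,6,12) assms)+

lemma place_less: "place T x < 4"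
  by (simp add: place_def)

lemma flag_less: "flag K T t k x < 2" "input_flag K T k x < 2"
  by (simp_all add: flag_def input_flag_def)

text \<open>An assignment is assembled from one table per tag. Tags below \<open>b\<close> are
  copied from \<open>u0\<close>, which serves to choose inner variables under fixed outer ones;
  entries are capped so that all values stay below \<open>D\<close>, also where the table is
  arbitrary.\<close>

lemma ex_table:
  fixes U :: "nat \<Rightarrow> nat \<Rightarrow> nat \<Rightarrow> nat \<Rightarrow> nat \<Rightarrow> nat"
  assumes "\<And>v. u0 v < D"
  obtains u where "\<And>v. u v < D" "\<And>v. v mod 11 < b \<Longrightarrow> u v = u0 v"
    "\<And>tag r t k x. b \<le> tag \<Longrightarrow> tag < 11 \<Longrightarrow> r < S \<Longrightarrow> t < S \<Longrightarrow> k < S \<Longrightarrow> U tag r t k x < D \<Longrightarrow> u (ad S tag r t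
        k x) = U tag r t k x"
proof
  define V where "V tag y = U tag (y mod S) (y div S mod S) (y div S ^ 2 mod S) (y div S ^ 3)" for tag y
  let ?u = "\<lambda>v. if v mod 11 < b then u0 v else min (D - 1) (V (v mod 11) (v div 11))"
  have "0 < D" using assms[of 0] by simp
  then have "min (D - 1) y < D" for y by linarith
  then show "?u v < D" for v using assms by presburger
  show "?u v = u0 v" if "v mod 11 < b" for v using that by simp
  show "?u (ad S tag r t k x) = U tag r t k x" if "b \<le> tag" "tag < 11" "r < S" "t < S" "k < S" "U
      tag r t k x < D" for tag r t k x
  proof -
    have "(11 * y + tag) mod 11 = tag" "(11 * y + tag) div 11 = y" for y :: nat using that(2) by auto
    then have "ad S tag r t k x mod 11 = tag" "ad S tag r t k x div 11 = r + S * (t + S * (k + S * x))"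
      unfolding ad_def by blast+
    moreover have "V tag (r + S * (t + S * (k + S * x))) = U tag r t k x" by (simp only: V_def
        components[OF that(3-5)])
    moreover have "min (D - 1) (U tag r t k x) = U tag r t k x" using that(6) by linarith
    ultimately show ?thesis using that(1) by (simp only: not_less[symmetric] if_False simp_thms)
  qed
qed

section \<open>The first level\<close>

lemma accepting_path_bound:
  assumes "poly_time M X"
  shows "\<exists>p :: nat poly. \<forall>w n c. (tm_step M X ^^ n) (initial M w) c \<longrightarrow> n < poly p (length w) + 1"
  using assms unfolding poly_time_def by (metis le_imp_less_Suc Suc_eq_plus1)

lemma coNP_hard:
  assumes "X \<in> coNP" "\<sigma> \<in> {Complete, Stable}"
  shows "poly_reducible X (SF_VE_inputs \<sigma>) (SF_VE \<sigma>)"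
proof -
  have "\<exists>M. - X = {w. accepts M {} w} \<and> well_formed M \<and> oracle_free M \<and> poly_time M {}"
    using assms(1) unfolding coNP_def co_def NP_def mem_Collect_eq .
  then obtain M where M: "- X = {w. accepts M {} w}" "well_formed M" "oracle_free M" "poly_time M
      {}" by (elim exE conjE)
  from accepting_path_bound[OF M(4)] obtain p :: "nat poly" where
    p0: "\<forall>w n c. (tm_step M {} ^^ n) (initial M w) c \<longrightarrow> n < poly p (length w) + 1" by (elim exE)
  have fin: "finite (tm_delta M)" using M(2) by (simp add: well_formed_def)
  from finite_list[OF fin] obtain dl where dl: "set dl = tm_delta M" by (elim exE)
  from ex_bounds[OF fin] obtain D0 where D0: "\<forall>D\<ge>D0. bounds M D" by (elim exE)
  define K where "K = tm_tapes M"
  \<comment> \<open>Values and features share one range: states, symbols, step codes, tape numbers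
    and the four places around the head.\<close>
  define D where "D = D0 + length dl + K + 4"
  have D: "bounds M D" "length dl < D" "K < D" "4 \<le> D" "0 < D" using D0 by (auto simp: D_def)
  define T where "T w = poly p (length w) + 1" for w :: "bool list"
  have p: "n < T w" if "(tm_step M {} ^^ n) (initial M w) c" for w n c unfolding T_def by (rule
      p0[rule_format, OF that])
  have run: "accepts M {} w \<longleftrightarrow> (\<exists>st tr cl. run_on M dl (T w) st tr cl \<and> input_at M (T w) (cl 0) w)"
    "accepts M {} w \<longleftrightarrow> (\<exists>st tr cl. run_on M dl (T w) st tr cl \<and> input_at M (T w) (cl 0) w \<and> (\<forall>t\<le>T w.
        st t < D) \<and>
      (\<forall>t<T w. tr t < D) \<and> (\<forall>t\<le>T w. \<forall>k<tm_tapes M. \<forall>x. cl t k x < D))" for w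
    by (rule accepts_iff_run[OF M(2) dl M(3) D(1,2)], erule p)+
  \<comment> \<open>The base has to exceed every time, tape and cell number of the table.\<close>
  define S where "S w = 2 * T w + K + 1" for w
  have S: "2 * T w < S w" "K \<le> S w" "T w \<le> S w" "0 < S w" "1 \<le> T w" for w by (simp_all add: S_def T_def)
  have T': "PF (\<lambda>ws e. T (ws 0))" unfolding T_def by (intro pf_intros)
  have S': "PF (\<lambda>ws e. S (ws 0))" unfolding S_def by (intro pf_intros T')
  define feats :: "wfun list" where "feats = [\<lambda>w c. flag K (T w) (ct S w c) (ck S w c) (cx S w c),
      \<lambda>w c. place (T w) (cx S w c),
    \<lambda>w c. min (ck S w c) (D - 1), \<lambda>w c. input_flag K (T w) (ck S w c) (cx S w c), \<lambda>w c. input_symb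
        (T w) w (ck S w c) (cx S w c)]"
  define adrs :: "wfun list" where "adrs = (\<lambda>w c. ad (S w) 2 0 0 (ck S w c) (cx S w c)) # block_adrs
      S T K 0 (\<lambda>_ _. 0)"
  define G :: "nat list \<Rightarrow> nat list \<Rightarrow> bool" where "G F v \<longleftrightarrow> (F ! 3 = 1 \<longrightarrow> v ! 0 = F ! 4) \<and> block_ok M
      dl (F ! 0) (F ! 1) (F ! 2) (drop 1 v)" for F v
  have c: "wPF (ct S)" "wPF (ck S)" "wPF (cx S)" by (intro wPF_intros S')+
  have sys: "system D feats adrs (\<lambda>w. S w ^ 4) (\<lambda>w. ad_bound (S w)) (\<lambda>_. False)"
  proof
    have "\<forall>\<phi>\<in>set feats. wPF \<phi>"
      unfolding feats_def list.set ball_simps by (intro conjI TrueI wPF_flag wPF_place wPF_input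
          wPF_intros(3,11) c T')
    then show "PF (\<lambda>ws e. \<phi> (ws 0) (e 0))" if "\<phi> \<in> set feats" for \<phi> using that unfolding wPF_def by blast
    have "\<forall>\<phi>\<in>set feats. \<phi> w c < D" for w c
      unfolding feats_def list.set ball_simps
      using flag_less(1)[of K "T w" "ct S w c" "ck S w c" "cx S w c"] flag_less(2)[of K "T w" "ck S
          w c" "cx S w c"] place_less[of "T w" "cx S w c"]
        symb_less[of w "cx S w c - T w"] D(4) by (auto simp: input_symb_def)
    then show "\<phi> w c < D" if "\<phi> \<in> set feats" for \<phi> w c using that by blast
    have "\<forall>a\<in>set adrs. wPF a"
      unfolding adrs_def list.set ball_simps
      by (intro conjI ballI wPF_ad wPF_intros(3) S' c) (rule wPF_block[OF S' T' wPF_intros(3)])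
    then show "PF (\<lambda>ws e. a (ws 0) (e 0))" if "a \<in> set adrs" for a using that unfolding wPF_def by blast
    show "a w c < ad_bound (S w)" if "a \<in> set adrs" "c < S w ^ 4" for a w c
    proof (cases "a \<in> set (block_adrs S T K 0 (\<lambda>_ _. 0))")
      case True
      show ?thesis by (rule block_adrs_less[where \<rho> = "\<lambda>_ _. 0", OF True that(2)]) (use S in auto)
    next
      case False
      then have "a = (\<lambda>w c. ad (S w) 2 0 0 (ck S w c) (cx S w c))" using that(1) by (simp add: adrs_def)
      then have a: "a w c = ad (S w) 2 0 0 (ck S w c) (cx S w c)" by (simp only:)
      show ?thesis unfolding a by (intro ad_less) (use component_bounds[OF that(2)] in linarith)+
    qed
    show "PF (\<lambda>ws e. S (ws 0) ^ 4)" "PF (\<lambda>ws e. ad_bound (S (ws 0)))" unfolding ad_bound_def by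
        (intro pf_intros S')+
    show "PP (\<lambda>ws e. False)" by (rule PP_const)
  qed (rule D(5))
  let ?run = "\<lambda>w u. run_on M dl (T w) (st_of (S w) u 0 0) (tr_of (S w) u 0 0) (cl_of (S w) u 0 0) \<and>
      input_at M (T w) (cl_of (S w) u 0 0 0) w"
  have holds: "system.holds feats adrs G (\<lambda>w. S w ^ 4) w u \<longleftrightarrow> ?run w u" for w u
  proof -
    define P where "P r t k x \<longleftrightarrow> (input_flag K (T w) k x = 1 \<longrightarrow> cl_of (S w) u 0 0 0 k x = input_symb
        (T w) w k x) \<and>
        block_ok M dl (flag K (T w) t k x) (place (T w) x) (min k (D - 1))
          (block_vals K (T w) t k x (st_of (S w) u 0 0) (tr_of (S w) u 0 0) (cl_of (S w) u 0 0))"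
              for r t k x :: nat
    have "G (map (\<lambda>\<phi>. \<phi> w c) feats) (map (\<lambda>a. u (a w c)) adrs) \<longleftrightarrow> P (cr S w c) (ct S w c) (ck S w c)
        (cx S w c)" for c
      by (simp add: G_def feats_def adrs_def map_block_adrs cl_of_def P_def numeral_2_eq_2)
    then have "system.holds feats adrs G (\<lambda>w. S w ^ 4) w u \<longleftrightarrow> (\<forall>r<S w. \<forall>t<S w. \<forall>k<S w. \<forall>x<S w. P r t k x)"
      unfolding system.holds_def[OF sys] all_components[where P = P, symmetric] by simp
    then show ?thesis
      unfolding blocks_run[of "T w" "S w" M D, folded K_def, OF S(1,2) D(3), symmetric]
        inputs_at[of "T w" "S w" M, folded K_def, OF S(1,2), symmetric] P_def
      using S(4)[of w] by auto
  qed
  have acc: "(\<exists>u. (\<forall>v. u v < D) \<and> ?run w u) \<longleftrightarrow> accepts M {} w" for w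
  proof
    assume "\<exists>u. (\<forall>v. u v < D) \<and> ?run w u"
    then obtain u where "?run w u" by blast
    then show "accepts M {} w" unfolding run(1) by (intro exI)
  next
    assume "accepts M {} w"
    then obtain st tr cl where r: "run_on M dl (T w) st tr cl" "input_at M (T w) (cl 0) w" "\<And>t. t \<le>
        T w \<Longrightarrow> st t < D"
      "\<And>t. t < T w \<Longrightarrow> tr t < D" "\<And>t k x. t \<le> T w \<Longrightarrow> k < K \<Longrightarrow> cl t k x < D"
      unfolding run(2) K_def by blast
    define U :: "nat \<Rightarrow> nat \<Rightarrow> nat \<Rightarrow> nat \<Rightarrow> nat \<Rightarrow> nat" where
      "U tag r t k x = (if tag = 0 then st t else if tag = 1 then tr t else cl t k x)" for tag r t k x
    obtain u where u0: "\<And>v. u v < D" "\<And>v. v mod 11 < 0 \<Longrightarrow> u v = 0"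
       "\<And>tag r t k x. 0 \<le> tag \<Longrightarrow> tag < 11 \<Longrightarrow> r < S w \<Longrightarrow> t < S w \<Longrightarrow> k < S w \<Longrightarrow> U tag r t k x < D \<Longrightarrow>
       u (ad (S w) tag r t k x) = U tag r t k x"
      by (rule ex_table[where ?u0.0 = "\<lambda>_. 0" and S = "S w" and U = U and b = 0, OF D(5)]) (rule that)
    note u = u0(1) u0(3)[OF le0]
    have l: "t < S w" if "t \<le> T w" for t using that S(1)[of w] by simp
    have k: "k < S w" if "k < K" for k using that S(2)[of w] by simp
    have "st_of (S w) u 0 0 t = st t" if "t \<le> T w" for t
      using u(2)[of 0 0 t 0 0] l[OF that] r(3)[OF that] S(4)[of w] by (simp add: st_of_def U_def)
    moreover have "tr_of (S w) u 0 0 t = tr t" if "t < T w" for t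
      using u(2)[of 1 0 t 0 0] l[of t] r(4)[OF that] that S(4)[of w] by (simp add: tr_of_def U_def)
    moreover have cl: "cl_of (S w) u 0 0 t k x = cl t k x" if "t \<le> T w" "k < K" for t k x
      using u(2)[of 2 0 t k x] l[of t] k[OF that(2)] r(5)[OF that] that S(4)[of w] by (simp add:
          cl_of_def U_def numeral_2_eq_2)
    ultimately have "run_on M dl (T w) (st_of (S w) u 0 0) (tr_of (S w) u 0 0) (cl_of (S w) u 0 0)"
      using r(1) run_on_cong[of "T w" "st_of (S w) u 0 0" st "tr_of (S w) u 0 0" tr M "cl_of (S w) u
          0 0" cl dl] unfolding K_def by blast
    moreover have "input_at M (T w) (cl_of (S w) u 0 0 0) w" using r(2) cl unfolding input_at_def
        K_def by simp
    ultimately show "\<exists>u. (\<forall>v. u v < D) \<and> ?run w u" using u(1) by blast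
  qed
  have "\<sigma> = (if \<sigma> = Complete then Complete else Stable)" using assms(2) by auto
  then obtain f where f: "poly_time_computable f" "\<And>w. f w \<in> SF_VE_inputs \<sigma>"
    "\<And>w. f w \<in> SF_VE \<sigma> \<longleftrightarrow> \<not> (\<exists>u. (\<forall>v. u v < D) \<and> system.holds feats adrs G (\<lambda>w. S w ^ 4) w u)"
    using system.reduction[OF sys, where sw = False and self = "\<sigma> = Complete" and \<sigma> = \<sigma> and G = G] by auto
  have "w \<in> X \<longleftrightarrow> f w \<in> SF_VE \<sigma>" for w
    unfolding f(3) holds acc using M(1) by auto
  with f(1,2) show ?thesis unfolding poly_reducible_def by blast
qed

section \<open>Oracle queries and their certificates\<close>

definition cell_kind :: "nat \<Rightarrow> nat \<Rightarrow> nat \<Rightarrow> nat \<Rightarrow> nat" where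
  "cell_kind K T k x = (if k < K \<and> x \<le> 2 * T then if k \<noteq> 0 \<or> x < T then 1 else if x = T then 2 else 3 else 0)"

definition query_cell :: "nat \<Rightarrow> nat \<Rightarrow> nat \<Rightarrow> nat \<Rightarrow> nat \<Rightarrow> bool" where
  "query_cell b i new left f \<longleftrightarrow> (b = 1 \<longrightarrow> new = 0) \<and> (2 \<le> b \<longrightarrow> copy_cell new left (if i = 1 then f else
      0) (b = 2))"

text \<open>The table \<open>c\<close> starts the machine \<open>N\<close> on the word written on the first \<open>e\<close> cells of the tape \<open>f\<close>.\<close>

definition starts_on :: "tm \<Rightarrow> nat \<Rightarrow> nat \<Rightarrow> (nat \<Rightarrow> nat \<Rightarrow> nat) \<Rightarrow> (nat \<Rightarrow> nat) \<Rightarrow> bool" where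
  "starts_on N T e c f \<longleftrightarrow> (\<forall>k<tm_tapes N. \<forall>x\<le>2 * T.
     query_cell (cell_kind (tm_tapes N) T k x) (of_bool (x - T < e)) (c k x) (c k (x - 1)) (f (x - T)))"

text \<open>Kind 1 cells are blank, kind 2 is the first cell of the input and kind 3 a later one;
  kind 0 lies outside the table. Symbols of \<open>f\<close> from position \<open>e\<close> on count
  as blank.\<close>

lemma starts_on_cells:
  assumes "0 < tm_tapes N"
  shows "starts_on N T e c f \<longleftrightarrow> (\<forall>k<tm_tapes N. \<forall>x\<le>2 * T. k \<noteq> 0 \<or> x < T \<longrightarrow> c k x = 0) \<and>
    (\<forall>i\<le>T. copy_cell (c 0 (T + i)) (c 0 (T + (i - 1))) (if i < e then f i else 0) (i = 0))" (is "_ \<longleftrightarrow> ?R")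
proof
  assume s: "starts_on N T e c f"
  show ?R
  proof (intro conjI allI impI)
    fix k x assume a: "k < tm_tapes N" "x \<le> 2 * T" "k \<noteq> 0 \<or> x < T"
    then have "cell_kind (tm_tapes N) T k x = 1" by (simp add: cell_kind_def)
    then show "c k x = 0" using s a unfolding starts_on_def query_cell_def by metis
  next
    fix i assume i: "i \<le> T"
    have "query_cell (cell_kind (tm_tapes N) T 0 (T + i)) (of_bool (T + i - T < e)) (c 0 (T + i)) (c
        0 (T + i - 1)) (f (T + i - T))"
      by (rule s[unfolded starts_on_def, rule_format]) (use assms i in auto)
    moreover have "cell_kind (tm_tapes N) T 0 (T + i) = (if i = 0 then 2 else 3)" using assms i by
        (simp add: cell_kind_def)
    ultimately show "copy_cell (c 0 (T + i)) (c 0 (T + (i - 1))) (if i < e then f i else 0) (i = 0)"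
      by (cases i) (auto simp: query_cell_def copy_cell_def split: if_splits)
  qed
next
  assume r: ?R
  show "starts_on N T e c f"
    unfolding starts_on_def
  proof (intro allI impI)
    fix k x assume a: "k < tm_tapes N" "x \<le> 2 * T"
    show "query_cell (cell_kind (tm_tapes N) T k x) (of_bool (x - T < e)) (c k x) (c k (x - 1)) (f (x - T))"
    proof (cases "k \<noteq> 0 \<or> x < T")
      case True
      then have "cell_kind (tm_tapes N) T k x = 1" using a by (simp add: cell_kind_def)
      moreover have "c k x = 0" using r a True by blast
      ultimately show ?thesis by (simp add: query_cell_def)
    next
      case False
      then obtain i where i: "x = T + i" "i \<le> T" "k = 0" using a le_Suc_ex[of T x] by auto
      have "copy_cell (c 0 (T + i)) (c 0 (T + (i - 1))) (if i < e then f i else 0) (i = 0)" using r i by blast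
      moreover have "cell_kind (tm_tapes N) T 0 (T + i) = (if i = 0 then 2 else 3)" using assms i by
          (simp add: cell_kind_def)
      ultimately show ?thesis using i by (cases i) (auto simp: query_cell_def copy_cell_def)
    qed
  qed
qed

lemma starts_on_iff:
  assumes "0 < tm_tapes N" "e \<le> T" "\<And>i. i < e \<Longrightarrow> f i = t (int i)" "\<And>i. e \<le> i \<Longrightarrow> t (int i) = 0"
  shows "starts_on N T e c f \<longleftrightarrow> (\<exists>v. length v \<le> e \<and> tape_holds t v \<and> input_at N T c v)"
proof -
  have f: "(if i < e then f i else 0) = t (int i)" for i using assms(3,4)[of i] by simp
  have "(\<forall>i\<le>T. copy_cell (c 0 (T + i)) (c 0 (T + (i - 1))) (t (int i)) (i = 0)) \<longleftrightarrow>
    (\<exists>v. length v \<le> e \<and> (\<forall>i<length v. t (int i) = bit_symbol (v ! i)) \<and> t (int (length v)) = 0 \<and>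
        (\<forall>i\<le>T. c 0 (T + i) = tape_of v (int i)))"
    by (rule copy_cells[where c = "\<lambda>i. c 0 (T + i)" and f = "\<lambda>i. t (int i)"]) (use assms(2,4) in auto)
  moreover have "input_at N T c v \<longleftrightarrow> (\<forall>k<tm_tapes N. \<forall>x\<le>2 * T. k \<noteq> 0 \<or> x < T \<longrightarrow> c k x = 0) \<and> (\<forall>i\<le>T. c
      0 (T + i) = tape_of v (int i))" (is "_ \<longleftrightarrow> ?z \<and> ?w v") for v
  proof
    assume i: "input_at N T c v"
    show "?z \<and> ?w v"
    proof (intro conjI allI impI)
      fix k x assume "k < tm_tapes N" "x \<le> 2 * T" "k \<noteq> 0 \<or> x < T"
      then show "c k x = 0" using i by (auto simp: input_at_def start_def tape_of_def)
    next
      fix j assume "j \<le> T"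
      then show "c 0 (T + j) = tape_of v (int j)" using i assms(1) by (simp add: input_at_def start_def)
    qed
  next
    assume z: "?z \<and> ?w v"
    show "input_at N T c v"
      unfolding input_at_def
    proof (intro allI impI)
      fix k x assume a: "k < tm_tapes N" "x \<le> 2 * T"
      show "c k x = start v k (int x - int T)"
      proof (cases "k \<noteq> 0 \<or> x < T")
        case True
        then show ?thesis using z a by (auto simp: start_def tape_of_def)
      next
        case False
        then obtain i where i: "x = T + i" "i \<le> T" "k = 0" using a le_Suc_ex[of T x] by auto
        then show ?thesis using z by (simp add: start_def)
      qed
    qed
  qed
  ultimately show ?thesis unfolding starts_on_cells[OF assms(1)] f tape_holds_def by blast
qed

text \<open>The tape is blank from cell \<open>e\<close> on, so the word it holds has at most
  \<open>e\<close> symbols and the time bound of the oracle machine covers it. The two forms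
  correspond to those of \<open>accepts_iff_run\<close>.\<close>

lemma oracle_answer:
  assumes "well_formed N" "set dl = tm_delta N" "oracle_free N" "bounds N D" "length dl < D"
    and path: "\<And>v n c. length v \<le> e \<Longrightarrow> (tm_step N {} ^^ n) (initial N v) c \<Longrightarrow> n < T"
    and e: "e \<le> T" "\<And>i. i < e \<Longrightarrow> f i = t (int i)" "\<And>i. e \<le> i \<Longrightarrow> t (int i) = 0"
  shows "(\<exists>v\<in>{v. accepts N {} v}. tape_holds t v) \<longleftrightarrow> (\<exists>st tr cl. run_on N dl T st tr cl \<and> starts_on N
      T e (cl 0) f)"
    and "(\<exists>v\<in>{v. accepts N {} v}. tape_holds t v) \<longleftrightarrow> (\<exists>st tr cl. run_on N dl T st tr cl \<and> starts_on N
        T e (cl 0) f \<and> (\<forall>t\<le>T. st t < D) \<and>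
      (\<forall>t<T. tr t < D) \<and> (\<forall>t\<le>T. \<forall>k<tm_tapes N. \<forall>x. cl t k x < D))"
proof -
  have "0 < tm_tapes N" using assms(1) by (simp add: well_formed_def)
  then have s: "starts_on N T e c f \<longleftrightarrow> (\<exists>v. length v \<le> e \<and> tape_holds t v \<and> input_at N T c v)" for c
    by (rule starts_on_iff) (fact e)+
  have l: "length v \<le> e" if "tape_holds t v" for v
  proof (rule ccontr)
    assume "\<not> length v \<le> e"
    then have "t (int e) = bit_symbol (v ! e)" using that by (simp add: tape_holds_def)
    moreover have "0 < bit_symbol (v ! e)" by (rule bit_symbol_bounds)
    ultimately show False using e(3)[of e] by simp
  qed
  have a: "(\<exists>v\<in>{v. accepts N {} v}. tape_holds t v) \<longleftrightarrow> (\<exists>v. length v \<le> e \<and> tape_holds t v \<and> accepts N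
      {} v)" using l by blast
  have run: "accepts N {} v \<longleftrightarrow> (\<exists>st tr cl. run_on N dl T st tr cl \<and> input_at N T (cl 0) v)"
    "accepts N {} v \<longleftrightarrow> (\<exists>st tr cl. run_on N dl T st tr cl \<and> input_at N T (cl 0) v \<and> (\<forall>t\<le>T. st t < D) \<and>
      (\<forall>t<T. tr t < D) \<and> (\<forall>t\<le>T. \<forall>k<tm_tapes N. \<forall>x. cl t k x < D))" if "length v \<le> e" for v
    by (rule accepts_iff_run[OF assms(1-5)], erule path[OF that])+
  show "(\<exists>v\<in>{v. accepts N {} v}. tape_holds t v) \<longleftrightarrow> (\<exists>st tr cl. run_on N dl T st tr cl \<and> starts_on N
      T e (cl 0) f)"
    proof -
    have "(\<exists>v. length v \<le> e \<and> tape_holds t v \<and> accepts N {} v) \<longleftrightarrow>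
      (\<exists>v. length v \<le> e \<and> tape_holds t v \<and> (\<exists>st tr cl. run_on N dl T st tr cl \<and> input_at N T (cl 0) v))"
      by (intro ex_cong1 conj_cong refl run)
    then show ?thesis unfolding a s by (simp only:) (rule iffI; elim exE conjE, intro exI conjI, assumption+)
  qed
  show "(\<exists>v\<in>{v. accepts N {} v}. tape_holds t v) \<longleftrightarrow> (\<exists>st tr cl. run_on N dl T st tr cl \<and> starts_on N
      T e (cl 0) f \<and> (\<forall>t\<le>T. st t < D) \<and>
      (\<forall>t<T. tr t < D) \<and> (\<forall>t\<le>T. \<forall>k<tm_tapes N. \<forall>x. cl t k x < D))"
    proof -
    have "(\<exists>v. length v \<le> e \<and> tape_holds t v \<and> accepts N {} v) \<longleftrightarrow>
      (\<exists>v. length v \<le> e \<and> tape_holds t v \<and> (\<exists>st tr cl. run_on N dl T st tr cl \<and> input_at N T (cl 0)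
          v \<and> (\<forall>t\<le>T. st t < D) \<and>
        (\<forall>t<T. tr t < D) \<and> (\<forall>t\<le>T. \<forall>k<tm_tapes N. \<forall>x. cl t k x < D)))"
      by (intro ex_cong1 conj_cong refl run)
    then show ?thesis unfolding a s by (simp only:) (rule iffI; elim exE conjE, intro exI conjI, assumption+)
  qed
qed

text \<open>A step at time \<open>r\<close> that does not idle is preceded by real steps only, and
  with truthful answers these form a genuine computation of \<open>M\<close>. So \<open>r\<close>
  obeys the time bound of \<open>M\<close>, however long the table is, and the extent of the tapes
  is bounded with it.\<close>

lemma query_time:
  assumes "well_formed M" "set dl = tm_delta M" "cs 0 = initial M w" "\<And>t. t < T \<Longrightarrow> gstep M dl (ds t)
      (cs t) (cs (Suc t))"
    and "r < T" "\<And>t. t < r \<Longrightarrow> truthful M dl X (ds t) (cs t)" "ds r \<noteq> length dl"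
    and "\<And>n c. (tm_step M X ^^ n) (initial M w) c \<Longrightarrow> n \<le> P"
  shows "r \<le> P" "blank_beyond (int (length w + P)) (cs r)"
proof -
  have "ds s \<noteq> length dl" if "s < r" for s
  proof
    assume "ds s = length dl"
    then show False
      using idle_forever[where T = T and ds = ds and cs = cs and M = M and dl = dl and s = s and t =
          r, OF assms(4,2)] assms(5,7) that by simp
  qed
  then have "tm_step M X (cs s) (cs (Suc s))" if "s < r" for s
    using gstep_tm_step[OF assms(2) assms(4)[of s] assms(6)[OF that]] assms(5) that by simp
  then have "(tm_step M X ^^ r) (initial M w) (cs r)"
    unfolding relpowp_fun_conv using assms(3) by blast
  from assms(8)[OF this] show r: "r \<le> P" .
  have "blank_beyond (int (length w + r)) (cs r)" by (rule gsteps_blank[OF assms(1-4)]) (use assms(5) in auto)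
  then show "blank_beyond (int (length w + P)) (cs r)" unfolding blank_beyond_def using r by force
qed

locale oracle_run =
  fixes M N :: tm and dl dl' :: "transition list" and p q :: "nat poly" and D :: nat
  assumes wf: "well_formed M" "well_formed N"
    and dl: "set dl = tm_delta M" "set dl' = tm_delta N"
    and free: "oracle_free N"
    and paths: "\<And>n w c. (tm_step M {v. accepts N {} v} ^^ n) (initial M w) c \<Longrightarrow> n \<le> poly p (length w)"
    and paths': "\<And>n v c. (tm_step N {} ^^ n) (initial N v) c \<Longrightarrow> n \<le> poly q (length v)"
    and D: "bounds M D" "bounds N D" "length dl + 3 \<le> D" "length dl' < D" "tm_tapes M < D" "tm_tapes
        N < D" "4 \<le> D"
begin

abbreviation "K \<equiv> tm_tapes M"
abbreviation "K' \<equiv> tm_tapes N"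

text \<open>At a query time \<open>r \<le> poly p (length w)\<close> the tapes are blank beyond
  \<open>length w + poly p (length w)\<close>, while cells up to distance \<open>T w - r\<close> are
  depicted: with twice the polynomial the query and the blank behind it are in view.
  \<open>T'\<close> exceeds the running time of \<open>N\<close> on words of length up to
  \<open>T w + 1\<close>.\<close>

definition T :: "bool list \<Rightarrow> nat" where "T w = 2 * poly p (length w) + length w + 3"
definition T' :: "bool list \<Rightarrow> nat" where "T' w = poly q (T w + 1) + T w + 2"
definition S :: "bool list \<Rightarrow> nat" where "S w = 2 * T' w + 2 * T w + K + K' + 1"

lemma S: "2 * T w < S w" "2 * T' w < S w" "K \<le> S w" "K' \<le> S w" "T w + T' w \<le> S w" "0 < S w" "T w + 1 \<le> T' w"
  by (simp_all add: S_def T'_def)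

lemma K: "0 < K" "0 < K'" using wf by (simp_all add: well_formed_def)

text \<open>At time \<open>r\<close> the table is reliable up to distance \<open>T w - r\<close>
  from the head. Counting the scanned cell, this offers \<open>T w - r + 1\<close> cells of the last
  tape as the query.\<close>

definition answers :: "bool list \<Rightarrow> (nat \<Rightarrow> nat) \<Rightarrow> nat \<Rightarrow> (nat \<Rightarrow> nat) \<Rightarrow> (nat \<Rightarrow> nat) \<Rightarrow> (nat \<Rightarrow> nat \<Rightarrow> nat
    \<Rightarrow> nat) \<Rightarrow> bool" where
  "answers w u r st tr cl \<longleftrightarrow> run_on N dl' (T' w) st tr cl \<and>
     starts_on N (T' w) (T w - r + 1) (cl 0) (\<lambda>i. cl_of (S w) u 0 0 r (K - 1) (T w + i))"

text \<open>What the outer variables claim: an accepting run with a certificate for every positive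
  answer. Negative answers are left to \<open>refuted\<close>.\<close>

definition right :: "bool list \<Rightarrow> (nat \<Rightarrow> nat) \<Rightarrow> bool" where
  "right w u \<longleftrightarrow> run_on M dl (T w) (st_of (S w) u 0 0) (tr_of (S w) u 0 0) (cl_of (S w) u 0 0) \<and>
     input_at M (T w) (cl_of (S w) u 0 0 0) w \<and>
     (\<forall>r<T w. tr_of (S w) u 0 0 r = length dl + 1 \<longrightarrow> answers w u r (st_of (S w) u 3 r) (tr_of (S w) u
         3 r) (cl_of (S w) u 3 r))"

definition in_range :: "bool list \<Rightarrow> (nat \<Rightarrow> nat) \<Rightarrow> (nat \<Rightarrow> nat) \<Rightarrow> (nat \<Rightarrow> nat \<Rightarrow> nat \<Rightarrow> nat) \<Rightarrow> bool" where
  "in_range w st tr cl \<longleftrightarrow> (\<forall>t\<le>T' w. st t < D) \<and> (\<forall>t<T' w. tr t < D) \<and> (\<forall>t\<le>T' w. \<forall>k<K'. \<forall>x. cl t k x < D)"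

definition refuted :: "bool list \<Rightarrow> (nat \<Rightarrow> nat) \<Rightarrow> bool" where
  "refuted w u \<longleftrightarrow> (\<exists>r<T w. tr_of (S w) u 0 0 r = length dl + 2 \<and> (\<exists>st tr cl. answers w u r st tr cl \<and>
      in_range w st tr cl))"

lemma answers_iff:
  assumes "depicts M (T w) (st_of (S w) u 0 0) (cl_of (S w) u 0 0) r c" "r < T w"
    and "r \<le> poly p (length w)" "blank_beyond (int (length w + poly p (length w))) c"
  shows "(\<exists>v\<in>{v. accepts N {} v}. tape_holds (last (snd c)) v) \<longleftrightarrow> (\<exists>st tr cl. answers w u r st tr cl)"
    and "(\<exists>v\<in>{v. accepts N {} v}. tape_holds (last (snd c)) v) \<longleftrightarrow> (\<exists>st tr cl. answers w u r st tr cl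
        \<and> in_range w st tr cl)"
proof -
  have l: "length (snd c) = K" using assms(1) by (simp add: depicts_def)
  then have la: "last (snd c) = snd c ! (K - 1)" "last (snd c) \<in> set (snd c)"
    using K(1) by (metis last_conv_nth length_greater_0_conv, metis last_in_set length_greater_0_conv)
  have e: "T w - r + 1 \<le> T' w" using S(7)[of w] by simp
  have f: "cl_of (S w) u 0 0 r (K - 1) (T w + i) = last (snd c) (int i)" if "i < T w - r + 1" for i
  proof -
    have "r \<le> T w + i \<and> T w + i + r \<le> 2 * T w" "K - 1 < K" using that assms(2) K(1) by auto
    then have "cl_of (S w) u 0 0 r (K - 1) (T w + i) = (snd c ! (K - 1)) (int (T w + i) - int (T w))"
      using assms(1) unfolding depicts_def by blast
    then show ?thesis unfolding la(1) by simp
  qed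
  have z: "last (snd c) (int i) = 0" if "T w - r + 1 \<le> i" for i
  proof -
    have "int (length w + poly p (length w)) < \<bar>int i\<bar>" using that assms(3) unfolding T_def by linarith
    then show ?thesis using assms(4) la(2) unfolding blank_beyond_def by blast
  qed
  have path: "n < T' w" if "length v \<le> T w - r + 1" "(tm_step N {} ^^ n) (initial N v) c" for v n c
  proof -
    have "n \<le> poly q (length v)" by (rule paths'[OF that(2)])
    also have "\<dots> \<le> poly q (T w + 1)" using that(1) by (intro poly_mono_nat) simp
    finally show ?thesis by (simp add: T'_def)
  qed
  note o = oracle_answer[where t = "last (snd c)" and f = "\<lambda>i. cl_of (S w) u 0 0 r (K - 1) (T w +
      i)" and e = "T w - r + 1", OF wf(2) dl(2) free D(2,4) path e f z]
  show "(\<exists>v\<in>{v. accepts N {} v}. tape_holds (last (snd c)) v) \<longleftrightarrow> (\<exists>st tr cl. answers w u r st tr cl)"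
    unfolding answers_def by (rule o(1))
  show "(\<exists>v\<in>{v. accepts N {} v}. tape_holds (last (snd c)) v) \<longleftrightarrow> (\<exists>st tr cl. answers w u r st tr cl \<and>
      in_range w st tr cl)"
    unfolding answers_def in_range_def conj_assoc by (rule o(2))
qed

lemma accepts_gsteps: "accepts M {v. accepts N {} v} w \<longleftrightarrow> (\<exists>cs ds. cs 0 = initial M w \<and> (\<forall>t<T w.
    gstep M dl (ds t) (cs t) (cs (Suc t)) \<and>
    ds t < length dl + 3 \<and> truthful M dl {v. accepts N {} v} (ds t) (cs t)) \<and> fst (cs (T w)) = tm_accept M)"
proof (rule accepts_iff_gsteps[OF wf(1) dl(1)])
  fix n c assume "(tm_step M {v. accepts N {} v} ^^ n) (initial M w) c"
  from paths[OF this] show "n < T w" by (simp add: T_def)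
qed

lemma query_blank:
  assumes "cs 0 = initial M w" "\<And>t. t < T w \<Longrightarrow> gstep M dl (ds t) (cs t) (cs (Suc t))" "r < T w"
    "\<And>t. t < r \<Longrightarrow> truthful M dl {v. accepts N {} v} (ds t) (cs t)" "ds r \<noteq> length dl"
  shows "r \<le> poly p (length w)" "blank_beyond (int (length w + poly p (length w))) (cs r)"
proof -
  show "r \<le> poly p (length w)" by (rule query_time(1)[OF wf(1) dl(1) assms]; (assumption | erule paths))
  show "blank_beyond (int (length w + poly p (length w))) (cs r)" by (rule query_time(2)[OF wf(1)
      dl(1) assms]; (assumption | erule paths))
qed

text \<open>By induction on time all answers are truthful. The hypothesis about earlier steps bounds
  the time of the query and thereby brings the whole query word into the reliable part of the
  table.\<close>

lemma right_sound:
  assumes "right w u" "\<not> refuted w u"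
  shows "accepts M {v. accepts N {} v} w"
proof -
  from run_sound[OF wf(1) dl(1)] assms(1) obtain cs where cs: "cs 0 = initial M w"
    "\<And>t. t \<le> T w \<Longrightarrow> depicts M (T w) (st_of (S w) u 0 0) (cl_of (S w) u 0 0) t (cs t)"
    "\<And>t. t < T w \<Longrightarrow> gstep M dl (tr_of (S w) u 0 0 t) (cs t) (cs (Suc t))" "fst (cs (T w)) = tm_accept M"
    unfolding right_def by metis
  have "truthful M dl {v. accepts N {} v} (tr_of (S w) u 0 0 r) (cs r)" if "r < T w" for r
    using that
  proof (induction r rule: less_induct)
    case (less r)
    show ?case
    proof (cases "tr_of (S w) u 0 0 r = length dl + 1 \<or> tr_of (S w) u 0 0 r = length dl + 2")
      case True
      have "truthful M dl {v. accepts N {} v} (tr_of (S w) u 0 0 t) (cs t)" if "t < r" for t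
        using less that by simp
      moreover have "tr_of (S w) u 0 0 r \<noteq> length dl" using True by auto
      ultimately have "r \<le> poly p (length w)" "blank_beyond (int (length w + poly p (length w))) (cs r)"
        using query_blank[where cs = cs and ds = "tr_of (S w) u 0 0", OF cs(1,3) less.prems] by simp_all
      note a = answers_iff[OF cs(2)[OF less_imp_le[OF less.prems]] less.prems this]
      show ?thesis
      proof (cases "tr_of (S w) u 0 0 r = length dl + 1")
        case t: True
        then have "answers w u r (st_of (S w) u 3 r) (tr_of (S w) u 3 r) (cl_of (S w) u 3 r)"
          using assms(1) less.prems unfolding right_def by blast
        then have "\<exists>v\<in>{v. accepts N {} v}. tape_holds (last (snd (cs r))) v" unfolding a(1) by (intro exI)
        then show ?thesis using t by (simp add: truthful_def)
      next
        case False
        then have t: "tr_of (S w) u 0 0 r = length dl + 2" using True by simp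
        then have "\<not> (\<exists>st tr cl. answers w u r st tr cl \<and> in_range w st tr cl)"
          using assms(2) less.prems unfolding refuted_def by blast
        then have "\<not> (\<exists>v\<in>{v. accepts N {} v}. tape_holds (last (snd (cs r))) v)" unfolding a(2) .
        then show ?thesis using t by (simp add: truthful_def)
      qed
    qed (simp add: truthful_def)
  qed
  moreover have "tr_of (S w) u 0 0 t < length dl + 3" if "t < T w" for t
    using cs(3)[OF that] by (auto simp: gstep_def)
  ultimately show ?thesis unfolding accepts_gsteps using cs by blast
qed

lemma starts_on_cong:
  assumes "\<And>k x. k < tm_tapes N' \<Longrightarrow> c k x = c' k x" "\<And>i. f i = f' i"
  shows "starts_on N' t e c f \<longleftrightarrow> starts_on N' t e c' f'"
  using assms by (simp add: starts_on_def)

lemma right_complete: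
  assumes "accepts M {v. accepts N {} v} w"
  shows "\<exists>u. (\<forall>v. u v < D) \<and> right w u \<and> \<not> refuted w u"
proof -
  from assms[unfolded accepts_gsteps] obtain cs ds where cs: "cs 0 = initial M w" "fst (cs (T w)) =
      tm_accept M"
    "\<And>t. t < T w \<Longrightarrow> gstep M dl (ds t) (cs t) (cs (Suc t))" "\<And>t. t < T w \<Longrightarrow> ds t < length dl + 3"
    "\<And>t. t < T w \<Longrightarrow> truthful M dl {v. accepts N {} v} (ds t) (cs t)" by metis
  obtain st cl where r: "run_on M dl (T w) st ds cl" "input_at M (T w) (cl 0) w" "\<And>t. t \<le> T w \<Longrightarrow> st t < D"
    "\<And>t k x. t \<le> T w \<Longrightarrow> k < K \<Longrightarrow> cl t k x < D" "\<And>t. t \<le> T w \<Longrightarrow> depicts M (T w) st cl t (cs t)"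
    using run_complete[OF wf(1) dl(1) D(1) cs(1,3,2)] by metis
  have q: "r \<le> poly p (length w) \<and> blank_beyond (int (length w + poly p (length w))) (cs r)" if "r <
      T w" "ds r \<noteq> length dl" for r
    using query_blank[where cs = cs and ds = ds, OF cs(1,3) that(1) _ that(2)] cs(5) that(1) by simp
  \<comment> \<open>\<open>B u\<close> says that \<open>u\<close> records the given run. What
    \<open>answers\<close> reads of the assignment is part of this record, so the certificates may
    be chosen for one such assignment \<open>u0\<close> and stored in another one.\<close>
  define B where "B u \<longleftrightarrow> (\<forall>t\<le>T w. st_of (S w) u 0 0 t = st t) \<and> (\<forall>t<T w. tr_of (S w) u 0 0 t = ds t) \<and>
    (\<forall>t\<le>T w. \<forall>k<K. \<forall>x. cl_of (S w) u 0 0 t k x = cl t k x)" for u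
  have B_right: "run_on M dl (T w) (st_of (S w) u 0 0) (tr_of (S w) u 0 0) (cl_of (S w) u 0 0)"
    "input_at M (T w) (cl_of (S w) u 0 0 0) w" if "B u" for u
  proof -
    have "run_on M dl (T w) (st_of (S w) u 0 0) (tr_of (S w) u 0 0) (cl_of (S w) u 0 0) \<longleftrightarrow> run_on M
        dl (T w) st ds cl"
      by (rule run_on_cong) (use that in \<open>simp_all add: B_def\<close>)
    with r(1) show "run_on M dl (T w) (st_of (S w) u 0 0) (tr_of (S w) u 0 0) (cl_of (S w) u 0 0)" by blast
    show "input_at M (T w) (cl_of (S w) u 0 0 0) w" using r(2) that by (simp add: input_at_def B_def)
  qed
  have B_dep: "depicts M (T w) (st_of (S w) u 0 0) (cl_of (S w) u 0 0) r (cs r)" if "B u" "r < T w" for u r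
    using r(5)[of r] that by (simp add: depicts_def B_def)
  have B_iff: "(\<exists>v\<in>{v. accepts N {} v}. tape_holds (last (snd (cs r))) v) \<longleftrightarrow> (\<exists>st tr cl. answers w u
      r st tr cl \<and> in_range w st tr cl)"
    if "B u" "r < T w" "ds r \<noteq> length dl" for u r
    using answers_iff(2)[OF B_dep[OF that(1,2)] that(2)] q[OF that(2,3)] by blast
  have B_eq: "answers w u r s d c \<longleftrightarrow> answers w u' r s d c" if "B u" "B u'" "r < T w" for u u' r s d c
  proof -
    have "cl_of (S w) u 0 0 r (K - 1) y = cl_of (S w) u' 0 0 r (K - 1) y" for y
      using that K(1) by (simp add: B_def)
    then show ?thesis by (simp only: answers_def)
  qed
  have ex: "\<exists>u. (\<forall>v. u v < D) \<and> B u \<and>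
    (\<forall>tag r t k x. 3 \<le> tag \<longrightarrow> tag < 11 \<longrightarrow> r < S w \<longrightarrow> t < S w \<longrightarrow> k < S w \<longrightarrow> V tag r t k x < D \<longrightarrow> u (ad (S
        w) tag r t k x) = V tag r t k x)"
    for V :: "nat \<Rightarrow> nat \<Rightarrow> nat \<Rightarrow> nat \<Rightarrow> nat \<Rightarrow> nat"
  proof -
    define U :: "nat \<Rightarrow> nat \<Rightarrow> nat \<Rightarrow> nat \<Rightarrow> nat \<Rightarrow> nat" where
      "U tag r t k x = (if tag = 0 then st t else if tag = 1 then ds t else if tag = 2 then cl t k x
          else V tag r t k x)" for tag r t k x
    have "0 < D" using D(7) by simp
    then obtain u where u0: "\<And>v. u v < D" "\<And>v. v mod 11 < 0 \<Longrightarrow> u v = 0"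
       "\<And>tag r t k x. 0 \<le> tag \<Longrightarrow> tag < 11 \<Longrightarrow> r < S w \<Longrightarrow> t < S w \<Longrightarrow> k < S w \<Longrightarrow> U tag r t k x < D \<Longrightarrow>
       u (ad (S w) tag r t k x) = U tag r t k x"
      by (rule ex_table[where ?u0.0 = "\<lambda>_. 0" and S = "S w" and U = U and b = 0]) (rule that)
    note u = u0(3)[OF le0]
    have l: "t < S w" if "t \<le> T w" for t using that S(1)[of w] by simp
    have "st_of (S w) u 0 0 t = st t" if "t \<le> T w" for t
      using u[of 0 0 t 0 0] l[OF that] r(3)[OF that] S(6)[of w] by (simp add: st_of_def U_def)
    moreover have "tr_of (S w) u 0 0 t = ds t" if "t < T w" for t
      using u[of 1 0 t 0 0] l[of t] cs(4)[OF that] that S(6)[of w] D(3) by (simp add: tr_of_def U_def)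
    moreover have "cl_of (S w) u 0 0 t k x = cl t k x" if "t \<le> T w" "k < K" for t k x
      using u[of 2 0 t k x] l[of t] S(3)[of w] r(4)[OF that] that S(6)[of w] by (simp add: cl_of_def
          U_def numeral_2_eq_2)
    ultimately have "B u" by (simp add: B_def)
    moreover have "u (ad (S w) tag r t k x) = V tag r t k x"
      if "3 \<le> tag" "tag < 11" "r < S w" "t < S w" "k < S w" "V tag r t k x < D" for tag r t k x
      using u[of tag r t k x] that by (simp add: U_def)
    ultimately show ?thesis using u0(1) by blast
  qed
  from ex[of "\<lambda>_ _ _ _ _. 0"] obtain u0 where u0: "B u0" by blast
  have "\<exists>s d c. r < T w \<and> ds r = length dl + 1 \<longrightarrow> answers w u0 r s d c \<and> in_range w s d c" for r
    using B_iff[OF u0, of r] cs(5)[of r] by (fastforce simp: truthful_def)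
  then obtain s d c where sdc: "\<And>r. r < T w \<Longrightarrow> ds r = length dl + 1 \<Longrightarrow> answers w u0 r (s r) (d r) (c
      r) \<and> in_range w (s r) (d r) (c r)"
    by metis
  define V :: "nat \<Rightarrow> nat \<Rightarrow> nat \<Rightarrow> nat \<Rightarrow> nat \<Rightarrow> nat" where
    "V tag r t k x = (if tag = 3 then s r t else if tag = 4 then d r t else c r t k x)" for tag r t k x
  from ex[of V] obtain u where u: "\<And>v. u v < D" "B u"
    "\<And>tag r t k x. 3 \<le> tag \<Longrightarrow> tag < 11 \<Longrightarrow> r < S w \<Longrightarrow> t < S w \<Longrightarrow> k < S w \<Longrightarrow> V tag r t k x < D \<Longrightarrow> u (ad (S
        w) tag r t k x) = V tag r t k x"
    by blast
  have "answers w u r (st_of (S w) u 3 r) (tr_of (S w) u 3 r) (cl_of (S w) u 3 r)" if "r < T w"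
      "tr_of (S w) u 0 0 r = length dl + 1" for r
  proof -
    have "ds r = length dl + 1" using that u(2) by (simp add: B_def)
    from sdc[OF that(1) this] have a: "answers w u r (s r) (d r) (c r)" "in_range w (s r) (d r) (c r)"
      using B_eq[OF u0 u(2) that(1)] by auto
    have l: "r < S w" "\<And>t. t \<le> T' w \<Longrightarrow> t < S w" "\<And>k. k < K' \<Longrightarrow> k < S w" using that(1) S(5,6,4)[of w]
        S(2)[of w] by linarith+
    have "st_of (S w) u 3 r t = s r t" if "t \<le> T' w" for t
      using u(3)[of 3 r t 0 0] l that a(2) S(6)[of w] by (simp add: st_of_def V_def in_range_def)
    moreover have "tr_of (S w) u 3 r t = d r t" if "t < T' w" for t
      using u(3)[of 4 r t 0 0] l that a(2) S(6)[of w] by (simp add: tr_of_def V_def in_range_def)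
    moreover have cl: "cl_of (S w) u 3 r t k x = c r t k x" if "t \<le> T' w" "k < K'" for t k x
      using u(3)[of 5 r t k x] l that a(2) by (simp add: cl_of_def V_def in_range_def)
    ultimately have "run_on N dl' (T' w) (st_of (S w) u 3 r) (tr_of (S w) u 3 r) (cl_of (S w) u 3 r)
        \<longleftrightarrow> run_on N dl' (T' w) (s r) (d r) (c r)"
      by (intro run_on_cong)
    moreover have "starts_on N (T' w) e (cl_of (S w) u 3 r 0) f \<longleftrightarrow> starts_on N (T' w) e (c r 0) f" for e f
      by (rule starts_on_cong) (use cl in simp_all)
    ultimately show ?thesis using a(1) by (simp only: answers_def)
  qed
  then have "right w u" using B_right[OF u(2)] by (simp add: right_def)
  moreover have "\<not> refuted w u"
  proof
    assume "refuted w u"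
    then obtain r where "r < T w" "tr_of (S w) u 0 0 r = length dl + 2" "\<exists>st tr cl. answers w u r st
        tr cl \<and> in_range w st tr cl"
      unfolding refuted_def by (elim exE conjE) blast
    moreover from this have "ds r = length dl + 2" using u(2) by (simp add: B_def)
    ultimately show False using B_iff[OF u(2), of r] cs(5)[of r] by (simp add: truthful_def)
  qed
  ultimately show ?thesis using u(1) by blast
qed

end

section \<open>The constraint system of an oracle computation\<close>

lemma wPF_cell_kind:
  assumes "PF (\<lambda>ws e. T (ws 0))" "wPF k" "wPF x"
  shows "wPF (\<lambda>w c. cell_kind K (T w) (k w c) (x w c))"
  unfolding cell_kind_def by (intro wPF_if PP_conj PP_disj PP_not PP_wPF wPF_intros(1,3,6) assms)

lemma chain_address:
  "11 * c + 10 = ad S 10 (c mod S) (c div S mod S) (c div S ^ 2 mod S) (c div S ^ 3)"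
  unfolding ad_def compose by simp

lemma all_split:
  assumes "0 < (S :: nat)" "\<And>r. C r \<Longrightarrow> r < S"
  shows "(\<forall>r<S. \<forall>t<S. \<forall>k<S. \<forall>x<S. A k x \<and> B t k x \<and> (C r \<longrightarrow> E r t k x)) \<longleftrightarrow>
    (\<forall>t<S. \<forall>k<S. \<forall>x<S. B t k x) \<and> (\<forall>k<S. \<forall>x<S. A k x) \<and> (\<forall>r. C r \<longrightarrow> (\<forall>t<S. \<forall>k<S. \<forall>x<S. E r t k x))"
proof (intro iffI conjI allI impI)
  assume h: "\<forall>r<S. \<forall>t<S. \<forall>k<S. \<forall>x<S. A k x \<and> B t k x \<and> (C r \<longrightarrow> E r t k x)"
  show "B t k x" if "t < S" "k < S" "x < S" for t k x using h assms(1) that by blast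
  show "A k x" if "k < S" "x < S" for k x using h assms(1) that by blast
  show "E r t k x" if "C r" "t < S" "k < S" "x < S" for r t k x using h assms(2)[OF that(1)] that by blast
qed auto

lemma all_split2:
  assumes "0 < (S :: nat)"
  shows "(\<forall>t<S. \<forall>k<S. \<forall>x<S. B t k x \<and> A k x) \<longleftrightarrow> (\<forall>t<S. \<forall>k<S. \<forall>x<S. B t k x) \<and> (\<forall>k<S. \<forall>x<S. A k x)"
proof (intro iffI conjI allI impI)
  assume h: "\<forall>t<S. \<forall>k<S. \<forall>x<S. B t k x \<and> A k x"
  show "B t k x" if "t < S" "k < S" "x < S" for t k x using h that by blast
  show "A k x" if "k < S" "x < S" for k x using h assms that by blast
qed auto

lemma all_restrict:
  assumes "\<And>k x. k < a \<Longrightarrow> x \<le> b \<Longrightarrow> k < S \<and> x < (S :: nat)" "\<And>k x. \<not> (k < (a :: nat) \<and> x \<le> b) \<Longrightarrow> A k x"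
  shows "(\<forall>k<a. \<forall>x\<le>b. A k x) \<longleftrightarrow> (\<forall>k<S. \<forall>x<S. A k x)"
proof (intro iffI allI impI)
  show "A k x" if "\<forall>k<a. \<forall>x\<le>b. A k x" for k x using that assms(2)[of k x] by (cases "k < a \<and> x \<le> b") auto
  show "A k x" if "\<forall>k<S. \<forall>x<S. A k x" "k < a" "x \<le> b" for k x using that(1) assms(1)[OF that(2,3)] by blast
qed

context oracle_run
begin

definition feats :: "wfun list" where
  "feats = [\<lambda>w c. flag K (T w) (ct S w c) (ck S w c) (cx S w c), \<lambda>w c. place (T w) (cx S w c), \<lambda>w c.
      min (ck S w c) (D - 1),
    \<lambda>w c. input_flag K (T w) (ck S w c) (cx S w c), \<lambda>w c. input_symb (T w) w (ck S w c) (cx S w c),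
    \<lambda>w c. flag K' (T' w) (ct S w c) (ck S w c) (cx S w c), \<lambda>w c. place (T' w) (cx S w c), \<lambda>w c.
        cell_kind K' (T' w) (ck S w c) (cx S w c),
    \<lambda>w c. of_bool (cx S w c - T' w < T w - cr S w c + 1), \<lambda>w c. of_bool (cr S w c < T w), \<lambda>w c.
        of_bool (c = 0), \<lambda>w c. of_bool (c + 1 = S w ^ 4)]"

definition adrs10 :: "wfun list" where
  "adrs10 = [\<lambda>w c. ad (S w) 2 0 0 (ck S w c) (cx S w c), \<lambda>w c. ad (S w) 1 0 (cr S w c) 0 0,
    \<lambda>w c. ad (S w) 2 0 (cr S w c) (K - 1) (T w + (cx S w c - T' w)),
    \<lambda>w c. ad (S w) 5 (cr S w c) 0 (ck S w c) (cx S w c), \<lambda>w c. ad (S w) 5 (cr S w c) 0 (ck S w c)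
        (cx S w c - 1),
    \<lambda>w c. ad (S w) 8 (cr S w c) 0 (ck S w c) (cx S w c), \<lambda>w c. ad (S w) 8 (cr S w c) 0 (ck S w c)
        (cx S w c - 1),
    \<lambda>w c. ad (S w) 9 (cr S w c) 0 0 0, \<lambda>w c. 11 * c + 10, \<lambda>w c. 11 * (c + 1) + 10]"

definition adrs :: "wfun list" where
  "adrs = adrs10 @ block_adrs S T K 0 (\<lambda>_ _. 0) @ block_adrs S T' K' 3 (cr S) @ block_adrs S T' K' 6 (cr S)"

text \<open>The value list consists of ten single addresses, a block of length \<open>9 + K\<close>
  for the run of \<open>M\<close>, and two of length \<open>9 + K'\<close> for the certifying and
  the refuting run of \<open>N\<close>; the offsets follow.\<close>

definition GR :: "nat list \<Rightarrow> nat list \<Rightarrow> bool" where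
  "GR F v \<longleftrightarrow> (F ! 3 = 1 \<longrightarrow> v ! 0 = F ! 4) \<and> block_ok M dl (F ! 0) (F ! 1) (F ! 2) (take (9 + K) (drop 10 v)) \<and>
     (F ! 9 = 1 \<and> v ! 1 = length dl + 1 \<longrightarrow>
       block_ok N dl' (F ! 5) (F ! 6) (F ! 2) (take (9 + K') (drop (19 + K) v)) \<and> query_cell (F ! 7)
           (F ! 8) (v ! 3) (v ! 4) (v ! 2))"

text \<open>The flags at the addresses \<open>11 c + 10\<close> have to rise from \<open>0\<close> to \<open>1\<close>; they may do so only where a
  constraint of the computation is violated or a negative oracle answer is refuted.\<close>

definition G :: "nat list \<Rightarrow> nat list \<Rightarrow> bool" where
  "G F v \<longleftrightarrow> (F ! 9 = 1 \<and> v ! 7 = 1 \<longrightarrow> v ! 1 = length dl + 2 \<and>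
       block_ok N dl' (F ! 5) (F ! 6) (F ! 2) (drop (28 + K + K') v) \<and> query_cell (F ! 7) (F ! 8) (v
           ! 5) (v ! 6) (v ! 2)) \<and>
     (F ! 10 = 1 \<longrightarrow> v ! 8 = 0) \<and> (F ! 11 = 1 \<longrightarrow> v ! 9 = 1) \<and>
     (v ! 9 = 1 \<longrightarrow> v ! 8 = 1 \<or> \<not> GR F v \<or> F ! 9 = 1 \<and> v ! 7 = 1)"

text \<open>The outer variables are those with tags 0 to 5, the run and its certificates; the
  refuting run, the marks and the flags are inner.\<close>

lemma sys: "system D feats adrs (\<lambda>w. S w ^ 4) (\<lambda>w. ad_bound (S w)) (\<lambda>v. v mod 11 < 6)"
proof
  have T: "PF (\<lambda>ws e. T (ws 0))" unfolding T_def by (intro pf_intros)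
  have T': "PF (\<lambda>ws e. T' (ws 0))" unfolding T'_def by (intro pf_intros T)
  have S': "PF (\<lambda>ws e. S (ws 0))" unfolding S_def by (intro pf_intros T T')
  have c: "wPF (cr S)" "wPF (ct S)" "wPF (ck S)" "wPF (cx S)" by (intro wPF_intros S')+
  have "\<forall>\<phi>\<in>set feats. wPF \<phi>"
    unfolding feats_def list.set ball_simps
    by (intro conjI TrueI wPF_flag wPF_place wPF_input wPF_cell_kind wPF_of_bool PP_wPF
        wPF_intros(2,3,4,5,10,11) wPF_intros(1)[of S] wPF_intros(1)[of T]
      wPF_intros(1)[of T'] c T T' S')
  then show "PF (\<lambda>ws e. \<phi> (ws 0) (e 0))" if "\<phi> \<in> set feats" for \<phi> using that unfolding wPF_def by blast
  have "of_bool b < D" "cell_kind a b' c' d < D" for b a b' c' d using D(7) by (auto simp: cell_kind_def)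
  then have "\<forall>\<phi>\<in>set feats. \<phi> w c < D" for w c
    unfolding feats_def list.set ball_simps
    using flag_less(1)[of K "T w" "ct S w c" "ck S w c" "cx S w c"] flag_less(1)[of K' "T' w" "ct S
        w c" "ck S w c" "cx S w c"]
      flag_less(2)[of K "T w" "ck S w c" "cx S w c"] place_less[of "T w" "cx S w c"] place_less[of
          "T' w" "cx S w c"]
      symb_less[of w "cx S w c - T w"] D(7) by (auto simp: input_symb_def)
  then show "\<phi> w c < D" if "\<phi> \<in> set feats" for \<phi> w c using that by blast
  have "\<forall>a\<in>set adrs10. wPF a"
    unfolding adrs10_def list.set ball_simps
    by (intro conjI TrueI wPF_ad wPF_intros(2-6) wPF_intros(1)[of T] wPF_intros(1)[of T'] c T T' S')
  moreover have "\<forall>a\<in>set (block_adrs S T K 0 (\<lambda>_ _. 0)) \<union> set (block_adrs S T' K' 3 (cr S)) \<union> set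
      (block_adrs S T' K' 6 (cr S)). wPF a"
    using wPF_block[OF S' T wPF_intros(3)] wPF_block[OF S' T' c(1)] by blast
  ultimately show "PF (\<lambda>ws e. a (ws 0) (e 0))" if "a \<in> set adrs" for a
    using that unfolding adrs_def set_append Un_iff wPF_def[symmetric] by blast
  show "a w c < ad_bound (S w)" if "a \<in> set adrs" "c < S w ^ 4" for a w c
  proof -
    note b = component_bounds[OF that(2)]
    \<comment> \<open>At the last constraint the successor number has the leading digit
      \<open>S w\<close>, just outside the usual range.\<close>
    have x: "(c + 1) div S w ^ 3 \<le> S w"
    proof -
      have "(c + 1) div S w ^ 3 \<le> S w ^ 4 div S w ^ 3" using that(2) by (intro div_le_mono) simp
      also have "\<dots> = S w" using S(6)[of w] by (simp add: power_diff[symmetric])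
      finally show ?thesis .
    qed
    have m: "(c + 1) mod S w < S w" "(c + 1) div S w mod S w < S w" "(c + 1) div S w ^ 2 mod S w < S
        w" using S(6)[of w] by simp_all
    have "\<forall>a\<in>set adrs10. a w c < ad_bound (S w)"
      unfolding adrs10_def list.set ball_simps chain_address[where S = "S w"]
      by (intro conjI TrueI ad_less) (use b x m S[of w] K in linarith)+
    moreover have "a w c < ad_bound (S w)" if "a \<in> set (block_adrs S T K 0 (\<lambda>_ _. 0))"
      by (rule block_adrs_less[where \<rho> = "\<lambda>_ _. 0", OF that \<open>c < S w ^ 4\<close>]) (use S[of w] in auto)
    moreover have "a w c < ad_bound (S w)" if "a \<in> set (block_adrs S T' K' tag (cr S))" "tag + 2 < 11" for tag
      by (rule block_adrs_less[OF that(1) \<open>c < S w ^ 4\<close>]) (use S[of w] b that(2) in auto)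
    ultimately show ?thesis using that(1) unfolding adrs_def by auto
  qed
  show "PF (\<lambda>ws e. S (ws 0) ^ 4)" "PF (\<lambda>ws e. ad_bound (S (ws 0)))" unfolding ad_bound_def by (intro
      pf_intros S')+
  show "PP (\<lambda>ws e. e 0 mod 11 < 6)" by (intro pf_intros)
qed (use D(7) in simp)

definition answer_at :: "bool list \<Rightarrow> (nat \<Rightarrow> nat) \<Rightarrow> nat \<Rightarrow> nat \<Rightarrow> nat \<Rightarrow> nat \<Rightarrow> nat \<Rightarrow> bool" where
  "answer_at w u tag r t k x \<longleftrightarrow>
     block_ok N dl' (flag K' (T' w) t k x) (place (T' w) x) (min k (D - 1))
       (block_vals K' (T' w) t k x (st_of (S w) u tag r) (tr_of (S w) u tag r) (cl_of (S w) u tag r)) \<and>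
     query_cell (cell_kind K' (T' w) k x) (of_bool (x - T' w < T w - r + 1)) (cl_of (S w) u tag r 0
         k x) (cl_of (S w) u tag r 0 k (x - 1))
       (cl_of (S w) u 0 0 r (K - 1) (T w + (x - T' w)))"

definition right_at :: "bool list \<Rightarrow> (nat \<Rightarrow> nat) \<Rightarrow> nat \<Rightarrow> nat \<Rightarrow> nat \<Rightarrow> nat \<Rightarrow> bool" where
  "right_at w u r t k x \<longleftrightarrow> (input_flag K (T w) k x = 1 \<longrightarrow> cl_of (S w) u 0 0 0 k x = input_symb (T w) w k x) \<and>
     block_ok M dl (flag K (T w) t k x) (place (T w) x) (min k (D - 1))
       (block_vals K (T w) t k x (st_of (S w) u 0 0) (tr_of (S w) u 0 0) (cl_of (S w) u 0 0)) \<and>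
     (r < T w \<and> tr_of (S w) u 0 0 r = length dl + 1 \<longrightarrow> answer_at w u 3 r t k x)"

definition claims :: "bool list \<Rightarrow> (nat \<Rightarrow> nat) \<Rightarrow> nat \<Rightarrow> bool" where
  "claims w u r \<longleftrightarrow> r < T w \<and> u (ad (S w) 9 r 0 0 0) = 1"

lemma answers_local:
  "(\<forall>t<S w. \<forall>k<S w. \<forall>x<S w. answer_at w u tag r t k x) \<longleftrightarrow> answers w u r (st_of (S w) u tag r) (tr_of
      (S w) u tag r) (cl_of (S w) u tag r)"
proof -
  have "starts_on N (T' w) (T w - r + 1) (cl_of (S w) u tag r 0) (\<lambda>i. cl_of (S w) u 0 0 r (K - 1) (T w + i)) \<longleftrightarrow>
    (\<forall>k<S w. \<forall>x<S w. query_cell (cell_kind K' (T' w) k x) (of_bool (x - T' w < T w - r + 1)) (cl_of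
        (S w) u tag r 0 k x)
      (cl_of (S w) u tag r 0 k (x - 1)) (cl_of (S w) u 0 0 r (K - 1) (T w + (x - T' w))))" (is "_ \<longleftrightarrow>
          (\<forall>k<_. \<forall>x<_. ?q k x)")
  proof -
    have "?q k x" if "\<not> (k < K' \<and> x \<le> 2 * T' w)" for k x
    proof -
      have "cell_kind K' (T' w) k x = 0" unfolding cell_kind_def by (rule if_not_P[OF that])
      then show ?thesis by (simp add: query_cell_def)
    qed
    moreover have "k < S w \<and> x < S w" if "k < K'" "x \<le> 2 * T' w" for k x using that S(2,4)[of w] by linarith
    ultimately show ?thesis unfolding starts_on_def by (intro all_restrict)
  qed
  then show ?thesis
    unfolding answers_def answer_at_def blocks_run[OF S(2) S(4) D(6), where dl = dl', symmetric]
        all_split2[OF S(6)] by (simp only:)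
qed

lemma right_local: "(\<forall>r<S w. \<forall>t<S w. \<forall>k<S w. \<forall>x<S w. right_at w u r t k x) \<longleftrightarrow> right w u"
proof -
  have "r < S w" if "r < T w" for r using that S(1)[of w] by simp
  then have "(\<forall>r<S w. \<forall>t<S w. \<forall>k<S w. \<forall>x<S w. right_at w u r t k x) \<longleftrightarrow>
     run_on M dl (T w) (st_of (S w) u 0 0) (tr_of (S w) u 0 0) (cl_of (S w) u 0 0) \<and>
     input_at M (T w) (cl_of (S w) u 0 0 0) w \<and>
     (\<forall>r. r < T w \<and> tr_of (S w) u 0 0 r = length dl + 1 \<longrightarrow> answers w u r (st_of (S w) u 3 r) (tr_of
         (S w) u 3 r) (cl_of (S w) u 3 r))"
    unfolding right_at_def blocks_run[OF S(1) S(3) D(5), where dl = dl, symmetric] inputs_at[OF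
        S(1,3), symmetric] answers_local[symmetric]
    by (intro all_split S(6)) simp
  then show ?thesis unfolding right_def by blast
qed

lemma G_iff:
  "G (map (\<lambda>\<phi>. \<phi> w c) feats) (map (\<lambda>a. u (a w c)) adrs) \<longleftrightarrow>
    (claims w u (cr S w c) \<longrightarrow> tr_of (S w) u 0 0 (cr S w c) = length dl + 2 \<and> answer_at w u 6 (cr S w
        c) (ct S w c) (ck S w c) (cx S w c)) \<and>
    (c = 0 \<longrightarrow> u (11 * c + 10) = 0) \<and> (c + 1 = S w ^ 4 \<longrightarrow> u (11 * (c + 1) + 10) = 1) \<and>
    (u (11 * (c + 1) + 10) = 1 \<longrightarrow> u (11 * c + 10) = 1 \<or> \<not> right_at w u (cr S w c) (ct S w c) (ck S w
        c) (cx S w c) \<or> claims w u (cr S w c))"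
proof -
  let ?F = "map (\<lambda>\<phi>. \<phi> w c) feats" and ?a = "map (\<lambda>a. u (a w c)) adrs10"
  let ?b = "block_vals K (T w) (ct S w c) (ck S w c) (cx S w c) (st_of (S w) u 0 0) (tr_of (S w) u 0
      0) (cl_of (S w) u 0 0)"
  let ?c = "\<lambda>tag. block_vals K' (T' w) (ct S w c) (ck S w c) (cx S w c) (st_of (S w) u tag (cr S w
      c)) (tr_of (S w) u tag (cr S w c)) (cl_of (S w) u tag (cr S w c))"
  define v where "v = ?a @ ?b @ ?c 3 @ ?c 6"
  have v: "map (\<lambda>a. u (a w c)) adrs = v" unfolding v_def adrs_def map_append map_block_adrs ..
  have la: "length ?a = 10" by (simp add: adrs10_def)
  have d: "drop 10 v = ?b @ ?c 3 @ ?c 6" using la by (simp add: v_def)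
  have "take (9 + K) (drop 10 v) = ?b" unfolding d by simp
  moreover have "drop (19 + K) v = ?c 3 @ ?c 6" "drop (28 + K + K') v = ?c 6" using la by (simp_all
      add: v_def)
  moreover have "take (9 + K') (?c 3 @ ?c 6) = ?c 3" by simp
  moreover have "v ! i = ?a ! i" if "i < 10" for i using la that by (simp add: v_def nth_append)
  then have "v ! 0 = cl_of (S w) u 0 0 0 (ck S w c) (cx S w c)" "v ! 1 = tr_of (S w) u 0 0 (cr S w c)"
    "v ! 2 = cl_of (S w) u 0 0 (cr S w c) (K - 1) (T w + (cx S w c - T' w))"
    "v ! 3 = cl_of (S w) u 3 (cr S w c) 0 (ck S w c) (cx S w c)" "v ! 4 = cl_of (S w) u 3 (cr S w c)
        0 (ck S w c) (cx S w c - 1)"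
    "v ! 5 = cl_of (S w) u 6 (cr S w c) 0 (ck S w c) (cx S w c)" "v ! 6 = cl_of (S w) u 6 (cr S w c)
        0 (ck S w c) (cx S w c - 1)"
    "v ! 7 = u (ad (S w) 9 (cr S w c) 0 0 0)" "v ! 8 = u (11 * c + 10)" "v ! 9 = u (11 * (c + 1) + 10)"
    by (simp_all add: adrs10_def tr_of_def cl_of_def del: add_2_eq_Suc add_2_eq_Suc')
  moreover have "?F ! 0 = flag K (T w) (ct S w c) (ck S w c) (cx S w c)" "?F ! 1 = place (T w) (cx S
      w c)" "?F ! 2 = min (ck S w c) (D - 1)"
    "?F ! 3 = input_flag K (T w) (ck S w c) (cx S w c)" "?F ! 4 = input_symb (T w) w (ck S w c) (cx S w c)"
    "?F ! 5 = flag K' (T' w) (ct S w c) (ck S w c) (cx S w c)" "?F ! 6 = place (T' w) (cx S w c)"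
    "?F ! 7 = cell_kind K' (T' w) (ck S w c) (cx S w c)" "?F ! 8 = of_bool (cx S w c - T' w < T w -
        cr S w c + 1)"
    "?F ! 9 = of_bool (cr S w c < T w)" "?F ! 10 = of_bool (c = 0)" "?F ! 11 = of_bool (c + 1 = S w ^ 4)"
    by (simp_all add: feats_def)
  moreover have "of_bool b = (1 :: nat) \<longleftrightarrow> b" for b by simp
  ultimately show ?thesis
    unfolding v by (simp only: G_def GR_def right_at_def answer_at_def claims_def)
qed

end

section \<open>Solutions and faulty outer assignments\<close>

context oracle_run
begin

abbreviation "hold \<equiv> system.holds feats adrs G (\<lambda>w. S w ^ 4)"

lemma hold_iff:
  "hold w u \<longleftrightarrow> (\<forall>c<S w ^ 4.
    (claims w u (cr S w c) \<longrightarrow> tr_of (S w) u 0 0 (cr S w c) = length dl + 2 \<and> answer_at w u 6 (cr S w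
        c) (ct S w c) (ck S w c) (cx S w c)) \<and>
    (c = 0 \<longrightarrow> u (11 * c + 10) = 0) \<and> (c + 1 = S w ^ 4 \<longrightarrow> u (11 * (c + 1) + 10) = 1) \<and>
    (u (11 * (c + 1) + 10) = 1 \<longrightarrow> u (11 * c + 10) = 1 \<or> \<not> right_at w u (cr S w c) (ct S w c) (ck S w
        c) (cx S w c) \<or> claims w u (cr S w c)))"
  unfolding system.holds_def[OF sys] G_iff ..

lemma run_vars_cong:
  assumes "\<forall>v. v mod 11 < 6 \<longrightarrow> u' v = u v" "tag \<le> 3"
  shows "st_of (S w) u' tag r = st_of (S w) u tag r" "tr_of (S w) u' tag r = tr_of (S w) u tag r"
      "cl_of (S w) u' tag r = cl_of (S w) u tag r"
proof -
  have "(11 * y + i) mod 11 = i" if "i < 6" for i y :: nat using that by simp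
  then have "ad (S w) i r t k x mod 11 = i" if "i < 6" for i r t k x using that unfolding ad_def by blast
  then have "u' (ad (S w) i r t k x) = u (ad (S w) i r t k x)" if "i < 6" for i r t k x using that
      assms(1) by simp
  then show "st_of (S w) u' tag r = st_of (S w) u tag r" "tr_of (S w) u' tag r = tr_of (S w) u tag
      r" "cl_of (S w) u' tag r = cl_of (S w) u tag r"
    using assms(2) by (intro ext; simp add: st_of_def tr_of_def cl_of_def)+
qed

lemma right_cong:
  assumes "\<forall>v. v mod 11 < 6 \<longrightarrow> u' v = u v"
  shows "right_at w u' r t k x \<longleftrightarrow> right_at w u r t k x" "right w u' \<longleftrightarrow> right w u" "answers w u' r s d
      c \<longleftrightarrow> answers w u r s d c"
proof -
  note e = run_vars_cong[where u' = u' and u = u and tag = 0, OF assms le0] run_vars_cong[where u' =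
      u' and u = u and tag = 3, OF assms order_refl]
  show "right_at w u' r t k x \<longleftrightarrow> right_at w u r t k x" unfolding right_at_def answer_at_def e ..
  show "answers w u' r s d c \<longleftrightarrow> answers w u r s d c" for r s d c unfolding answers_def e ..
  then show "right w u' \<longleftrightarrow> right w u" unfolding right_def e by simp
qed

text \<open>The flags start with 0 and end with 1, so at some place they become 1; a correct run
  leaves only a claimed refutation as the reason. A claim for \<open>r\<close> is checked by every
  constraint with run \<open>r\<close>, and together these say that the refuting run is
  complete.\<close>

lemma refuted_if_hold:
  assumes "hold w u" "\<And>v. u v < D" "right w u"
  shows "refuted w u"
proof -
  note h = assms(1)[unfolded hold_iff, rule_format]
  have S4: "0 < S w ^ 4" using S(6)[of w] by simp
  have r: "right_at w u (cr S w c) (ct S w c) (ck S w c) (cx S w c)" if "c < S w ^ 4" for c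
    using assms(3)[folded right_local] component_bounds[OF that] by blast
  have "\<exists>c<S w ^ 4. claims w u (cr S w c)"
  proof (rule ccontr)
    assume n: "\<not> ?thesis"
    have "u (11 * c + 10) \<noteq> 1" if "c \<le> S w ^ 4" for c
      using that
    proof (induction c)
      case 0
      then show ?case using h[OF S4] by simp
    next
      case (Suc c)
      then have "c < S w ^ 4" by simp
      with Suc show ?case using h[of c] r[of c] n by auto
    qed
    from this[OF order_refl] show False using h[of "S w ^ 4 - 1"] S4 by simp
  qed
  then obtain c0 where c0: "claims w u (cr S w c0)" "c0 < S w ^ 4" by blast
  define r0 where "r0 = cr S w c0"
  have r0: "r0 < T w" "r0 < S w" using c0 component_bounds[OF c0(2)] by (simp_all add: claims_def r0_def)
  have a: "tr_of (S w) u 0 0 r0 = length dl + 2 \<and> answer_at w u 6 r0 t k x" if "t < S w" "k < S w"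
      "x < S w" for t k x
  proof -
    let ?c = "r0 + S w * (t + S w * (k + S w * x))"
    have "\<forall>c<S w ^ 4. claims w u (cr S w c) \<longrightarrow> tr_of (S w) u 0 0 (cr S w c) = length dl + 2 \<and>
        answer_at w u 6 (cr S w c) (ct S w c) (ck S w c) (cx S w c)"
      using h by blast
    then have "claims w u r0 \<longrightarrow> tr_of (S w) u 0 0 r0 = length dl + 2 \<and> answer_at w u 6 r0 t k x"
      using all_components[where S = "S w" and P = "\<lambda>r t k x. claims w u r \<longrightarrow> tr_of (S w) u 0 0 r =
          length dl + 2 \<and> answer_at w u 6 r t k x"]
        r0(2) that by simp
    then show ?thesis using c0(1) by (simp add: r0_def)
  qed
  have "answers w u r0 (st_of (S w) u 6 r0) (tr_of (S w) u 6 r0) (cl_of (S w) u 6 r0)"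
    unfolding answers_local[symmetric] using a by blast
  moreover have "in_range w (st_of (S w) u 6 r0) (tr_of (S w) u 6 r0) (cl_of (S w) u 6 r0)"
    using assms(2) by (simp add: in_range_def st_of_def tr_of_def cl_of_def)
  moreover have "tr_of (S w) u 0 0 r0 = length dl + 2" using a S(6)[of w] by blast
  ultimately show ?thesis unfolding refuted_def using r0(1) by blast
qed

text \<open>The flags are set so as to rise exactly at \<open>c0\<close>. If a constraint of the run
  is violated there, no refutation is claimed (\<open>act\<close> is false); otherwise one is
  claimed for the run index of \<open>c0\<close>, and the given run of \<open>N\<close> is entered
  under the tags 6 to 8.\<close>

lemma hold_if_violated:
  assumes u: "\<And>v. u v < D" and c0: "c0 < S w ^ 4"
    and cases: "\<not> act \<and> \<not> right_at w u (cr S w c0) (ct S w c0) (ck S w c0) (cx S w c0) \<or>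
      act \<and> cr S w c0 < T w \<and> tr_of (S w) u 0 0 (cr S w c0) = length dl + 2 \<and> answers w u (cr S w
          c0) s d c \<and> in_range w s d c"
  shows "\<exists>u'. (\<forall>v. u' v < D) \<and> (\<forall>v. v mod 11 < 6 \<longrightarrow> u' v = u v) \<and> hold w u'"
proof -
  define U :: "nat \<Rightarrow> nat \<Rightarrow> nat \<Rightarrow> nat \<Rightarrow> nat \<Rightarrow> nat" where
    "U tag r t k x = (if tag = 6 then s t else if tag = 7 then d t else if tag = 8 then c t k x
      else if tag = 9 then of_bool (act \<and> r = cr S w c0) else of_bool (c0 < r + S w * (t + S w * (k
          + S w * x))))" for tag r t k x
  obtain u' where u': "\<And>v. u' v < D" "\<And>v. v mod 11 < 6 \<Longrightarrow> u' v = u v"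
    "\<And>tag r t k x. 6 \<le> tag \<Longrightarrow> tag < 11 \<Longrightarrow> r < S w \<Longrightarrow> t < S w \<Longrightarrow> k < S w \<Longrightarrow> U tag r t k x < D \<Longrightarrow> u' (ad (S
        w) tag r t k x) = U tag r t k x"
    by (rule ex_table[where ?u0.0 = u and S = "S w" and U = U and b = 6, OF u]) (rule that)
  have agree: "\<forall>v. v mod 11 < 6 \<longrightarrow> u' v = u v" using u'(2) by blast
  have D1: "of_bool b < D" for b using D(7) by auto
  have chain: "u' (11 * e + 10) = of_bool (c0 < e)" for e
  proof -
    have m: "e mod S w < S w" "e div S w mod S w < S w" "e div S w ^ 2 mod S w < S w" using S(6)[of
        w] by simp_all
    have "U 10 (e mod S w) (e div S w mod S w) (e div S w ^ 2 mod S w) (e div S w ^ 3) = of_bool (c0 < e)"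
      by (simp add: U_def compose)
    then show ?thesis unfolding chain_address[where S = "S w"] using u'(3)[of 10, OF _ _ m] D1 by simp
  qed
  have r0: "cr S w c0 < S w" using S(6)[of w] by simp
  have claims: "claims w u' r \<longleftrightarrow> r < T w \<and> act \<and> r = cr S w c0" for r
  proof -
    have "u' (ad (S w) 9 r 0 0 0) = of_bool (act \<and> r = cr S w c0)" if "r < T w"
      using u'(3)[of 9 r 0 0 0] that S(1,6)[of w] D1 by (simp add: U_def)
    then show ?thesis unfolding claims_def by (cases "act \<and> r = cr S w c0") auto
  qed
  have ans: "tr_of (S w) u' 0 0 r = length dl + 2 \<and> (\<forall>t<S w. \<forall>k<S w. \<forall>x<S w. answer_at w u' 6 r t k
      x)" if "claims w u' r" for r
  proof -
    from that have act: "act" "r = cr S w c0" by (simp_all add: claims)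
    with cases have a: "tr_of (S w) u 0 0 r = length dl + 2" "answers w u r s d c" "in_range w s d c" by auto
    have l: "r < S w" "\<And>t. t \<le> T' w \<Longrightarrow> t < S w" "\<And>k. k < K' \<Longrightarrow> k < S w" using r0 act(2) S(2,4)[of w]
        by linarith+
    have "st_of (S w) u' 6 r t = s t" if "t \<le> T' w" for t
      using u'(3)[of 6 r t 0 0] l that a(3) S(6)[of w] by (simp add: st_of_def U_def in_range_def)
    moreover have "tr_of (S w) u' 6 r t = d t" if "t < T' w" for t
      using u'(3)[of 7 r t 0 0] l that a(3) S(6)[of w] by (simp add: tr_of_def U_def in_range_def)
    moreover have cl: "cl_of (S w) u' 6 r t k x = c t k x" if "t \<le> T' w" "k < K'" for t k x
      using u'(3)[of 8 r t k x] l that a(3) by (simp add: cl_of_def U_def in_range_def)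
    ultimately have "run_on N dl' (T' w) (st_of (S w) u' 6 r) (tr_of (S w) u' 6 r) (cl_of (S w) u' 6
        r) \<longleftrightarrow> run_on N dl' (T' w) s d c"
      by (intro run_on_cong)
    moreover have "starts_on N (T' w) e (cl_of (S w) u' 6 r 0) f \<longleftrightarrow> starts_on N (T' w) e (c 0) f" for e f
      by (rule starts_on_cong) (use cl in simp_all)
    moreover have "answers w u' r s d c" using a(2) right_cong(3)[where u' = u' and u = u, OF agree] by blast
    ultimately have "answers w u' r (st_of (S w) u' 6 r) (tr_of (S w) u' 6 r) (cl_of (S w) u' 6 r)"
        by (simp only: answers_def)
    moreover have "tr_of (S w) u' 0 0 r = length dl + 2" using run_vars_cong(2)[where u' = u' and u
        = u and tag = 0, OF agree] a(1) by simp
    ultimately show ?thesis unfolding answers_local by blast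
  qed
  have "hold w u'"
    unfolding hold_iff
  proof (intro allI impI, intro conjI)
    fix e assume e: "e < S w ^ 4"
    show "claims w u' (cr S w e) \<longrightarrow> tr_of (S w) u' 0 0 (cr S w e) = length dl + 2 \<and> answer_at w u' 6
        (cr S w e) (ct S w e) (ck S w e) (cx S w e)"
      using ans[of "cr S w e"] component_bounds[OF e] by blast
    show "e = 0 \<longrightarrow> u' (11 * e + 10) = 0" unfolding chain by simp
    show "e + 1 = S w ^ 4 \<longrightarrow> u' (11 * (e + 1) + 10) = 1" unfolding chain using c0 by auto
    show "u' (11 * (e + 1) + 10) = 1 \<longrightarrow> u' (11 * e + 10) = 1 \<or> \<not> right_at w u' (cr S w e) (ct S w e)
        (ck S w e) (cx S w e) \<or> claims w u' (cr S w e)"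
    proof
      assume "u' (11 * (e + 1) + 10) = 1"
      then have "c0 \<le> e" unfolding chain by (cases "c0 < e + 1") auto
      then consider "c0 < e" | "e = c0" by linarith
      then show "u' (11 * e + 10) = 1 \<or> \<not> right_at w u' (cr S w e) (ct S w e) (ck S w e) (cx S w e)
          \<or> claims w u' (cr S w e)"
      proof cases
        case 1
        then show ?thesis by (simp add: chain)
      next
        case 2
        from cases have "\<not> right_at w u' (cr S w c0) (ct S w c0) (ck S w c0) (cx S w c0) \<or> claims w
            u' (cr S w c0)"
          unfolding claims right_cong(1)[where u' = u' and u = u, OF agree] by blast
        then show ?thesis unfolding 2 by blast
      qed
    qed
  qed
  with u'(1) agree show ?thesis by blast
qed

text \<open>This is the inversion: solvability in the inner variables expresses that the outer ones
  fail, so an outer assignment without a solution is a correct transcript whose negative answers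
  withstand refutation.\<close>

lemma hold_extension_iff:
  assumes "\<And>v. u v < D"
  shows "(\<exists>u'. (\<forall>v. u' v < D) \<and> (\<forall>v. v mod 11 < 6 \<longrightarrow> u' v = u v) \<and> hold w u') \<longleftrightarrow> \<not> right w u \<or> refuted w u"
proof
  assume "\<exists>u'. (\<forall>v. u' v < D) \<and> (\<forall>v. v mod 11 < 6 \<longrightarrow> u' v = u v) \<and> hold w u'"
  then obtain u' where u': "\<And>v. u' v < D" "\<forall>v. v mod 11 < 6 \<longrightarrow> u' v = u v" "hold w u'" by blast
  have "refuted w u' \<longleftrightarrow> refuted w u"
    unfolding refuted_def right_cong(3)[where u' = u' and u = u, OF u'(2)] run_vars_cong(2)[where u'
        = u' and u = u and tag = 0, OF u'(2) le0] ..
  then show "\<not> right w u \<or> refuted w u"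
    using refuted_if_hold[OF u'(3,1)] right_cong(2)[where u' = u' and u = u, OF u'(2)] by blast
next
  assume "\<not> right w u \<or> refuted w u"
  then consider "\<not> right w u" | "refuted w u" by blast
  then show "\<exists>u'. (\<forall>v. u' v < D) \<and> (\<forall>v. v mod 11 < 6 \<longrightarrow> u' v = u v) \<and> hold w u'"
  proof cases
    case 1
    then have "\<not> (\<forall>c<S w ^ 4. right_at w u (cr S w c) (ct S w c) (ck S w c) (cx S w c))"
      unfolding all_components[where P = "right_at w u"] right_local .
    then obtain c0 where "c0 < S w ^ 4" "\<not> right_at w u (cr S w c0) (ct S w c0) (ck S w c0) (cx S w
        c0)" by blast
    then show ?thesis using hold_if_violated[where act = False and u = u, OF assms] by blast
  next
    case 2
    then obtain r s d c where r: "r < T w" "tr_of (S w) u 0 0 r = length dl + 2" "answers w u r s d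
        c" "in_range w s d c"
      unfolding refuted_def by (elim exE conjE)
    have rS: "r < S w" using r(1) S(1)[of w] by simp
    then have m: "r mod S w = r" by simp
    have "S w ^ 1 \<le> S w ^ 4" using S(6)[of w] by (intro power_increasing) auto
    then have r4: "r < S w ^ 4" using rS by simp
    \<comment> \<open>As \<open>r\<close> is below the base, the constraint with number
      \<open>r\<close> has run \<open>r\<close> and time, tape and cell 0.\<close>
    show ?thesis by (rule hold_if_violated[where ?c0.0 = r and act = True and u = u and s = s and d
        = d and c = c, OF assms r4]) (use r m in simp)
  qed
qed

end

lemma Pi2p_hard:
  assumes "X \<in> Pi2p" "\<sigma> \<in> {Preferred, SemiStable}"
  shows "poly_reducible X (SF_VE_inputs \<sigma>) (SF_VE \<sigma>)"
proof -
  have "\<exists>N. (well_formed N \<and> oracle_free N \<and> poly_time N {}) \<and>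
    (\<exists>M. - X = {w. accepts M {v. accepts N {} v} w} \<and> well_formed M \<and> poly_time M {v. accepts N {} v})"
    using assms(1) unfolding Pi2p_def co_def Sigma2p_def NP_oracle_def NP_def by auto
  then obtain N M where N: "well_formed N" "oracle_free N" "poly_time N {}" and
    M: "- X = {w. accepts M {v. accepts N {} v} w}" "well_formed M" "poly_time M {v. accepts N {}
        v}" by (elim exE conjE)
  from M(3) obtain p :: "nat poly" where p: "\<forall>w c n. (tm_step M {v. accepts N {} v} ^^ n) (initial M
      w) c \<longrightarrow> n \<le> poly p (length w)"
    unfolding poly_time_def by (elim exE)
  from N(3) obtain q :: "nat poly" where q: "\<forall>w c n. (tm_step N {} ^^ n) (initial N w) c \<longrightarrow> n \<le> poly
      q (length w)"
    unfolding poly_time_def by (elim exE)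
  have fin: "finite (tm_delta M)" "finite (tm_delta N)" using M(2) N(1) by (simp_all add: well_formed_def)
  from finite_list[OF fin(1)] obtain dl where dl: "set dl = tm_delta M" by (elim exE)
  from finite_list[OF fin(2)] obtain dl' where dl': "set dl' = tm_delta N" by (elim exE)
  from ex_bounds[OF fin(1)] obtain D1 where D1: "\<forall>D\<ge>D1. bounds M D" by (elim exE)
  from ex_bounds[OF fin(2)] obtain D2 where D2: "\<forall>D\<ge>D2. bounds N D" by (elim exE)
  \<comment> \<open>One range for the values of both machines; the step codes of \<open>M\<close> go
    up to \<open>length dl + 2\<close>.\<close>
  define D where "D = D1 + D2 + length dl + length dl' + tm_tapes M + tm_tapes N + 4"
  have o: "oracle_run M N dl dl' p q D"
  proof
    show "n \<le> poly p (length w)" if "(tm_step M {v. accepts N {} v} ^^ n) (initial M w) c" for n w c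
        by (rule p[rule_format, OF that])
    show "n \<le> poly q (length v)" if "(tm_step N {} ^^ n) (initial N v) c" for n v c by (rule
        q[rule_format, OF that])
    show "bounds M D" "bounds N D" using D1 D2 by (simp_all add: D_def)
  qed (use M(2) N(1,2) dl dl' in \<open>simp_all add: D_def\<close>)
  interpret oracle_run M N dl dl' p q D by (rule o)
  have "\<exists>f. poly_time_computable f \<and> (\<forall>w. f w \<in> SF_VE_inputs \<sigma>) \<and> (\<forall>w. f w \<in> SF_VE \<sigma> \<longleftrightarrow>
    \<not> (\<exists>u. (\<forall>v. u v < D) \<and> \<not> (\<exists>u'. (\<forall>v. u' v < D) \<and> (\<forall>v. v mod 11 < 6 \<longrightarrow> u' v = u v) \<and> hold w u')))"
    using system.reduction[OF sys, where sw = True and self = True and \<sigma> = \<sigma> and G = G] assms(2) by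
        (simp only: if_True simp_thms)
  then obtain f where f: "poly_time_computable f" "\<forall>w. f w \<in> SF_VE_inputs \<sigma>" "\<forall>w. f w \<in> SF_VE \<sigma> \<longleftrightarrow>
    \<not> (\<exists>u. (\<forall>v. u v < D) \<and> \<not> (\<exists>u'. (\<forall>v. u' v < D) \<and> (\<forall>v. v mod 11 < 6 \<longrightarrow> u' v = u v) \<and> hold w u'))"
        by (elim exE conjE)
  have "w \<in> X \<longleftrightarrow> f w \<in> SF_VE \<sigma>" for w
  proof -
    have "(\<exists>u. (\<forall>v. u v < D) \<and> \<not> (\<exists>u'. (\<forall>v. u' v < D) \<and> (\<forall>v. v mod 11 < 6 \<longrightarrow> u' v = u v) \<and> hold w u')) \<longleftrightarrow>
      (\<exists>u. (\<forall>v. u v < D) \<and> right w u \<and> \<not> refuted w u)"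
      using hold_extension_iff by blast
    also have "\<dots> \<longleftrightarrow> accepts M {v. accepts N {} v} w" using right_sound right_complete by blast
    also have "\<dots> \<longleftrightarrow> w \<notin> X" using M(1) by auto
    finally show ?thesis using f(3) by blast
  qed
  with f(1,2) show ?thesis unfolding poly_reducible_def by blast
qed

theorem theorem6:
  shows "(\<forall>\<sigma> \<in> {Complete, Stable}. complete_for coNP (SF_VE_inputs \<sigma>) (SF_VE \<sigma>)) \<and>
         (\<forall>\<sigma> \<in> {Preferred, SemiStable}. complete_for Pi2p (SF_VE_inputs \<sigma>) (SF_VE \<sigma>))"
  unfolding complete_for_def using SF_VE_coNP SF_VE_Pi2p coNP_hard Pi2p_hard by blast

end
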